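(* Consider the hidden Markov model $(P,\pi,\Phi)$ (see context). Suppose that: (Ergodicity) $\|\mathbf{P}^z(X_n\in\cdot)-\pi\|_{\mathrm{TV}}\to0$ as $n\to\infty$ for $\pi$-a.e. $z\in E$; (Nondegeneracy) there exist a probability measure $\varphi$ on $\mathcal{B}(F)$ and a strictly positive measurable function $g:E\times F\to]0,\infty[$ such that $\Phi(z,A)=\int I_A(u)g(z,u)\varphi(du)$ for all $A\in\mathcal{B}(F)$, $z\in E$. Let $\mu$ be a probability measure on $\mathcal{B}(E)$, and let $\Pi^\mu_n,\Pi^\pi_n$ be the nonlinear filters with initial measures $\mu,\pi$. Then $$\|\Pi^\mu_n-\Pi^\pi_n\|_{\mathrm{TV}}\xrightarrow{n\to\infty}0\quad\mathbf{P}^\mu\text{-a.s.}\qquad\text{if and only if}\qquad\|\mathbf{P}^\mu(X_n\in\cdot)-\pi\|_{\mathrm{TV}}\xrightarrow{n\to\infty}0.$$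
   Context: Let $E,F$ be Polish spaces, with coordinate processes $X_n,Y_n$ on $E^{\mathbb{Z}}\times F^{\mathbb{Z}}$, $Y=(Y_k)_{k\in\mathbb{Z}}$, $\Omega^Y=F^{\mathbb{Z}}$. $P:E\times\mathcal{B}(E)\to[0,1]$ is a probability kernel, $\pi$ a probability measure on $E$ with $\int P(z,A)\pi(dz)=\pi(A)$ for all $A$, and $\Phi:E\times\mathcal{B}(F)\to[0,1]$ a probability kernel. For a probability measure $\nu$ on $E$, $\mathbf{P}^\nu$ is the law of $(X_n,Y_n)_{n\ge0}$ under which $(X_n)_{n\ge0}$ is a Markov chain with transition kernel $P$ and $X_0\sim\nu$ and, conditionally on $(X_n)_{n\ge0}$, the $Y_n$ are independent with $Y_n\sim\Phi(X_n,\cdot)$; $\mathbf{P}^z=\mathbf{P}^{\delta_z}$. Filter: with $g$ the observation density of the nondegeneracy assumption, the probability kernels $\Pi^\mu_n:\Omega^Y\times\mathcal{B}(E)\to[0,1]$ are defined for $y\in\Omega^Y$ by $$\Pi^\mu_0(y,A)=\frac{\int I_A(z)g(z,y(0))\mu(dz)}{\int g(z,y(0))\mu(dz)},\qquad \Pi^\mu_n(y,A)=\frac{\int I_A(z)g(z,y(n))P(z',dz)\Pi^\mu_{n-1}(y,dz')}{\int g(z,y(n))P(z',dz)\Pi^\mu_{n-1}(y,dz')},$$ with an arbitrary measurable choice of probability measure for those $y$ for which a denominator is infinite (a $\mathbf{P}^\gamma$-null set of observation paths for every $\gamma$). $\Pi^\mu_n$ is a version of the regular conditional probability $\mathbf{P}^\mu(X_n\in\cdot|Y_0,\ldots,Y_n)$.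 In a.s. statements $\Pi^\mu_n$ stands for $\Pi^\mu_n(Y,\cdot)$. $\|\rho\|_{\mathrm{TV}}=\sup_{\|f\|_\infty\le1}|\int f\,d\rho|$. *)

theory Defs
  imports "HOL-Probability.Probability"
begin

text \<open>
  Throughout, a probability measure on \<^typ>\<open>'e::polish_space\<close> is an element of
  \<^term>\<open>space (prob_algebra borel)\<close>, and a probability kernel is a measurable map into
  \<^term>\<open>prob_algebra borel\<close>.
\<close>

text \<open>
  \<open>tv_dist M N\<close> is \<open>\<parallel>M - N\<parallel>\<^sub>T\<^sub>V\<close>, normalised so that mutually singular probability measures
  are at distance 2. The supremum is one of real numbers; for probability measures the set is
  nonempty and bounded by 2.
\<close>

definition tv_dist :: "'a measure \<Rightarrow> 'a measure \<Rightarrow> real" where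
  "tv_dist M N =
     (SUP f\<in>{f \<in> borel_measurable M. \<forall>x. \<bar>f x\<bar> \<le> (1::real)}.
        \<bar>integral\<^sup>L M f - integral\<^sup>L N f\<bar>)"

lemma tv_dist_bdd_above:
  assumes "prob_space M" "prob_space N" "sets M = sets N"
  shows "bdd_above ((\<lambda>f. \<bar>integral\<^sup>L M f - integral\<^sup>L N f\<bar>) `
           {f \<in> borel_measurable M. \<forall>x. \<bar>f x\<bar> \<le> (1::real)})"
proof (rule bdd_aboveI2)
  fix f :: "'a \<Rightarrow> real" assume f: "f \<in> {f \<in> borel_measurable M. \<forall>x. \<bar>f x\<bar> \<le> 1}"
  have *: "\<bar>integral\<^sup>L K f\<bar> \<le> 1" if "prob_space K" "sets K = sets M" for K
  proof -
    interpret prob_space K by fact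
    have "f \<in> borel_measurable K"
      using f measurable_cong_sets[OF that(2) refl] by auto
    then have "integrable K f"
      by (intro integrable_const_bound[where B=1]) (use f in auto)
    then have "integral\<^sup>L K f \<le> 1 \<and> - 1 \<le> integral\<^sup>L K f"
      using f by (auto intro!: integral_le_const integral_ge_const simp: abs_le_iff minus_le_iff)
    then show ?thesis by auto
  qed
  show "\<bar>integral\<^sup>L M f - integral\<^sup>L N f\<bar> \<le> 2"
    using *[of M] *[of N] assms by auto
qed

text \<open>
  Law on path space of the Markov chain with transition kernel \<open>P\<close> and initial law \<open>\<nu>\<close>,
  obtained from the Ionescu-Tulcea extension theorem: the \<open>n\<close>-th step draws the value at time
  \<open>n\<close> given the values at times \<open>0, \<dots>, n - 1\<close>.
\<close>

definition markov_step :: "('e::polish_space \<Rightarrow> 'e measure) \<Rightarrow> 'e measure \<Rightarrow>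
    nat \<Rightarrow> (nat \<Rightarrow> 'e) \<Rightarrow> 'e measure" where
  "markov_step P \<nu> n x = (if n = 0 then \<nu> else P (x (n - 1)))"

definition markov_law :: "('e::polish_space \<Rightarrow> 'e measure) \<Rightarrow> 'e measure \<Rightarrow>
    (nat \<Rightarrow> 'e) measure" where
  "markov_law P \<nu> =
     projective_family.lim UNIV (Ionescu_Tulcea.CI (markov_step P \<nu>) (\<lambda>_. borel)) (\<lambda>_. borel)"

text \<open>
  The law of the pair \<open>((X\<^sub>n)\<^sub>n, (Y\<^sub>n)\<^sub>n)\<close>: given \<open>(X\<^sub>n)\<^sub>n = x\<close>, the observations are distributed
  according to the product of the measures \<open>\<Phi> (x n)\<close>.
\<close>

definition hmm_law :: "('e::polish_space \<Rightarrow> 'e measure) \<Rightarrow> ('e \<Rightarrow> 'f::polish_space measure) \<Rightarrow>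
    'e measure \<Rightarrow> ((nat \<Rightarrow> 'e) \<times> (nat \<Rightarrow> 'f)) measure" where
  "hmm_law P \<Phi> \<nu> = markov_law P \<nu> \<bind>
     (\<lambda>x. distr (\<Pi>\<^sub>M n\<in>UNIV. \<Phi> (x n)) ((\<Pi>\<^sub>M n\<in>UNIV. borel) \<Otimes>\<^sub>M (\<Pi>\<^sub>M n\<in>UNIV. borel))
            (\<lambda>y. (x, y)))"

text \<open>
  Reweighting of \<open>\<nu>\<close> by the likelihood \<open>h\<close>; the fallback \<open>\<rho>\<close> is used when the normalising
  constant is infinite. The constant is positive whenever \<open>h\<close> is and \<open>\<nu>\<close> is a probability measure.
\<close>

definition bayes :: "('e \<Rightarrow> real) \<Rightarrow> 'e measure \<Rightarrow> 'e measure \<Rightarrow> 'e measure" where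
  "bayes h \<rho> \<nu> =
     (let c = (\<integral>\<^sup>+z. ennreal (h z) \<partial>\<nu>)
      in if c = \<infinity> then \<rho> else density \<nu> (\<lambda>z. ennreal (h z) / c))"

text \<open>
  \<open>hmm_filter P g \<rho> \<mu> n y\<close> is the filter at time \<open>n\<close> with initial measure \<open>\<mu>\<close> along the
  observation path \<open>y\<close>, where \<open>\<rho> n y\<close> is the arbitrary choice made where the normalising constant
  at time \<open>n\<close> is infinite.
\<close>

primrec hmm_filter :: "('e::polish_space \<Rightarrow> 'e measure) \<Rightarrow> ('e \<Rightarrow> 'f \<Rightarrow> real) \<Rightarrow>
    (nat \<Rightarrow> (nat \<Rightarrow> 'f) \<Rightarrow> 'e measure) \<Rightarrow> 'e measure \<Rightarrow> nat \<Rightarrow> (nat \<Rightarrow> 'f) \<Rightarrow> 'e measure" where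
  "hmm_filter P g \<rho> \<mu> 0 y = bayes (\<lambda>z. g z (y 0)) (\<rho> 0 y) \<mu>"
| "hmm_filter P g \<rho> \<mu> (Suc n) y =
     bayes (\<lambda>z. g z (y (Suc n))) (\<rho> (Suc n) y) (hmm_filter P g \<rho> \<mu> n y \<bind> P)"

context
  fixes P :: "'e::polish_space \<Rightarrow> 'e measure" and \<nu> :: "'e measure"
  assumes P[measurable]: "P \<in> borel \<rightarrow>\<^sub>M prob_algebra borel"
    and \<nu>: "\<nu> \<in> space (prob_algebra borel)"
begin

lemma Ionescu_Tulcea_markov_step: "Ionescu_Tulcea (markov_step P \<nu>) (\<lambda>_. borel)"
proof (rule Ionescu_Tulcea.intro)
  fix i
  show "markov_step P \<nu> i \<in> PiM {0..<i} (\<lambda>_. borel) \<rightarrow>\<^sub>M subprob_algebra borel"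
  proof (cases i)
    case 0
    then show ?thesis
      using \<nu> by (auto simp: markov_step_def[abs_def] space_prob_algebra space_subprob_algebra
          prob_space_imp_subprob_space)
  next
    case (Suc j)
    have [measurable]: "(\<lambda>x. x j) \<in> PiM {0..<Suc j} (\<lambda>_. borel::'e measure) \<rightarrow>\<^sub>M borel"
      by (rule measurable_component_singleton) auto
    show ?thesis
      unfolding Suc markov_step_def[abs_def]
      by (auto intro!: measurable_compose[OF _ measurable_prob_algebraD[OF P]])
  qed
next
  show "prob_space (markov_step P \<nu> i x)" for i x
    using \<nu> measurable_space[OF P, of "x (i - 1)"]
    by (auto simp: markov_step_def space_prob_algebra)
qed

interpretation IT: Ionescu_Tulcea "markov_step P \<nu>" "\<lambda>_. borel"
  by (rule Ionescu_Tulcea_markov_step)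

lemma sets_markov_law[measurable_cong]: "sets (markov_law P \<nu>) = sets (\<Pi>\<^sub>M n\<in>UNIV. borel)"
  unfolding markov_law_def by simp

lemma space_markov_law: "space (markov_law P \<nu>) = UNIV"
  using sets_eq_imp_space_eq[OF sets_markov_law] by (simp add: space_PiM)

private lemma distr_markov_law:
  "distr (markov_law P \<nu>) (\<Pi>\<^sub>M i\<in>{0..<n}. borel) (\<lambda>x. restrict x {0..<n}) =
     IT.C 0 n (\<lambda>_. undefined)"
proof (rule measure_eqI)
  fix A assume "A \<in> sets (distr (markov_law P \<nu>) (\<Pi>\<^sub>M i\<in>{0..<n}. borel) (\<lambda>x. restrict x {0..<n}))"
  then have A[measurable]: "A \<in> sets (\<Pi>\<^sub>M i\<in>{0..<n}. borel)"
    by simp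
  have "emeasure (distr (markov_law P \<nu>) (\<Pi>\<^sub>M i\<in>{0..<n}. borel) (\<lambda>x. restrict x {0..<n})) A =
      emeasure (markov_law P \<nu>) (prod_emb UNIV (\<lambda>_. borel) {0..<n} A)"
    by (rule emeasure_distr_restrict) (auto simp: sets_markov_law)
  also have "\<dots> = IT.C 0 n (\<lambda>_. undefined) (prod_emb {0..<n} (\<lambda>_. borel) {0..<n} A)"
    unfolding markov_law_def by (simp add: IT.lim IT.emeasure_CI)
  also have "prod_emb {0..<n} (\<lambda>_. borel) {0..<n} A = A"
    using sets.sets_into_space[OF A] by (intro prod_emb_id) (auto simp: space_PiM)
  finally show "emeasure (distr (markov_law P \<nu>) (\<Pi>\<^sub>M i\<in>{0..<n}. borel) (\<lambda>x. restrict x {0..<n})) A =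
      IT.C 0 n (\<lambda>_. undefined) A" .
qed (simp add: IT.sets_C)

lemma prob_space_markov_law: "prob_space (markov_law P \<nu>)"
proof (rule prob_space_distrD)
  show "prob_space (distr (markov_law P \<nu>) (\<Pi>\<^sub>M i\<in>{0..<0}. borel) (\<lambda>x. restrict x {0..<0}))"
    unfolding distr_markov_law by (rule IT.prob_space_C) simp
qed (measurable; simp add: sets_markov_law)

private lemma restrict_measurable[measurable]:
  "(\<lambda>x. restrict x {0..<n}) \<in> markov_law P \<nu> \<rightarrow>\<^sub>M (\<Pi>\<^sub>M i\<in>{0..<n}. borel)"
  unfolding measurable_cong_sets[OF sets_markov_law refl] by (rule measurable_restrict_subset) simp

private lemma C_Suc: "IT.C 0 (Suc n) (\<lambda>_. undefined) = IT.C 0 n (\<lambda>_. undefined) \<bind> IT.eP n"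
  by simp

private lemma emeasure_C_Suc:
  assumes [measurable]: "Q \<in> sets (\<Pi>\<^sub>M i\<in>{0..<Suc n}. borel)"
  shows "emeasure (IT.C 0 (Suc n) (\<lambda>_. undefined)) Q =
    (\<integral>\<^sup>+x. emeasure (markov_step P \<nu> n x) {z. x(n := z) \<in> Q} \<partial>IT.C 0 n (\<lambda>_. undefined))"
proof -
  have C: "IT.C 0 n (\<lambda>_. undefined) \<in> space (prob_algebra (\<Pi>\<^sub>M i\<in>{0..<n}. borel))"
    using IT.prob_space_C[of "\<lambda>_. undefined" 0 n] by (simp add: space_prob_algebra IT.sets_C)
  have "emeasure (IT.C 0 (Suc n) (\<lambda>_. undefined)) Q =
      (\<integral>\<^sup>+x. emeasure (IT.eP n x) Q \<partial>IT.C 0 n (\<lambda>_. undefined))"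
    unfolding C_Suc
    by (rule emeasure_bind_prob_algebra[OF C _ assms])
       (intro measurable_prob_algebraI IT.prob_space_eP IT.measurable_eP)
  also have "\<dots> = (\<integral>\<^sup>+x. emeasure (markov_step P \<nu> n x) {z. x(n := z) \<in> Q} \<partial>IT.C 0 n (\<lambda>_. undefined))"
    by (intro nn_integral_cong) (auto simp: IT.emeasure_eP IT.space_C vimage_def)
  finally show ?thesis .
qed

lemma emeasure_markov_law_0:
  assumes [measurable]: "A \<in> sets borel"
  shows "emeasure (markov_law P \<nu>) {x. x 0 \<in> A} = emeasure \<nu> A"
proof -
  let ?Q = "{x \<in> space (\<Pi>\<^sub>M i\<in>{0..<Suc 0}. borel). x 0 \<in> A}"
  have Q: "?Q \<in> sets (\<Pi>\<^sub>M i\<in>{0..<Suc 0}. borel)"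
    by (rule sets_Collect_single') (use assms in auto)
  have "{x. x 0 \<in> A} = (\<lambda>x. restrict x {0..<Suc 0}) -` ?Q \<inter> space (markov_law P \<nu>)"
    by (auto simp: space_markov_law space_PiM)
  then have "emeasure (markov_law P \<nu>) {x. x 0 \<in> A} = emeasure (IT.C 0 (Suc 0) (\<lambda>_. undefined)) ?Q"
    using Q by (simp add: distr_markov_law[symmetric] emeasure_distr del: IT.C.simps)
  also have "\<dots> = (\<integral>\<^sup>+x. emeasure \<nu> A \<partial>IT.C 0 0 (\<lambda>_. undefined))"
    unfolding emeasure_C_Suc[OF Q]
    by (intro nn_integral_cong) (auto simp: markov_step_def space_PiM PiE_iff extensional_def)
  also have "\<dots> = emeasure \<nu> A"
    using prob_space.emeasure_space_1[OF IT.prob_space_C[of "\<lambda>_. undefined" 0 0]]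
    by (simp add: space_PiM del: IT.C.simps)
  finally show ?thesis .
qed

lemma emeasure_markov_law_Suc:
  assumes A: "A \<in> sets (\<Pi>\<^sub>M i\<in>{0..<Suc n}. borel)" and B: "B \<in> sets borel"
  shows "emeasure (markov_law P \<nu>) {x. restrict x {0..<Suc n} \<in> A \<and> x (Suc n) \<in> B} =
    (\<integral>\<^sup>+x. indicator A (restrict x {0..<Suc n}) * emeasure (P (x n)) B \<partial>markov_law P \<nu>)"
proof -
  let ?S = "\<lambda>n. (\<Pi>\<^sub>M i\<in>{0..<n}. borel :: 'e measure)"
  have r[measurable]: "(\<lambda>x. restrict x {0..<Suc n}) \<in> ?S (Suc (Suc n)) \<rightarrow>\<^sub>M ?S (Suc n)"
    by (rule measurable_restrict_subset) auto
  have [measurable]: "(\<lambda>x. x (Suc n)) \<in> ?S (Suc (Suc n)) \<rightarrow>\<^sub>M borel"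
    "(\<lambda>x. x n) \<in> ?S (Suc n) \<rightarrow>\<^sub>M borel"
    by (auto intro: measurable_component_singleton)
  let ?Q = "{x \<in> space (?S (Suc (Suc n))). restrict x {0..<Suc n} \<in> A \<and> x (Suc n) \<in> B}"
  have Q: "?Q \<in> sets (?S (Suc (Suc n)))"
    using A B by measurable
  have "{x. restrict x {0..<Suc n} \<in> A \<and> x (Suc n) \<in> B} =
      (\<lambda>x. restrict x {0..<Suc (Suc n)}) -` ?Q \<inter> space (markov_law P \<nu>)"
    by (auto simp: space_markov_law space_PiM Int_absorb1)
  then have "emeasure (markov_law P \<nu>) {x. restrict x {0..<Suc n} \<in> A \<and> x (Suc n) \<in> B} =
      emeasure (IT.C 0 (Suc (Suc n)) (\<lambda>_. undefined)) ?Q"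
    using Q by (simp add: distr_markov_law[symmetric] emeasure_distr del: IT.C.simps)
  also have "\<dots> = (\<integral>\<^sup>+x. indicator A x * emeasure (P (x n)) B \<partial>IT.C 0 (Suc n) (\<lambda>_. undefined))"
    unfolding emeasure_C_Suc[OF Q]
  proof (intro nn_integral_cong)
    fix x assume "x \<in> space (IT.C 0 (Suc n) (\<lambda>_. undefined))"
    then have x: "x \<in> space (?S (Suc n))"
      by (simp add: IT.space_C del: IT.C.simps)
    have "x(Suc n := z) \<in> ?Q \<longleftrightarrow> x \<in> A \<and> z \<in> B" for z
    proof -
      have "restrict (x(Suc n := z)) {0..<Suc n} = x"
        using x by (auto simp: space_PiM PiE_iff extensional_def fun_eq_iff restrict_def)
      moreover have "x(Suc n := z) \<in> space (?S (Suc (Suc n)))"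
        using x by (auto simp: space_PiM PiE_iff extensional_def)
      ultimately show ?thesis by simp
    qed
    then have "{z. x(Suc n := z) \<in> ?Q} = (if x \<in> A then B else {})" by auto
    then show "emeasure (markov_step P \<nu> (Suc n) x) {z. x(Suc n := z) \<in> ?Q} =
        indicator A x * emeasure (P (x n)) B"
      by (simp add: markov_step_def)
  qed
  also have "\<dots> = (\<integral>\<^sup>+x. indicator A (restrict x {0..<Suc n}) * emeasure (P (x n)) B \<partial>markov_law P \<nu>)"
    unfolding distr_markov_law[symmetric]
  proof (rule nn_integral_distr[OF restrict_measurable, THEN trans])
    have [measurable]: "(\<lambda>z. emeasure (P z) B) \<in> borel_measurable borel"
      using measurable_compose[OF measurable_prob_algebraD[OF P] measurable_emeasure_subprob_algebra[OF B]] .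
    have "(\<lambda>x. indicator A x * emeasure (P (x n)) B) \<in> borel_measurable (?S (Suc n))"
      using A by measurable
    then show "(\<lambda>x. indicator A x * emeasure (P (x n)) B) \<in> borel_measurable
        (distr (markov_law P \<nu>) (?S (Suc n)) (\<lambda>x. restrict x {0..<Suc n}))"
      by simp
  qed (simp add: restrict_def)
  finally show ?thesis .
qed

context
  fixes \<Phi> :: "'e \<Rightarrow> 'f::polish_space measure"
  assumes \<Phi>[measurable]: "\<Phi> \<in> borel \<rightarrow>\<^sub>M prob_algebra borel"
begin

private lemma sets_\<Phi>: "sets (\<Phi> x) = sets borel" and prob_\<Phi>: "prob_space (\<Phi> x)"
  using measurable_space[OF \<Phi>, of x] by (auto simp: space_prob_algebra)

lemma measurable_PiM_obs:
  "(\<lambda>x. \<Pi>\<^sub>M n\<in>UNIV. \<Phi> (x n)) \<in> (\<Pi>\<^sub>M n\<in>UNIV. borel) \<rightarrow>\<^sub>M prob_algebra (\<Pi>\<^sub>M n\<in>(UNIV::nat set). borel)"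
proof (rule measurable_prob_algebra_generated[OF sets_PiM Int_stable_prod_algebra prod_algebra_sets_into_space])
  fix A assume "A \<in> prod_algebra UNIV (\<lambda>_::nat. borel :: 'f measure)"
  then obtain J E where A: "A = prod_emb UNIV (\<lambda>_. borel) J (\<Pi>\<^sub>E j\<in>J. E j)" "finite J"
    "\<And>j. j \<in> J \<Longrightarrow> E j \<in> sets borel"
    by (elim prod_algebraE) auto
  have "emeasure (\<Pi>\<^sub>M n\<in>UNIV. \<Phi> (x n)) A = (\<Prod>j\<in>J. emeasure (\<Phi> (x j)) (E j))" for x
  proof -
    have "A = prod_emb UNIV (\<lambda>n. \<Phi> (x n)) J (\<Pi>\<^sub>E j\<in>J. E j)"
      unfolding A prod_emb_def using sets_eq_imp_space_eq[OF sets_\<Phi>] by simp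
    then show ?thesis
      using A by (simp add: emeasure_PiM_emb prob_\<Phi> sets_\<Phi>)
  qed
  moreover have "(\<lambda>x. \<Prod>j\<in>J. emeasure (\<Phi> (x j)) (E j)) \<in> borel_measurable (\<Pi>\<^sub>M n\<in>UNIV. borel)"
  proof (rule borel_measurable_prod_ennreal)
    fix j assume "j \<in> J"
    then have [measurable]: "(\<lambda>z. emeasure (\<Phi> z) (E j)) \<in> borel_measurable borel"
      using measurable_compose[OF measurable_prob_algebraD[OF \<Phi>] measurable_emeasure_subprob_algebra] A
      by blast
    show "(\<lambda>x. emeasure (\<Phi> (x j)) (E j)) \<in> borel_measurable (\<Pi>\<^sub>M n\<in>UNIV. borel)"
      by measurable
  qed
  ultimately show "(\<lambda>x. emeasure (\<Pi>\<^sub>M n\<in>UNIV. \<Phi> (x n)) A) \<in> borel_measurable (\<Pi>\<^sub>M n\<in>UNIV. borel)"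
    by simp
qed (auto intro!: prob_space_PiM prob_\<Phi> sets_PiM_cong simp: sets_\<Phi>)

private lemma hmm_kernel:
  "(\<lambda>x. distr (\<Pi>\<^sub>M n\<in>UNIV. \<Phi> (x n)) ((\<Pi>\<^sub>M n\<in>UNIV. borel) \<Otimes>\<^sub>M (\<Pi>\<^sub>M n\<in>UNIV. borel)) (\<lambda>y. (x, y)))
     \<in> (\<Pi>\<^sub>M n\<in>(UNIV::nat set). borel) \<rightarrow>\<^sub>M
       prob_algebra ((\<Pi>\<^sub>M n\<in>(UNIV::nat set). borel) \<Otimes>\<^sub>M (\<Pi>\<^sub>M n\<in>(UNIV::nat set). borel))"
  by (rule measurable_distr_prob_space2[OF measurable_PiM_obs]) simp

private lemma markov_law_in: "markov_law P \<nu> \<in> space (prob_algebra (\<Pi>\<^sub>M n\<in>UNIV. borel))"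
  by (simp add: space_prob_algebra sets_markov_law prob_space_markov_law)

lemma prob_space_hmm_law: "prob_space (hmm_law P \<Phi> \<nu>)"
  unfolding hmm_law_def by (rule prob_space_bind'[OF markov_law_in hmm_kernel])

lemma sets_hmm_law:
  "sets (hmm_law P \<Phi> \<nu>) = sets ((\<Pi>\<^sub>M n\<in>UNIV. borel) \<Otimes>\<^sub>M (\<Pi>\<^sub>M n\<in>UNIV. borel))"
  unfolding hmm_law_def by (rule sets_bind'[OF markov_law_in hmm_kernel])

lemma emeasure_hmm_law:
  assumes A: "A \<in> sets (\<Pi>\<^sub>M n\<in>UNIV. borel)"
    and J: "finite J" and B: "\<And>j. j \<in> J \<Longrightarrow> B j \<in> sets borel"
  shows "emeasure (hmm_law P \<Phi> \<nu>) (A \<times> {y. \<forall>j\<in>J. y j \<in> B j}) =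
    (\<integral>\<^sup>+x. indicator A x * (\<Prod>j\<in>J. emeasure (\<Phi> (x j)) (B j)) \<partial>markov_law P \<nu>)"
proof -
  let ?B = "{y. \<forall>j\<in>J. y j \<in> B j}"
  have B_eq: "?B = prod_emb UNIV (\<lambda>_. borel) J (\<Pi>\<^sub>E j\<in>J. B j)"
    by (auto simp: prod_emb_def)
  have B': "?B \<in> sets (\<Pi>\<^sub>M n\<in>UNIV. borel)"
    unfolding B_eq using J B by (intro sets_PiM_I) auto
  have AB: "A \<times> ?B \<in> sets ((\<Pi>\<^sub>M n\<in>UNIV. borel) \<Otimes>\<^sub>M (\<Pi>\<^sub>M n\<in>UNIV. borel))"
    using A B' by simp
  have "emeasure (distr (\<Pi>\<^sub>M n\<in>UNIV. \<Phi> (x n)) ((\<Pi>\<^sub>M n\<in>UNIV. borel) \<Otimes>\<^sub>M (\<Pi>\<^sub>M n\<in>UNIV. borel)) (\<lambda>y. (x, y)))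
      (A \<times> ?B) = indicator A x * (\<Prod>j\<in>J. emeasure (\<Phi> (x j)) (B j))" for x
  proof -
    have sets_eq: "sets (\<Pi>\<^sub>M n\<in>UNIV. \<Phi> (x n)) = sets (\<Pi>\<^sub>M n\<in>UNIV. borel)"
      by (auto intro!: sets_PiM_cong simp: sets_\<Phi>)
    have "(\<lambda>y. (x, y)) \<in> (\<Pi>\<^sub>M n\<in>UNIV. \<Phi> (x n)) \<rightarrow>\<^sub>M (\<Pi>\<^sub>M n\<in>UNIV. borel) \<Otimes>\<^sub>M (\<Pi>\<^sub>M n\<in>UNIV. borel)"
      unfolding measurable_cong_sets[OF sets_eq refl] by (rule measurable_Pair1') (simp add: space_PiM)
    then have "emeasure (distr (\<Pi>\<^sub>M n\<in>UNIV. \<Phi> (x n)) ((\<Pi>\<^sub>M n\<in>UNIV. borel) \<Otimes>\<^sub>M (\<Pi>\<^sub>M n\<in>UNIV. borel)) (\<lambda>y. (x, y)))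
        (A \<times> ?B) = indicator A x * emeasure (\<Pi>\<^sub>M n\<in>UNIV. \<Phi> (x n)) ?B"
      using AB sets_eq_imp_space_eq[OF sets_eq]
      by (subst emeasure_distr) (auto simp: vimage_def space_PiM split: split_indicator)
    also have "emeasure (\<Pi>\<^sub>M n\<in>UNIV. \<Phi> (x n)) ?B = (\<Prod>j\<in>J. emeasure (\<Phi> (x j)) (B j))"
    proof -
      have "?B = prod_emb UNIV (\<lambda>n. \<Phi> (x n)) J (\<Pi>\<^sub>E j\<in>J. B j)"
        unfolding B_eq prod_emb_def using sets_eq_imp_space_eq[OF sets_\<Phi>] by simp
      then show ?thesis
        using J B by (simp add: emeasure_PiM_emb prob_\<Phi> sets_\<Phi>)
    qed
    finally show ?thesis .
  qed
  then show ?thesis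
    unfolding hmm_law_def by (simp add: emeasure_bind_prob_algebra[OF markov_law_in hmm_kernel AB])
qed

end

end

lemma bayes_prob:
  assumes h: "h \<in> borel_measurable borel" "\<And>z. 0 < h z"
    and \<rho>: "\<rho> \<in> space (prob_algebra borel)" and \<nu>: "\<nu> \<in> space (prob_algebra borel)"
  shows "bayes h \<rho> \<nu> \<in> space (prob_algebra borel)"
    and "A \<in> sets borel \<Longrightarrow> (\<integral>\<^sup>+z. ennreal (h z) \<partial>\<nu>) < \<infinity> \<Longrightarrow>
      emeasure (bayes h \<rho> \<nu>) A =
        (\<integral>\<^sup>+z. indicator A z * ennreal (h z) \<partial>\<nu>) / (\<integral>\<^sup>+z. ennreal (h z) \<partial>\<nu>)"
proof -
  have s[measurable_cong]: "sets \<nu> = sets borel" and "prob_space \<nu>"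
    using \<nu> by (auto simp: space_prob_algebra)
  interpret prob_space \<nu> by fact
  note h(1)[measurable]
  let ?c = "\<integral>\<^sup>+z. ennreal (h z) \<partial>\<nu>"
  have c0: "?c \<noteq> 0"
  proof
    assume "?c = 0"
    then have "AE z in \<nu>. ennreal (h z) = 0"
      by (subst (asm) nn_integral_0_iff_AE) auto
    then have "AE z in \<nu>. False"
      by eventually_elim (metis ennreal_eq_0_iff h(2) not_le)
    then show False by simp
  qed
  have eq: "emeasure (density \<nu> (\<lambda>z. ennreal (h z) / ?c)) A =
      (\<integral>\<^sup>+z. indicator A z * ennreal (h z) \<partial>\<nu>) / ?c" if [measurable]: "A \<in> sets borel" for A
  proof -
    have "emeasure (density \<nu> (\<lambda>z. ennreal (h z) / ?c)) A =
        (\<integral>\<^sup>+z. (indicator A z * ennreal (h z)) / ?c \<partial>\<nu>)"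
      by (subst emeasure_density) (auto simp: divide_ennreal_def mult_ac)
    also have "\<dots> = (\<integral>\<^sup>+z. indicator A z * ennreal (h z) \<partial>\<nu>) / ?c"
      by (rule nn_integral_divide) measurable
    finally show ?thesis .
  qed
  show "emeasure (bayes h \<rho> \<nu>) A = (\<integral>\<^sup>+z. indicator A z * ennreal (h z) \<partial>\<nu>) / ?c"
    if "A \<in> sets borel" "?c < \<infinity>"
    using that eq by (simp add: bayes_def Let_def)
  show "bayes h \<rho> \<nu> \<in> space (prob_algebra borel)"
  proof (cases "?c = \<infinity>")
    case True
    then show ?thesis using \<rho> by (simp add: bayes_def)
  next
    case False
    have "emeasure (density \<nu> (\<lambda>z. ennreal (h z) / ?c)) UNIV = 1"
      using c0 False by (subst eq) (auto simp: less_top intro: ennreal_divide_self)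
    moreover have "space \<nu> = UNIV" using sets_eq_imp_space_eq[OF s] by simp
    ultimately show ?thesis
      using False s by (auto simp: bayes_def space_prob_algebra intro!: prob_spaceI)
  qed
qed

context
  fixes P :: "'e::polish_space \<Rightarrow> 'e measure" and g :: "'e \<Rightarrow> 'f::polish_space \<Rightarrow> real"
    and \<rho> :: "nat \<Rightarrow> (nat \<Rightarrow> 'f) \<Rightarrow> 'e measure" and \<mu> :: "'e measure"
  assumes P[measurable]: "P \<in> borel \<rightarrow>\<^sub>M prob_algebra borel"
    and g[measurable]: "(\<lambda>(z, u). g z u) \<in> borel_measurable (borel \<Otimes>\<^sub>M borel)"
    and g_pos: "\<And>z u. 0 < g z u"
    and \<rho>: "\<And>n. \<rho> n \<in> (\<Pi>\<^sub>M k\<in>UNIV. borel) \<rightarrow>\<^sub>M prob_algebra borel"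
    and \<mu>: "\<mu> \<in> space (prob_algebra borel)"
begin

private lemma g_section: "(\<lambda>z. g z u) \<in> borel_measurable borel"
  by measurable

private lemma \<rho>_in: "\<rho> n y \<in> space (prob_algebra borel)"
  using measurable_space[OF \<rho>, of y] by (simp add: space_PiM)

lemma hmm_filter_prob: "hmm_filter P g \<rho> \<mu> n y \<in> space (prob_algebra borel)"
proof (induction n)
  case (Suc n)
  have "hmm_filter P g \<rho> \<mu> n y \<bind> P \<in> space (prob_algebra borel)"
    using prob_space_bind'[OF Suc P] sets_bind'[OF Suc P] by (simp add: space_prob_algebra)
  then show ?case
    by (simp add: bayes_prob(1) g_section g_pos \<rho>_in)
qed (simp add: bayes_prob(1) g_section g_pos \<rho>_in \<mu>)

lemma emeasure_hmm_filter_0: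
  assumes "A \<in> sets borel" and "(\<integral>\<^sup>+z. ennreal (g z (y 0)) \<partial>\<mu>) < \<infinity>"
  shows "emeasure (hmm_filter P g \<rho> \<mu> 0 y) A =
    (\<integral>\<^sup>+z. indicator A z * ennreal (g z (y 0)) \<partial>\<mu>) / (\<integral>\<^sup>+z. ennreal (g z (y 0)) \<partial>\<mu>)"
  using assms by (simp add: bayes_prob(2) g_section g_pos \<rho>_in \<mu>)

lemma emeasure_hmm_filter_Suc:
  fixes n y
  defines "\<nu> \<equiv> hmm_filter P g \<rho> \<mu> n y"
  assumes A: "A \<in> sets borel"
    and fin: "(\<integral>\<^sup>+z'. \<integral>\<^sup>+z. ennreal (g z (y (Suc n))) \<partial>P z' \<partial>\<nu>) < \<infinity>"
  shows "emeasure (hmm_filter P g \<rho> \<mu> (Suc n) y) A =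
    (\<integral>\<^sup>+z'. \<integral>\<^sup>+z. indicator A z * ennreal (g z (y (Suc n))) \<partial>P z' \<partial>\<nu>) /
    (\<integral>\<^sup>+z'. \<integral>\<^sup>+z. ennreal (g z (y (Suc n))) \<partial>P z' \<partial>\<nu>)"
proof -
  have \<nu>: "\<nu> \<in> space (prob_algebra borel)"
    unfolding \<nu>_def by (rule hmm_filter_prob)
  then have s: "sets \<nu> = sets borel" by (simp add: space_prob_algebra)
  have \<nu>P: "\<nu> \<bind> P \<in> space (prob_algebra borel)"
    using prob_space_bind'[OF \<nu> P] sets_bind'[OF \<nu> P] by (simp add: space_prob_algebra)
  have *: "(\<integral>\<^sup>+z. f z \<partial>(\<nu> \<bind> P)) = (\<integral>\<^sup>+z'. \<integral>\<^sup>+z. f z \<partial>P z' \<partial>\<nu>)"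
    if "f \<in> borel_measurable borel" for f
    by (rule nn_integral_bind[OF that])
       (simp add: measurable_cong_sets[OF s refl] measurable_prob_algebraD[OF P])
  have g1[measurable]: "(\<lambda>z. g z (y (Suc n))) \<in> borel_measurable borel"
    by (rule g_section)
  have e1: "(\<integral>\<^sup>+z. ennreal (g z (y (Suc n))) \<partial>(\<nu> \<bind> P)) =
      (\<integral>\<^sup>+z'. \<integral>\<^sup>+z. ennreal (g z (y (Suc n))) \<partial>P z' \<partial>\<nu>)"
    by (rule *) measurable
  have e2: "(\<integral>\<^sup>+z. indicator A z * ennreal (g z (y (Suc n))) \<partial>(\<nu> \<bind> P)) =
      (\<integral>\<^sup>+z'. \<integral>\<^sup>+z. indicator A z * ennreal (g z (y (Suc n))) \<partial>P z' \<partial>\<nu>)"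
    by (rule *) (use A in measurable)
  show ?thesis
    using bayes_prob(2)[OF g_section g_pos \<rho>_in \<nu>P A, of "y (Suc n)" "Suc n" y] fin
    by (simp add: e1 e2 \<nu>_def[symmetric])
qed

end

end

theory Submission
  imports Defs
begin

text \<open>
  The heart of the matter is that likelihood ratios forget the current state of the signal. Let
  \<open>A\<^sub>n\<close> be the stationary law of the pair of \<open>X\<^sub>n\<close> and the past observations, and let \<open>u\<^sub>n \<le> 1\<close> be the
  density with respect to \<open>A\<^sub>n\<close> of the law started at time \<open>0\<close> from a measure dominated by \<open>A\<^sub>0\<close>. The
  numbers \<open>\<integral>u\<^sub>n\<^sup>2 dA\<^sub>n\<close> decrease, so the increments of \<open>u\<^sub>n\<close> along the chain vanish. Since
  \<open>g > 0\<close>, up to a small error the chain may be replaced by one whose observations are pure noise,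
  and by ergodicity the signal of the latter is then nearly independent of the past. Hence \<open>u\<^sub>n\<close> is close
  in \<open>L\<^sup>1\<close> to a function of the observations alone.

  If \<open>\<mu>P\<^sup>n\<close> converges to \<open>\<pi>\<close>, all but a small part of the law started from \<open>\<mu>\<close> is eventually of this
  form. The unnormalised filters for \<open>\<mu>\<close> and \<open>\<pi>\<close> are then proportional up to kernels \<open>R\<^sub>1, R\<^sub>2\<close> of small
  expected mass. As unnormalised filters evolve linearly, this persists, and Ville's maximal
  inequality bounds the mass of the evolved error relative to that of the filter uniformly in time.

  Conversely, let \<open>B\<^sub>n\<close> be \<open>\<pi>\<close>-null and carry the singular part of \<open>\<mu>P\<^sup>n\<close>. The prediction of \<open>X\<^sub>n\<close> by
  \<open>\<Pi>\<^sup>\<pi>\<close> does not charge \<open>B\<^sub>n\<close>, so merging gives \<open>\<mu>P\<^sup>n(B\<^sub>n) \<rightarrow> 0\<close>, and ergodicity takes care of the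
  absolutely continuous part.
\<close>

section \<open>Comparison of measures and kernels\<close>

text \<open>The obstacle is that neither assumption is quantitative: g is positive without a lower
  bound, and ergodicity has no rate and holds only from almost every start. Laws are therefore
  compared by bounds x \<le> K y + \<delta>, where K depends on \<delta> and the number of steps but
  not on the joint law of signal and past. Only this uniformity allows the comparison to be applied
  to the last m steps before a time n that tends to infinity. It holds because the signal is
  distributed as \<pi> in every joint law to which it is applied, and the errors are averages over
  the signal alone.

  Vanishing increments force forgetting for the following reason. Let the noise chain run from two
  signals with the same past. Both runs end in nearly the same law, so both initial values of the
  likelihood ratio are close to the same later value, and hence to each other.

  The law started from \<mu> may have a part singular to the stationary one at all times. Positivity
  of g ensures that this part of the joint law of signal and observations is no larger than that of
  the signal alone, so the law of the signal controls it.\<close>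

lemma nn_integral_le_add_if_emeasure_le:
  assumes "finite_measure M" "finite_measure N" and s: "sets M = sets N"
    and le: "\<And>A. A \<in> sets M \<Longrightarrow> emeasure M A \<le> emeasure N A + c"
    and f: "f \<in> borel_measurable M" and f1: "\<And>x. x \<in> space M \<Longrightarrow> f x \<le> (1::ennreal)"
  shows "(\<integral>\<^sup>+x. f x \<partial>M) \<le> (\<integral>\<^sup>+x. f x \<partial>N) + c"
proof -
  have sp: "space N = space M" using sets_eq_imp_space_eq[OF s] by simp
  \<comment> \<open>The layer cake formula. Integrating the setwise bound over the levels t in [0,
    1) picks up the constant c exactly once.\<close>
  have layer: "(\<integral>\<^sup>+x. f x \<partial>K) = (\<integral>\<^sup>+t. emeasure K {x\<in>space K. ennreal t < f x} *
    indicator {0..<1} t \<partial>lborel)"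
    if "finite_measure K" and sK: "sets K = sets M" for K
  proof -
    interpret finite_measure K by fact
    interpret pair_sigma_finite K lborel ..
    have fK[measurable]: "f \<in> borel_measurable K"
      using f by (simp add: measurable_cong_sets[OF sK refl])
    have spK: "space K = space M" using sets_eq_imp_space_eq[OF sK] .
    have "(\<integral>\<^sup>+x. f x \<partial>K) = (\<integral>\<^sup>+x. \<integral>\<^sup>+t. indicator {t. ennreal t < f x} t *
      indicator {0..<1} t \<partial>lborel \<partial>K)"
    proof (intro nn_integral_cong)
      fix x assume "x \<in> space K"
      then obtain r where r: "f x = ennreal r" "0 \<le> r" "r \<le> 1"
        using f1[of x] spK by (cases "f x") (auto simp: top_unique)
      have "(\<integral>\<^sup>+t. indicator {t. ennreal t < f x} t * indicator {0..<1} t \<partial>lborel)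
          = (\<integral>\<^sup>+t. indicator {0..<r} t \<partial>lborel)"
        by (intro nn_integral_cong) (use r in \<open>auto simp: ennreal_less_iff split: split_indicator\<close>)
      then show "f x = (\<integral>\<^sup>+t. indicator {t. ennreal t < f x} t * indicator {0..<1} t \<partial>lborel)"
        using r by simp
    qed
    also have "\<dots> = (\<integral>\<^sup>+t. \<integral>\<^sup>+x. indicator {t. ennreal t < f x} t * indicator {0..<1} t \<partial>K \<partial>lborel)"
      by (rule Fubini'[symmetric]) (simp only: split_beta', measurable)
    also have "\<dots> = (\<integral>\<^sup>+t. emeasure K {x\<in>space K. ennreal t < f x} * indicator {0..<1} t \<partial>lborel)"
    proof (intro nn_integral_cong)
      fix t :: real
      have "(\<integral>\<^sup>+x. indicator {t. ennreal t < f x} t * indicator {0..<1} t \<partial>K)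
          = (\<integral>\<^sup>+x. indicator {x\<in>space K. ennreal t < f x} x * indicator {0..<1} t \<partial>K)"
        by (intro nn_integral_cong) (auto split: split_indicator)
      also have "\<dots> = emeasure K {x\<in>space K. ennreal t < f x} * indicator {0..<1} t"
        by (subst nn_integral_multc) auto
      finally show "(\<integral>\<^sup>+x. indicator {t. ennreal t < f x} t * indicator {0..<1} t \<partial>K)
          = emeasure K {x\<in>space K. ennreal t < f x} * indicator {0..<1} t" .
    qed
    finally show ?thesis .
  qed
  have mN: "(\<lambda>t. emeasure N {x\<in>space N. ennreal t < f x}) \<in> borel_measurable lborel"
  proof -
    interpret finite_measure N by fact
    have [measurable]: "f \<in> borel_measurable N"
      using f by (simp add: measurable_cong_sets[OF s[symmetric] refl])
    show ?thesis by measurable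
  qed
  have fm: "{x\<in>space M. ennreal t < f x} \<in> sets M" for t
    using f by measurable
  have "(\<integral>\<^sup>+x. f x \<partial>M) = (\<integral>\<^sup>+t. emeasure M {x\<in>space M. ennreal t < f x} * indicator {0..<1} t \<partial>lborel)"
    by (rule layer) (use assms in auto)
  also have "\<dots> \<le> (\<integral>\<^sup>+t. emeasure N {x\<in>space N. ennreal t < f x} * indicator {0..<1} t + c *
    indicator {0..<1::real} t \<partial>lborel)"
    using le[OF fm] by (intro nn_integral_mono) (auto simp: sp split: split_indicator)
  also have "\<dots> = (\<integral>\<^sup>+t. emeasure N {x\<in>space N. ennreal t < f x} * indicator {0..<1} t \<partial>lborel) +
    (\<integral>\<^sup>+t. c * indicator {0..<1::real} t \<partial>lborel)"
    using mN by (intro nn_integral_add) auto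
  also have "(\<integral>\<^sup>+t. emeasure N {x\<in>space N. ennreal t < f x} * indicator {0..<1} t \<partial>lborel) =
    (\<integral>\<^sup>+x. f x \<partial>N)"
    by (rule layer[symmetric]) (use assms in auto)
  also have "(\<integral>\<^sup>+t. c * indicator {0..<1::real} t \<partial>lborel) = c"
    by (subst nn_integral_cmult) auto
  finally show ?thesis .
qed

lemma nn_integral_mono_emeasure:
  assumes s: "sets M = sets N" and le: "\<And>A. A \<in> sets M \<Longrightarrow> emeasure M A \<le> emeasure N A"
  shows "(\<integral>\<^sup>+x. f x \<partial>M) \<le> (\<integral>\<^sup>+x. f x \<partial>N)"
proof (rule nn_integral_mono_measure[OF s])
  show "M \<le> N"
    using s le by (subst le_measure) (auto simp: le_fun_def emeasure_notin_sets)
qed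

text \<open>
  A countable family on which setwise bounds up to a constant can be tested. It makes the
  discrepancy \<open>excess\<close> below between \<open>P\<^sup>m(x, \<cdot>)\<close> and \<open>\<pi>\<close> measurable in \<open>x\<close>.
\<close>

definition comparing :: "'a::polish_space set set \<Rightarrow> bool" where
  "comparing \<B> \<longleftrightarrow> countable \<B> \<and> \<B> \<subseteq> sets borel \<and>
     (\<forall>M N c A. sets M = sets borel \<longrightarrow> sets N = sets borel \<longrightarrow> finite_measure M \<longrightarrow> finite_measure N \<longrightarrow>
       (\<forall>B\<in>\<B>. emeasure M B \<le> emeasure N B + c) \<longrightarrow> A \<in> sets borel \<longrightarrow>
       emeasure M A \<le> emeasure N A + c)"

text \<open>Finite unions of basic open sets exhaust open sets from inside, and open sets
  approximate Borel sets from outside by outer regularity. Unions are taken because an inequality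
  with an additive constant cannot be summed over disjoint basic sets.\<close>

lemma ex_comparing: "\<exists>\<B> :: 'a::polish_space set set. comparing \<B>"
proof -
  obtain B :: "'a set set" where B: "countable B" "topological_basis B"
    using ex_countable_basis by auto
  let ?B = "Union ` {X. finite X \<and> X \<subseteq> B}"
  have openB: "open U" if "U \<in> ?B" for U
    using that topological_basis_open[OF B(2)] by (auto intro!: open_Union)
  have main: "emeasure M A \<le> emeasure N A + c"
    if s: "sets M = sets borel" "sets N = sets borel" and fin: "finite_measure M" "finite_measure N"
      and le: "\<And>B. B \<in> ?B \<Longrightarrow> emeasure M B \<le> emeasure N B + c" and A: "A \<in> sets borel"
    for M N :: "'a measure" and c A
  proof -
    interpret M: finite_measure M by fact
    interpret N: finite_measure N by fact
    have op: "emeasure M U \<le> emeasure N U + c" if "open U" for U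
    proof -
      have "\<exists>B'\<subseteq>B. \<Union>B' = U"
        using B(2) that by (simp add: topological_basis_def)
      then obtain B' where B': "B' \<subseteq> B" "U = \<Union>B'"
        by auto
      have cB': "countable B'" using B' B(1) countable_subset by auto
      define V where "V n = \<Union>{b \<in> B'. to_nat_on B' b \<le> n}" for n
      have fin_V: "finite {b \<in> B'. to_nat_on B' b \<le> n}" for n
      proof (rule finite_imageD)
        show "finite (to_nat_on B' ` {b \<in> B'. to_nat_on B' b \<le> n})"
          by (rule finite_subset[of _ "{..n}"]) auto
        show "inj_on (to_nat_on B') {b \<in> B'. to_nat_on B' b \<le> n}"
          using inj_on_to_nat_on[OF cB'] by (rule inj_on_subset) auto
      qed
      have VB: "V n \<in> ?B" for n
        unfolding V_def using fin_V[of n] B'(1) by (intro imageI) auto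
      have inc: "incseq V"
        by (auto simp: incseq_def V_def intro: le_trans)
      have U: "U = (\<Union>n. V n)"
        unfolding B'(2) V_def by auto
      have "emeasure M U = (SUP n. emeasure M (V n))"
        unfolding U using inc openB[OF VB] s by (subst SUP_emeasure_incseq) auto
      also have "\<dots> \<le> emeasure N U + c"
      proof (rule SUP_least)
        fix n
        have "emeasure M (V n) \<le> emeasure N (V n) + c" by (rule le[OF VB])
        also have "emeasure N (V n) \<le> emeasure N U"
          using openB[OF VB] that s by (intro emeasure_mono) (auto simp: U)
        finally show "emeasure M (V n) \<le> emeasure N U + c" by simp
      qed
      finally show ?thesis .
    qed
    \<comment> \<open>The constant is moved to the left so that the infimum over open supersets can
      be taken on the right.\<close>
    have le_open: "emeasure M A - c \<le> emeasure N U" if "A \<subseteq> U" "open U" for U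
    proof -
      have "emeasure M A \<le> emeasure M U" using that s by (intro emeasure_mono) auto
      then have "emeasure M A \<le> c + emeasure N U" using op[OF that(2)] by (simp add: add.commute)
      then show ?thesis using M.emeasure_finite[of A] by (simp add: ennreal_minus_le_iff)
    qed
    have "emeasure M A - c \<le> (INF U \<in> {U. A \<subseteq> U \<and> open U}. emeasure N U)"
      by (rule INF_greatest) (use le_open in auto)
    also have "\<dots> = emeasure N A"
      using outer_regular[of N A] s fin A N.emeasure_finite by auto
    finally show ?thesis
      by (simp add: ennreal_minus_le_iff add.commute)
  qed
  have "countable ?B"
    by (intro countable_image countable_Collect_finite_subset B)
  moreover have "?B \<subseteq> sets borel"
    using openB by auto
  moreover have "emeasure M A \<le> emeasure N A + c"
    if "sets M = sets borel" "sets N = sets borel" "finite_measure M" "finite_measure N"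
      "\<forall>B\<in>?B. emeasure M B \<le> emeasure N B + c" "A \<in> sets borel" for M N :: "'a measure" and c A
    using main[of M N c A] that by auto
  ultimately show ?thesis
    unfolding comparing_def by (intro exI[of _ ?B]) simp
qed

definition comparing_base :: "'a::polish_space set set" where
  "comparing_base = (SOME \<B>. comparing \<B>)"

lemma countable_comparing_base: "countable comparing_base"
  and comparing_base_sets: "B \<in> comparing_base \<Longrightarrow> B \<in> sets borel"
  and emeasure_le_if_comparing_base:
    "sets M = sets borel \<Longrightarrow> sets N = sets borel \<Longrightarrow> finite_measure M \<Longrightarrow> finite_measure N \<Longrightarrow>
      (\<And>B. B \<in> comparing_base \<Longrightarrow> emeasure M B \<le> emeasure N B + c) \<Longrightarrow> A \<in> sets borel \<Longrightarrow>
      emeasure M A \<le> emeasure N A + c"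
proof -
  have c: "comparing comparing_base"
    unfolding comparing_base_def by (rule someI_ex[OF ex_comparing])
  show "countable comparing_base" and "B \<in> comparing_base \<Longrightarrow> B \<in> sets borel"
    using c by (auto simp: comparing_def)
  assume "sets M = sets borel" "sets N = sets borel" "finite_measure M" "finite_measure N"
    "\<And>B. B \<in> comparing_base \<Longrightarrow> emeasure M B \<le> emeasure N B + c" "A \<in> sets borel"
  then show "emeasure M A \<le> emeasure N A + c"
    using c[unfolded comparing_def, THEN conjunct2, THEN conjunct2, rule_format, of M N c A] by simp
qed

text \<open>Both measures have densities \<open>f\<close> and \<open>h\<close> with respect to their
  sum. The set where \<open>f\<close> vanishes carries the singular part of N, and the quotient of
  \<open>h\<close> by \<open>f\<close> is the density elsewhere.\<close>

lemma Lebesgue_decomposition: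
  assumes "prob_space M" "prob_space N" and s: "sets N = sets M"
  obtains N0 and q :: "'a \<Rightarrow> real" where "N0 \<in> sets M" "emeasure M N0 = 0" "q \<in> borel_measurable M"
    "\<And>x. 0 \<le> q x" "density N (indicator (space M - N0)) = density M (\<lambda>x. ennreal (q x))"
proof -
  interpret M: prob_space M by fact
  interpret N: prob_space N by fact
  note s[measurable_cong]
  have sp: "space N = space M" using sets_eq_imp_space_eq[OF s] .
  \<comment> \<open>The sum of M and N, obtained as a bind over the counting measure on two
    points.\<close>
  define R where "R = count_space (UNIV::bool set) \<bind> (\<lambda>b. if b then M else N)"
  have k: "(\<lambda>b. if b then M else N) \<in> count_space UNIV \<rightarrow>\<^sub>M subprob_algebra M"
    using assms by (auto simp: space_subprob_algebra prob_space_imp_subprob_space)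
  have sR[measurable_cong]: "sets R = sets M"
    unfolding R_def using k by (auto intro!: sets_bind simp: s)
  have spR: "space R = space M" using sets_eq_imp_space_eq[OF sR] .
  have R: "emeasure R A = emeasure M A + emeasure N A" if "A \<in> sets M" for A
    unfolding R_def using k that
    by (subst emeasure_bind[where N=M])
      (auto simp: nn_integral_count_space_finite UNIV_bool add.commute)
  have "finite_measure R"
    using M.emeasure_space_1 N.emeasure_space_1 by (intro finite_measureI) (auto simp: R spR sp)
  then interpret R: finite_measure R .
  have "absolutely_continuous R M" "absolutely_continuous R N"
    by (auto simp: absolutely_continuous_def null_sets_def R s sR)
  then obtain f h where f: "f \<in> borel_measurable R" "density R f = M"
    and h: "h \<in> borel_measurable R" "density R h = N"
    using R.Radon_Nikodym[of M] R.Radon_Nikodym[of N] by (auto simp: sR s)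
  note f(1)[measurable] h(1)[measurable]
  have mass: "AE x in R. d x \<noteq> \<infinity>"
    if d: "d \<in> borel_measurable R" and K: "density R d = K" "prob_space K" for d :: "'a \<Rightarrow> ennreal" and K
  proof (rule nn_integral_PInf_AE[OF d])
    have "(\<integral>\<^sup>+x. d x \<partial>R) = emeasure (density R d) (space R)"
      using d by (subst emeasure_density) (auto intro!: nn_integral_cong)
    also have "\<dots> = 1"
      using prob_space.emeasure_space_1[OF K(2)] K(1) by (metis space_density)
    finally show "(\<integral>\<^sup>+x. d x \<partial>R) \<noteq> \<infinity>" by simp
  qed
  have ff: "AE x in R. f x \<noteq> \<infinity>" and hf: "AE x in R. h x \<noteq> \<infinity>"
    using mass[OF f assms(1)] mass[OF h assms(2)] by auto
  define N0 where "N0 = {x\<in>space M. f x = 0}"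
  define q where "q x = (if f x = 0 then 0 else enn2real (h x / f x))" for x
  have N0[measurable]: "N0 \<in> sets M" unfolding N0_def using f sR by measurable
  have qm: "q \<in> borel_measurable R" unfolding q_def by measurable
  have "emeasure M N0 = (\<integral>\<^sup>+x. f x * indicator N0 x \<partial>R)"
    using f N0 sR by (subst f(2)[symmetric], subst emeasure_density) auto
  also have "\<dots> = (\<integral>\<^sup>+x. 0 \<partial>R)"
    by (intro nn_integral_cong) (auto simp: N0_def split: split_indicator)
  finally have "emeasure M N0 = 0" by simp
  moreover have "density N (indicator (space M - N0)) = density M (\<lambda>x. ennreal (q x))"
  proof -
    have "density N (indicator (space M - N0)) = density R (\<lambda>x. h x * indicator (space M - N0) x)"
      using h N0 by (subst h(2)[symmetric], subst density_density_eq) auto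
    also have "\<dots> = density R (\<lambda>x. f x * ennreal (q x))"
    proof (rule density_cong)
      show "AE x in R. h x * indicator (space M - N0) x = f x * ennreal (q x)"
        using ff hf AE_space
      proof eventually_elim
        case (elim x)
        show ?case
        proof (cases "f x = 0")
          case False
          then obtain a b where ab: "f x = ennreal a" "0 < a" "h x = ennreal b" "0 \<le> b"
            using elim by (cases "f x"; cases "h x") (auto simp: less_le)
          then show ?thesis
            using elim by (auto simp: q_def N0_def spR divide_ennreal ennreal_mult[symmetric] split:
              split_indicator)
        qed (use elim in \<open>auto simp: q_def N0_def spR split: split_indicator\<close>)
      qed
    qed (use qm in measurable)
    also have "\<dots> = density M (\<lambda>x. ennreal (q x))"
      using density_density_eq[of f R "\<lambda>x. ennreal (q x)"] f qm by simp
    finally show ?thesis .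
  qed
  moreover have "q \<in> borel_measurable M"
    using qm by (simp add: measurable_cong_sets[OF sR refl])
  moreover have "\<And>x. 0 \<le> q x" by (simp add: q_def)
  ultimately show thesis by (intro that[of N0 q] N0)
qed

section \<open>Pointwise inequalities from integrated ones\<close>

lemma AE_le_if_nn_integral_le:
  assumes [measurable]: "f \<in> borel_measurable M" "g \<in> borel_measurable M"
    and fin: "(\<integral>\<^sup>+x. g x \<partial>M) < \<infinity>"
    and le: "\<And>C. C \<in> sets M \<Longrightarrow> (\<integral>\<^sup>+x. f x * indicator C x \<partial>M) \<le> (\<integral>\<^sup>+x. g x * indicator C x \<partial>M)"
  shows "AE x in M. f x \<le> (g x :: ennreal)"
proof -
  define C where "C = {x\<in>space M. g x < f x}"
  have C[measurable]: "C \<in> sets M" unfolding C_def by measurable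
  have finC: "(\<integral>\<^sup>+x. g x * indicator C x \<partial>M) \<noteq> \<infinity>"
  proof -
    have "(\<integral>\<^sup>+x. g x * indicator C x \<partial>M) \<le> (\<integral>\<^sup>+x. g x \<partial>M)"
      by (intro nn_integral_mono) (auto split: split_indicator)
    then show ?thesis using fin by auto
  qed
  have "(\<integral>\<^sup>+x. f x * indicator C x - g x * indicator C x \<partial>M)
      = (\<integral>\<^sup>+x. f x * indicator C x \<partial>M) - (\<integral>\<^sup>+x. g x * indicator C x \<partial>M)"
    using finC by (intro nn_integral_diff) (auto simp: C_def split: split_indicator)
  also have "\<dots> = 0"
    using le[OF C] finC by (intro diff_eq_0_ennreal) (auto simp: less_top)
  finally have "AE x in M. f x * indicator C x - g x * indicator C x = 0"
    by (subst (asm) nn_integral_0_iff_AE) auto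
  then show ?thesis
    using AE_space
  proof eventually_elim
    case (elim x)
    show ?case
    proof (rule ccontr)
      assume *: "\<not> f x \<le> g x"
      then have "x \<in> C" using elim by (auto simp: C_def)
      then have "f x - g x = 0" using elim by simp
      then show False using * by (simp add: ennreal_minus_eq_0)
    qed
  qed
qed

text \<open>For a single B the exceptional null set may depend on B. The countable family
  \<open>comparing_base\<close> leaves countably many such sets, and outside of their union the
  inequality extends to all Borel sets at once.\<close>

lemma AE_kernel_le:
  fixes K L :: "'a \<Rightarrow> 'e::polish_space measure"
  assumes sK: "\<And>x. sets (K x) = sets borel" and sL: "\<And>x. sets (L x) = sets borel"
    and mK: "\<And>B. B \<in> sets borel \<Longrightarrow> (\<lambda>x. emeasure (K x) B) \<in> borel_measurable M"
    and mL: "\<And>B. B \<in> sets borel \<Longrightarrow> (\<lambda>x. emeasure (L x) B) \<in> borel_measurable M"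
    and fin: "(\<integral>\<^sup>+x. emeasure (L x) UNIV \<partial>M) < \<infinity>"
    and le: "\<And>B C. B \<in> sets borel \<Longrightarrow> C \<in> sets M \<Longrightarrow>
      (\<integral>\<^sup>+x. emeasure (K x) B * indicator C x \<partial>M) \<le> (\<integral>\<^sup>+x. emeasure (L x) B * indicator C x \<partial>M)"
  shows "AE x in M. \<forall>B\<in>sets borel. emeasure (K x) B \<le> emeasure (L x) B"
proof -
  have AE1: "AE x in M. emeasure (K x) B \<le> emeasure (L x) B" if B: "B \<in> sets borel" for B
  proof (rule AE_le_if_nn_integral_le)
    have "(\<integral>\<^sup>+x. emeasure (L x) B \<partial>M) \<le> (\<integral>\<^sup>+x. emeasure (L x) UNIV \<partial>M)"
      using sL by (intro nn_integral_mono emeasure_mono) auto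
    then show "(\<integral>\<^sup>+x. emeasure (L x) B \<partial>M) < \<infinity>" using fin by auto
  qed (use B mK mL le in auto)
  have "AE x in M. \<forall>B\<in>comparing_base. emeasure (K x) B \<le> emeasure (L x) B"
    using AE1 comparing_base_sets by (subst AE_ball_countable[OF countable_comparing_base]) auto
  moreover have "AE x in M. emeasure (L x) UNIV \<noteq> \<infinity>"
    using fin mL[of UNIV] by (intro nn_integral_PInf_AE) auto
  moreover have "AE x in M. emeasure (K x) UNIV \<le> emeasure (L x) UNIV"
    by (rule AE1) simp
  ultimately show ?thesis
  proof eventually_elim
    case (elim x)
    have "space (K x) = UNIV" "space (L x) = UNIV"
      using sets_eq_imp_space_eq[OF sK] sets_eq_imp_space_eq[OF sL] by auto
    then have "finite_measure (K x)" "finite_measure (L x)"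
      using elim by (auto intro!: finite_measureI simp: top_unique)
    then show ?case
      using emeasure_le_if_comparing_base[OF sK sL, where c=0] elim(1) by simp
  qed
qed

section \<open>The chain of states and observation histories\<close>

lemma nn_integral_kernel[measurable (raw)]:
  assumes "K \<in> M \<rightarrow>\<^sub>M prob_algebra N" and "(\<lambda>(x, y). f x y) \<in> borel_measurable (M \<Otimes>\<^sub>M N)"
  shows "(\<lambda>x. \<integral>\<^sup>+y. f x y \<partial>K x) \<in> borel_measurable M"
  using nn_integral_measurable_subprob_algebra2[OF assms(2) measurable_prob_algebraD[OF assms(1)]] .

lemma nn_integral_bind_prob:
  assumes "sets L = sets M" "K \<in> M \<rightarrow>\<^sub>M prob_algebra N" "f \<in> borel_measurable N"
  shows "(\<integral>\<^sup>+y. f y \<partial>(L \<bind> K)) = (\<integral>\<^sup>+x. \<integral>\<^sup>+y. f y \<partial>K x \<partial>L)"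
  using assms(3) by (rule nn_integral_bind)
    (use assms measurable_prob_algebraD in \<open>auto cong: measurable_cong_sets\<close>)

lemma bind_in_prob_algebra:
  "A \<in> space (prob_algebra M) \<Longrightarrow> K \<in> M \<rightarrow>\<^sub>M prob_algebra N \<Longrightarrow> A \<bind> K \<in> space (prob_algebra N)"
  using prob_space_bind'[of A M K N] sets_bind'[of A M K N] by (simp add: space_prob_algebra)

lemma kernel_prob:
  "K \<in> M \<rightarrow>\<^sub>M prob_algebra N \<Longrightarrow> x \<in> space M \<Longrightarrow> prob_space (K x)"
  "K \<in> M \<rightarrow>\<^sub>M prob_algebra N \<Longrightarrow> x \<in> space M \<Longrightarrow> sets (K x) = sets N"
  using measurable_space[of K M "prob_algebra N" x] by (auto simp: space_prob_algebra)

lemma (in prob_space) nn_integral_le_1: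
  "(\<And>x. x \<in> space M \<Longrightarrow> f x \<le> 1) \<Longrightarrow> (\<integral>\<^sup>+x. f x \<partial>M) \<le> 1"
  using nn_integral_mono[of M f "\<lambda>_. 1"] by (simp add: emeasure_space_1)

lemma nn_integral_swap_prob:
  assumes "prob_space M" "prob_space N" "(\<lambda>(x, y). f x y) \<in> borel_measurable (M \<Otimes>\<^sub>M N)"
  shows "(\<integral>\<^sup>+x. \<integral>\<^sup>+y. f x y \<partial>N \<partial>M) = (\<integral>\<^sup>+y. \<integral>\<^sup>+x. f x y \<partial>M \<partial>N)"
proof -
  interpret M: prob_space M by fact
  interpret N: prob_space N by fact
  interpret pair_sigma_finite M N ..
  show ?thesis using Fubini'[OF assms(3)] by simp
qed

section \<open>Iterated kernels\<close>

primrec kpow :: "'a measure \<Rightarrow> ('a \<Rightarrow> 'a measure) \<Rightarrow> nat \<Rightarrow> 'a \<Rightarrow> 'a measure" where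
  "kpow M K 0 = return M"
| "kpow M K (Suc n) = (\<lambda>x. K x \<bind> kpow M K n)"

lemma kpow_measurable[measurable (raw)]:
  assumes [measurable]: "K \<in> M \<rightarrow>\<^sub>M prob_algebra M"
  shows "kpow M K n \<in> M \<rightarrow>\<^sub>M prob_algebra M"
  by (induction n) (auto intro: measurable_bind_prob_space assms)

lemma nn_integral_kpow_Suc:
  assumes K: "K \<in> M \<rightarrow>\<^sub>M prob_algebra M" and f: "f \<in> borel_measurable M" and x: "x \<in> space M"
  shows "(\<integral>\<^sup>+z. f z \<partial>kpow M K (Suc n) x) = (\<integral>\<^sup>+y. \<integral>\<^sup>+z. f z \<partial>kpow M K n y \<partial>K x)"
  using nn_integral_bind_prob[OF kernel_prob(2)[OF K x] kpow_measurable[OF K] f] by simp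

lemma nn_integral_kpow_add:
  assumes K: "K \<in> M \<rightarrow>\<^sub>M prob_algebra M" and f: "f \<in> borel_measurable M" and x: "x \<in> space M"
  shows "(\<integral>\<^sup>+z. f z \<partial>kpow M K (m + n) x) = (\<integral>\<^sup>+y. \<integral>\<^sup>+z. f z \<partial>kpow M K n y \<partial>kpow M K m x)"
  using x
proof (induction m arbitrary: x)
  case 0
  have "(\<lambda>y. \<integral>\<^sup>+z. f z \<partial>kpow M K n y) \<in> borel_measurable M"
    using K f by measurable
  then show ?case using 0 by (simp add: nn_integral_return)
next
  case (Suc m)
  have [measurable]: "(\<lambda>y. \<integral>\<^sup>+z. f z \<partial>kpow M K n y) \<in> borel_measurable M"
    using K f by measurable
  have "(\<integral>\<^sup>+z. f z \<partial>kpow M K (Suc (m + n)) x) = (\<integral>\<^sup>+y. \<integral>\<^sup>+z. f z \<partial>kpow M K (m + n) y \<partial>K x)"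
    by (rule nn_integral_kpow_Suc[OF K f Suc.prems])
  also have "\<dots> = (\<integral>\<^sup>+y. (\<integral>\<^sup>+y'. \<integral>\<^sup>+z. f z \<partial>kpow M K n y' \<partial>kpow M K m y) \<partial>K x)"
    using sets_eq_imp_space_eq[OF kernel_prob(2)[OF K Suc.prems]]
    by (intro nn_integral_cong Suc.IH) auto
  also have "\<dots> = (\<integral>\<^sup>+y'. \<integral>\<^sup>+z. f z \<partial>kpow M K n y' \<partial>kpow M K (Suc m) x)"
    by (rule nn_integral_kpow_Suc[symmetric, OF K _ Suc.prems]) measurable
  finally show ?case by simp
qed

lemma bind_kpow_add:
  assumes K: "K \<in> M \<rightarrow>\<^sub>M prob_algebra M" and L: "L \<in> space (prob_algebra M)"
  shows "L \<bind> kpow M K (m + n) = (L \<bind> kpow M K m) \<bind> kpow M K n"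
proof (rule measure_eqI)
  have s: "sets L = sets M" using L by (simp add: space_prob_algebra)
  note bnd = bind_in_prob_algebra[OF _ kpow_measurable[OF K]]
  have s1: "sets (L \<bind> kpow M K k) = sets M" for k
    using bnd[OF L] by (auto simp: space_prob_algebra)
  have s2: "sets ((L \<bind> kpow M K m) \<bind> kpow M K n) = sets M"
    using bnd[OF bnd[OF L]] by (auto simp: space_prob_algebra)
  show "sets (L \<bind> kpow M K (m + n)) = sets ((L \<bind> kpow M K m) \<bind> kpow M K n)"
    by (simp add: s1 s2)
  fix A assume "A \<in> sets (L \<bind> kpow M K (m + n))"
  then have A[measurable]: "A \<in> sets M" by (simp add: s1)
  have i: "indicator A \<in> borel_measurable M" by measurable
  have "emeasure (L \<bind> kpow M K (m + n)) A = (\<integral>\<^sup>+x. indicator A x \<partial>(L \<bind> kpow M K (m + n)))"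
    by (simp add: s1)
  also have "\<dots> = (\<integral>\<^sup>+x. \<integral>\<^sup>+z. indicator A z \<partial>kpow M K (m + n) x \<partial>L)"
    by (rule nn_integral_bind_prob[OF s kpow_measurable[OF K] i])
  also have "\<dots> = (\<integral>\<^sup>+x. \<integral>\<^sup>+y. \<integral>\<^sup>+z. indicator A z \<partial>kpow M K n y \<partial>kpow M K m x \<partial>L)"
    using sets_eq_imp_space_eq[OF s] by (intro nn_integral_cong nn_integral_kpow_add[OF K i]) simp
  also have "\<dots> = (\<integral>\<^sup>+y. \<integral>\<^sup>+z. indicator A z \<partial>kpow M K n y \<partial>(L \<bind> kpow M K m))"
    by (rule nn_integral_bind_prob[symmetric, OF s kpow_measurable[OF K]])
      (use K in measurable)
  also have "\<dots> = (\<integral>\<^sup>+z. indicator A z \<partial>((L \<bind> kpow M K m) \<bind> kpow M K n))"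
    by (rule nn_integral_bind_prob[symmetric, OF s1 kpow_measurable[OF K] i])
  also have "\<dots> = emeasure ((L \<bind> kpow M K m) \<bind> kpow M K n) A"
    by (simp add: s2)
  finally show "emeasure (L \<bind> kpow M K (m + n)) A = emeasure ((L \<bind> kpow M K m) \<bind> kpow M K n) A" .
qed

text \<open>
  A state \<open>(x, h)\<close> consists of the current value of the signal, whose observation is still to be
  drawn, and of the history \<open>h\<close> of the earlier observations. The type of histories is kept abstract so
  that a parameter can be carried along as part of the history; see \<open>hist_chain_param\<close>.
\<close>

locale hist_chain =
  fixes P :: "'e::polish_space \<Rightarrow> 'e measure" and \<phi> :: "'f::polish_space measure"
    and \<pi> :: "'e measure" and MH :: "'h measure" and push :: "'f \<Rightarrow> 'h \<Rightarrow> 'h"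
  assumes P[measurable]: "P \<in> borel \<rightarrow>\<^sub>M prob_algebra borel"
    and \<phi>: "\<phi> \<in> space (prob_algebra borel)"
    and \<pi>: "\<pi> \<in> space (prob_algebra borel)"
    and stationary: "\<pi> \<bind> P = \<pi>"
    and push: "(\<lambda>(w, h). push w h) \<in> borel \<Otimes>\<^sub>M MH \<rightarrow>\<^sub>M MH"
begin

lemma sets_\<pi>[measurable_cong, simp]: "sets \<pi> = sets borel" and prob_\<pi>: "prob_space \<pi>"
  using \<pi> by (auto simp: space_prob_algebra)

lemma space_\<pi>[simp]: "space \<pi> = UNIV"
  using sets_eq_imp_space_eq[OF sets_\<pi>] by simp

sublocale \<pi>: prob_space \<pi> by (rule prob_\<pi>)

lemma push_in: "h \<in> space MH \<Longrightarrow> push w h \<in> space MH"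
  using measurable_space[OF push, of "(w, h)"] by (simp add: space_pair_measure)

lemma sets_\<phi>[measurable_cong, simp]: "sets \<phi> = sets borel" and prob_\<phi>: "prob_space \<phi>"
  using \<phi> by (auto simp: space_prob_algebra)

lemma space_\<phi>[simp]: "space \<phi> = UNIV"
  using sets_eq_imp_space_eq[OF sets_\<phi>] by simp

sublocale \<phi>: prob_space \<phi> by (rule prob_\<phi>)

lemma sets_P[measurable_cong, simp]: "sets (P x) = sets borel" and prob_P: "prob_space (P x)"
  and space_P[simp]: "space (P x) = UNIV"
  using kernel_prob[OF P, of x] sets_eq_imp_space_eq[of "P x" borel] by auto

text \<open>The given \<open>g\<close> and the constant 1 both belong to this class, so the observed
  chain and the chain with pure noise are instances of one construction and can be compared step by
  step.\<close>

definition obs_density :: "('e \<Rightarrow> 'f \<Rightarrow> real) \<Rightarrow> bool" where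
  "obs_density g \<longleftrightarrow> (\<lambda>(x, w). g x w) \<in> borel_measurable (borel \<Otimes>\<^sub>M borel) \<and> (\<forall>x w. 0 < g x w) \<and>
     (\<forall>x. (\<integral>\<^sup>+w. ennreal (g x w) \<partial>\<phi>) = 1)"

lemma obs_densityD:
  assumes "obs_density g"
  shows "(\<lambda>(x, w). g x w) \<in> borel_measurable (borel \<Otimes>\<^sub>M borel)" "0 < g x w"
    "(\<integral>\<^sup>+w. ennreal (g x w) \<partial>\<phi>) = 1"
  using assms by (auto simp: obs_density_def)

lemma obs_density_1: "obs_density (\<lambda>_ _. 1)"
  using \<phi>.emeasure_space_1 by (simp add: obs_density_def)

definition obs :: "('e \<Rightarrow> 'f \<Rightarrow> real) \<Rightarrow> 'e \<Rightarrow> 'f measure" where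
  "obs g x = density \<phi> (\<lambda>w. ennreal (g x w))"

lemma sets_obs[measurable_cong, simp]: "sets (obs g x) = sets borel"
  and space_obs[simp]: "space (obs g x) = UNIV"
  by (simp_all add: obs_def)

lemma nn_integral_obs:
  assumes g: "obs_density g" and [measurable]: "f \<in> borel_measurable borel"
  shows "(\<integral>\<^sup>+w. f w \<partial>obs g x) = (\<integral>\<^sup>+w. ennreal (g x w) * f w \<partial>\<phi>)"
proof -
  note obs_densityD(1)[OF g, measurable]
  show ?thesis unfolding obs_def by (rule nn_integral_density) measurable
qed

lemma obs_kernel: assumes g: "obs_density g" shows "obs g \<in> borel \<rightarrow>\<^sub>M prob_algebra borel"
proof (rule measurable_prob_algebraI)
  note obs_densityD(1)[OF g, measurable]
  show p: "prob_space (obs g x)" for x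
    using obs_densityD(3)[OF g, of x]
    by (auto intro!: prob_spaceI simp: obs_def emeasure_density)
  show "obs g \<in> borel \<rightarrow>\<^sub>M subprob_algebra borel"
  proof (rule measurable_subprob_algebra)
    show "subprob_space (obs g x)" for x by (rule prob_space_imp_subprob_space[OF p])
    fix A :: "'f set" assume [measurable]: "A \<in> sets borel"
    have "(\<lambda>x. emeasure (obs g x) A) = (\<lambda>x. \<integral>\<^sup>+w. ennreal (g x w) * indicator A w \<partial>\<phi>)"
      by (auto simp: obs_def emeasure_density fun_eq_iff)
    then show "(\<lambda>x. emeasure (obs g x) A) \<in> borel_measurable borel" by simp
  qed simp
qed

text \<open>Given the current signal, its observation and the next signal are independent, hence the
  product measure.\<close>

definition step :: "('e \<Rightarrow> 'f \<Rightarrow> real) \<Rightarrow> 'e \<times> 'h \<Rightarrow> ('e \<times> 'h) measure" where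
  "step g = (\<lambda>(x, h). distr (obs g x \<Otimes>\<^sub>M P x) (borel \<Otimes>\<^sub>M MH) (\<lambda>(w, z). (z, push w h)))"

lemma step_kernel:
  assumes g: "obs_density g"
  shows "step g \<in> borel \<Otimes>\<^sub>M MH \<rightarrow>\<^sub>M prob_algebra (borel \<Otimes>\<^sub>M MH)"
proof -
  note obs_kernel[OF g, measurable] push[measurable]
  show ?thesis
    unfolding step_def split_beta'
    by (rule measurable_distr_prob_space2[where M="borel \<Otimes>\<^sub>M borel"]) measurable
qed

lemma push_section: "h \<in> space MH \<Longrightarrow> (\<lambda>w. push w h) \<in> borel \<rightarrow>\<^sub>M MH"
  using measurable_compose[OF measurable_Pair2' push] by simp

lemma nn_integral_step:
  assumes g: "obs_density g" and F[measurable]: "F \<in> borel_measurable (borel \<Otimes>\<^sub>M MH)"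
    and h: "h \<in> space MH"
  shows "(\<integral>\<^sup>+s. F s \<partial>step g (x, h)) =
    (\<integral>\<^sup>+w. ennreal (g x w) * (\<integral>\<^sup>+z. F (z, push w h) \<partial>P x) \<partial>\<phi>)"
proof -
  note obs_kernel[OF g, measurable] push_section[OF h, measurable]
  interpret Px: prob_space "P x" by (rule prob_P)
  have "(\<integral>\<^sup>+s. F s \<partial>step g (x, h)) = (\<integral>\<^sup>+(w, z). F (z, push w h) \<partial>(obs g x \<Otimes>\<^sub>M P x))"
    unfolding step_def by (simp, subst nn_integral_distr) (auto simp: split_beta')
  also have "\<dots> = (\<integral>\<^sup>+w. \<integral>\<^sup>+z. F (z, push w h) \<partial>P x \<partial>obs g x)"
    by (subst Px.nn_integral_fst[symmetric]) (auto simp: split_beta')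
  also have "\<dots> = (\<integral>\<^sup>+w. ennreal (g x w) * (\<integral>\<^sup>+z. F (z, push w h) \<partial>P x) \<partial>\<phi>)"
    by (rule nn_integral_obs[OF g]) measurable
  finally show ?thesis .
qed

abbreviation "EH \<equiv> borel \<Otimes>\<^sub>M MH"

abbreviation steps :: "('e \<Rightarrow> 'f \<Rightarrow> real) \<Rightarrow> nat \<Rightarrow> 'e \<times> 'h \<Rightarrow> ('e \<times> 'h) measure" where
  "steps g \<equiv> kpow EH (step g)"

lemma steps_kernel: "obs_density g \<Longrightarrow> steps g n \<in> EH \<rightarrow>\<^sub>M prob_algebra EH"
  by (rule kpow_measurable[OF step_kernel])

text \<open>The signal is stationary while its dependence on the history is arbitrary. The class is
  preserved by \<open>step g\<close> for every observation density, since observations do not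
  influence the signal.\<close>

definition marg :: "('e \<times> 'h) measure \<Rightarrow> bool" where
  "marg L \<longleftrightarrow> L \<in> space (prob_algebra EH) \<and> distr L borel fst = \<pi>"

lemma margD:
  assumes "marg L"
  shows "L \<in> space (prob_algebra EH)" "sets L = sets EH" "space L = space EH" "prob_space L"
  using assms sets_eq_imp_space_eq[of L EH] by (auto simp: marg_def space_prob_algebra)

lemma nn_integral_marg:
  assumes L: "marg L" and f: "f \<in> borel_measurable borel"
  shows "(\<integral>\<^sup>+s. f (fst s) \<partial>L) = (\<integral>\<^sup>+x. f x \<partial>\<pi>)"
proof -
  note margD(2)[OF L, measurable_cong]
  have "(\<integral>\<^sup>+x. f x \<partial>distr L borel fst) = (\<integral>\<^sup>+s. f (fst s) \<partial>L)"
    by (rule nn_integral_distr) (use f in measurable)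
  then show ?thesis using L by (simp add: marg_def)
qed

lemma margI:
  assumes L: "L \<in> space (prob_algebra EH)"
    and eq: "\<And>A. A \<in> sets borel \<Longrightarrow> (\<integral>\<^sup>+s. indicator A (fst s) \<partial>L) = emeasure \<pi> A"
  shows "marg L"
  unfolding marg_def
proof (intro conjI L measure_eqI)
  have s[measurable_cong]: "sets L = sets EH" using L by (simp add: space_prob_algebra)
  fix A :: "'e set" assume "A \<in> sets (distr L borel fst)"
  then have [measurable]: "A \<in> sets borel" by simp
  have "emeasure (distr L borel fst) A = (\<integral>\<^sup>+x. indicator A x \<partial>distr L borel fst)" by simp
  also have "\<dots> = (\<integral>\<^sup>+s. indicator A (fst s) \<partial>L)"
    by (rule nn_integral_distr) measurable
  finally show "emeasure (distr L borel fst) A = emeasure \<pi> A" using eq by simp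
qed simp

lemma nn_integral_P_\<pi>:
  assumes "f \<in> borel_measurable borel"
  shows "(\<integral>\<^sup>+x. \<integral>\<^sup>+z. f z \<partial>P x \<partial>\<pi>) = (\<integral>\<^sup>+x. f x \<partial>\<pi>)"
  using nn_integral_bind_prob[OF sets_\<pi> P assms] stationary by simp

lemma nn_integral_step_fst:
  assumes g: "obs_density g" and [measurable]: "f \<in> borel_measurable borel" and h: "h \<in> space MH"
  shows "(\<integral>\<^sup>+s. f (fst s) \<partial>step g (x, h)) = (\<integral>\<^sup>+z. f z \<partial>P x)"
proof -
  note obs_densityD(1)[OF g, measurable]
  have "(\<integral>\<^sup>+s. f (fst s) \<partial>step g (x, h)) = (\<integral>\<^sup>+w. ennreal (g x w) * (\<integral>\<^sup>+z. f z \<partial>P x) \<partial>\<phi>)"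
    using nn_integral_step[OF g _ h, of "\<lambda>s. f (fst s)"] by simp
  also have "\<dots> = (\<integral>\<^sup>+z. f z \<partial>P x)"
    using obs_densityD(3)[OF g] by (subst nn_integral_multc) auto
  finally show ?thesis .
qed

lemma nn_integral_steps_fst:
  assumes g: "obs_density g" and [measurable]: "f \<in> borel_measurable borel" and h: "h \<in> space MH"
  shows "(\<integral>\<^sup>+s. f (fst s) \<partial>steps g n (x, h)) = (\<integral>\<^sup>+z. f z \<partial>kpow borel P n x)"
  using h
proof (induction n arbitrary: x h)
  case 0
  then show ?case by (simp add: nn_integral_return space_pair_measure)
next
  case (Suc n)
  have s: "(x, h) \<in> space EH" using Suc.prems by (simp add: space_pair_measure)
  have "(\<integral>\<^sup>+s. f (fst s) \<partial>steps g (Suc n) (x, h)) =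
    (\<integral>\<^sup>+s. \<integral>\<^sup>+s'. f (fst s') \<partial>steps g n s \<partial>step g (x, h))"
    by (rule nn_integral_kpow_Suc[OF step_kernel[OF g] _ s]) measurable
  also have "\<dots> = (\<integral>\<^sup>+s. (\<integral>\<^sup>+z. f z \<partial>kpow borel P n (fst s)) \<partial>step g (x, h))"
  proof (intro nn_integral_cong)
    fix s assume "s \<in> space (step g (x, h))"
    then have "s \<in> space EH"
      using sets_eq_imp_space_eq[OF kernel_prob(2)[OF step_kernel[OF g] s]] by simp
    then show "(\<integral>\<^sup>+s'. f (fst s') \<partial>steps g n s) = (\<integral>\<^sup>+z. f z \<partial>kpow borel P n (fst s))"
      using Suc.IH[of "snd s" "fst s"] by (simp add: space_pair_measure mem_Times_iff)
  qed
  also have "\<dots> = (\<integral>\<^sup>+z. f z \<partial>kpow borel P (Suc n) x)"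
    using nn_integral_step_fst[OF g _ Suc.prems, of "\<lambda>y. \<integral>\<^sup>+z. f z \<partial>kpow borel P n y" x]
      nn_integral_kpow_Suc[OF P, of f x n] by simp
  finally show ?case .
qed

lemma marg_step:
  assumes L: "marg L" and g: "obs_density g"
  shows "marg (L \<bind> step g)"
proof (rule margI)
  show "L \<bind> step g \<in> space (prob_algebra EH)"
    by (rule bind_in_prob_algebra[OF margD(1)[OF L] step_kernel[OF g]])
  fix A :: "'e set" assume [measurable]: "A \<in> sets borel"
  have "(\<integral>\<^sup>+s. indicator A (fst s) \<partial>(L \<bind> step g)) = (\<integral>\<^sup>+s. \<integral>\<^sup>+s'. indicator A (fst s') \<partial>step g s \<partial>L)"
    by (rule nn_integral_bind_prob[OF margD(2)[OF L] step_kernel[OF g]]) measurable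
  also have "\<dots> = (\<integral>\<^sup>+s. (\<integral>\<^sup>+z. indicator A z \<partial>P (fst s)) \<partial>L)"
  proof (intro nn_integral_cong)
    fix s assume "s \<in> space L"
    then show "(\<integral>\<^sup>+s'. indicator A (fst s') \<partial>step g s) = (\<integral>\<^sup>+z. indicator A z \<partial>P (fst s))"
      using nn_integral_step_fst[OF g, of "indicator A" "snd s" "fst s"]
      by (simp add: margD(3)[OF L] space_pair_measure mem_Times_iff)
  qed
  also have "\<dots> = emeasure \<pi> A"
    using nn_integral_marg[OF L, of "\<lambda>x. \<integral>\<^sup>+z. indicator A z \<partial>P x"] nn_integral_P_\<pi>[of "indicator A"]
    by (simp del: nn_integral_indicator add: nn_integral_indicator[of A \<pi>])
  finally show "(\<integral>\<^sup>+s. indicator A (fst s) \<partial>(L \<bind> step g)) = emeasure \<pi> A" .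
qed

lemma marg_steps:
  assumes L: "marg L" and g: "obs_density g"
  shows "marg (L \<bind> steps g n)"
proof (induction n)
  case 0
  then show ?case using L margD(2)[OF L] by (simp add: bind_return'')
next
  case (Suc n)
  have "steps g 1 s = step g s" if "s \<in> space EH" for s
    using kernel_prob(2)[OF step_kernel[OF g] that] by (simp add: bind_return'')
  then have "K \<bind> steps g 1 = K \<bind> step g" if "marg K" for K
    using margD(3)[OF that] by (intro bind_cong) auto
  then show ?case
    using bind_kpow_add[OF step_kernel[OF g] margD(1)[OF L], of n 1] marg_step[OF Suc g] Suc by simp
qed

section \<open>Change of the observation density\<close>

definition tail_mass :: "('e \<Rightarrow> 'f \<Rightarrow> real) \<Rightarrow> ('e \<Rightarrow> 'f \<Rightarrow> real) \<Rightarrow> real \<Rightarrow> ennreal" where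
  "tail_mass g\<^sub>1 g\<^sub>2 K = (\<integral>\<^sup>+x. \<integral>\<^sup>+w. ennreal (g\<^sub>1 x w) * indicator {w. K * g\<^sub>2 x w < g\<^sub>1 x w} w \<partial>\<phi> \<partial>\<pi>)"

text \<open>The ratio of the densities is finite because \<open>g\<^sub>2\<close> is positive, so
  the part of \<open>g\<^sub>1\<close> above K times \<open>g\<^sub>2\<close> disappears by
  dominated convergence. In general no K bounds the ratio everywhere, which is why the comparisons
  below carry an additive error.\<close>

lemma tail_mass_small:
  assumes g1: "obs_density g\<^sub>1" and g2: "obs_density g\<^sub>2" and \<delta>: "0 < \<delta>"
  obtains K :: real where "0 \<le> K" "tail_mass g\<^sub>1 g\<^sub>2 K \<le> ennreal \<delta>"
proof -
  note obs_densityD(1)[OF g1, measurable] obs_densityD(1)[OF g2, measurable]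
  let ?u = "\<lambda>i::nat. \<lambda>s. ennreal (g\<^sub>1 (fst s) (snd s)) * indicator {s. real i *
    g\<^sub>2 (fst s) (snd s) < g\<^sub>1 (fst s) (snd s)} s"
  have [measurable]: "{s. real i * g\<^sub>2 (fst s) (snd s) < g\<^sub>1 (fst s) (snd s)} \<in> sets (borel \<Otimes>\<^sub>M
    borel)" for i
  proof -
    have "{s \<in> space (borel \<Otimes>\<^sub>M borel). real i *
      g\<^sub>2 (fst s) (snd s) < g\<^sub>1 (fst s) (snd s)} \<in> sets (borel \<Otimes>\<^sub>M borel)"
      by measurable
    then show ?thesis by (simp add: space_pair_measure)
  qed
  have "(\<lambda>i. \<integral>\<^sup>+s. ?u i s \<partial>(\<pi> \<Otimes>\<^sub>M \<phi>)) \<longlonglongrightarrow> (\<integral>\<^sup>+s. 0 \<partial>(\<pi> \<Otimes>\<^sub>M \<phi>))"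
  proof (rule nn_integral_dominated_convergence[where w="\<lambda>s. ennreal (g\<^sub>1 (fst s) (snd s))"])
    show "(\<integral>\<^sup>+s. ennreal (g\<^sub>1 (fst s) (snd s)) \<partial>(\<pi> \<Otimes>\<^sub>M \<phi>)) < \<infinity>"
      by (subst \<phi>.nn_integral_fst[symmetric])
        (auto simp: obs_densityD(3)[OF g1] \<pi>.emeasure_space_1[simplified])
    show "AE s in \<pi> \<Otimes>\<^sub>M \<phi>. (\<lambda>i. ?u i s) \<longlonglongrightarrow> 0"
    proof (rule AE_I2)
      fix s
      obtain N :: nat where N: "g\<^sub>1 (fst s) (snd s) / g\<^sub>2 (fst s) (snd s) \<le> real N"
        using real_arch_simple by blast
      have "?u i s = 0" if "i \<ge> N" for i
      proof -
        have "g\<^sub>1 (fst s) (snd s) / g\<^sub>2 (fst s) (snd s) \<le> real i" using N that by simp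
        then have "g\<^sub>1 (fst s) (snd s) \<le> real i * g\<^sub>2 (fst s) (snd s)"
          using obs_densityD(2)[OF g2] by (simp add: pos_divide_le_eq)
        then show ?thesis by simp
      qed
      then show "(\<lambda>i. ?u i s) \<longlonglongrightarrow> 0"
        by (intro tendsto_eventually eventually_sequentiallyI[of N]) auto
    qed
  qed (auto split: split_indicator)
  then have "(\<lambda>i. tail_mass g\<^sub>1 g\<^sub>2 (real i)) \<longlonglongrightarrow> 0"
    unfolding tail_mass_def by (subst (asm) \<phi>.nn_integral_fst[symmetric]) (auto simp: indicator_def)
  then have "eventually (\<lambda>i. tail_mass g\<^sub>1 g\<^sub>2 (real i) < ennreal \<delta>) sequentially"
    using \<delta> by (intro order_tendstoD) auto
  then obtain i where "tail_mass g\<^sub>1 g\<^sub>2 (real i) < ennreal \<delta>"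
    by (auto simp: eventually_sequentially)
  then show thesis by (intro that[of "real i"]) auto
qed

text \<open>Where \<open>g\<^sub>1\<close> exceeds K times \<open>g\<^sub>2\<close>, the test
  function is replaced by its bound 1. The mass of this part is a function of the current signal, so
  it depends on L only through \<pi>.\<close>

lemma step_change:
  assumes L: "marg L" and g1: "obs_density g\<^sub>1" and g2: "obs_density g\<^sub>2" and K: "0 \<le> K"
    and F[measurable]: "F \<in> borel_measurable EH" and F1: "\<And>s. F s \<le> 1"
  shows "(\<integral>\<^sup>+s. \<integral>\<^sup>+s'. F s' \<partial>step g\<^sub>1 s \<partial>L) \<le>
    ennreal K * (\<integral>\<^sup>+s. \<integral>\<^sup>+s'. F s' \<partial>step g\<^sub>2 s \<partial>L) + tail_mass g\<^sub>1 g\<^sub>2 K"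
proof -
  note obs_densityD(1)[OF g1, measurable] obs_densityD(1)[OF g2, measurable]
  note step_kernel[OF g1, measurable] step_kernel[OF g2, measurable] margD(2)[OF L, measurable_cong]
  let ?t = "\<lambda>x w. ennreal (g\<^sub>1 x w) * indicator {w. K * g\<^sub>2 x w < g\<^sub>1 x w} w"
  let ?T = "\<lambda>x. \<integral>\<^sup>+w. ?t x w \<partial>\<phi>"
  have [measurable]: "(\<lambda>(x, w). ?t x w) \<in> borel_measurable (borel \<Otimes>\<^sub>M borel)"
  proof -
    have "(\<lambda>(x, w). ?t x w) = (\<lambda>s. if K *
      g\<^sub>2 (fst s) (snd s) < g\<^sub>1 (fst s) (snd s) then ennreal (g\<^sub>1 (fst s) (snd s)) else 0)"
      by (auto simp: fun_eq_iff)
    then show ?thesis by simp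
  qed
  have pt: "(\<integral>\<^sup>+s'. F s' \<partial>step g\<^sub>1 s) \<le> ennreal K * (\<integral>\<^sup>+s'. F s' \<partial>step g\<^sub>2 s) + ?T (fst s)"
    if "s \<in> space L" for s
  proof -
    obtain x h where s: "s = (x, h)" by (cases s)
    then have h: "h \<in> space MH"
      using that margD(3)[OF L] by (simp add: space_pair_measure)
    note push_section[OF h, measurable]
    let ?J = "\<lambda>w. \<integral>\<^sup>+z. F (z, push w h) \<partial>P x"
    have J1: "?J w \<le> 1" for w
      using F1 by (intro prob_space.nn_integral_le_1[OF prob_P])
    have "(\<integral>\<^sup>+s'. F s' \<partial>step g\<^sub>1 s) = (\<integral>\<^sup>+w. ennreal (g\<^sub>1 x w) * ?J w \<partial>\<phi>)"
      unfolding s by (rule nn_integral_step[OF g1 F h])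
    also have "\<dots> \<le> (\<integral>\<^sup>+w. ennreal K * (ennreal (g\<^sub>2 x w) * ?J w) + ?t x w \<partial>\<phi>)"
    proof (intro nn_integral_mono)
      fix w
      show "ennreal (g\<^sub>1 x w) * ?J w \<le> ennreal K * (ennreal (g\<^sub>2 x w) * ?J w) + ?t x w"
      proof (cases "K * g\<^sub>2 x w < g\<^sub>1 x w")
        case True
        then have "ennreal (g\<^sub>1 x w) * ?J w \<le> ?t x w"
          using mult_left_mono[OF J1[of w], of "ennreal (g\<^sub>1 x w)"] by simp
        then show ?thesis by (simp add: add_increasing)
      next
        case False
        then have "ennreal (g\<^sub>1 x w) \<le> ennreal (K * g\<^sub>2 x w)" by (intro ennreal_leI) simp
        also have "\<dots> = ennreal K * ennreal (g\<^sub>2 x w)"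
          using K obs_densityD(2)[OF g2, of x w] by (simp add: ennreal_mult)
        finally have "ennreal (g\<^sub>1 x w) * ?J w \<le> (ennreal K * ennreal (g\<^sub>2 x w)) * ?J w"
          by (intro mult_right_mono) auto
        then show ?thesis using False by (simp add: mult.assoc)
      qed
    qed
    also have "\<dots> = ennreal K * (\<integral>\<^sup>+w. ennreal (g\<^sub>2 x w) * ?J w \<partial>\<phi>) + ?T x"
      by (subst nn_integral_add; (subst nn_integral_cmult)?) measurable
    also have "(\<integral>\<^sup>+w. ennreal (g\<^sub>2 x w) * ?J w \<partial>\<phi>) = (\<integral>\<^sup>+s'. F s' \<partial>step g\<^sub>2 s)"
      unfolding s by (rule nn_integral_step[OF g2 F h, symmetric])
    finally show ?thesis by (simp add: s)
  qed
  have "(\<integral>\<^sup>+s. \<integral>\<^sup>+s'. F s' \<partial>step g\<^sub>1 s \<partial>L) \<le>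
    (\<integral>\<^sup>+s. ennreal K * (\<integral>\<^sup>+s'. F s' \<partial>step g\<^sub>2 s) + ?T (fst s) \<partial>L)"
    by (intro nn_integral_mono pt)
  also have "\<dots> = ennreal K * (\<integral>\<^sup>+s. \<integral>\<^sup>+s'. F s' \<partial>step g\<^sub>2 s \<partial>L) + (\<integral>\<^sup>+s. ?T (fst s) \<partial>L)"
    by (subst nn_integral_add; (subst nn_integral_cmult)?) measurable
  also have "(\<integral>\<^sup>+s. ?T (fst s) \<partial>L) = tail_mass g\<^sub>1 g\<^sub>2 K"
    unfolding tail_mass_def by (rule nn_integral_marg[OF L]) measurable
  finally show ?thesis .
qed

text \<open>
  Uniform absolute continuity: \<open>K\<close> does not depend on \<open>L\<close>, because only the \<open>\<pi>\<close>-distributed signal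
  decides how large \<open>g\<^sub>1 / g\<^sub>2\<close> is.
\<close>

lemma steps_change:
  assumes g1: "obs_density g\<^sub>1" and g2: "obs_density g\<^sub>2" and "0 < \<delta>"
  shows "\<exists>K::real. 0 \<le> K \<and> (\<forall>L F. marg L \<longrightarrow> F \<in> borel_measurable EH \<longrightarrow> (\<forall>s. F s \<le> 1) \<longrightarrow>
    (\<integral>\<^sup>+s. \<integral>\<^sup>+s'. F s' \<partial>steps g\<^sub>1 n s \<partial>L) \<le>
      ennreal K * (\<integral>\<^sup>+s. \<integral>\<^sup>+s'. F s' \<partial>steps g\<^sub>2 n s \<partial>L) + ennreal \<delta>)"
  using \<open>0 < \<delta>\<close>
proof (induction n arbitrary: \<delta>)
  case 0
  show ?case by (rule exI[of _ 1]) (auto simp: add_increasing2)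
next
  case (Suc n)
  note step_kernel[OF g1, measurable] step_kernel[OF g2, measurable]
  obtain K1 :: real where K1: "0 \<le> K1" "tail_mass g\<^sub>1 g\<^sub>2 K1 \<le> ennreal (\<delta> / 2)"
    using tail_mass_small[OF g1 g2, of "\<delta> / 2"] Suc.prems by auto
  \<comment> \<open>The error of the remaining n steps is multiplied by \<open>K1\<close>, the
    constant of the first step, and is chosen smaller for that reason. Adding 1 avoids a division by
    zero.\<close>
  define \<delta>' where "\<delta>' = \<delta> / (2 * (K1 + 1))"
  have \<delta>': "0 < \<delta>'" "K1 * \<delta>' \<le> \<delta> / 2"
    using K1 Suc.prems by (auto simp: \<delta>'_def field_simps)
  obtain K2 :: real where K2: "0 \<le> K2" and IH: "\<And>L F. marg L \<Longrightarrow> F \<in> borel_measurable EH \<Longrightarrow> (\<And>s. F s \<le> 1) \<Longrightarrow>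
    (\<integral>\<^sup>+s. \<integral>\<^sup>+s'. F s' \<partial>steps g\<^sub>1 n s \<partial>L) \<le>
      ennreal K2 * (\<integral>\<^sup>+s. \<integral>\<^sup>+s'. F s' \<partial>steps g\<^sub>2 n s \<partial>L) + ennreal \<delta>'"
    using Suc.IH[OF \<delta>'(1)] by metis
  show ?case
  proof (intro exI[of _ "K1 * K2"] conjI allI impI)
    show "0 \<le> K1 * K2" using K1 K2 by simp
    fix L :: "('e \<times> 'h) measure" and F :: "'e \<times> 'h \<Rightarrow> ennreal"
    assume L: "marg L" and F[measurable]: "F \<in> borel_measurable EH" and F1: "\<forall>s. F s \<le> 1"
    have sp: "s \<in> space EH" if "s \<in> space L" for s using that margD(3)[OF L] by simp
    \<comment> \<open>\<open>step_change\<close> asks for the bound 1 at every point, but nothing is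
      known of \<open>steps\<close> outside of \<open>space EH\<close>; hence the value 0
      there.\<close>
    let ?G = "\<lambda>s. if s \<in> space EH then \<integral>\<^sup>+s'. F s' \<partial>steps g\<^sub>1 n s else 0"
    have G[measurable]: "?G \<in> borel_measurable EH"
      by (subst measurable_If_set) auto
    have G1: "?G s \<le> 1" for s
      using prob_space.nn_integral_le_1[OF kernel_prob(1)[OF steps_kernel[OF g1, of n]], of s F] F1
        by auto
    have Gi: "(\<integral>\<^sup>+s'. F s' \<partial>steps g\<^sub>1 (Suc n) s) = (\<integral>\<^sup>+s'. ?G s' \<partial>step g\<^sub>1 s)" if "s \<in> space EH" for s
      using sets_eq_imp_space_eq[OF kernel_prob(2)[OF step_kernel[OF g1] that]]
      by (subst nn_integral_kpow_Suc[OF step_kernel[OF g1] F that]) (auto intro!: nn_integral_cong)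
    have Gi2: "(\<integral>\<^sup>+s'. ?G s' \<partial>step g\<^sub>2 s) =
      (\<integral>\<^sup>+s'. \<integral>\<^sup>+s''. F s'' \<partial>steps g\<^sub>1 n s' \<partial>step g\<^sub>2 s)" if "s \<in> space EH" for s
      using sets_eq_imp_space_eq[OF kernel_prob(2)[OF step_kernel[OF g2] that]]
      by (auto intro!: nn_integral_cong)
    have "(\<integral>\<^sup>+s. \<integral>\<^sup>+s'. F s' \<partial>steps g\<^sub>1 (Suc n) s \<partial>L) = (\<integral>\<^sup>+s. \<integral>\<^sup>+s'. ?G s' \<partial>step g\<^sub>1 s \<partial>L)"
      by (intro nn_integral_cong Gi sp)
    also have "\<dots> \<le> ennreal K1 * (\<integral>\<^sup>+s. \<integral>\<^sup>+s'. ?G s' \<partial>step g\<^sub>2 s \<partial>L) + ennreal (\<delta> / 2)"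
      using step_change[OF L g1 g2 K1(1) G G1] K1(2) by (rule order_trans[OF _ add_left_mono])
    also have "(\<integral>\<^sup>+s. \<integral>\<^sup>+s'. ?G s' \<partial>step g\<^sub>2 s \<partial>L) =
      (\<integral>\<^sup>+s. \<integral>\<^sup>+s'. \<integral>\<^sup>+s''. F s'' \<partial>steps g\<^sub>1 n s' \<partial>step g\<^sub>2 s \<partial>L)"
      by (intro nn_integral_cong Gi2 sp)
    also have "\<dots> = (\<integral>\<^sup>+s'. \<integral>\<^sup>+s''. F s'' \<partial>steps g\<^sub>1 n s' \<partial>(L \<bind> step g\<^sub>2))"
      by (rule nn_integral_bind_prob[symmetric, OF margD(2)[OF L] step_kernel[OF g2]]) measurable
    also have "\<dots> \<le> ennreal K2 * (\<integral>\<^sup>+s'. \<integral>\<^sup>+s''. F s'' \<partial>steps g\<^sub>2 n s' \<partial>(L \<bind> step g\<^sub>2)) + ennreal \<delta>'"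
      by (rule IH[OF marg_step[OF L g2] F]) (use F1 in auto)
    also have "(\<integral>\<^sup>+s'. \<integral>\<^sup>+s''. F s'' \<partial>steps g\<^sub>2 n s' \<partial>(L \<bind> step g\<^sub>2)) =
      (\<integral>\<^sup>+s. \<integral>\<^sup>+s'. \<integral>\<^sup>+s''. F s'' \<partial>steps g\<^sub>2 n s' \<partial>step g\<^sub>2 s \<partial>L)"
      by (rule nn_integral_bind_prob[OF margD(2)[OF L] step_kernel[OF g2]]) measurable
    also have "\<dots> = (\<integral>\<^sup>+s. \<integral>\<^sup>+s'. F s' \<partial>steps g\<^sub>2 (Suc n) s \<partial>L)"
      by (intro nn_integral_cong nn_integral_kpow_Suc[symmetric, OF step_kernel[OF g2] F] sp)
    finally have "(\<integral>\<^sup>+s. \<integral>\<^sup>+s'. F s' \<partial>steps g\<^sub>1 (Suc n) s \<partial>L) \<le>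
        ennreal K1 * (ennreal K2 * (\<integral>\<^sup>+s. \<integral>\<^sup>+s'. F s' \<partial>steps g\<^sub>2 (Suc n) s \<partial>L) + ennreal \<delta>') +
          ennreal (\<delta> / 2)"
      by (simp add: mult_left_mono add_right_mono del: kpow.simps)
    also have "\<dots> = ennreal (K1 * K2) * (\<integral>\<^sup>+s. \<integral>\<^sup>+s'. F s' \<partial>steps g\<^sub>2 (Suc n) s \<partial>L) + (ennreal (K1 *
      \<delta>') + ennreal (\<delta> / 2))"
      using K1 K2 \<delta>' by (simp add: distrib_left ennreal_mult mult.assoc add.assoc del: kpow.simps)
    also have "ennreal (K1 * \<delta>') + ennreal (\<delta> / 2) = ennreal (K1 * \<delta>' + \<delta> / 2)"
      using K1 \<delta>' Suc.prems by (simp add: ennreal_plus)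
    also have "\<dots> \<le> ennreal \<delta>"
      using \<delta>' by (intro ennreal_leI) simp
    finally show "(\<integral>\<^sup>+s. \<integral>\<^sup>+s'. F s' \<partial>steps g\<^sub>1 (Suc n) s \<partial>L) \<le>
        ennreal (K1 * K2) * (\<integral>\<^sup>+s. \<integral>\<^sup>+s'. F s' \<partial>steps g\<^sub>2 (Suc n) s \<partial>L) + ennreal \<delta>"
      by (simp add: add_left_mono del: kpow.simps)
  qed
qed

section \<open>The chain with pure noise as observations\<close>

abbreviation Pn :: "nat \<Rightarrow> 'e \<Rightarrow> 'e measure" where
  "Pn \<equiv> kpow borel P"

lemma Pn_kernel[measurable]: "Pn n \<in> borel \<rightarrow>\<^sub>M prob_algebra borel"
  by (rule kpow_measurable[OF P])

lemma sets_Pn[measurable_cong, simp]: "sets (Pn n x) = sets borel" and prob_Pn: "prob_space (Pn n x)"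
  and space_Pn[simp]: "space (Pn n x) = UNIV"
  using kernel_prob[OF Pn_kernel, of x] sets_eq_imp_space_eq[of "Pn n x" borel] by auto

definition refresh :: "'h \<Rightarrow> 'h measure" where
  "refresh h = distr \<phi> MH (\<lambda>w. push w h)"

lemma refresh_kernel[measurable]: "refresh \<in> MH \<rightarrow>\<^sub>M prob_algebra MH"
proof -
  note push[measurable]
  show ?thesis
    unfolding refresh_def
    by (rule measurable_distr_prob_space2[where M=borel]) (use \<phi> in measurable)
qed

abbreviation refreshes :: "nat \<Rightarrow> 'h \<Rightarrow> 'h measure" where
  "refreshes \<equiv> kpow MH refresh"

lemma refreshes_kernel[measurable]: "refreshes n \<in> MH \<rightarrow>\<^sub>M prob_algebra MH"
  by (rule kpow_measurable[OF refresh_kernel])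

lemma nn_integral_refresh:
  assumes "h \<in> space MH" "f \<in> borel_measurable MH"
  shows "(\<integral>\<^sup>+h'. f h' \<partial>refresh h) = (\<integral>\<^sup>+w. f (push w h) \<partial>\<phi>)"
  unfolding refresh_def using assms push_section[OF assms(1)] by (subst nn_integral_distr) auto

abbreviation blind :: "'e \<Rightarrow> 'f \<Rightarrow> real" where
  "blind \<equiv> \<lambda>_ _. 1"

text \<open>Such observations carry no information: the signal moves by P and the history collects
  fresh noise, independently of each other. This product form makes ergodicity of the signal alone
  applicable to the pair.\<close>

lemma nn_integral_steps_blind:
  assumes h: "h \<in> space MH" and F[measurable]: "F \<in> borel_measurable EH"
  shows "(\<integral>\<^sup>+s. F s \<partial>steps blind n (x, h)) = (\<integral>\<^sup>+h'. \<integral>\<^sup>+z. F (z, h') \<partial>Pn n x \<partial>refreshes n h)"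
  using h
proof (induction n arbitrary: x h)
  case 0
  have "(\<lambda>h'. F (x, h')) \<in> borel_measurable MH" by measurable
  then show ?case using 0 by (simp add: nn_integral_return space_pair_measure)
next
  case (Suc n)
  note h = Suc.prems
  note step_kernel[OF obs_density_1, measurable] push_section[OF h, measurable]
  have s: "(x, h) \<in> space EH" using h by (simp add: space_pair_measure)
  have "(\<integral>\<^sup>+s. F s \<partial>steps blind (Suc n) (x, h)) =
    (\<integral>\<^sup>+s. \<integral>\<^sup>+s'. F s' \<partial>steps blind n s \<partial>step blind (x, h))"
    by (rule nn_integral_kpow_Suc[OF step_kernel[OF obs_density_1] F s])
  also have "\<dots> = (\<integral>\<^sup>+w. \<integral>\<^sup>+z. \<integral>\<^sup>+s'. F s' \<partial>steps blind n (z, push w h) \<partial>P x \<partial>\<phi>)"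
    by (subst nn_integral_step[OF obs_density_1 _ h]) auto
  also have "\<dots> = (\<integral>\<^sup>+w. \<integral>\<^sup>+z. \<integral>\<^sup>+h'. \<integral>\<^sup>+z'. F (z', h') \<partial>Pn n z \<partial>refreshes n (push w h) \<partial>P x \<partial>\<phi>)"
    by (intro nn_integral_cong Suc.IH push_in h)
  also have "\<dots> = (\<integral>\<^sup>+w. \<integral>\<^sup>+h'. \<integral>\<^sup>+z. \<integral>\<^sup>+z'. F (z', h') \<partial>Pn n z \<partial>P x \<partial>refreshes n (push w h) \<partial>\<phi>)"
  proof (intro nn_integral_cong nn_integral_swap_prob prob_P)
    fix w
    have w: "push w h \<in> space MH" by (rule push_in[OF h])
    show "prob_space (refreshes n (push w h))"
      by (rule kernel_prob(1)[OF refreshes_kernel w])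
    note kernel_prob(2)[OF refreshes_kernel w, measurable_cong]
    show "(\<lambda>(z, h'). \<integral>\<^sup>+z'. F (z', h') \<partial>Pn n z) \<in> borel_measurable (P x \<Otimes>\<^sub>M refreshes n (push w h))"
      by measurable
  qed
  also have "\<dots> = (\<integral>\<^sup>+w. \<integral>\<^sup>+h'. \<integral>\<^sup>+z'. F (z', h') \<partial>Pn (Suc n) x \<partial>refreshes n (push w h) \<partial>\<phi>)"
  proof (intro nn_integral_cong)
    fix w h' assume "h' \<in> space (refreshes n (push w h))"
    then have "h' \<in> space MH"
      using sets_eq_imp_space_eq[OF kernel_prob(2)[OF refreshes_kernel push_in[OF h]]] by simp
    then have "(\<lambda>z'. F (z', h')) \<in> borel_measurable borel" by measurable
    then show "(\<integral>\<^sup>+z. \<integral>\<^sup>+z'. F (z', h') \<partial>Pn n z \<partial>P x) = (\<integral>\<^sup>+z'. F (z', h') \<partial>Pn (Suc n) x)"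
      by (intro nn_integral_kpow_Suc[symmetric, OF P]) auto
  qed
  also have "\<dots> = (\<integral>\<^sup>+h''. \<integral>\<^sup>+h'. \<integral>\<^sup>+z'. F (z', h') \<partial>Pn (Suc n) x \<partial>refreshes n h'' \<partial>refresh h)"
    by (rule nn_integral_refresh[symmetric, OF h]) measurable
  also have "\<dots> = (\<integral>\<^sup>+h'. \<integral>\<^sup>+z'. F (z', h') \<partial>Pn (Suc n) x \<partial>refreshes (Suc n) h)"
    by (rule nn_integral_kpow_Suc[symmetric, OF refresh_kernel _ h]) measurable
  finally show ?case .
qed

text \<open>A frozen component is added to the history. As the type of histories is arbitrary,
  results on the chain then cover test functions that depend on data known at the start.\<close>

lemma hist_chain_param:
  "hist_chain P \<phi> \<pi> (MP \<Otimes>\<^sub>M MH) (\<lambda>w (p, h). (p, push w h))"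
proof -
  note push[measurable]
  have "(\<lambda>(w, h). (\<lambda>(p, h). (p, push w h)) h) \<in> borel \<Otimes>\<^sub>M (MP \<Otimes>\<^sub>M MH) \<rightarrow>\<^sub>M MP \<Otimes>\<^sub>M MH"
    unfolding split_beta' by measurable
  then show ?thesis
    by unfold_locales (use P \<phi> \<pi> stationary in auto)
qed

lemma nn_integral_steps_param:
  fixes MP :: "'p measure" and n :: nat and g
  defines "st \<equiv> kpow (borel \<Otimes>\<^sub>M (MP \<Otimes>\<^sub>M MH)) (hist_chain.step P \<phi> (MP \<Otimes>\<^sub>M MH) (\<lambda>w (p, h). (p, push w
    h)) g)"
  assumes g: "obs_density g" and F[measurable]: "F \<in> borel_measurable (borel \<Otimes>\<^sub>M (MP \<Otimes>\<^sub>M MH))"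
    and p: "p \<in> space MP" and h: "h \<in> space MH"
  shows "(\<integral>\<^sup>+s. F s \<partial>st n (x, (p, h))) = (\<integral>\<^sup>+s. F (fst s, (p, snd s)) \<partial>steps g n (x, h))"
proof -
  interpret prm: hist_chain P \<phi> \<pi> "MP \<Otimes>\<^sub>M MH" "\<lambda>w (p, h). (p, push w h)" by (rule hist_chain_param)
  have F': "(\<lambda>s. F (fst s, (p, snd s))) \<in> borel_measurable EH"
    using p by measurable
  note step_kernel[OF g, measurable] prm.step_kernel[OF g, measurable]
  show ?thesis
    using h
  proof (induction n arbitrary: x h)
    case 0
    then show ?case using p by (simp add: st_def nn_integral_return space_pair_measure)
  next
    case (Suc n)
    note h = Suc.prems
    have s: "(x, h) \<in> space EH" "(x, (p, h)) \<in> space (borel \<Otimes>\<^sub>M (MP \<Otimes>\<^sub>M MH))"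
      using h p by (simp_all add: space_pair_measure)
    have ph: "(p, h) \<in> space (MP \<Otimes>\<^sub>M MH)" using h p by (simp add: space_pair_measure)
    have stF: "(\<lambda>s. \<integral>\<^sup>+s'. F s' \<partial>st n s) \<in> borel_measurable (borel \<Otimes>\<^sub>M (MP \<Otimes>\<^sub>M MH))"
      unfolding st_def by measurable
    have stF': "(\<lambda>s. \<integral>\<^sup>+s'. F (fst s', (p, snd s')) \<partial>steps g n s) \<in> borel_measurable EH"
      using p by measurable
    have "(\<integral>\<^sup>+s. F s \<partial>st (Suc n) (x, (p, h))) = (\<integral>\<^sup>+s. \<integral>\<^sup>+s'. F s' \<partial>st n s \<partial>prm.step g (x, (p, h)))"
      unfolding st_def by (rule nn_integral_kpow_Suc[OF prm.step_kernel[OF g] F s(2)])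
    also have "\<dots> = (\<integral>\<^sup>+w. ennreal (g x w) * (\<integral>\<^sup>+z. \<integral>\<^sup>+s'. F s' \<partial>st n (z, (p, push w h)) \<partial>P x) \<partial>\<phi>)"
      using prm.nn_integral_step[OF g stF ph, of x] by (simp only: prod.case)
    also have "\<dots> = (\<integral>\<^sup>+w. ennreal (g x w) *
      (\<integral>\<^sup>+z. \<integral>\<^sup>+s'. F (fst s', (p, snd s')) \<partial>steps g n (z, push w h) \<partial>P x) \<partial>\<phi>)"
      by (simp only: Suc.IH[OF push_in[OF h]])
    also have "\<dots> = (\<integral>\<^sup>+s. \<integral>\<^sup>+s'. F (fst s', (p, snd s')) \<partial>steps g n s \<partial>step g (x, h))"
      using nn_integral_step[OF g stF' h, of x] by (rule sym)
    also have "\<dots> = (\<integral>\<^sup>+s. F (fst s, (p, snd s)) \<partial>steps g (Suc n) (x, h))"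
      by (rule nn_integral_kpow_Suc[symmetric, OF step_kernel[OF g] F' s(1)])
    finally show ?case .
  qed
qed

text \<open>\<open>steps_change\<close> treats test functions of the final state only. Here the test
  function may also depend on a parameter whose joint law with signal and history is arbitrary, and
  K still does not depend on that law.\<close>

lemma steps_change_param:
  fixes MP :: "'p measure" and n :: nat
  assumes g1: "obs_density g\<^sub>1" and g2: "obs_density g\<^sub>2" and "0 < \<delta>"
  shows "\<exists>K::real. 0 \<le> K \<and> (\<forall>L F. L \<in> space (prob_algebra (borel \<Otimes>\<^sub>M (MP \<Otimes>\<^sub>M MH))) \<longrightarrow>
    distr L borel fst = \<pi> \<longrightarrow>
      F \<in> borel_measurable (MP \<Otimes>\<^sub>M EH) \<longrightarrow> (\<forall>s. F s \<le> 1) \<longrightarrow>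
    (\<integral>\<^sup>+s. \<integral>\<^sup>+s'. F (fst (snd s), s') \<partial>steps g\<^sub>1 n (fst s, snd (snd s)) \<partial>L) \<le>
    ennreal K * (\<integral>\<^sup>+s. \<integral>\<^sup>+s'. F (fst (snd s), s') \<partial>steps g\<^sub>2 n (fst s, snd (snd s)) \<partial>L) + ennreal \<delta>)"
proof -
  interpret prm: hist_chain P \<phi> \<pi> "MP \<Otimes>\<^sub>M MH" "\<lambda>w (p, h). (p, push w h)" by (rule hist_chain_param)
  obtain K :: real where K: "0 \<le> K" and le: "\<And>L F. prm.marg L \<Longrightarrow> F \<in> borel_measurable prm.EH \<Longrightarrow>
    (\<And>s. F s \<le> 1) \<Longrightarrow>
    (\<integral>\<^sup>+s. \<integral>\<^sup>+s'. F s' \<partial>prm.steps g\<^sub>1 n s \<partial>L) \<le>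
      ennreal K * (\<integral>\<^sup>+s. \<integral>\<^sup>+s'. F s' \<partial>prm.steps g\<^sub>2 n s \<partial>L) + ennreal \<delta>"
    using prm.steps_change[OF g1 g2 \<open>0 < \<delta>\<close>, of n] by metis
  show ?thesis
  proof (intro exI[of _ K] conjI K allI impI)
    fix L :: "('e \<times> 'p \<times> 'h) measure" and F :: "'p \<times> 'e \<times> 'h \<Rightarrow> ennreal"
    assume L: "L \<in> space (prob_algebra prm.EH)" "distr L borel fst = \<pi>"
      and F[measurable]: "F \<in> borel_measurable (MP \<Otimes>\<^sub>M EH)" and F1: "\<forall>s. F s \<le> 1"
    have m: "prm.marg L" using L by (simp add: prm.marg_def)
    let ?F = "\<lambda>s. F (fst (snd s), (fst s, snd (snd s)))"
    have F': "?F \<in> borel_measurable prm.EH" by measurable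
    have eq: "(\<integral>\<^sup>+s. \<integral>\<^sup>+s'. ?F s' \<partial>prm.steps g n s \<partial>L) =
        (\<integral>\<^sup>+s. \<integral>\<^sup>+s'. F (fst (snd s), s') \<partial>steps g n (fst s, snd (snd s)) \<partial>L)" if g:
          "obs_density g" for g
    proof (intro nn_integral_cong)
      fix s assume "s \<in> space L"
      then obtain x p h where s: "s = (x, (p, h))" "p \<in> space MP" "h \<in> space MH"
        using prm.margD(3)[OF m] by (cases s) (auto simp: space_pair_measure)
      show "(\<integral>\<^sup>+s'. ?F s' \<partial>prm.steps g n s) =
        (\<integral>\<^sup>+s'. F (fst (snd s), s') \<partial>steps g n (fst s, snd (snd s)))"
        using nn_integral_steps_param[OF g F' s(2,3), of n x] by (simp add: s)
    qed
    show "(\<integral>\<^sup>+s. \<integral>\<^sup>+s'. F (fst (snd s), s') \<partial>steps g\<^sub>1 n (fst s, snd (snd s)) \<partial>L) \<le>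
      ennreal K * (\<integral>\<^sup>+s. \<integral>\<^sup>+s'. F (fst (snd s), s') \<partial>steps g\<^sub>2 n (fst s, snd (snd s)) \<partial>L) + ennreal \<delta>"
      using le[OF m F'] F1 by (simp add: eq[OF g1] eq[OF g2])
  qed
qed

section \<open>Distance of the transition laws from the invariant law\<close>

lemma AE_marg:
  assumes L: "marg L" and ae: "AE x in \<pi>. Q x"
  shows "AE s in L. Q (fst s)"
proof -
  have "fst \<in> L \<rightarrow>\<^sub>M borel" using margD(2)[OF L] by measurable
  moreover have "distr L borel fst = \<pi>" using L by (simp add: marg_def)
  then have "AE x in distr L borel fst. Q x" using ae by (rule ssubst)
  ultimately show ?thesis by (rule AE_distrD)
qed

text \<open>Half of the total variation norm of the difference. Subtraction in
  \<open>ennreal\<close> is truncated, so only sets on which the transition law is larger count;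
  complements give the other sign.\<close>

definition excess :: "nat \<Rightarrow> 'e \<Rightarrow> ennreal" where
  "excess m x = (SUP B\<in>comparing_base. emeasure (Pn m x) B - emeasure \<pi> B)"

lemma emeasure_Pn_measurable[measurable (raw)]:
  "B \<in> sets borel \<Longrightarrow> (\<lambda>x. emeasure (Pn m x) B) \<in> borel_measurable borel"
  using measurable_compose[OF measurable_prob_algebraD[OF Pn_kernel]
    measurable_emeasure_subprob_algebra] .

lemma excess_measurable[measurable]: "excess m \<in> borel_measurable borel"
  unfolding excess_def
  by (intro borel_measurable_SUP countable_comparing_base borel_measurable_minus_ennreal
      emeasure_Pn_measurable comparing_base_sets) auto

lemma excess_le_1: "excess m x \<le> 1"
  unfolding excess_def
  by (intro SUP_least order_trans[OF diff_le_self_ennreal]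
      prob_space.emeasure_le_1[OF prob_Pn])

lemma emeasure_Pn_le:
  assumes A: "A \<in> sets borel"
  shows "emeasure (Pn m x) A \<le> emeasure \<pi> A + excess m x"
proof (rule emeasure_le_if_comparing_base)
  fix B :: "'e set" assume "B \<in> comparing_base"
  then have "emeasure (Pn m x) B - emeasure \<pi> B \<le> excess m x"
    unfolding excess_def by (intro SUP_upper)
  then show "emeasure (Pn m x) B \<le> emeasure \<pi> B + excess m x"
    by (simp add: ennreal_minus_le_iff)
qed (use A prob_Pn prob_\<pi> in \<open>auto intro: prob_space.finite_measure\<close>)

lemma emeasure_\<pi>_le:
  assumes A: "A \<in> sets borel"
  shows "emeasure \<pi> A \<le> emeasure (Pn m x) A + excess m x"
proof -
  interpret Px: prob_space "Pn m x" by (rule prob_Pn)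
  have "emeasure (Pn m x) (UNIV - A) \<le> emeasure \<pi> (UNIV - A) + excess m x"
    using A by (intro emeasure_Pn_le) auto
  moreover have "emeasure (Pn m x) (UNIV - A) = 1 - emeasure (Pn m x) A"
    "emeasure \<pi> (UNIV - A) = 1 - emeasure \<pi> A"
    using A emeasure_compl[of A "Pn m x"] emeasure_compl[of A \<pi>] Px.emeasure_space_1
      \<pi>.emeasure_space_1 by auto
  moreover obtain a b c where "emeasure (Pn m x) A = ennreal a" "emeasure \<pi> A =
    ennreal b" "excess m x = ennreal c"
    "0 \<le> a" "a \<le> 1" "0 \<le> b" "b \<le> 1" "0 \<le> c"
    using Px.emeasure_le_1[of A] \<pi>.emeasure_le_1[of A] excess_le_1[of m x]
    by (cases "emeasure (Pn m x) A"; cases "emeasure \<pi> A"; cases "excess m x") (auto simp: top_unique)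
  ultimately show ?thesis
    by (simp add: ennreal_minus ennreal_plus[symmetric] ennreal_1[symmetric] del: ennreal_plus
      ennreal_1)
qed

lemma nn_integral_Pn_le:
  assumes "f \<in> borel_measurable borel" "\<And>z. f z \<le> 1"
  shows "(\<integral>\<^sup>+z. f z \<partial>Pn m x) \<le> (\<integral>\<^sup>+z. f z \<partial>\<pi>) + excess m x"
    and "(\<integral>\<^sup>+z. f z \<partial>\<pi>) \<le> (\<integral>\<^sup>+z. f z \<partial>Pn m x) + excess m x"
proof -
  have fin: "finite_measure (Pn m x)" "finite_measure \<pi>"
    using prob_Pn prob_\<pi> prob_space.finite_measure by auto
  have s: "sets (Pn m x) = sets \<pi>" by simp
  have f: "f \<in> borel_measurable (Pn m x)" "f \<in> borel_measurable \<pi>"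
    using assms(1) by measurable
  show "(\<integral>\<^sup>+z. f z \<partial>Pn m x) \<le> (\<integral>\<^sup>+z. f z \<partial>\<pi>) + excess m x"
    by (rule nn_integral_le_add_if_emeasure_le[OF fin s _ f(1) assms(2)]) (rule emeasure_Pn_le, simp)
  show "(\<integral>\<^sup>+z. f z \<partial>\<pi>) \<le> (\<integral>\<^sup>+z. f z \<partial>Pn m x) + excess m x"
    by (rule nn_integral_le_add_if_emeasure_le[OF fin(2,1) s[symmetric] _ f(2) assms(2)])
      (rule emeasure_\<pi>_le, simp)
qed

definition mixing :: "nat \<Rightarrow> ennreal" where
  "mixing m = (\<integral>\<^sup>+x. excess m x \<partial>\<pi>)"

text \<open>The measure on the left is the stationary law of the pair of \<open>X\<^sub>0\<close>
  and \<open>X\<^sub>m\<close>.\<close>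

lemma nn_integral_joint:
  assumes "F \<in> borel_measurable (borel \<Otimes>\<^sub>M borel)"
  shows "(\<integral>\<^sup>+s. F s \<partial>(\<pi> \<bind> (\<lambda>x. distr (Pn m x) (borel \<Otimes>\<^sub>M borel) (Pair x)))) =
    (\<integral>\<^sup>+x. \<integral>\<^sup>+z. F (x, z) \<partial>Pn m x \<partial>\<pi>)"
proof -
  have k: "(\<lambda>x. distr (Pn m x) (borel \<Otimes>\<^sub>M borel) (Pair x)) \<in> borel \<rightarrow>\<^sub>M prob_algebra (borel \<Otimes>\<^sub>M borel)"
    by (rule measurable_distr_prob_space2[OF Pn_kernel]) measurable
  have "(\<integral>\<^sup>+s. F s \<partial>(\<pi> \<bind> (\<lambda>x. distr (Pn m x) (borel \<Otimes>\<^sub>M borel) (Pair x)))) =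
      (\<integral>\<^sup>+x. \<integral>\<^sup>+s. F s \<partial>distr (Pn m x) (borel \<Otimes>\<^sub>M borel) (Pair x) \<partial>\<pi>)"
    by (rule nn_integral_bind_prob[OF sets_\<pi> k assms])
  also have "\<dots> = (\<integral>\<^sup>+x. \<integral>\<^sup>+z. F (x, z) \<partial>Pn m x \<partial>\<pi>)"
    by (intro nn_integral_cong nn_integral_distr) (use assms in measurable)
  finally show ?thesis .
qed

lemma joint_prob_space:
  "prob_space (\<pi> \<bind> (\<lambda>x. distr (Pn m x) (borel \<Otimes>\<^sub>M borel) (Pair x)))"
  "sets (\<pi> \<bind> (\<lambda>x. distr (Pn m x) (borel \<Otimes>\<^sub>M borel) (Pair x))) = sets (borel \<Otimes>\<^sub>M borel)"
proof -
  have k: "(\<lambda>x. distr (Pn m x) (borel \<Otimes>\<^sub>M borel) (Pair x)) \<in> borel \<rightarrow>\<^sub>M prob_algebra (borel \<Otimes>\<^sub>M borel)"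
    by (rule measurable_distr_prob_space2[OF Pn_kernel]) measurable
  show "prob_space (\<pi> \<bind> (\<lambda>x. distr (Pn m x) (borel \<Otimes>\<^sub>M borel) (Pair x)))"
    by (rule prob_space_bind'[OF \<pi> k])
  show "sets (\<pi> \<bind> (\<lambda>x. distr (Pn m x) (borel \<Otimes>\<^sub>M borel) (Pair x))) = sets (borel \<Otimes>\<^sub>M borel)"
    by (rule sets_bind'[OF \<pi> k])
qed

lemma nn_integral_mono_density:
  fixes S T :: "'e measure"
  assumes s: "sets S = sets borel" "sets T = sets borel"
    and le: "\<forall>B\<in>sets borel. emeasure (density S d) B \<le> emeasure (density T (\<lambda>_. c)) B"
    and d: "d \<in> borel_measurable borel" and f[measurable]: "f \<in> borel_measurable borel"
  shows "(\<integral>\<^sup>+z. d z * f z \<partial>S) \<le> c * (\<integral>\<^sup>+z. f z \<partial>T)"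
proof -
  note s[measurable_cong] d[measurable]
  have "(\<integral>\<^sup>+z. f z \<partial>density S d) \<le> (\<integral>\<^sup>+z. f z \<partial>density T (\<lambda>_. c))"
    by (rule nn_integral_mono_emeasure) (use s le in auto)
  then show ?thesis
    by (subst (asm) (1 2) nn_integral_density; (subst (asm) nn_integral_cmult)?) auto
qed

text \<open>
  The set \<open>G\<close> collects the pairs of states between which the \<open>m\<close>-step transition law and the
  invariant law have densities in \<open>[1/2, 2]\<close> with respect to each other.
\<close>

lemma ex_overlap:
  assumes mix: "mixing m \<le> ennreal \<delta>" and \<delta>: "0 \<le> \<delta>"
  obtains G where "G \<in> sets (borel \<Otimes>\<^sub>M borel)"
    "AE x in \<pi>. \<forall>f\<in>borel_measurable borel. (\<integral>\<^sup>+z. indicator G (x, z) * f z \<partial>Pn m x) \<le>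
      2 * (\<integral>\<^sup>+z. f z \<partial>\<pi>)"
    "AE x in \<pi>. \<forall>f\<in>borel_measurable borel. (\<integral>\<^sup>+z. indicator G (x, z) * f z \<partial>\<pi>) \<le>
      2 * (\<integral>\<^sup>+z. f z \<partial>Pn m x)"
    "(\<integral>\<^sup>+x. \<integral>\<^sup>+z. indicator (- G) (x, z) \<partial>Pn m x \<partial>\<pi>) \<le> ennreal (3 * \<delta>)"
    "(\<integral>\<^sup>+x. \<integral>\<^sup>+z. indicator (- G) (x, z) \<partial>\<pi> \<partial>\<pi>) \<le> ennreal (3 * \<delta>)"
proof -
  \<comment> \<open>\<open>J\<close> is the stationary law of two signals m steps apart, and
    \<open>I\<close> below is that of two independent stationary signals. The mixing bound says that
    they differ by at most \<delta> on every set.\<close>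
  define J where "J = \<pi> \<bind> (\<lambda>x. distr (Pn m x) (borel \<Otimes>\<^sub>M borel) (Pair x))"
  have J: "prob_space J" and sJ[measurable_cong]: "sets J = sets (borel \<Otimes>\<^sub>M borel)"
    unfolding J_def by (rule joint_prob_space)+
  have nJ: "(\<integral>\<^sup>+s. F s \<partial>J) = (\<integral>\<^sup>+x. \<integral>\<^sup>+z. F (x, z) \<partial>Pn m x \<partial>\<pi>)" if "F \<in> borel_measurable (borel \<Otimes>\<^sub>M
    borel)" for F
    unfolding J_def using that by (rule nn_integral_joint)
  define I where "I = \<pi> \<Otimes>\<^sub>M \<pi>"
  have sI[measurable_cong]: "sets I = sets (borel \<Otimes>\<^sub>M borel)"
    unfolding I_def by (intro sets_pair_measure_cong) auto
  have I: "prob_space I" unfolding I_def by (intro prob_space_pair prob_\<pi>)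
  have nI: "(\<integral>\<^sup>+s. F s \<partial>I) = (\<integral>\<^sup>+x. \<integral>\<^sup>+z. F (x, z) \<partial>\<pi> \<partial>\<pi>)" if "F \<in> borel_measurable (borel \<Otimes>\<^sub>M
    borel)" for F
    unfolding I_def using that by (intro \<pi>.nn_integral_fst[symmetric])
      (simp add: measurable_cong_sets[OF sI[unfolded I_def] refl])
  have spI: "space I = UNIV" and spJ: "space J = UNIV"
    using sets_eq_imp_space_eq[OF sI] sets_eq_imp_space_eq[OF sJ] by (simp_all add: space_pair_measure)
  interpret J: prob_space J by (rule J)
  interpret I: prob_space I by (rule I)
  obtain N0 and q :: "'e \<times> 'e \<Rightarrow> real" where N0: "N0 \<in> sets I" "emeasure I N0 = 0"
    and q: "q \<in> borel_measurable I"
    "\<And>s. 0 \<le> q s" "density J (indicator (space I - N0)) = density I (\<lambda>s. ennreal (q s))"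
    by (rule Lebesgue_decomposition[OF I J]) (auto simp: sI sJ)
  have N0m[measurable]: "N0 \<in> sets (borel \<Otimes>\<^sub>M borel)" using N0 sI by simp
  have qm[measurable]: "q \<in> borel_measurable (borel \<Otimes>\<^sub>M borel)"
    using q(1) by (simp add: measurable_cong_sets[OF sI refl])
  have dec: "(\<integral>\<^sup>+s. indicator (- N0) s * F s \<partial>J) = (\<integral>\<^sup>+s. ennreal (q s) * F s \<partial>I)"
    if [measurable]: "F \<in> borel_measurable (borel \<Otimes>\<^sub>M borel)" for F
  proof -
    have m: "indicator (space I - N0) \<in> borel_measurable J"
      unfolding spI by measurable
    have "(\<integral>\<^sup>+s. indicator (- N0) s * F s \<partial>J) = (\<integral>\<^sup>+s. F s \<partial>density J (indicator (space I - N0)))"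
      by (subst nn_integral_density[OF m]) (auto simp: spI Compl_eq_Diff_UNIV)
    also have "\<dots> = (\<integral>\<^sup>+s. F s \<partial>density I (\<lambda>s. ennreal (q s)))"
      by (simp only: q(3))
    also have "\<dots> = (\<integral>\<^sup>+s. ennreal (q s) * F s \<partial>I)"
      by (rule nn_integral_density) measurable
    finally show ?thesis .
  qed
  \<comment> \<open>On \<open>D1\<close> the law \<open>J\<close> is too large relative to
    \<open>I\<close>, including its singular part; on \<open>D2\<close> it is too small.\<close>
  define D1 where "D1 = {s. s \<in> N0 \<or> 2 < q s}"
  define D2 where "D2 = {s. s \<notin> N0 \<and> q s < 1 / 2}"
  define G where "G = - (D1 \<union> D2)"
  have cm[measurable]: "- A \<in> sets (borel \<Otimes>\<^sub>M borel)" if "A \<in> sets (borel \<Otimes>\<^sub>M borel)" for A ::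
    "('e \<times> 'e) set"
    using sets.compl_sets[OF that] by (simp add: space_pair_measure Compl_eq_Diff_UNIV)
  have [measurable]: "{s. 2 < q s} \<in> sets (borel \<Otimes>\<^sub>M borel)" "{s. q s < 1 / 2} \<in> sets (borel \<Otimes>\<^sub>M borel)"
    using measurable_sets[OF qm, of "{2<..}"] measurable_sets[OF qm, of "{..<1/2}"]
    by (simp_all add: space_pair_measure vimage_def)
  have e: "D1 = N0 \<union> {s. 2 < q s}" "D2 = (- N0) \<inter> {s. q s < 1 / 2}" by (auto simp: D1_def D2_def)
  have Dm[measurable]: "D1 \<in> sets (borel \<Otimes>\<^sub>M borel)" "D2 \<in> sets (borel \<Otimes>\<^sub>M borel)"
    unfolding e by measurable
  have Gm[measurable]: "G \<in> sets (borel \<Otimes>\<^sub>M borel)" unfolding G_def by measurable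
  have Gq: "indicator G s * F s \<le> 2 * (ennreal (q s) * F s)"
    "indicator G s * (ennreal (q s) * F s) \<le> 2 * F s" for s and F :: "'e \<times> 'e \<Rightarrow> ennreal"
  proof -
    have "1 \<le> ennreal (2 * q s) \<and> ennreal (q s) \<le> ennreal 2" if "s \<in> G"
      using that ennreal_leI[of 1 "2 * q s"] ennreal_leI[of "q s" 2] by (auto simp: G_def D1_def D2_def)
    then have "s \<in> G \<Longrightarrow> 1 * F s \<le> ennreal (2 * q s) * F s" "s \<in> G \<Longrightarrow> ennreal (q s) * F s \<le>
      ennreal 2 * F s"
      by (blast intro: mult_right_mono zero_le)+
    then show "indicator G s * F s \<le> 2 * (ennreal (q s) * F s)"
      "indicator G s * (ennreal (q s) * F s) \<le> 2 * F s"
      using q(2)[of s] by (auto simp: ennreal_mult mult.assoc split: split_indicator)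
  qed
  have GJ: "(\<integral>\<^sup>+s. indicator G s * F s \<partial>J) \<le> 2 * (\<integral>\<^sup>+s. F s \<partial>I)"
    if [measurable]: "F \<in> borel_measurable (borel \<Otimes>\<^sub>M borel)" for F
  proof -
    have "(\<integral>\<^sup>+s. indicator G s * F s \<partial>J) = (\<integral>\<^sup>+s. indicator (- N0) s * (indicator G s * F s) \<partial>J)"
      by (intro nn_integral_cong) (auto simp: G_def D1_def split: split_indicator)
    also have "\<dots> = (\<integral>\<^sup>+s. ennreal (q s) * (indicator G s * F s) \<partial>I)"
      by (rule dec) measurable
    also have "\<dots> \<le> (\<integral>\<^sup>+s. 2 * F s \<partial>I)"
      using Gq(2)[of _ F] by (intro nn_integral_mono) (simp add: mult_ac)
    also have "\<dots> = 2 * (\<integral>\<^sup>+s. F s \<partial>I)" by (rule nn_integral_cmult) measurable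
    finally show ?thesis .
  qed
  have GI: "(\<integral>\<^sup>+s. indicator G s * F s \<partial>I) \<le> 2 * (\<integral>\<^sup>+s. F s \<partial>J)"
    if [measurable]: "F \<in> borel_measurable (borel \<Otimes>\<^sub>M borel)" for F
  proof -
    have "(\<integral>\<^sup>+s. indicator G s * F s \<partial>I) \<le> (\<integral>\<^sup>+s. 2 * (ennreal (q s) * F s) \<partial>I)"
      by (intro nn_integral_mono Gq)
    also have "\<dots> = 2 * (\<integral>\<^sup>+s. ennreal (q s) * F s \<partial>I)" by (rule nn_integral_cmult) measurable
    also have "\<dots> = 2 * (\<integral>\<^sup>+s. indicator (- N0) s * F s \<partial>J)" by (subst dec) auto
    also have "\<dots> \<le> 2 * (\<integral>\<^sup>+s. F s \<partial>J)"
      by (intro mult_left_mono nn_integral_mono) (auto split: split_indicator)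
    finally show ?thesis .
  qed
  have sect: "(\<lambda>z. indicator G (x, z)) \<in> borel_measurable borel" for x :: 'e
    by measurable
  have eJ: "emeasure (density (Pn m x) (\<lambda>z. indicator G (x, z))) B =
    (\<integral>\<^sup>+z. indicator G (x, z) * indicator B z \<partial>Pn m x)"
    and eI: "emeasure (density \<pi> (\<lambda>z. indicator G (x, z))) B =
      (\<integral>\<^sup>+z. indicator G (x, z) * indicator B z \<partial>\<pi>)"
    and cJ: "emeasure (density (Pn m x) (\<lambda>_. 2)) B = 2 * (\<integral>\<^sup>+z. indicator B z \<partial>Pn m x)"
    and cI: "emeasure (density \<pi> (\<lambda>_. 2)) B = 2 * (\<integral>\<^sup>+z. indicator B z \<partial>\<pi>)"
    if [measurable]: "B \<in> sets borel" for B x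
    by (subst emeasure_density; (subst nn_integral_cmult)?; auto)+
  have rect[measurable]: "(\<lambda>s. indicator C (fst s) *
    indicator B (snd s) :: ennreal) \<in> borel_measurable (borel \<Otimes>\<^sub>M borel)"
    if [measurable]: "B \<in> sets borel" "C \<in> sets borel" for B C :: "'e set"
    by measurable
  \<comment> \<open>The integrated bounds \<open>GJ\<close> and, below, \<open>GI\<close> are tested
    on rectangles, which turns them into bounds between kernels for almost every x.\<close>
  have A1: "AE x in \<pi>. \<forall>B\<in>sets borel. emeasure (density (Pn m x) (\<lambda>z. indicator G (x, z))) B \<le>
    emeasure (density \<pi> (\<lambda>_. 2)) B"
  proof (rule AE_kernel_le)
    fix B C :: "'e set" assume [measurable]: "B \<in> sets borel" and "C \<in> sets \<pi>"
    then have [measurable]: "C \<in> sets borel" by simp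
    have "(\<integral>\<^sup>+x. emeasure (density (Pn m x) (\<lambda>z. indicator G (x, z))) B * indicator C x \<partial>\<pi>) =
        (\<integral>\<^sup>+x. \<integral>\<^sup>+z. indicator G (x, z) * (indicator C x * indicator B z) \<partial>Pn m x \<partial>\<pi>)"
      by (intro nn_integral_cong) (subst eJ; auto split: split_indicator)
    also have "\<dots> = (\<integral>\<^sup>+s. indicator G s * (indicator C (fst s) * indicator B (snd s)) \<partial>J)"
      by (subst nJ) auto
    also have "\<dots> \<le> 2 * (\<integral>\<^sup>+s. indicator C (fst s) * indicator B (snd s) \<partial>I)"
      by (rule GJ) measurable
    also have "\<dots> = 2 * (\<integral>\<^sup>+x. \<integral>\<^sup>+z. indicator C x * indicator B z \<partial>\<pi> \<partial>\<pi>)"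
      by (subst nI) auto
    also have "\<dots> = (\<integral>\<^sup>+x. 2 * (\<integral>\<^sup>+z. indicator C x * indicator B z \<partial>\<pi>) \<partial>\<pi>)"
      by (rule nn_integral_cmult[symmetric]) measurable
    also have "\<dots> = (\<integral>\<^sup>+x. emeasure (density \<pi> (\<lambda>_. 2)) B * indicator C x \<partial>\<pi>)"
      by (intro nn_integral_cong) (subst cI; auto split: split_indicator)
    finally show "(\<integral>\<^sup>+x. emeasure (density (Pn m x) (\<lambda>z. indicator G (x, z))) B * indicator C x \<partial>\<pi>) \<le>
      (\<integral>\<^sup>+x. emeasure (density \<pi> (\<lambda>_. 2)) B * indicator C x \<partial>\<pi>)" .
  next
    show "(\<integral>\<^sup>+x. emeasure (density \<pi> (\<lambda>_. 2)) UNIV \<partial>\<pi>) < \<infinity>"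
      using \<pi>.emeasure_space_1 by (simp add: cI)
  qed (auto simp: eJ cI cong: measurable_cong_sets)
  have A2: "AE x in \<pi>. \<forall>B\<in>sets borel. emeasure (density \<pi> (\<lambda>z. indicator G (x, z))) B \<le>
    emeasure (density (Pn m x) (\<lambda>_. 2)) B"
  proof (rule AE_kernel_le)
    fix B C :: "'e set" assume [measurable]: "B \<in> sets borel" and "C \<in> sets \<pi>"
    then have [measurable]: "C \<in> sets borel" by simp
    have "(\<integral>\<^sup>+x. emeasure (density \<pi> (\<lambda>z. indicator G (x, z))) B * indicator C x \<partial>\<pi>) =
        (\<integral>\<^sup>+x. \<integral>\<^sup>+z. indicator G (x, z) * (indicator C x * indicator B z) \<partial>\<pi> \<partial>\<pi>)"
      by (intro nn_integral_cong) (subst eI; auto split: split_indicator)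
    also have "\<dots> = (\<integral>\<^sup>+s. indicator G s * (indicator C (fst s) * indicator B (snd s)) \<partial>I)"
      by (subst nI) auto
    also have "\<dots> \<le> 2 * (\<integral>\<^sup>+s. indicator C (fst s) * indicator B (snd s) \<partial>J)"
      by (rule GI) measurable
    also have "\<dots> = 2 * (\<integral>\<^sup>+x. \<integral>\<^sup>+z. indicator C x * indicator B z \<partial>Pn m x \<partial>\<pi>)"
      by (subst nJ) auto
    also have "\<dots> = (\<integral>\<^sup>+x. 2 * (\<integral>\<^sup>+z. indicator C x * indicator B z \<partial>Pn m x) \<partial>\<pi>)"
      by (rule nn_integral_cmult[symmetric]) measurable
    also have "\<dots> = (\<integral>\<^sup>+x. emeasure (density (Pn m x) (\<lambda>_. 2)) B * indicator C x \<partial>\<pi>)"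
      by (intro nn_integral_cong) (subst cJ; auto split: split_indicator)
    finally show "(\<integral>\<^sup>+x. emeasure (density \<pi> (\<lambda>z. indicator G (x, z))) B * indicator C x \<partial>\<pi>) \<le>
      (\<integral>\<^sup>+x. emeasure (density (Pn m x) (\<lambda>_. 2)) B * indicator C x \<partial>\<pi>)" .
  next
    have "(\<integral>\<^sup>+x. emeasure (density (Pn m x) (\<lambda>_. 2)) UNIV \<partial>\<pi>) = (\<integral>\<^sup>+x. 2 \<partial>\<pi>)"
      using prob_space.emeasure_space_1[OF prob_Pn] by (intro nn_integral_cong) (simp add: cJ)
    then show "(\<integral>\<^sup>+x. emeasure (density (Pn m x) (\<lambda>_. 2)) UNIV \<partial>\<pi>) < \<infinity>"
      using \<pi>.emeasure_space_1 by simp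
  qed (auto simp: eI cJ cong: measurable_cong_sets)
  have JI: "measure J D \<le> measure I D + \<delta>" and IJ: "measure I D \<le> measure J D + \<delta>"
    if [measurable]: "D \<in> sets (borel \<Otimes>\<^sub>M borel)" for D
  proof -
    have i: "indicator D \<in> borel_measurable (borel \<Otimes>\<^sub>M borel)" by measurable
    have em: "emeasure J D = (\<integral>\<^sup>+x. \<integral>\<^sup>+z. indicator D (x, z) \<partial>Pn m x \<partial>\<pi>)"
      "emeasure I D = (\<integral>\<^sup>+x. \<integral>\<^sup>+z. indicator D (x, z) \<partial>\<pi> \<partial>\<pi>)"
      using nJ[OF i] nI[OF i] by (simp_all add: sI sJ)
    have "emeasure J D \<le> (\<integral>\<^sup>+x. (\<integral>\<^sup>+z. indicator D (x, z) \<partial>\<pi>) + excess m x \<partial>\<pi>)"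
      unfolding em by (intro nn_integral_mono nn_integral_Pn_le) (auto simp: indicator_def)
    also have "\<dots> = emeasure I D + mixing m"
      unfolding em mixing_def by (rule nn_integral_add) measurable
    finally have 1: "emeasure J D \<le> emeasure I D + ennreal \<delta>"
      using mix by (rule order_trans[OF _ add_left_mono])
    have "emeasure I D \<le> (\<integral>\<^sup>+x. (\<integral>\<^sup>+z. indicator D (x, z) \<partial>Pn m x) + excess m x \<partial>\<pi>)"
      unfolding em by (intro nn_integral_mono nn_integral_Pn_le) (auto simp: indicator_def)
    also have "\<dots> = emeasure J D + mixing m"
      unfolding em mixing_def by (rule nn_integral_add) measurable
    finally have 2: "emeasure I D \<le> emeasure J D + ennreal \<delta>"
      using mix by (rule order_trans[OF _ add_left_mono])
    show "measure J D \<le> measure I D + \<delta>" "measure I D \<le> measure J D + \<delta>"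
      using 1 2 \<delta> by (simp_all add: I.emeasure_eq_measure J.emeasure_eq_measure
        ennreal_plus[symmetric] del: ennreal_plus)
  qed
  \<comment> \<open>As \<open>J\<close> exceeds \<open>I\<close> by at most \<delta> on any set,
    this inequality leaves at most \<delta> for \<open>I\<close> and 2 \<delta> for \<open>J\<close>
    on \<open>D1\<close>. On \<open>D2\<close> the roles are exchanged. The sums are the 3 \<delta>
    of the conclusion.\<close>
  have D1: "2 * measure I D1 \<le> measure J D1"
  proof -
    have "emeasure I D1 \<le> emeasure I N0 + emeasure I (D1 - N0)"
      by (rule order_trans[OF emeasure_mono emeasure_subadditive]) (auto simp: sI)
    then have "2 * emeasure I D1 \<le> 2 * (\<integral>\<^sup>+s. indicator (D1 - N0) s \<partial>I)"
      using N0(2) by (simp add: sI mult_left_mono)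
    also have "\<dots> = (\<integral>\<^sup>+s. 2 * indicator (D1 - N0) s \<partial>I)"
      by (rule nn_integral_cmult[symmetric]) measurable
    also have "\<dots> \<le> (\<integral>\<^sup>+s. ennreal (q s) * indicator (D1 - N0) s \<partial>I)"
    proof (intro nn_integral_mono)
      fix s
      show "2 * indicator (D1 - N0) s \<le> ennreal (q s) * indicator (D1 - N0) s"
        using ennreal_leI[of 2 "q s"] by (auto simp: D1_def split: split_indicator)
    qed
    also have "\<dots> = (\<integral>\<^sup>+s. indicator (- N0) s * indicator (D1 - N0) s \<partial>J)"
      by (rule dec[symmetric]) measurable
    also have "\<dots> \<le> (\<integral>\<^sup>+s. indicator D1 s \<partial>J)"
      by (intro nn_integral_mono) (auto split: split_indicator)
    also have "\<dots> = emeasure J D1" by (simp add: sJ)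
    finally have "ennreal (2 * measure I D1) \<le> ennreal (measure J D1)"
      by (simp add: I.emeasure_eq_measure J.emeasure_eq_measure ennreal_mult)
    then show ?thesis by simp
  qed
  have D2: "2 * measure J D2 \<le> measure I D2"
  proof -
    have "2 * emeasure J D2 = 2 * (\<integral>\<^sup>+s. indicator (- N0) s * indicator D2 s \<partial>J)"
    proof -
      have "(\<integral>\<^sup>+s. indicator (- N0) s * indicator D2 s \<partial>J) = (\<integral>\<^sup>+s. indicator D2 s \<partial>J)"
        by (intro nn_integral_cong) (auto simp: D2_def split: split_indicator)
      then show ?thesis by (simp add: sJ)
    qed
    also have "\<dots> = 2 * (\<integral>\<^sup>+s. ennreal (q s) * indicator D2 s \<partial>I)"
      by (subst dec) auto
    also have "\<dots> = (\<integral>\<^sup>+s. 2 * (ennreal (q s) * indicator D2 s) \<partial>I)"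
      by (rule nn_integral_cmult[symmetric]) measurable
    also have "\<dots> \<le> (\<integral>\<^sup>+s. indicator D2 s \<partial>I)"
    proof (intro nn_integral_mono)
      fix s
      have "ennreal (2 * q s) \<le> 1" if "s \<in> D2"
        using that by (auto simp: D2_def intro!: ennreal_le_1[THEN iffD2])
      then show "2 * (ennreal (q s) * indicator D2 s) \<le> indicator D2 s"
        using q(2)[of s] by (auto simp: ennreal_mult split: split_indicator)
    qed
    also have "\<dots> = emeasure I D2" by (simp add: sI)
    finally have "ennreal (2 * measure J D2) \<le> ennreal (measure I D2)"
      by (simp add: I.emeasure_eq_measure J.emeasure_eq_measure ennreal_mult)
    then show ?thesis by simp
  qed
  have cG: "- G = D1 \<union> D2" by (auto simp: G_def)
  have "measure J (- G) \<le> measure J D1 + measure J D2" "measure I (- G) \<le> measure I D1 + measure I D2"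
    unfolding cG by (auto intro!: measure_Un_le simp: sI sJ)
  then have small: "measure J (- G) \<le> 3 * \<delta>" "measure I (- G) \<le> 3 * \<delta>"
    using D1 D2 JI[OF Dm(1)] IJ[OF Dm(2)] JI[OF Dm(2)] IJ[OF Dm(1)] by linarith+
  have iG: "indicator (- G) \<in> borel_measurable (borel \<Otimes>\<^sub>M borel)" by measurable
  show thesis
  proof (rule that[OF Gm])
    show "AE x in \<pi>. \<forall>f\<in>borel_measurable borel. (\<integral>\<^sup>+z. indicator G (x, z) * f z \<partial>Pn m x) \<le>
      2 * (\<integral>\<^sup>+z. f z \<partial>\<pi>)"
      using A1 by eventually_elim (intro ballI nn_integral_mono_density; use sect in simp)
    show "AE x in \<pi>. \<forall>f\<in>borel_measurable borel. (\<integral>\<^sup>+z. indicator G (x, z) * f z \<partial>\<pi>) \<le>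
      2 * (\<integral>\<^sup>+z. f z \<partial>Pn m x)"
      using A2 by eventually_elim (intro ballI nn_integral_mono_density; use sect in simp)
    show "(\<integral>\<^sup>+x. \<integral>\<^sup>+z. indicator (- G) (x, z) \<partial>Pn m x \<partial>\<pi>) \<le> ennreal (3 * \<delta>)"
      using ennreal_leI[OF small(1)] nJ[OF iG]
        by (simp add: sJ J.emeasure_eq_measure[symmetric] del: ennreal_le_iff)
    show "(\<integral>\<^sup>+x. \<integral>\<^sup>+z. indicator (- G) (x, z) \<partial>\<pi> \<partial>\<pi>) \<le> ennreal (3 * \<delta>)"
      using ennreal_leI[OF small(2)] nI[OF iG]
        by (simp add: sI I.emeasure_eq_measure[symmetric] del: ennreal_le_iff)
  qed
qed

text \<open>Integrating \<open>redraw F\<close> against a law L amounts to integrating F against the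
  product of \<pi> and the history marginal of L.\<close>

abbreviation redraw :: "('e \<times> 'h \<Rightarrow> ennreal) \<Rightarrow> 'e \<times> 'h \<Rightarrow> ennreal" where
  "redraw F s \<equiv> \<integral>\<^sup>+z. F (z, snd s) \<partial>\<pi>"

lemma redraw_measurable:
  assumes [measurable]: "F \<in> borel_measurable EH" shows "redraw F \<in> borel_measurable EH"
  using \<pi> by (intro nn_integral_kernel[where N=borel]) auto

lemma redraw_le_1: "(\<And>s. F s \<le> 1) \<Longrightarrow> redraw F s \<le> 1"
  by (rule \<pi>.nn_integral_le_1)

lemma nn_integral_steps_le_1:
  assumes "obs_density g" "s \<in> space EH" "\<And>s. F s \<le> 1"
  shows "(\<integral>\<^sup>+s'. F s' \<partial>steps g n s) \<le> 1"
  by (rule prob_space.nn_integral_le_1[OF kernel_prob(1)[OF steps_kernel[OF assms(1)] assms(2)]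
    assms(3)])

lemma emeasure_Pn_UNIV[simp]: "emeasure (Pn n x) UNIV = 1"
  using prob_space.emeasure_space_1[OF prob_Pn, of n x] by simp

lemma const_\<pi>_kernel[measurable]: "(\<lambda>_. \<pi>) \<in> M \<rightarrow>\<^sub>M prob_algebra borel"
  using \<pi> by simp

text \<open>The bookkeeping of \<open>steps_le_redraw\<close>. I2 is the part off the overlap set;
  I1 is the part on it, changed to pure noise with constant k; the factor 2 is the density bound on
  the overlap set; z is changed back to the true observations with constant K2 and error \<delta>'.
  Off-overlap part and the two changes contribute \<delta> / 3 each.\<close>

lemma combine_bounds:
  fixes x y z I1 I2 :: ennreal and k K K2 \<delta> \<delta>' :: real
  assumes "x \<le> I1 + I2" "I2 \<le> ennreal (\<delta> / 3)" "I1 \<le> ennreal k * (2 * z) + ennreal (\<delta> / 3)"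
    "z \<le> ennreal K2 * y + ennreal \<delta>'" "0 \<le> k" "k \<le> K" "0 \<le> K2" "0 < \<delta>" "0 \<le> \<delta>'" "2 * k * \<delta>' \<le> \<delta> / 3"
  shows "x \<le> ennreal (2 * K * K2) * y + ennreal \<delta>"
proof -
  have "I1 \<le> ennreal k * (2 * (ennreal K2 * y + ennreal \<delta>')) + ennreal (\<delta> / 3)"
    by (rule order_trans[OF assms(3)]) (intro add_right_mono mult_left_mono assms(4); simp)
  also have "ennreal k * (2 * (ennreal K2 * y + ennreal \<delta>')) =
    ennreal (2 * k * K2) * y + ennreal (2 * k * \<delta>')"
  proof -
    have 1: "ennreal (2 * k * K2) = 2 * (ennreal k * ennreal K2)" "ennreal (2 * k * \<delta>') =
      2 * (ennreal k * ennreal \<delta>')"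
      using assms by (simp_all add: ennreal_mult mult.assoc)
    show ?thesis unfolding 1 by (simp add: distrib_left mult_ac)
  qed
  also have "\<dots> \<le> ennreal (2 * K * K2) * y + ennreal (\<delta> / 3)"
    using assms(5-) by (intro add_mono mult_right_mono ennreal_leI) auto
  finally have "I1 \<le> ennreal (2 * K * K2) * y + ennreal (\<delta> / 3) + ennreal (\<delta> / 3)"
    by (simp add: add_right_mono)
  then have "x \<le> ennreal (2 * K * K2) * y + ennreal (\<delta> / 3) + ennreal (\<delta> / 3) + ennreal (\<delta> / 3)"
    using order_trans[OF assms(1) add_mono[OF _ assms(2)]] by blast
  also have "\<dots> = ennreal (2 * K * K2) * y + (ennreal (\<delta> / 3) + ennreal (\<delta> / 3) + ennreal (\<delta> / 3))"
    by (simp add: add.assoc)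
  also have "ennreal (\<delta> / 3) + ennreal (\<delta> / 3) + ennreal (\<delta> / 3) = ennreal \<delta>"
    using \<open>0 < \<delta>\<close> by (simp add: ennreal_plus[symmetric] del: ennreal_plus)
  finally show ?thesis .
qed

lemma steps_integral_measurable:
  assumes g: "obs_density g" and F: "F \<in> borel_measurable EH"
  shows "(\<lambda>s. \<integral>\<^sup>+s'. F s' \<partial>steps g m s) \<in> borel_measurable EH"
  using measurable_compose[OF measurable_snd F]
  by (intro nn_integral_kernel[OF steps_kernel[OF g]]) (simp add: split_beta')

lemma marg_integral_measurable:
  assumes L: "marg L" and g: "obs_density g" and F: "F \<in> borel_measurable EH"
  shows "(\<lambda>s. \<integral>\<^sup>+s'. F s' \<partial>steps g m s) \<in> borel_measurable L"
  using steps_integral_measurable[OF g F] by (simp add: measurable_cong_sets[OF margD(2)[OF L] refl])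

lemma marg_sections:
  assumes L: "marg L" and s: "s \<in> space L"
  shows "s \<in> space EH" "snd s \<in> space MH"
  using s margD(3)[OF L] by (simp_all add: space_pair_measure mem_Times_iff)

lemma nn_integral_steps_swap:
  assumes g: "obs_density g" and s: "s \<in> space EH"
    and f[measurable]: "(\<lambda>(z, s'). f z s') \<in> borel_measurable (borel \<Otimes>\<^sub>M EH)"
  shows "(\<integral>\<^sup>+s'. \<integral>\<^sup>+z. f z s' \<partial>\<pi> \<partial>steps g m s) = (\<integral>\<^sup>+z. \<integral>\<^sup>+s'. f z s' \<partial>steps g m s \<partial>\<pi>)"
proof (rule nn_integral_swap_prob[OF kernel_prob(1)[OF steps_kernel[OF g] s] prob_\<pi>])
  note [measurable_cong] = kernel_prob(2)[OF steps_kernel[OF g] s]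
  show "(\<lambda>(s', z). f z s') \<in> borel_measurable (steps g m s \<Otimes>\<^sub>M \<pi>)" by measurable
qed

lemma nn_integral_steps_marg:
  assumes L: "marg L" and g: "obs_density g"
    and f[measurable]: "(\<lambda>(x, z). f x z) \<in> borel_measurable (borel \<Otimes>\<^sub>M borel)"
  shows "(\<integral>\<^sup>+s. \<integral>\<^sup>+s'. f (fst s) (fst s') \<partial>steps g m s \<partial>L) = (\<integral>\<^sup>+x. \<integral>\<^sup>+z. f x z \<partial>Pn m x \<partial>\<pi>)"
proof -
  have "(\<integral>\<^sup>+s. \<integral>\<^sup>+s'. f (fst s) (fst s') \<partial>steps g m s \<partial>L) =
    (\<integral>\<^sup>+s. (\<integral>\<^sup>+z. f (fst s) z \<partial>Pn m (fst s)) \<partial>L)"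
  proof (intro nn_integral_cong)
    fix s assume "s \<in> space L"
    show "(\<integral>\<^sup>+s'. f (fst s) (fst s') \<partial>steps g m s) = (\<integral>\<^sup>+z. f (fst s) z \<partial>Pn m (fst s))"
      using nn_integral_steps_fst[OF g _ marg_sections(2)[OF L \<open>s \<in> space L\<close>], of "f (fst s)" m
        "fst s"] by simp
  qed
  also have "\<dots> = (\<integral>\<^sup>+x. \<integral>\<^sup>+z. f x z \<partial>Pn m x \<partial>\<pi>)"
    by (rule nn_integral_marg[OF L]) measurable
  finally show ?thesis .
qed

lemma nn_integral_steps_blind_marg:
  assumes L: "marg L" and f: "\<And>s. s \<in> space L \<Longrightarrow> f s \<in> borel_measurable EH"
  shows "(\<integral>\<^sup>+s. \<integral>\<^sup>+s'. f s s' \<partial>steps blind m s \<partial>L) =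
    (\<integral>\<^sup>+s. \<integral>\<^sup>+h'. \<integral>\<^sup>+z. f s (z, h') \<partial>Pn m (fst s) \<partial>refreshes m (snd s) \<partial>L)"
proof (intro nn_integral_cong)
  fix s assume s: "s \<in> space L"
  show "(\<integral>\<^sup>+s'. f s s' \<partial>steps blind m s) =
    (\<integral>\<^sup>+h'. \<integral>\<^sup>+z. f s (z, h') \<partial>Pn m (fst s) \<partial>refreshes m (snd s))"
    using nn_integral_steps_blind[OF marg_sections(2)[OF L s] f[OF s], of m "fst s"] by simp
qed

lemma refreshes_section:
  assumes L: "marg L" and s: "s \<in> space L" and h': "h' \<in> space (refreshes m (snd s))"
    and F[measurable]: "F \<in> borel_measurable EH"
  shows "(\<lambda>z. F (z, h')) \<in> borel_measurable borel"
proof -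
  have "h' \<in> space MH"
    using h' sets_eq_imp_space_eq[OF kernel_prob(2)[OF refreshes_kernel marg_sections(2)[OF L s]]]
      by simp
  then show ?thesis by measurable
qed

text \<open>Under pure noise and given the start, the signal is independent of the history, so on G
  its density bound relative to \<pi> can be used with the history held fixed.\<close>

lemma blind_le_redraw:
  assumes L: "marg L" and F[measurable]: "F \<in> borel_measurable EH"
    and G[measurable]: "G \<in> sets (borel \<Otimes>\<^sub>M borel)"
    and ov: "AE x in \<pi>. \<forall>f\<in>borel_measurable borel. (\<integral>\<^sup>+z. indicator G (x, z) * f z \<partial>Pn m x) \<le>
      2 * (\<integral>\<^sup>+z. f z \<partial>\<pi>)"
  shows "(\<integral>\<^sup>+s. \<integral>\<^sup>+s'. indicator G (fst s, fst s') * F s' \<partial>steps blind m s \<partial>L) \<le>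
    2 * (\<integral>\<^sup>+s. \<integral>\<^sup>+s'. redraw F s' \<partial>steps blind m s \<partial>L)"
proof -
  note sK[measurable] = steps_kernel[OF obs_density_1] and [measurable_cong] = margD(2)[OF L]
  have rF: "redraw F \<in> borel_measurable EH" by (rule redraw_measurable[OF F])
  have "(\<integral>\<^sup>+s. \<integral>\<^sup>+s'. indicator G (fst s, fst s') * F s' \<partial>steps blind m s \<partial>L) =
    (\<integral>\<^sup>+s. \<integral>\<^sup>+h'. \<integral>\<^sup>+z. indicator G (fst s, z) * F (z, h') \<partial>Pn m (fst s) \<partial>refreshes m (snd s) \<partial>L)"
    by (subst nn_integral_steps_blind_marg[OF L]) auto
  also have "\<dots> \<le> (\<integral>\<^sup>+s. \<integral>\<^sup>+h'. 2 * (\<integral>\<^sup>+z. F (z, h') \<partial>\<pi>) \<partial>refreshes m (snd s) \<partial>L)"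
  proof (intro nn_integral_mono_AE)
    show "AE s in L. (\<integral>\<^sup>+h'. \<integral>\<^sup>+z. indicator G (fst s, z) *
      F (z, h') \<partial>Pn m (fst s) \<partial>refreshes m (snd s)) \<le>
      (\<integral>\<^sup>+h'. 2 * (\<integral>\<^sup>+z. F (z, h') \<partial>\<pi>) \<partial>refreshes m (snd s))"
      using AE_marg[OF L ov] AE_space
    proof eventually_elim
      case (elim s)
      show ?case
        by (intro nn_integral_mono elim(1)[rule_format] refreshes_section[OF L elim(2) _ F])
    qed
  qed
  also have "\<dots> = (\<integral>\<^sup>+s. \<integral>\<^sup>+h'. \<integral>\<^sup>+z. 2 * redraw F (z, h') \<partial>Pn m (fst s) \<partial>refreshes m (snd s) \<partial>L)"
    by simp
  also have "\<dots> = (\<integral>\<^sup>+s. \<integral>\<^sup>+s'. 2 * redraw F s' \<partial>steps blind m s \<partial>L)"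
    by (subst nn_integral_steps_blind_marg[OF L]) auto
  also have "\<dots> = (\<integral>\<^sup>+s. 2 * (\<integral>\<^sup>+s'. redraw F s' \<partial>steps blind m s) \<partial>L)"
  proof (intro nn_integral_cong nn_integral_cmult)
    fix s assume "s \<in> space L"
    note [measurable_cong] = kernel_prob(2)[OF steps_kernel[OF obs_density_1] marg_sections(1)[OF L
      this]]
    show "redraw F \<in> borel_measurable (steps blind m s)" by measurable
  qed
  also have "\<dots> = 2 * (\<integral>\<^sup>+s. \<integral>\<^sup>+s'. redraw F s' \<partial>steps blind m s \<partial>L)"
    by (rule nn_integral_cmult[OF marg_integral_measurable[OF L obs_density_1 rF]])
  finally show ?thesis .
qed

text \<open>The redrawn signal z is unrelated to the final signal of the chain, so G has to be
  evaluated at the start and at z. Integrating over z first turns z, with the history fixed, into a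
  signal moved by m steps.\<close>

lemma redraw_le_blind:
  assumes L: "marg L" and F[measurable]: "F \<in> borel_measurable EH"
    and G[measurable]: "G \<in> sets (borel \<Otimes>\<^sub>M borel)"
    and ov: "AE x in \<pi>. \<forall>f\<in>borel_measurable borel. (\<integral>\<^sup>+z. indicator G (x, z) * f z \<partial>\<pi>) \<le>
      2 * (\<integral>\<^sup>+z. f z \<partial>Pn m x)"
  shows "(\<integral>\<^sup>+s. \<integral>\<^sup>+z. \<integral>\<^sup>+s'. indicator G (fst s, z) * F (z, snd s') \<partial>steps blind m s \<partial>\<pi> \<partial>L) \<le>
    2 * (\<integral>\<^sup>+s. \<integral>\<^sup>+s'. F s' \<partial>steps blind m s \<partial>L)"
proof -
  note sK[measurable] = steps_kernel[OF obs_density_1] and [measurable_cong] = margD(2)[OF L]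
  have rF: "redraw F \<in> borel_measurable EH" by (rule redraw_measurable[OF F])
  have "(\<integral>\<^sup>+s. \<integral>\<^sup>+z. \<integral>\<^sup>+s'. indicator G (fst s, z) * F (z, snd s') \<partial>steps blind m s \<partial>\<pi> \<partial>L) =
    (\<integral>\<^sup>+s. \<integral>\<^sup>+s'. \<integral>\<^sup>+z. indicator G (fst s, z) * F (z, snd s') \<partial>\<pi> \<partial>steps blind m s \<partial>L)"
  proof (intro nn_integral_cong nn_integral_steps_swap[symmetric] obs_density_1)
    fix s assume s: "s \<in> space L"
    show "s \<in> space EH" by (rule marg_sections(1)[OF L s])
    show "(\<lambda>(z, s'). indicator G (fst s, z) * F (z, snd s')) \<in> borel_measurable (borel \<Otimes>\<^sub>M EH)"
      by measurable
  qed
  also have "\<dots> = (\<integral>\<^sup>+s. \<integral>\<^sup>+h'. \<integral>\<^sup>+z'. (\<integral>\<^sup>+z. indicator G (fst s, z) *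
    F (z, h') \<partial>\<pi>) \<partial>Pn m (fst s) \<partial>refreshes m (snd s) \<partial>L)"
    by (subst nn_integral_steps_blind_marg[OF L]) auto
  also have "\<dots> = (\<integral>\<^sup>+s. \<integral>\<^sup>+h'. (\<integral>\<^sup>+z. indicator G (fst s, z) * F (z, h') \<partial>\<pi>) \<partial>refreshes m (snd s) \<partial>L)"
    by simp
  also have "\<dots> \<le> (\<integral>\<^sup>+s. \<integral>\<^sup>+h'. 2 * (\<integral>\<^sup>+z. F (z, h') \<partial>Pn m (fst s)) \<partial>refreshes m (snd s) \<partial>L)"
  proof (intro nn_integral_mono_AE)
    show "AE s in L. (\<integral>\<^sup>+h'. (\<integral>\<^sup>+z. indicator G (fst s, z) * F (z, h') \<partial>\<pi>) \<partial>refreshes m (snd s)) \<le>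
      (\<integral>\<^sup>+h'. 2 * (\<integral>\<^sup>+z. F (z, h') \<partial>Pn m (fst s)) \<partial>refreshes m (snd s))"
      using AE_marg[OF L ov] AE_space
    proof eventually_elim
      case (elim s)
      show ?case
        by (intro nn_integral_mono elim(1)[rule_format] refreshes_section[OF L elim(2) _ F])
    qed
  qed
  also have "\<dots> = (\<integral>\<^sup>+s. 2 * (\<integral>\<^sup>+h'. \<integral>\<^sup>+z. F (z, h') \<partial>Pn m (fst s) \<partial>refreshes m (snd s)) \<partial>L)"
  proof (intro nn_integral_cong nn_integral_cmult)
    fix s assume "s \<in> space L"
    note [measurable_cong] = kernel_prob(2)[OF refreshes_kernel marg_sections(2)[OF L this]]
    show "(\<lambda>h'. \<integral>\<^sup>+z. F (z, h') \<partial>Pn m (fst s)) \<in> borel_measurable (refreshes m (snd s))" by measurable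
  qed
  also have "\<dots> = 2 * (\<integral>\<^sup>+s. \<integral>\<^sup>+h'. \<integral>\<^sup>+z. F (z, h') \<partial>Pn m (fst s) \<partial>refreshes m (snd s) \<partial>L)"
    by (rule nn_integral_cmult) measurable
  also have "\<dots> = 2 * (\<integral>\<^sup>+s. \<integral>\<^sup>+s'. F s' \<partial>steps blind m s \<partial>L)"
    by (subst nn_integral_steps_blind_marg[OF L]) auto
  finally show ?thesis .
qed

text \<open>Three replacements give either direction: the observations become pure noise, the
  transition law is exchanged for the invariant law on the overlap set, and the true observations
  are restored. All of them are uniform in L. The number m is fixed first by mixing, the constants
  of the changes of density come after it.\<close>

lemma steps_le_redraw:
  assumes g: "obs_density g" and mix: "mixing \<longlonglongrightarrow> 0" and "0 < \<delta>"
  shows "\<exists>m K. 0 \<le> K \<and> (\<forall>L F. marg L \<longrightarrow> F \<in> borel_measurable EH \<longrightarrow> (\<forall>s. F s \<le> 1) \<longrightarrow>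
    (\<integral>\<^sup>+s. \<integral>\<^sup>+s'. F s' \<partial>steps g m s \<partial>L) \<le>
      ennreal K * (\<integral>\<^sup>+s. \<integral>\<^sup>+s'. redraw F s' \<partial>steps g m s \<partial>L) + ennreal \<delta> \<and>
    (\<integral>\<^sup>+s. \<integral>\<^sup>+s'. redraw F s' \<partial>steps g m s \<partial>L) \<le>
      ennreal K * (\<integral>\<^sup>+s. \<integral>\<^sup>+s'. F s' \<partial>steps g m s \<partial>L) + ennreal \<delta>)"
proof -
  have "eventually (\<lambda>m. mixing m < ennreal (\<delta> / 9)) sequentially"
    using mix \<open>0 < \<delta>\<close> by (intro order_tendstoD) auto
  then obtain m where m: "mixing m \<le> ennreal (\<delta> / 9)"
    using eventually_happens'[OF sequentially_bot] less_imp_le by metis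
  obtain G where G[measurable]: "G \<in> sets (borel \<Otimes>\<^sub>M borel)"
    and G\<pi>: "AE x in \<pi>. \<forall>f\<in>borel_measurable borel. (\<integral>\<^sup>+z. indicator G (x, z) * f z \<partial>Pn m x) \<le>
      2 * (\<integral>\<^sup>+z. f z \<partial>\<pi>)"
    and GP: "AE x in \<pi>. \<forall>f\<in>borel_measurable borel. (\<integral>\<^sup>+z. indicator G (x, z) * f z \<partial>\<pi>) \<le>
      2 * (\<integral>\<^sup>+z. f z \<partial>Pn m x)"
    and smallP: "(\<integral>\<^sup>+x. \<integral>\<^sup>+z. indicator (- G) (x, z) \<partial>Pn m x \<partial>\<pi>) \<le> ennreal (3 * (\<delta> / 9))"
    and small\<pi>: "(\<integral>\<^sup>+x. \<integral>\<^sup>+z. indicator (- G) (x, z) \<partial>\<pi> \<partial>\<pi>) \<le> ennreal (3 * (\<delta> / 9))"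
    by (rule ex_overlap[OF m]) (use \<open>0 < \<delta>\<close> in auto)
  have cG[measurable]: "- G \<in> sets (borel \<Otimes>\<^sub>M borel)"
    using sets.compl_sets[OF G] by (simp add: space_pair_measure Compl_eq_Diff_UNIV)
  have \<delta>3: "0 < \<delta> / 3" using \<open>0 < \<delta>\<close> by simp
  \<comment> \<open>The overlap set involves the signal at the start, which is therefore carried as
    a parameter. For the reverse direction the parameter is the pair of this signal and the redrawn
    one.\<close>
  obtain K1 :: real where K1: "0 \<le> K1"
    and le1: "\<forall>L F. L \<in> space (prob_algebra (borel \<Otimes>\<^sub>M ((borel :: 'e measure) \<Otimes>\<^sub>M MH))) \<longrightarrow>
    distr L borel fst = \<pi> \<longrightarrow>
      F \<in> borel_measurable ((borel :: 'e measure) \<Otimes>\<^sub>M EH) \<longrightarrow> (\<forall>s. F s \<le> 1) \<longrightarrow>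
    (\<integral>\<^sup>+s. \<integral>\<^sup>+s'. F (fst (snd s), s') \<partial>steps g m (fst s, snd (snd s)) \<partial>L) \<le>
    ennreal K1 * (\<integral>\<^sup>+s. \<integral>\<^sup>+s'. F (fst (snd s), s') \<partial>steps blind m (fst s, snd (snd s)) \<partial>L) +
      ennreal (\<delta> / 3)"
    using steps_change_param[OF g obs_density_1 \<delta>3, of "(borel :: 'e measure)" m]
      by (elim exE conjE) (rule that)
  obtain K1' :: real where K1': "0 \<le> K1'"
    and le1': "\<forall>L F. L \<in> space (prob_algebra (borel \<Otimes>\<^sub>M ((borel \<Otimes>\<^sub>M borel :: ('e \<times> 'e) measure) \<Otimes>\<^sub>M
    MH))) \<longrightarrow> distr L borel fst = \<pi> \<longrightarrow>
      F \<in> borel_measurable ((borel \<Otimes>\<^sub>M borel :: ('e \<times> 'e) measure) \<Otimes>\<^sub>M EH) \<longrightarrow> (\<forall>s. F s \<le> 1) \<longrightarrow>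
    (\<integral>\<^sup>+s. \<integral>\<^sup>+s'. F (fst (snd s), s') \<partial>steps g m (fst s, snd (snd s)) \<partial>L) \<le>
    ennreal K1' * (\<integral>\<^sup>+s. \<integral>\<^sup>+s'. F (fst (snd s), s') \<partial>steps blind m (fst s, snd (snd s)) \<partial>L) +
      ennreal (\<delta> / 3)"
    using steps_change_param[OF g obs_density_1 \<delta>3, of "(borel \<Otimes>\<^sub>M borel :: ('e \<times> 'e) measure)" m]
      by (elim exE conjE) (rule that)
  \<comment> \<open>The error of changing back is later multiplied by 2 and by \<open>K1\<close> or
    \<open>K1'\<close>; either product stays below \<delta> / 3.\<close>
  define \<delta>' where "\<delta>' = \<delta> / (6 * (K1 + K1' + 1))"
  have \<delta>': "0 < \<delta>'" "2 * K1 * \<delta>' \<le> \<delta> / 3" "2 * K1' * \<delta>' \<le> \<delta> / 3"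
    using K1 K1' \<open>0 < \<delta>\<close> by (auto simp: \<delta>'_def field_simps)
  obtain K2 :: real where K2: "0 \<le> K2" and le2: "\<forall>L F. marg L \<longrightarrow> F \<in> borel_measurable EH \<longrightarrow> (\<forall>s. F s \<le>
    1) \<longrightarrow>
    (\<integral>\<^sup>+s. \<integral>\<^sup>+s'. F s' \<partial>steps blind m s \<partial>L) \<le>
      ennreal K2 * (\<integral>\<^sup>+s. \<integral>\<^sup>+s'. F s' \<partial>steps g m s \<partial>L) + ennreal \<delta>'"
    using steps_change[OF obs_density_1 g \<delta>'(1), of m] by (elim exE conjE) (rule that)
  show ?thesis
  proof (intro exI[of _ m] exI[of _ "2 * (K1 + K1') * K2"] conjI allI impI)
    show "0 \<le> 2 * (K1 + K1') * K2" using K1 K1' K2 by simp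
    fix L :: "('e \<times> 'h) measure" and F :: "'e \<times> 'h \<Rightarrow> ennreal"
    assume L: "marg L" and F[measurable]: "F \<in> borel_measurable EH" and F1': "\<forall>s. F s \<le> 1"
    have F1: "F s \<le> 1" for s by (rule F1'[rule_format])
    note margD(2)[OF L, measurable_cong]
    note sK[measurable] = steps_kernel[OF g] steps_kernel[OF obs_density_1]
    interpret L: prob_space L by (rule margD(4)[OF L])
    have spL: "s \<in> space EH" if "s \<in> space L" for s using that margD(3)[OF L] by simp
    have sndL: "snd s \<in> space MH" if "s \<in> space L" for s using spL[OF that]
      by (simp add: space_pair_measure mem_Times_iff)
    have rF: "redraw F \<in> borel_measurable EH" by (rule redraw_measurable[OF F])
    have r1: "redraw F s \<le> 1" for s by (rule redraw_le_1[OF F1])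
    show "(\<integral>\<^sup>+s. \<integral>\<^sup>+s'. F s' \<partial>steps g m s \<partial>L) \<le>
      ennreal (2 * (K1 + K1') * K2) * (\<integral>\<^sup>+s. \<integral>\<^sup>+s'. redraw F s' \<partial>steps g m s \<partial>L) + ennreal \<delta>"
    proof (rule combine_bounds[where k=K1])
      let ?L = "distr L (borel \<Otimes>\<^sub>M (borel \<Otimes>\<^sub>M MH)) (\<lambda>s. (fst s, (fst s, snd s)))"
      let ?I = "\<lambda>g. \<integral>\<^sup>+s. \<integral>\<^sup>+s'. indicator G (fst s, fst s') * F s' \<partial>steps g m s \<partial>L"
      show "(\<integral>\<^sup>+s. \<integral>\<^sup>+s'. F s' \<partial>steps g m s \<partial>L) \<le>
        ?I g + (\<integral>\<^sup>+s. \<integral>\<^sup>+s'. indicator (- G) (fst s, fst s') \<partial>steps g m s \<partial>L)"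
      proof -
        have "(\<integral>\<^sup>+s. \<integral>\<^sup>+s'. F s' \<partial>steps g m s \<partial>L) \<le>
            (\<integral>\<^sup>+s. \<integral>\<^sup>+s'. indicator G (fst s, fst s') * F s' +
              indicator (- G) (fst s, fst s') \<partial>steps g m s \<partial>L)"
          using F1 by (intro nn_integral_mono) (auto split: split_indicator)
        also have "\<dots> = (\<integral>\<^sup>+s. (\<integral>\<^sup>+s'. indicator G (fst s, fst s') * F s' \<partial>steps g m s) +
          (\<integral>\<^sup>+s'. indicator (- G) (fst s, fst s') \<partial>steps g m s) \<partial>L)"
        proof (intro nn_integral_cong nn_integral_add)
          fix s assume "s \<in> space L"
          note [measurable_cong] = kernel_prob(2)[OF steps_kernel[OF g] spL[OF this]]
          show "(\<lambda>s'. indicator G (fst s, fst s') * F s') \<in> borel_measurable (steps g m s)"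
            "(\<lambda>s'. indicator (- G) (fst s, fst s')) \<in> borel_measurable (steps g m s)"
            by measurable
        qed
        also have "\<dots> = ?I g + (\<integral>\<^sup>+s. \<integral>\<^sup>+s'. indicator (- G) (fst s, fst s') \<partial>steps g m s \<partial>L)"
          by (rule nn_integral_add) measurable
        finally show ?thesis .
      qed
      show "(\<integral>\<^sup>+s. \<integral>\<^sup>+s'. indicator (- G) (fst s, fst s') \<partial>steps g m s \<partial>L) \<le> ennreal (\<delta> / 3)"
        using smallP nn_integral_steps_marg[OF L g, of "\<lambda>x z. indicator (- G) (x, z)" m] by simp
      have mL: "(\<lambda>s. (fst s, (fst s, snd s))) \<in> L \<rightarrow>\<^sub>M borel \<Otimes>\<^sub>M (borel \<Otimes>\<^sub>M MH)" by measurable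
      have tr: "(\<integral>\<^sup>+s. \<integral>\<^sup>+s'. indicator G (fst (snd s), fst s') *
        F s' \<partial>steps g' m (fst s, snd (snd s)) \<partial>?L) = ?I g'"
        if g': "obs_density g'" for g'
      proof -
        note steps_kernel[OF g', measurable]
        have m1: "(\<lambda>s. \<integral>\<^sup>+s'. indicator G (fst (snd s), fst s') * F s' \<partial>steps g' m (fst s, snd (snd s)))
            \<in> borel_measurable (borel \<Otimes>\<^sub>M (borel \<Otimes>\<^sub>M MH))"
          by measurable
        show ?thesis by (subst nn_integral_distr[OF mL], use m1 in simp, simp)
      qed
      have "?I g \<le> ennreal K1 * ?I blind + ennreal (\<delta> / 3)"
        unfolding tr[OF g, symmetric] tr[OF obs_density_1, symmetric]
      proof (rule le1[rule_format, of ?L "\<lambda>(p, s'). indicator G (p, fst s') *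
        F s'", unfolded split_conv])
        show "?L \<in> space (prob_algebra (borel \<Otimes>\<^sub>M (borel \<Otimes>\<^sub>M MH)))"
          using L.prob_space_distr[OF mL] by (simp add: space_prob_algebra)
        show "distr ?L borel fst = \<pi>"
          using L by (subst distr_distr[OF _ mL]) (auto simp: marg_def comp_def)
        show "(\<lambda>(p, s'). indicator G (p, fst s') * F s') \<in> borel_measurable (borel \<Otimes>\<^sub>M EH)"
          by measurable
        show "(case s of (p, s') \<Rightarrow> indicator G (p, fst s') * F s') \<le> 1" for s
          using F1 by (auto split: prod.split split_indicator)
      qed
      also have "?I blind \<le> 2 * (\<integral>\<^sup>+s. \<integral>\<^sup>+s'. redraw F s' \<partial>steps blind m s \<partial>L)"
        by (rule blind_le_redraw[OF L F G G\<pi>])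
      finally show "?I g \<le> ennreal K1 * (2 * (\<integral>\<^sup>+s. \<integral>\<^sup>+s'. redraw F s' \<partial>steps blind m s \<partial>L)) +
        ennreal (\<delta> / 3)"
        by (simp add: mult_left_mono add_right_mono)
      show "(\<integral>\<^sup>+s. \<integral>\<^sup>+s'. redraw F s' \<partial>steps blind m s \<partial>L) \<le>
        ennreal K2 * (\<integral>\<^sup>+s. \<integral>\<^sup>+s'. redraw F s' \<partial>steps g m s \<partial>L) + ennreal \<delta>'"
        by (rule le2[rule_format, OF L rF r1])
    qed (use K1 K1' K2 \<delta>' \<open>0 < \<delta>\<close> in auto)
    show "(\<integral>\<^sup>+s. \<integral>\<^sup>+s'. redraw F s' \<partial>steps g m s \<partial>L) \<le>
      ennreal (2 * (K1 + K1') * K2) * (\<integral>\<^sup>+s. \<integral>\<^sup>+s'. F s' \<partial>steps g m s \<partial>L) + ennreal \<delta>"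
    proof (rule combine_bounds[where k=K1'])
      let ?M = "L \<Otimes>\<^sub>M \<pi>"
      let ?f = "\<lambda>s. (fst (fst s), ((fst (fst s), snd s), snd (fst s)))"
      let ?L = "distr ?M (borel \<Otimes>\<^sub>M ((borel \<Otimes>\<^sub>M borel) \<Otimes>\<^sub>M MH)) ?f"
      let ?I = "\<lambda>g. \<integral>\<^sup>+s. \<integral>\<^sup>+z. \<integral>\<^sup>+s'. indicator G (fst s, z) * F (z, snd s') \<partial>steps g m s \<partial>\<pi> \<partial>L"
      show "(\<integral>\<^sup>+s. \<integral>\<^sup>+s'. redraw F s' \<partial>steps g m s \<partial>L) \<le>
        ?I g + (\<integral>\<^sup>+s. \<integral>\<^sup>+z. indicator (- G) (fst s, z) \<partial>\<pi> \<partial>L)"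
      proof -
        have "(\<integral>\<^sup>+s. \<integral>\<^sup>+s'. redraw F s' \<partial>steps g m s \<partial>L) =
          (\<integral>\<^sup>+s. \<integral>\<^sup>+z. \<integral>\<^sup>+s'. F (z, snd s') \<partial>steps g m s \<partial>\<pi> \<partial>L)"
          by (intro nn_integral_cong nn_integral_steps_swap[OF g spL]) auto
        also have "\<dots> \<le> (\<integral>\<^sup>+s. \<integral>\<^sup>+z. (\<integral>\<^sup>+s'. indicator G (fst s, z) * F (z, snd s') \<partial>steps g m s) +
          indicator (- G) (fst s, z) \<partial>\<pi> \<partial>L)"
        proof (intro nn_integral_mono)
          fix s z assume "s \<in> space L"
          show "(\<integral>\<^sup>+s'. F (z, snd s') \<partial>steps g m s) \<le>
            (\<integral>\<^sup>+s'. indicator G (fst s, z) * F (z, snd s') \<partial>steps g m s) + indicator (- G) (fst s, z)"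
            using nn_integral_steps_le_1[OF g spL[OF \<open>s \<in> space L\<close>], of "\<lambda>s'. F (z, snd s')" m] F1
            by (auto split: split_indicator)
        qed
        also have "\<dots> = (\<integral>\<^sup>+s. (\<integral>\<^sup>+z. \<integral>\<^sup>+s'. indicator G (fst s, z) *
          F (z, snd s') \<partial>steps g m s \<partial>\<pi>) + (\<integral>\<^sup>+z. indicator (- G) (fst s, z) \<partial>\<pi>) \<partial>L)"
        proof (intro nn_integral_cong nn_integral_add)
          fix s assume "s \<in> space L"
          have [measurable]: "(\<lambda>_. steps g m s) \<in> borel \<rightarrow>\<^sub>M prob_algebra EH"
            using measurable_space[OF steps_kernel[OF g] spL[OF \<open>s \<in> space L\<close>]] by simp
          show "(\<lambda>z. \<integral>\<^sup>+s'. indicator G (fst s, z) * F (z, snd s') \<partial>steps g m s) \<in> borel_measurable \<pi>"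
            by measurable
        qed measurable
        also have "\<dots> = ?I g + (\<integral>\<^sup>+s. \<integral>\<^sup>+z. indicator (- G) (fst s, z) \<partial>\<pi> \<partial>L)"
          by (rule nn_integral_add) measurable
        finally show ?thesis .
      qed
      show "(\<integral>\<^sup>+s. \<integral>\<^sup>+z. indicator (- G) (fst s, z) \<partial>\<pi> \<partial>L) \<le> ennreal (\<delta> / 3)"
        using small\<pi> by (subst nn_integral_marg[OF L, of "\<lambda>x. \<integral>\<^sup>+z. indicator (- G) (x, z) \<partial>\<pi>"]) auto
      have mL: "?f \<in> ?M \<rightarrow>\<^sub>M borel \<Otimes>\<^sub>M ((borel \<Otimes>\<^sub>M borel) \<Otimes>\<^sub>M MH)" by measurable
      have pM: "prob_space ?M" by (intro prob_space_pair prob_\<pi> margD(4)[OF L])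
      have tr: "(\<integral>\<^sup>+s. \<integral>\<^sup>+s'. indicator G (fst (snd s)) *
        F (snd (fst (snd s)), snd s') \<partial>steps g' m (fst s, snd (snd s)) \<partial>?L) = ?I g'"
        if g': "obs_density g'" for g'
      proof -
        note steps_kernel[OF g', measurable]
        have m1: "(\<lambda>s. \<integral>\<^sup>+s'. indicator G (fst (snd s)) *
          F (snd (fst (snd s)), snd s') \<partial>steps g' m (fst s, snd (snd s)))
            \<in> borel_measurable (borel \<Otimes>\<^sub>M ((borel \<Otimes>\<^sub>M borel) \<Otimes>\<^sub>M MH))"
          by measurable
        have m2: "(\<lambda>s. \<integral>\<^sup>+s'. indicator G (fst (fst s), snd s) *
          F (snd s, snd s') \<partial>steps g' m (fst s)) \<in> borel_measurable ?M"
          by measurable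
        have "(\<integral>\<^sup>+s. \<integral>\<^sup>+s'. indicator G (fst (snd s)) *
          F (snd (fst (snd s)), snd s') \<partial>steps g' m (fst s, snd (snd s)) \<partial>?L)
          = (\<integral>\<^sup>+s. \<integral>\<^sup>+s'. indicator G (fst (fst s), snd s) * F (snd s, snd s') \<partial>steps g' m (fst s) \<partial>?M)"
          by (subst nn_integral_distr[OF mL], use m1 in simp, simp)
        also have "\<dots> = ?I g'"
          by (subst \<pi>.nn_integral_fst[OF m2, symmetric]) simp
        finally show ?thesis .
      qed
      have "?I g \<le> ennreal K1' * ?I blind + ennreal (\<delta> / 3)"
        unfolding tr[OF g, symmetric] tr[OF obs_density_1, symmetric]
      proof (rule le1'[rule_format, of ?L
        "\<lambda>(p, s'). indicator G p * F (snd p, snd s')", unfolded split_conv])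
        show "?L \<in> space (prob_algebra (borel \<Otimes>\<^sub>M ((borel \<Otimes>\<^sub>M borel) \<Otimes>\<^sub>M MH)))"
          using prob_space.prob_space_distr[OF pM mL] by (simp add: space_prob_algebra)
        have "distr ?L borel fst = distr (distr ?M L fst) borel fst"
          by (subst (1 2) distr_distr) (auto simp: comp_def)
        also have "\<dots> = \<pi>"
          using L \<pi>.distr_pair_fst[of L] by (simp add: marg_def)
        finally show "distr ?L borel fst = \<pi>" .
        show "(\<lambda>(p, s'). indicator G p * F (snd p, snd s')) \<in> borel_measurable ((borel \<Otimes>\<^sub>M borel)
          \<Otimes>\<^sub>M EH)"
          by measurable
        show "(case s of (p, s') \<Rightarrow> indicator G p * F (snd p, snd s')) \<le> 1" for s
          using F1 by (auto split: prod.split split_indicator)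
      qed
      also have "?I blind \<le> 2 * (\<integral>\<^sup>+s. \<integral>\<^sup>+s'. F s' \<partial>steps blind m s \<partial>L)"
        by (rule redraw_le_blind[OF L F G GP])
      finally show "?I g \<le> ennreal K1' * (2 * (\<integral>\<^sup>+s. \<integral>\<^sup>+s'. F s' \<partial>steps blind m s \<partial>L)) +
        ennreal (\<delta> / 3)"
        by (simp add: mult_left_mono add_right_mono)
      show "(\<integral>\<^sup>+s. \<integral>\<^sup>+s'. F s' \<partial>steps blind m s \<partial>L) \<le>
        ennreal K2 * (\<integral>\<^sup>+s. \<integral>\<^sup>+s'. F s' \<partial>steps g m s \<partial>L) + ennreal \<delta>'"
        by (rule le2[rule_format, OF L F F1])
    qed (use K1 K1' K2 \<delta>' \<open>0 < \<delta>\<close> in auto)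
  qed
qed

end

section \<open>Likelihood ratios forget the signal\<close>

text \<open>Convergence to 0, in the form in which bounds with an additive error \<delta> deliver
  it.\<close>

definition vanishing :: "(nat \<Rightarrow> ennreal) \<Rightarrow> bool" where
  "vanishing X \<longleftrightarrow> (\<forall>\<delta>>0. eventually (\<lambda>n. X n \<le> ennreal \<delta>) sequentially)"

text \<open>The constant K grows as \<delta> shrinks but does not depend on n: \<delta> is fixed
  first, and then n is taken so large that K times X n is small.\<close>

lemma vanishing_transfer:
  assumes X: "vanishing X"
    and le: "\<And>\<delta>::real. 0 < \<delta> \<Longrightarrow> \<exists>K::real. 0 \<le> K \<and> eventually (\<lambda>n. Y n \<le>
      ennreal K * X n + ennreal \<delta>) sequentially"
  shows "vanishing Y"
  unfolding vanishing_def
proof (intro allI impI)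
  fix \<delta> :: real assume \<delta>: "0 < \<delta>"
  then obtain K :: real where K: "0 \<le> K" and ev: "eventually (\<lambda>n. Y n \<le>
    ennreal K * X n + ennreal (\<delta> / 2)) sequentially"
    using le[of "\<delta> / 2"] by auto
  have "0 < \<delta> / (2 * (K + 1))" using \<delta> K by simp
  then have "eventually (\<lambda>n. X n \<le> ennreal (\<delta> / (2 * (K + 1)))) sequentially"
    using X by (simp add: vanishing_def)
  with ev show "eventually (\<lambda>n. Y n \<le> ennreal \<delta>) sequentially"
  proof eventually_elim
    case (elim n)
    have "Y n \<le> ennreal K * ennreal (\<delta> / (2 * (K + 1))) + ennreal (\<delta> / 2)"
      by (rule order_trans[OF elim(1)]) (intro add_right_mono mult_left_mono elim(2); simp)
    also have "\<dots> = ennreal (K * (\<delta> / (2 * (K + 1))) + \<delta> / 2)"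
      using K \<delta> by (simp add: ennreal_mult[symmetric] ennreal_plus[symmetric] del: ennreal_plus)
    also have "\<dots> \<le> ennreal \<delta>"
      using K \<delta> by (intro ennreal_leI) (simp add: field_simps)
    finally show ?case .
  qed
qed

text \<open>The version of \<open>bind_kpow_add\<close> for a measure L of arbitrary mass, such as a
  law multiplied by a density.\<close>

lemma nn_integral_bind_kpow_add:
  assumes K: "K \<in> M \<rightarrow>\<^sub>M prob_algebra M" and L: "sets L = sets M" and f: "f \<in> borel_measurable M"
  shows "(\<integral>\<^sup>+z. f z \<partial>(L \<bind> kpow M K (m + n))) = (\<integral>\<^sup>+y. \<integral>\<^sup>+z. f z \<partial>kpow M K n y \<partial>(L \<bind> kpow M K m))"
proof -
  have m: "(\<lambda>y. \<integral>\<^sup>+z. f z \<partial>kpow M K n y) \<in> borel_measurable M"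
    using measurable_compose[OF measurable_snd f]
    by (intro nn_integral_kernel[OF kpow_measurable[OF K]]) (simp add: split_beta')
  have "(\<integral>\<^sup>+z. f z \<partial>(L \<bind> kpow M K (m + n))) = (\<integral>\<^sup>+x. \<integral>\<^sup>+z. f z \<partial>kpow M K (m + n) x \<partial>L)"
    by (rule nn_integral_bind_prob[OF L kpow_measurable[OF K] f])
  also have "\<dots> = (\<integral>\<^sup>+x. \<integral>\<^sup>+y. \<integral>\<^sup>+z. f z \<partial>kpow M K n y \<partial>kpow M K m x \<partial>L)"
    using sets_eq_imp_space_eq[OF L] by (intro nn_integral_cong nn_integral_kpow_add[OF K f]) simp
  also have "\<dots> = (\<integral>\<^sup>+y. \<integral>\<^sup>+z. f z \<partial>kpow M K n y \<partial>(L \<bind> kpow M K m))"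
    by (rule nn_integral_bind_prob[symmetric, OF L kpow_measurable[OF K] m])
  finally show ?thesis .
qed

text \<open>The Radon-Nikodym derivative is at most 1 almost everywhere. Truncating it makes the
  bounds hold at every point and spares later arguments the null sets.\<close>

lemma Radon_Nikodym_le:
  assumes "finite_measure M" and s: "sets N = sets M" and le: "\<And>A. A \<in> sets M \<Longrightarrow> emeasure N A \<le>
    emeasure M A"
  obtains u :: "'a \<Rightarrow> real" where "u \<in> borel_measurable M" "\<And>x. 0 \<le> u x" "\<And>x. u x \<le> 1"
    "N = density M (\<lambda>x. ennreal (u x))"
proof -
  interpret finite_measure M by fact
  have "absolutely_continuous M N"
    using le by (auto simp: absolutely_continuous_def null_sets_def s) (metis le_zero_eq)
  then obtain f where f[measurable]: "f \<in> borel_measurable M" and N: "density M f = N"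
    using Radon_Nikodym[OF _ s] by auto
  have "AE x in M. f x \<le> 1"
  proof (rule AE_le_if_nn_integral_le)
    fix C assume [measurable]: "C \<in> sets M"
    have "(\<integral>\<^sup>+x. f x * indicator C x \<partial>M) = emeasure N C"
      by (simp add: N[symmetric] emeasure_density)
    then show "(\<integral>\<^sup>+x. f x * indicator C x \<partial>M) \<le> (\<integral>\<^sup>+x. 1 * indicator C x \<partial>M)"
      using le[of C] by simp
  qed (auto simp: less_top[symmetric])
  then have "AE x in M. f x = ennreal (min 1 (enn2real (f x)))"
  proof eventually_elim
    case (elim x)
    then show ?case by (cases "f x") (auto simp: top_unique min_def)
  qed
  then have "N = density M (\<lambda>x. ennreal (min 1 (enn2real (f x))))"
    unfolding N[symmetric] by (intro density_cong) auto
  then show thesis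
    by (intro that[of "\<lambda>x. min 1 (enn2real (f x))"]) auto
qed

text \<open>Takes the place of the Cauchy-Schwarz inequality when passing from squares to absolute
  values: either |x| is at most \<eta>, or it is at most its square divided by \<eta>.\<close>

lemma ennreal_le_add_square_div:
  assumes "0 < (\<eta>::real)"
  shows "ennreal \<bar>x\<bar> \<le> ennreal (1 / \<eta>) * ennreal (x\<^sup>2) + ennreal \<eta>"
proof -
  have "\<bar>x\<bar> \<le> x\<^sup>2 / \<eta> + \<eta>"
  proof (cases "\<bar>x\<bar> \<le> \<eta>")
    case True
    then show ?thesis using assms by (simp add: add_increasing)
  next
    case False
    then have "\<bar>x\<bar> * \<eta> \<le> \<bar>x\<bar> * \<bar>x\<bar>" by (intro mult_left_mono) auto
    then have "\<bar>x\<bar> \<le> x\<^sup>2 / \<eta>" using assms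
      by (simp add: pos_le_divide_eq power2_eq_square abs_mult_self_eq)
    then show ?thesis using assms by simp
  qed
  then have "ennreal \<bar>x\<bar> \<le> ennreal (1 / \<eta> * x\<^sup>2 + \<eta>)" by (intro ennreal_leI) simp
  also have "ennreal (1 / \<eta> * x\<^sup>2 + \<eta>) = ennreal (1 / \<eta>) * ennreal (x\<^sup>2) + ennreal \<eta>"
    using assms by (subst ennreal_plus, simp, simp, subst ennreal_mult, simp_all)
  finally show ?thesis .
qed

context hist_chain
begin

lemma emeasure_steps_bind_le:
  assumes L: "sets L = sets EH" and M: "sets M = sets EH" and g: "obs_density g"
    and le: "\<And>A. A \<in> sets EH \<Longrightarrow> emeasure L A \<le> emeasure M A" and F: "F \<in> borel_measurable EH"
  shows "(\<integral>\<^sup>+s. F s \<partial>(L \<bind> steps g n)) \<le> (\<integral>\<^sup>+s. F s \<partial>(M \<bind> steps g n))"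
  by (subst (1 2) nn_integral_bind_prob[OF _ steps_kernel[OF g] F])
    (use L M le in \<open>auto intro!: nn_integral_mono_emeasure\<close>)

text \<open>Kernels preserve domination of measures, so a start with a density of at most 1 has such
  a density at all later times.\<close>

lemma ex_steps_density:
  assumes g: "obs_density g" and L: "marg L"
    and u0[measurable]: "u\<^sub>0 \<in> borel_measurable EH" and u01: "\<And>s. (u\<^sub>0 s :: real) \<le> 1"
  shows "\<exists>u :: 'e \<times> 'h \<Rightarrow> real. u \<in> borel_measurable EH \<and> (\<forall>s. 0 \<le> u s \<and> u s \<le> 1) \<and>
    density L (\<lambda>s. ennreal (u\<^sub>0 s)) \<bind> steps g n = density (L \<bind> steps g n) (\<lambda>s. ennreal (u s))"
proof -
  note [measurable_cong] = margD(2)[OF L]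
  let ?a = "density L (\<lambda>s. ennreal (u\<^sub>0 s))"
  have ne: "space ?a \<noteq> {}" "space L \<noteq> {}"
    using prob_space.not_empty[OF margD(4)[OF L]] by auto
  have sa: "sets ?a = sets EH" using margD(2)[OF L] by simp
  have sA: "sets (L \<bind> steps g n) = sets EH" using margD(2)[OF marg_steps[OF L g]] .
  have sB: "sets (?a \<bind> steps g n) = sets EH"
    using ne(1) measurable_prob_algebraD[OF steps_kernel[OF g]] sa kernel_prob(2)[OF steps_kernel[OF
      g]] sets_eq_imp_space_eq[OF sa]
    by (intro sets_bind) auto
  obtain u :: "'e \<times> 'h \<Rightarrow> real" where u: "u \<in> borel_measurable (L \<bind> steps g n)" "\<And>s. 0 \<le>
    u s" "\<And>s. u s \<le> 1"
    "?a \<bind> steps g n = density (L \<bind> steps g n) (\<lambda>s. ennreal (u s))"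
  proof (rule Radon_Nikodym_le)
    show "finite_measure (L \<bind> steps g n)"
      using margD(4)[OF marg_steps[OF L g]] by (rule prob_space.finite_measure)
    show "sets (?a \<bind> steps g n) = sets (L \<bind> steps g n)" by (simp only: sA sB)
    fix A assume "A \<in> sets (L \<bind> steps g n)"
    then have A[measurable]: "A \<in> sets EH" by (simp only: sA)
    have i: "indicator A \<in> borel_measurable EH" by measurable
    have "(\<integral>\<^sup>+s. indicator A s \<partial>(?a \<bind> steps g n)) \<le> (\<integral>\<^sup>+s. indicator A s \<partial>(L \<bind> steps g n))"
    proof (rule emeasure_steps_bind_le[OF sa margD(2)[OF L] g _ i])
      fix B :: "('e \<times> 'h) set" assume [measurable]: "B \<in> sets EH"
      have "emeasure ?a B = (\<integral>\<^sup>+s. ennreal (u\<^sub>0 s) * indicator B s \<partial>L)"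
        by (rule emeasure_density) measurable
      also have "\<dots> \<le> (\<integral>\<^sup>+s. indicator B s \<partial>L)"
        using u01 by (intro nn_integral_mono) (auto split: split_indicator)
      finally show "emeasure ?a B \<le> emeasure L B" by (simp add: margD(2)[OF L])
    qed
    then show "emeasure (?a \<bind> steps g n) A \<le> emeasure (L \<bind> steps g n) A"
      by (simp add: sA sB)
  qed (rule that)
  then show ?thesis
    by (intro exI[of _ u]) (simp add: measurable_cong_sets[OF sA refl])
qed

text \<open>
  \<open>u (n + l)\<close> is a conditional expectation of \<open>u n\<close>, so the mean squared increment is a difference of
  two terms of the decreasing sequence \<open>I\<close>.
\<close>

lemma likelihood_increments_vanish:
  fixes u :: "nat \<Rightarrow> 'e \<times> 'h \<Rightarrow> real"
  assumes g: "obs_density g" and L: "marg L"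
    and um: "\<And>n. u n \<in> borel_measurable EH" and u: "\<And>n s. 0 \<le> u n s" "\<And>n s. u n s \<le> 1"
    and a: "sets a = sets EH" "\<And>n. a \<bind> steps g n = density (L \<bind> steps g n) (\<lambda>s. ennreal (u n s))"
  shows "vanishing (\<lambda>n. \<integral>\<^sup>+s. \<integral>\<^sup>+s'. ennreal \<bar>u n s - u (n + l) s'\<bar> \<partial>steps g l s \<partial>(L \<bind> steps g n))"
proof -
  let ?A = "\<lambda>n. L \<bind> steps g n"
  have A: "marg (?A n)" for n by (rule marg_steps[OF L g])
  note steps_kernel[OF g, measurable] um[measurable]
  have sA[measurable_cong]: "sets (?A n) = sets EH" for n by (rule margD(2)[OF A])
  have add: "(\<integral>\<^sup>+s. F s \<partial>?A (n + l)) =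
    (\<integral>\<^sup>+s. \<integral>\<^sup>+s'. F s' \<partial>steps g l s \<partial>?A n)" if "F \<in> borel_measurable EH" for F n
    by (rule nn_integral_bind_kpow_add[OF step_kernel[OF g] margD(2)[OF L] that])
  have adda: "(\<integral>\<^sup>+s. F s \<partial>(a \<bind> steps g (n + l))) =
    (\<integral>\<^sup>+s. \<integral>\<^sup>+s'. F s' \<partial>steps g l s \<partial>(a \<bind> steps g n))" if "F \<in> borel_measurable EH" for F n
    by (rule nn_integral_bind_kpow_add[OF step_kernel[OF g] a(1) that])
  define I where "I n = (\<integral>\<^sup>+s. ennreal ((u n s)\<^sup>2) \<partial>?A n)" for n
  let ?E = "\<lambda>n. \<integral>\<^sup>+s. \<integral>\<^sup>+s'. ennreal ((u n s - u (n + l) s')\<^sup>2) \<partial>steps g l s \<partial>?A n"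
  have I1: "I n \<le> 1" for n
    unfolding I_def using u by (intro prob_space.nn_integral_le_1[OF margD(4)[OF A]])
      (auto intro!: ennreal_le_1[THEN iffD2] power_le_one)
  have E: "?E n + I (n + l) = I n" for n
  proof -
    \<comment> \<open>The law at time n weighted by \<open>u n\<close> is the evolved measure
      \<open>a\<close>. Letting it run for l more steps turns the mixed product into the square at
      time n + l.\<close>
    have cross: "(\<integral>\<^sup>+s. \<integral>\<^sup>+s'. ennreal (u n s * u (n + l) s') \<partial>steps g l s \<partial>?A n) = I (n + l)"
    proof -
      have "(\<integral>\<^sup>+s. \<integral>\<^sup>+s'. ennreal (u n s * u (n + l) s') \<partial>steps g l s \<partial>?A n) =
          (\<integral>\<^sup>+s. ennreal (u n s) * (\<integral>\<^sup>+s'. ennreal (u (n + l) s') \<partial>steps g l s) \<partial>?A n)"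
      proof (intro nn_integral_cong)
        fix s assume "s \<in> space (?A n)"
        note [measurable_cong] = kernel_prob(2)[OF steps_kernel[OF g] marg_sections(1)[OF A this]]
        show "(\<integral>\<^sup>+s'. ennreal (u n s * u (n + l) s') \<partial>steps g l s) =
          ennreal (u n s) * (\<integral>\<^sup>+s'. ennreal (u (n + l) s') \<partial>steps g l s)"
          using u by (subst nn_integral_cmult[symmetric]) (auto simp: ennreal_mult)
      qed
      also have "\<dots> = (\<integral>\<^sup>+s. \<integral>\<^sup>+s'. ennreal (u (n + l) s') \<partial>steps g l s \<partial>(a \<bind> steps g n))"
        unfolding a(2) by (subst nn_integral_density) auto
      also have "\<dots> = (\<integral>\<^sup>+s. ennreal (u (n + l) s) \<partial>(a \<bind> steps g (n + l)))"
        by (rule adda[symmetric]) measurable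
      also have "\<dots> = (\<integral>\<^sup>+s. ennreal (u (n + l) s) * ennreal (u (n + l) s) \<partial>?A (n + l))"
        unfolding a(2) by (subst nn_integral_density) auto
      also have "\<dots> = I (n + l)"
        unfolding I_def using u by (simp add: power2_eq_square ennreal_mult)
      finally show ?thesis .
    qed
    \<comment> \<open>The cross term is kept on the side of the square, because subtraction in
      \<open>ennreal\<close> is truncated.\<close>
    have "?E n + 2 * I (n + l) = (\<integral>\<^sup>+s. \<integral>\<^sup>+s'. ennreal ((u n s - u (n + l) s')\<^sup>2) + 2 *
      ennreal (u n s * u (n + l) s') \<partial>steps g l s \<partial>?A n)"
    proof -
      have "(\<integral>\<^sup>+s. \<integral>\<^sup>+s'. ennreal ((u n s - u (n + l) s')\<^sup>2) + 2 * ennreal (u n s * u (n +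
        l) s') \<partial>steps g l s \<partial>?A n) =
        (\<integral>\<^sup>+s. (\<integral>\<^sup>+s'. ennreal ((u n s - u (n + l) s')\<^sup>2) \<partial>steps g l s) + 2 *
          (\<integral>\<^sup>+s'. ennreal (u n s * u (n + l) s') \<partial>steps g l s) \<partial>?A n)"
      proof (intro nn_integral_cong)
        fix s assume "s \<in> space (?A n)"
        note [measurable_cong] = kernel_prob(2)[OF steps_kernel[OF g] marg_sections(1)[OF A this]]
        show "(\<integral>\<^sup>+s'. ennreal ((u n s - u (n + l) s')\<^sup>2) + 2 * ennreal (u n s * u (n +
          l) s') \<partial>steps g l s) =
          (\<integral>\<^sup>+s'. ennreal ((u n s - u (n + l) s')\<^sup>2) \<partial>steps g l s) + 2 * (\<integral>\<^sup>+s'. ennreal (u n s *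
            u (n + l) s') \<partial>steps g l s)"
          by (subst nn_integral_add; (subst nn_integral_cmult)?) auto
      qed
      also have "\<dots> = ?E n + 2 * (\<integral>\<^sup>+s. \<integral>\<^sup>+s'. ennreal (u n s * u (n + l) s') \<partial>steps g l s \<partial>?A n)"
        by (subst nn_integral_add; (subst nn_integral_cmult)?) measurable
      finally show ?thesis by (simp only: cross)
    qed
    also have "\<dots> = (\<integral>\<^sup>+s. \<integral>\<^sup>+s'. ennreal ((u n s)\<^sup>2) + ennreal ((u (n + l) s')\<^sup>2) \<partial>steps g l s \<partial>?A n)"
    proof (intro nn_integral_cong)
      fix s s'
      have "ennreal ((u n s - u (n + l) s')\<^sup>2) + ennreal (2 * (u n s * u (n + l) s')) =
          ennreal ((u n s - u (n + l) s')\<^sup>2 + 2 * (u n s * u (n + l) s'))"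
        by (rule ennreal_plus[symmetric]) (use u in simp_all)
      also have "(u n s - u (n + l) s')\<^sup>2 + 2 * (u n s * u (n + l) s') = (u n s)\<^sup>2 + (u (n + l) s')\<^sup>2"
        by (simp add: power2_diff)
      also have "ennreal \<dots> = ennreal ((u n s)\<^sup>2) + ennreal ((u (n + l) s')\<^sup>2)"
        by (rule ennreal_plus) simp_all
      finally have "ennreal ((u n s - u (n + l) s')\<^sup>2) + ennreal (2 * (u n s * u (n + l) s')) = \<dots>" .
      then show "ennreal ((u n s - u (n + l) s')\<^sup>2) + 2 * ennreal (u n s * u (n + l) s') =
        ennreal ((u n s)\<^sup>2) + ennreal ((u (n + l) s')\<^sup>2)"
        using u by (simp add: ennreal_mult)
    qed
    also have "\<dots> = (\<integral>\<^sup>+s. ennreal ((u n s)\<^sup>2) + (\<integral>\<^sup>+s'. ennreal ((u (n + l) s')\<^sup>2) \<partial>steps g l s) \<partial>?A n)"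
    proof (intro nn_integral_cong)
      fix s assume s: "s \<in> space (?A n)"
      note [measurable_cong] = kernel_prob(2)[OF steps_kernel[OF g] marg_sections(1)[OF A s]]
      show "(\<integral>\<^sup>+s'. ennreal ((u n s)\<^sup>2) + ennreal ((u (n + l) s')\<^sup>2) \<partial>steps g l s) =
        ennreal ((u n s)\<^sup>2) + (\<integral>\<^sup>+s'. ennreal ((u (n + l) s')\<^sup>2) \<partial>steps g l s)"
        using prob_space.emeasure_space_1[OF kernel_prob(1)[OF steps_kernel[OF g]
          marg_sections(1)[OF A s]]]
        by (subst nn_integral_add) auto
    qed
    also have "\<dots> = I n + (\<integral>\<^sup>+s. \<integral>\<^sup>+s'. ennreal ((u (n + l) s')\<^sup>2) \<partial>steps g l s \<partial>?A n)"
      unfolding I_def by (rule nn_integral_add) measurable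
    also have "\<dots> = I n + I (n + l)"
      unfolding I_def by (subst add) auto
    finally have "I (n + l) + (?E n + I (n + l)) = I (n + l) + I n"
      by (simp add: mult_2 ac_simps)
    then show ?thesis
      using I1[of "n + l"] by (auto simp: ennreal_add_left_cancel top_unique)
  qed
  have "vanishing ?E"
  proof -
    have Ifin: "I n = ennreal (enn2real (I n))" for n
      using I1[of n] by (cases "I n") (auto simp: top_unique)
    have dec: "enn2real (I (n + l)) \<le> enn2real (I n)" for n
    proof (rule enn2real_mono)
      show "I (n + l) \<le> I n" by (subst E[of n, symmetric]) (simp add: add_increasing)
      show "I n < top" using le_less_trans[OF I1[of n]] by simp
    qed
    have "(\<lambda>n. enn2real (I n) - enn2real (I (n + l))) \<longlonglongrightarrow> 0"
    proof (cases "l = 0")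
      case False
      \<comment> \<open>A sum of differences with lag l telescopes down to its first l terms, each
        at most 1.\<close>
      have sum: "(\<Sum>i<N. enn2real (I i) - enn2real (I (i + l))) \<le> real l" for N
      proof -
        have "(\<Sum>i<N. enn2real (I i) - enn2real (I (i + l))) =
          (\<Sum>i<N. enn2real (I i)) - (\<Sum>i\<in>{l..<N + l}. enn2real (I i))"
          by (simp add: sum_subtractf sum.shift_bounds_nat_ivl[of _ 0 l N, simplified]
            lessThan_atLeast0)
        also have "(\<Sum>i<N. enn2real (I i)) \<le> (\<Sum>i\<in>{0..<N + l}. enn2real (I i))"
          by (intro sum_mono2) auto
        also have "(\<Sum>i\<in>{0..<N + l}. enn2real (I i)) =
          (\<Sum>i\<in>{0..<l}. enn2real (I i)) + (\<Sum>i\<in>{l..<N + l}. enn2real (I i))"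
          by (rule sum.atLeastLessThan_concat[symmetric]) auto
        also have "(\<Sum>i\<in>{0..<l}. enn2real (I i)) \<le> (\<Sum>i\<in>{0..<l}. 1)"
          using I1 by (intro sum_mono) (auto intro!: enn2real_leI)
        finally show ?thesis by simp
      qed
      have "summable (\<lambda>n. enn2real (I n) - enn2real (I (n + l)))"
        by (rule summableI_nonneg_bounded[OF _ sum]) (use dec in simp)
      then show ?thesis by (rule summable_LIMSEQ_zero)
    qed simp
    then have lim: "eventually (\<lambda>n. enn2real (I n) - enn2real (I (n +
      l)) < \<delta>) sequentially" if "0 < \<delta>" for \<delta>
      using that by (rule order_tendstoD)
    show ?thesis
      unfolding vanishing_def
    proof (intro allI impI)
      fix \<delta> :: real assume "0 < \<delta>"
      from lim[OF this] show "eventually (\<lambda>n. ?E n \<le> ennreal \<delta>) sequentially"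
      proof eventually_elim
        case (elim n)
        have "?E n + ennreal (enn2real (I (n + l))) = ennreal (enn2real (I n))"
          using E[of n] Ifin by metis
        also have "\<dots> \<le> ennreal (\<delta> + enn2real (I (n + l)))"
          using elim by (intro ennreal_leI) simp
        also have "\<dots> = ennreal \<delta> + ennreal (enn2real (I (n + l)))"
          using \<open>0 < \<delta>\<close> by (simp add: ennreal_plus)
        finally have "ennreal (enn2real (I (n + l))) + ?E n \<le>
          ennreal (enn2real (I (n + l))) + ennreal \<delta>"
          by (simp only: add.commute)
        then show ?case
          by (simp only: ennreal_add_left_cancel_le) simp
      qed
    qed
  qed
  then show ?thesis
  proof (rule vanishing_transfer)
    fix \<delta> :: real assume \<delta>: "0 < \<delta>"
    have "(\<integral>\<^sup>+s. \<integral>\<^sup>+s'. ennreal \<bar>u n s - u (n + l) s'\<bar> \<partial>steps g l s \<partial>?A n) \<le>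
      ennreal (1 / \<delta>) * ?E n + ennreal \<delta>" for n
    proof -
      have "(\<integral>\<^sup>+s. \<integral>\<^sup>+s'. ennreal \<bar>u n s - u (n + l) s'\<bar> \<partial>steps g l s \<partial>?A n) \<le>
        (\<integral>\<^sup>+s. ennreal (1 / \<delta>) * (\<integral>\<^sup>+s'. ennreal ((u n s - u (n + l) s')\<^sup>2) \<partial>steps g l s) +
          ennreal \<delta> \<partial>?A n)"
      proof (intro nn_integral_mono)
        fix s assume s: "s \<in> space (?A n)"
        note [measurable_cong] = kernel_prob(2)[OF steps_kernel[OF g] marg_sections(1)[OF A s]]
        have "(\<integral>\<^sup>+s'. ennreal \<bar>u n s - u (n + l) s'\<bar> \<partial>steps g l s) \<le>
            (\<integral>\<^sup>+s'. ennreal (1 / \<delta>) * ennreal ((u n s - u (n + l) s')\<^sup>2) + ennreal \<delta> \<partial>steps g l s)"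
          by (intro nn_integral_mono ennreal_le_add_square_div \<delta>)
        also have "\<dots> = ennreal (1 / \<delta>) * (\<integral>\<^sup>+s'. ennreal ((u n s - u (n + l) s')\<^sup>2) \<partial>steps g l s) +
          ennreal \<delta>"
          using prob_space.emeasure_space_1[OF kernel_prob(1)[OF steps_kernel[OF g]
            marg_sections(1)[OF A s]]]
          by (subst nn_integral_add; (subst nn_integral_cmult)?) auto
        finally show "(\<integral>\<^sup>+s'. ennreal \<bar>u n s - u (n + l) s'\<bar> \<partial>steps g l s) \<le>
          ennreal (1 / \<delta>) * (\<integral>\<^sup>+s'. ennreal ((u n s - u (n + l) s')\<^sup>2) \<partial>steps g l s) + ennreal \<delta>" .
      qed
      also have "\<dots> = ennreal (1 / \<delta>) * ?E n + ennreal \<delta>"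
        using prob_space.emeasure_space_1[OF margD(4)[OF A]]
        by (subst nn_integral_add; (subst nn_integral_cmult)?) auto
      finally show ?thesis .
    qed
    then show "\<exists>K. 0 \<le> K \<and> (\<forall>\<^sub>F n in sequentially. (\<integral>\<^sup>+s. \<integral>\<^sup>+s'. ennreal \<bar>u n s - u (n +
      l) s'\<bar> \<partial>steps g l s \<partial>?A n) \<le> ennreal K * ?E n + ennreal \<delta>)"
      using \<delta> by (intro exI[of _ "1 / \<delta>"]) auto
  qed
qed

text \<open>The last m steps before time n are split off, and \<open>steps_le_redraw\<close> is
  applied to the law at time n - m. That law varies with n, which is why uniformity in L is
  essential.\<close>

lemma redraw_transfer:
  assumes g: "obs_density g" and mix: "mixing \<longlonglongrightarrow> 0" and L: "marg L"
    and F: "\<And>n. F n \<in> borel_measurable EH" "\<And>n s. F n s \<le> 1"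
  shows "vanishing (\<lambda>n. \<integral>\<^sup>+s. F n s \<partial>(L \<bind> steps g n)) \<Longrightarrow>
    vanishing (\<lambda>n. \<integral>\<^sup>+s. redraw (F n) s \<partial>(L \<bind> steps g n))"
    and "vanishing (\<lambda>n. \<integral>\<^sup>+s. redraw (F n) s \<partial>(L \<bind> steps g n)) \<Longrightarrow>
      vanishing (\<lambda>n. \<integral>\<^sup>+s. F n s \<partial>(L \<bind> steps g n))"
proof -
  let ?A = "\<lambda>n. L \<bind> steps g n"
  have split: "(\<integral>\<^sup>+s. f s \<partial>?A n) = (\<integral>\<^sup>+s. \<integral>\<^sup>+s'. f s' \<partial>steps g m s \<partial>?A (n - m))"
    if "m \<le> n" "f \<in> borel_measurable EH" for f m n
    using nn_integral_bind_kpow_add[OF step_kernel[OF g] margD(2)[OF L] that(2), of "n - m" m]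
      that(1) by simp
  have "\<exists>K::real. 0 \<le> K \<and> eventually (\<lambda>n. (\<integral>\<^sup>+s. F n s \<partial>?A n) \<le>
    ennreal K * (\<integral>\<^sup>+s. redraw (F n) s \<partial>?A n) + ennreal \<delta>) sequentially \<and>
      eventually (\<lambda>n. (\<integral>\<^sup>+s. redraw (F n) s \<partial>?A n) \<le>
        ennreal K * (\<integral>\<^sup>+s. F n s \<partial>?A n) + ennreal \<delta>) sequentially"
    if \<delta>: "0 < \<delta>" for \<delta> :: real
  proof -
    obtain m and K :: real where K: "0 \<le> K" and le: "\<forall>L F. marg L \<longrightarrow> F \<in> borel_measurable EH \<longrightarrow>
      (\<forall>s. F s \<le> 1) \<longrightarrow>
      (\<integral>\<^sup>+s. \<integral>\<^sup>+s'. F s' \<partial>steps g m s \<partial>L) \<le>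
        ennreal K * (\<integral>\<^sup>+s. \<integral>\<^sup>+s'. redraw F s' \<partial>steps g m s \<partial>L) + ennreal \<delta> \<and>
      (\<integral>\<^sup>+s. \<integral>\<^sup>+s'. redraw F s' \<partial>steps g m s \<partial>L) \<le>
        ennreal K * (\<integral>\<^sup>+s. \<integral>\<^sup>+s'. F s' \<partial>steps g m s \<partial>L) + ennreal \<delta>"
      using steps_le_redraw[OF g mix \<delta>] by (elim exE conjE) (rule that)
    have both: "(\<integral>\<^sup>+s. F n s \<partial>?A n) \<le> ennreal K * (\<integral>\<^sup>+s. redraw (F n) s \<partial>?A n) + ennreal \<delta> \<and>
      (\<integral>\<^sup>+s. redraw (F n) s \<partial>?A n) \<le> ennreal K * (\<integral>\<^sup>+s. F n s \<partial>?A n) + ennreal \<delta>" if n: "m \<le> n" for n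
      unfolding split[OF n F(1)[of n]] split[OF n redraw_measurable[OF F(1)[of n]]]
      by (rule le[rule_format, OF marg_steps[OF L g] F])
    show ?thesis
      using K both by (intro exI[of _ K] conjI eventually_sequentiallyI[of m]) auto
  qed
  note key = this
  show "vanishing (\<lambda>n. \<integral>\<^sup>+s. F n s \<partial>?A n) \<Longrightarrow> vanishing (\<lambda>n. \<integral>\<^sup>+s. redraw (F n) s \<partial>?A n)"
    by (erule vanishing_transfer) (use key in blast)
  show "vanishing (\<lambda>n. \<integral>\<^sup>+s. redraw (F n) s \<partial>?A n) \<Longrightarrow> vanishing (\<lambda>n. \<integral>\<^sup>+s. F n s \<partial>?A n)"
    by (erule vanishing_transfer) (use key in blast)
qed

lemma ennreal_abs_diff_le_1: "0 \<le> a \<Longrightarrow> a \<le> 1 \<Longrightarrow> 0 \<le> b \<Longrightarrow> b \<le> (1::real) \<Longrightarrow> ennreal \<bar>a - b\<bar> \<le> 1"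
  by (simp add: abs_le_iff)

text \<open>Two changes are made to the increments, and neither destroys their decay:
  \<open>redraw_transfer\<close> makes the signal at time n independent of the past, and
  \<open>steps_change_param\<close> makes the next l observations pure noise.\<close>

lemma independent_start_blind_vanishes:
  fixes u :: "nat \<Rightarrow> 'e \<times> 'h \<Rightarrow> real"
  assumes g: "obs_density g" and mix: "mixing \<longlonglongrightarrow> 0" and L: "marg L"
    and um: "\<And>n. u n \<in> borel_measurable EH" and u: "\<And>n s. 0 \<le> u n s" "\<And>n s. u n s \<le> 1"
    and inc: "vanishing (\<lambda>n. \<integral>\<^sup>+s. \<integral>\<^sup>+s'. ennreal \<bar>u n s - u (n + l) s'\<bar> \<partial>steps g l s \<partial>(L \<bind> steps g n))"
  shows "vanishing (\<lambda>n. \<integral>\<^sup>+s. \<integral>\<^sup>+x. \<integral>\<^sup>+s'. ennreal \<bar>u n (x, snd s) - u (n +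
    l) s'\<bar> \<partial>steps blind l (x, snd s) \<partial>\<pi> \<partial>(L \<bind> steps g n))"
proof -
  let ?A = "\<lambda>n. L \<bind> steps g n"
  have A: "marg (?A n)" for n by (rule marg_steps[OF L g])
  note steps_kernel[OF g, measurable] steps_kernel[OF obs_density_1, measurable] um[measurable]
  have sA[measurable_cong]: "sets (?A n) = sets EH" for n by (rule margD(2)[OF A])
  define G where "G n s = (if s \<in> space EH then \<integral>\<^sup>+s'. ennreal \<bar>u n s - u (n +
    l) s'\<bar> \<partial>steps g l s else 0)" for n s
  have Gm: "G n \<in> borel_measurable EH" for n
    unfolding G_def by (subst measurable_If_set) auto
  have G1: "G n s \<le> 1" for n s
    unfolding G_def by (simp, intro impI nn_integral_steps_le_1[OF g] ennreal_abs_diff_le_1 u)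
  have "(\<integral>\<^sup>+s. \<integral>\<^sup>+s'. ennreal \<bar>u n s - u (n + l) s'\<bar> \<partial>steps g l s \<partial>?A n) = (\<integral>\<^sup>+s. G n s \<partial>?A n)" for n
    by (intro nn_integral_cong) (simp add: G_def marg_sections(1)[OF A])
  then have "vanishing (\<lambda>n. \<integral>\<^sup>+s. G n s \<partial>?A n)" using inc by simp
  then have "vanishing (\<lambda>n. \<integral>\<^sup>+s. redraw (G n) s \<partial>?A n)"
    by (rule redraw_transfer(1)[OF g mix L Gm G1])
  moreover have "(\<integral>\<^sup>+s. redraw (G n) s \<partial>?A n) =
      (\<integral>\<^sup>+s. \<integral>\<^sup>+x. \<integral>\<^sup>+s'. ennreal \<bar>u n (x, snd s) - u (n + l) s'\<bar> \<partial>steps g l (x, snd s) \<partial>\<pi> \<partial>?A n)" for n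
    by (intro nn_integral_cong) (simp add: G_def marg_sections(2)[OF A] space_pair_measure)
  ultimately have van: "vanishing (\<lambda>n. \<integral>\<^sup>+s. \<integral>\<^sup>+x. \<integral>\<^sup>+s'. ennreal \<bar>u n (x, snd s) - u (n +
    l) s'\<bar> \<partial>steps g l (x, snd s) \<partial>\<pi> \<partial>?A n)"
    by simp
  show ?thesis
  proof (rule vanishing_transfer[OF van])
    fix \<delta> :: real assume "0 < \<delta>"
    obtain K :: real where K: "0 \<le> K" and le:
      "\<forall>L F. L \<in> space (prob_algebra (borel \<Otimes>\<^sub>M ((borel :: real measure) \<Otimes>\<^sub>M MH))) \<longrightarrow>
      distr L borel fst = \<pi> \<longrightarrow>
        F \<in> borel_measurable ((borel :: real measure) \<Otimes>\<^sub>M EH) \<longrightarrow> (\<forall>s. F s \<le> 1) \<longrightarrow>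
      (\<integral>\<^sup>+s. \<integral>\<^sup>+s'. F (fst (snd s), s') \<partial>steps blind l (fst s, snd (snd s)) \<partial>L) \<le>
      ennreal K * (\<integral>\<^sup>+s. \<integral>\<^sup>+s'. F (fst (snd s), s') \<partial>steps g l (fst s, snd (snd s)) \<partial>L) + ennreal \<delta>"
      using steps_change_param[OF obs_density_1 g \<open>0 < \<delta>\<close>, of "borel :: real measure" l]
        by (elim exE conjE) (rule that)
    have "(\<integral>\<^sup>+s. \<integral>\<^sup>+x. \<integral>\<^sup>+s'. ennreal \<bar>u n (x, snd s) - u (n +
      l) s'\<bar> \<partial>steps blind l (x, snd s) \<partial>\<pi> \<partial>?A n) \<le>
        ennreal K * (\<integral>\<^sup>+s. \<integral>\<^sup>+x. \<integral>\<^sup>+s'. ennreal \<bar>u n (x, snd s) - u (n +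
          l) s'\<bar> \<partial>steps g l (x, snd s) \<partial>\<pi> \<partial>?A n) + ennreal \<delta>" for n
    proof -
      let ?M = "?A n \<Otimes>\<^sub>M \<pi>"
      \<comment> \<open>The parameter is the value of \<open>u n\<close> at the redrawn state. It
        ranges over all reals, so the integrand below is capped at 1; on values of \<open>u\<close>
        the cap has no effect.\<close>
      let ?f = "\<lambda>s. (snd s, (u n (snd s, snd (fst s)), snd (fst s)))"
      let ?L = "distr ?M (borel \<Otimes>\<^sub>M (borel \<Otimes>\<^sub>M MH)) ?f"
      let ?F = "\<lambda>(p, s'). min 1 (ennreal \<bar>p - u (n + l) s'\<bar>)"
      interpret A: prob_space "?A n" by (rule margD(4)[OF A])
      have mL: "?f \<in> ?M \<rightarrow>\<^sub>M borel \<Otimes>\<^sub>M (borel \<Otimes>\<^sub>M MH)" by measurable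
      have Fm: "?F \<in> borel_measurable (borel \<Otimes>\<^sub>M EH)" by measurable
      have pM: "prob_space ?M" by (intro prob_space_pair prob_\<pi> margD(4)[OF A])
      have tr: "(\<integral>\<^sup>+s. \<integral>\<^sup>+s'. ?F (fst (snd s), s') \<partial>steps g' l (fst s, snd (snd s)) \<partial>?L) =
          (\<integral>\<^sup>+s. \<integral>\<^sup>+x. \<integral>\<^sup>+s'. ennreal \<bar>u n (x, snd s) - u (n + l) s'\<bar> \<partial>steps g' l (x, snd s) \<partial>\<pi> \<partial>?A n)"
        if g': "obs_density g'" for g'
      proof -
        note steps_kernel[OF g', measurable]
        have m1: "(\<lambda>s. \<integral>\<^sup>+s'. ?F (fst (snd s), s') \<partial>steps g' l (fst s, snd (snd s))) \<in>
          borel_measurable (borel \<Otimes>\<^sub>M (borel \<Otimes>\<^sub>M MH))"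
          by measurable
        have m2: "(\<lambda>s. \<integral>\<^sup>+s'. ennreal \<bar>u n (snd s, snd (fst s)) - u (n +
          l) s'\<bar> \<partial>steps g' l (snd s, snd (fst s))) \<in> borel_measurable ?M"
          by measurable
        have mn: "min 1 (ennreal \<bar>u n a - u (n + l) b\<bar>) = ennreal \<bar>u n a - u (n + l) b\<bar>" for a b
          using u ennreal_abs_diff_le_1 by (simp add: min_absorb2)
        have "(\<integral>\<^sup>+s. \<integral>\<^sup>+s'. ?F (fst (snd s), s') \<partial>steps g' l (fst s, snd (snd s)) \<partial>?L) =
            (\<integral>\<^sup>+s. \<integral>\<^sup>+s'. ennreal \<bar>u n (snd s, snd (fst s)) - u (n +
              l) s'\<bar> \<partial>steps g' l (snd s, snd (fst s)) \<partial>?M)"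
          by (subst nn_integral_distr[OF mL], use m1 in simp, simp add: mn)
        also have "\<dots> = (\<integral>\<^sup>+s. \<integral>\<^sup>+x. \<integral>\<^sup>+s'. ennreal \<bar>u n (x, snd s) - u (n +
          l) s'\<bar> \<partial>steps g' l (x, snd s) \<partial>\<pi> \<partial>?A n)"
          by (subst \<pi>.nn_integral_fst[OF m2, symmetric]) simp
        finally show ?thesis .
      qed
      show ?thesis
        unfolding tr[OF g, symmetric] tr[OF obs_density_1, symmetric]
      proof (rule le[rule_format, of ?L ?F])
        show "?L \<in> space (prob_algebra (borel \<Otimes>\<^sub>M (borel \<Otimes>\<^sub>M MH)))"
          using prob_space.prob_space_distr[OF pM mL] by (simp add: space_prob_algebra)
        have "distr ?L borel fst = distr ?M \<pi> snd"
        proof -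
          have "distr ?L borel fst = distr ?M borel snd"
            by (subst distr_distr[OF _ mL]) (auto simp: comp_def)
          also have "\<dots> = distr ?M \<pi> snd" by (rule distr_cong) auto
          finally show ?thesis .
        qed
        also have "\<dots> = \<pi>"
        proof (rule measure_eqI)
          fix B assume "B \<in> sets (distr ?M \<pi> snd)"
          then have B: "B \<in> sets \<pi>" by simp
          then have "emeasure (distr ?M \<pi> snd) B = emeasure ?M (space (?A n) \<times> B)"
            using sets.sets_into_space[OF B] by (subst emeasure_distr)
              (auto simp: space_pair_measure intro!: arg_cong[where f="emeasure ?M"])
          also have "\<dots> = emeasure \<pi> B"
            using B by (subst \<pi>.emeasure_pair_measure_Times) (auto simp: A.emeasure_space_1)
          finally show "emeasure (distr ?M \<pi> snd) B = emeasure \<pi> B" .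
        qed simp
        finally show "distr ?L borel fst = \<pi>" .
        show "?F \<in> borel_measurable (borel \<Otimes>\<^sub>M EH)" by (rule Fm)
        show "?F s \<le> 1" for s by (auto split: prod.split)
      qed
    qed
    then show "\<exists>K. 0 \<le> K \<and> (\<forall>\<^sub>F n in sequentially.
      (\<integral>\<^sup>+s. \<integral>\<^sup>+x. \<integral>\<^sup>+s'. ennreal \<bar>u n (x, snd s) - u (n + l) s'\<bar> \<partial>steps blind l (x, snd s) \<partial>\<pi> \<partial>?A n) \<le>
      ennreal K * (\<integral>\<^sup>+s. \<integral>\<^sup>+x. \<integral>\<^sup>+s'. ennreal \<bar>u n (x, snd s) - u (n +
        l) s'\<bar> \<partial>steps g l (x, snd s) \<partial>\<pi> \<partial>?A n) + ennreal \<delta>)"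
      using K by (intro exI[of _ K]) auto
  qed
qed

text \<open>With the history h fixed, l noise steps from a signal x lead to a state distributed
  almost as \<pi> times the extended history, a law that does not depend on x. The values of
  \<open>f\<close> at two signals are therefore both compared with \<open>f'\<close> at a common
  state drawn from this law. The price is \<open>excess l\<close> for each of them.\<close>

lemma independent_pair_le:
  fixes f f' :: "'e \<times> 'h \<Rightarrow> real"
  assumes h: "h \<in> space MH"
    and fm[measurable]: "f \<in> borel_measurable EH" and f'm[measurable]: "f' \<in> borel_measurable EH"
    and f: "\<And>s. 0 \<le> f s" "\<And>s. f s \<le> 1" and f': "\<And>s. 0 \<le> f' s" "\<And>s. f' s \<le> 1"
  shows "(\<integral>\<^sup>+x'. \<integral>\<^sup>+x. ennreal \<bar>f (x, h) - f (x', h)\<bar> \<partial>\<pi> \<partial>\<pi>) \<le>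
    2 * (\<integral>\<^sup>+x. \<integral>\<^sup>+s'. ennreal \<bar>f (x, h) - f' s'\<bar> \<partial>steps blind l (x, h) \<partial>\<pi>) + 2 * mixing l"
proof -
  note steps_kernel[OF obs_density_1, measurable]
  let ?V = "refreshes l h"
  interpret V: prob_space ?V by (rule kernel_prob(1)[OF refreshes_kernel h])
  have sV[measurable_cong]: "sets ?V = sets MH" by (rule kernel_prob(2)[OF refreshes_kernel h])
  have spV: "space ?V = space MH" by (rule sets_eq_imp_space_eq[OF sV])
  have V[measurable]: "(\<lambda>_. ?V) \<in> N \<rightarrow>\<^sub>M prob_algebra MH" for N :: "'z measure"
    using measurable_space[OF refreshes_kernel h] by simp
  have fh[measurable]: "(\<lambda>x. f (x, h)) \<in> borel_measurable borel"
    using h by measurable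
  let ?J = "\<lambda>x. \<integral>\<^sup>+h'. \<integral>\<^sup>+z. ennreal \<bar>f (x, h) - f' (z, h')\<bar> \<partial>\<pi> \<partial>?V"
  let ?J' = "\<lambda>x. \<integral>\<^sup>+s'. ennreal \<bar>f (x, h) - f' s'\<bar> \<partial>steps blind l (x, h)"
  have Jm: "?J \<in> borel_measurable borel"
    by (intro nn_integral_kernel[OF V]) measurable
  have J'm: "?J' \<in> borel_measurable borel"
    using h by measurable
  have tri: "ennreal \<bar>f (x, h) - f (x', h)\<bar> \<le> ?J x' + ?J x" for x x'
  proof -
    have "ennreal \<bar>f (x, h) - f (x', h)\<bar> = (\<integral>\<^sup>+h'. \<integral>\<^sup>+z. ennreal \<bar>f (x, h) - f (x', h)\<bar> \<partial>\<pi> \<partial>?V)"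
      using V.emeasure_space_1 \<pi>.emeasure_space_1 by simp
    also have "\<dots> \<le> (\<integral>\<^sup>+h'. \<integral>\<^sup>+z. ennreal \<bar>f (x', h) - f' (z, h')\<bar> +
      ennreal \<bar>f (x, h) - f' (z, h')\<bar> \<partial>\<pi> \<partial>?V)"
      by (intro nn_integral_mono) (simp add: ennreal_plus[symmetric] ennreal_leI del: ennreal_plus)
    also have "\<dots> = (\<integral>\<^sup>+h'. (\<integral>\<^sup>+z. ennreal \<bar>f (x', h) - f' (z, h')\<bar> \<partial>\<pi>) +
      (\<integral>\<^sup>+z. ennreal \<bar>f (x, h) - f' (z, h')\<bar> \<partial>\<pi>) \<partial>?V)"
    proof (intro nn_integral_cong nn_integral_add)
      fix h' assume "h' \<in> space ?V"
      then have "h' \<in> space MH" by (simp only: spV)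
      then show "(\<lambda>z. ennreal \<bar>f (x', h) - f' (z, h')\<bar>) \<in> borel_measurable \<pi>"
        "(\<lambda>z. ennreal \<bar>f (x, h) - f' (z, h')\<bar>) \<in> borel_measurable \<pi>"
        by measurable
    qed
    also have "\<dots> = ?J x' + ?J x"
      by (rule nn_integral_add) measurable
    finally show ?thesis .
  qed
  have J_le: "?J x \<le> ?J' x + excess l x" for x
  proof -
    have "?J x \<le> (\<integral>\<^sup>+h'. (\<integral>\<^sup>+z. ennreal \<bar>f (x, h) - f' (z, h')\<bar> \<partial>Pn l x) + excess l x \<partial>?V)"
    proof (intro nn_integral_mono nn_integral_Pn_le(2))
      fix h' z assume "h' \<in> space ?V"
      then have "h' \<in> space MH" by (simp only: spV)
      then show "(\<lambda>z. ennreal \<bar>f (x, h) - f' (z, h')\<bar>) \<in> borel_measurable borel" by measurable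
      show "ennreal \<bar>f (x, h) - f' (z, h')\<bar> \<le> 1" using f f' by (intro ennreal_abs_diff_le_1)
    qed
    also have "\<dots> = (\<integral>\<^sup>+h'. \<integral>\<^sup>+z. ennreal \<bar>f (x, h) - f' (z, h')\<bar> \<partial>Pn l x \<partial>?V) + excess l x"
      using V.emeasure_space_1 by (subst nn_integral_add) auto
    also have "(\<integral>\<^sup>+h'. \<integral>\<^sup>+z. ennreal \<bar>f (x, h) - f' (z, h')\<bar> \<partial>Pn l x \<partial>?V) = ?J' x"
      by (subst nn_integral_steps_blind[OF h]) auto
    finally show ?thesis .
  qed
  have "(\<integral>\<^sup>+x'. \<integral>\<^sup>+x. ennreal \<bar>f (x, h) - f (x', h)\<bar> \<partial>\<pi> \<partial>\<pi>) \<le> (\<integral>\<^sup>+x'. \<integral>\<^sup>+x. ?J x' + ?J x \<partial>\<pi> \<partial>\<pi>)"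
    by (intro nn_integral_mono tri)
  also have "\<dots> = (\<integral>\<^sup>+x'. ?J x' + (\<integral>\<^sup>+x. ?J x \<partial>\<pi>) \<partial>\<pi>)"
    using Jm \<pi>.emeasure_space_1 by (intro nn_integral_cong) (subst nn_integral_add; simp)
  also have "\<dots> = 2 * (\<integral>\<^sup>+x. ?J x \<partial>\<pi>)"
    using Jm \<pi>.emeasure_space_1 by (subst nn_integral_add) (simp_all add: mult_2)
  also have "\<dots> \<le> 2 * (\<integral>\<^sup>+x. ?J' x + excess l x \<partial>\<pi>)"
    by (intro mult_left_mono nn_integral_mono J_le) simp
  also have "\<dots> = 2 * (\<integral>\<^sup>+x. ?J' x \<partial>\<pi>) + 2 * mixing l"
    unfolding mixing_def using J'm by (subst nn_integral_add) (simp_all add: distrib_left)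
  finally show ?thesis .
qed

text \<open>The dependence of \<open>u n\<close> on the signal is small when the signal is drawn
  independently of the history, by \<open>independent_pair_le\<close>. The second part of
  \<open>redraw_transfer\<close> brings this back to the true law, under which signal and history
  are dependent.\<close>

lemma likelihood_forgets:
  fixes u\<^sub>0 :: "'e \<times> 'h \<Rightarrow> real"
  assumes g: "obs_density g" and mix: "mixing \<longlonglongrightarrow> 0" and L: "marg L"
    and u0: "u\<^sub>0 \<in> borel_measurable EH" "\<And>s. u\<^sub>0 s \<le> 1" and \<epsilon>: "0 < \<epsilon>"
  obtains n u v where "u \<in> borel_measurable EH" "\<And>s. 0 \<le> u s" "\<And>s. u s \<le> (1::real)"
    "v \<in> borel_measurable MH" "\<And>h. 0 \<le> v h"
    "density L (\<lambda>s. ennreal (u\<^sub>0 s)) \<bind> steps g n = density (L \<bind> steps g n) (\<lambda>s. ennreal (u s))"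
    "(\<integral>\<^sup>+s. ennreal \<bar>u s - v (snd s)\<bar> \<partial>(L \<bind> steps g n)) \<le> ennreal \<epsilon>"
proof -
  let ?A = "\<lambda>n. L \<bind> steps g n"
  have A: "marg (?A n)" for n by (rule marg_steps[OF L g])
  have "\<forall>n. \<exists>u :: 'e \<times> 'h \<Rightarrow> real. u \<in> borel_measurable EH \<and> (\<forall>s. 0 \<le> u s \<and> u s \<le> 1) \<and>
      density L (\<lambda>s. ennreal (u\<^sub>0 s)) \<bind> steps g n = density (?A n) (\<lambda>s. ennreal (u s))"
    by (intro allI ex_steps_density[OF g L u0])
  then obtain u :: "nat \<Rightarrow> 'e \<times> 'h \<Rightarrow> real" where um: "\<And>n. u n \<in> borel_measurable EH"
    and u: "\<And>n s. 0 \<le> u n s" "\<And>n s. u n s \<le> 1"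
    and dens: "\<And>n. density L (\<lambda>s. ennreal (u\<^sub>0 s)) \<bind> steps g n = density (?A n) (\<lambda>s. ennreal (u n s))"
    by metis
  note steps_kernel[OF g, measurable] steps_kernel[OF obs_density_1, measurable] um[measurable]
  have sA[measurable_cong]: "sets (?A n) = sets EH" for n by (rule margD(2)[OF A])
  have inc: "vanishing (\<lambda>n. \<integral>\<^sup>+s. \<integral>\<^sup>+s'. ennreal \<bar>u n s - u (n + l) s'\<bar> \<partial>steps g l s \<partial>?A n)" for l
    by (rule likelihood_increments_vanish[OF g L um u _ dens]) (simp add: margD(2)[OF L])
  \<comment> \<open>The mean deviation of \<open>u n\<close> at s from its values at signals drawn
    independently with the same history.\<close>
  define F where "F n s = (\<integral>\<^sup>+x. ennreal \<bar>u n (x, snd s) - u n s\<bar> \<partial>\<pi>)" for n s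
  have Fm: "F n \<in> borel_measurable EH" for n
    unfolding F_def by measurable
  have F1: "F n s \<le> 1" for n s
    unfolding F_def using u by (intro \<pi>.nn_integral_le_1 ennreal_abs_diff_le_1)
  have "vanishing (\<lambda>n. \<integral>\<^sup>+s. redraw (F n) s \<partial>?A n)"
    unfolding vanishing_def
  proof (intro allI impI)
    fix \<delta> :: real assume \<delta>: "0 < \<delta>"
    have "eventually (\<lambda>l. mixing l < ennreal (\<delta> / 4)) sequentially"
      using mix \<delta> by (intro order_tendstoD) auto
    from eventually_happens'[OF sequentially_bot this]
    obtain l where "mixing l < ennreal (\<delta> / 4)" ..
    then have l: "mixing l \<le> ennreal (\<delta> / 4)" by simp
    let ?R = "\<lambda>n. \<integral>\<^sup>+s. \<integral>\<^sup>+x. \<integral>\<^sup>+s'. ennreal \<bar>u n (x, snd s) - u (n +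
      l) s'\<bar> \<partial>steps blind l (x, snd s) \<partial>\<pi> \<partial>?A n"
    have "vanishing ?R"
      by (rule independent_start_blind_vanishes[OF g mix L um u inc])
    then have "eventually (\<lambda>n. ?R n \<le> ennreal (\<delta> / 4)) sequentially"
      using \<delta> by (simp add: vanishing_def)
    then show "eventually (\<lambda>n. (\<integral>\<^sup>+s. redraw (F n) s \<partial>?A n) \<le> ennreal \<delta>) sequentially"
    proof eventually_elim
      case (elim n)
      have "(\<integral>\<^sup>+s. redraw (F n) s \<partial>?A n) \<le>
          (\<integral>\<^sup>+s. 2 * (\<integral>\<^sup>+x. \<integral>\<^sup>+s'. ennreal \<bar>u n (x, snd s) - u (n +
            l) s'\<bar> \<partial>steps blind l (x, snd s) \<partial>\<pi>) + 2 * mixing l \<partial>?A n)"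
        unfolding F_def snd_conv
        by (intro nn_integral_mono independent_pair_le um u marg_sections(2)[OF A])
      also have "\<dots> = 2 * ?R n + 2 * mixing l"
        using prob_space.emeasure_space_1[OF margD(4)[OF A]]
        by (subst nn_integral_add; (subst nn_integral_cmult)?) auto
      also have "\<dots> \<le> 2 * ennreal (\<delta> / 4) + 2 * ennreal (\<delta> / 4)"
        by (intro add_mono mult_left_mono elim l) auto
      also have "\<dots> = ennreal \<delta>"
      proof -
        have "2 * ennreal (\<delta> / 4) = ennreal (\<delta> / 2)"
          using \<delta> ennreal_mult[of 2 "\<delta> / 4"] by simp
        then show ?thesis using \<delta> by (simp add: ennreal_plus[symmetric] del: ennreal_plus)
      qed
      finally show ?case .
    qed
  qed
  then have "vanishing (\<lambda>n. \<integral>\<^sup>+s. F n s \<partial>?A n)"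
    by (rule redraw_transfer(2)[OF g mix L Fm F1])
  then have "eventually (\<lambda>n. (\<integral>\<^sup>+s. F n s \<partial>?A n) \<le> ennreal \<epsilon>) sequentially"
    using \<epsilon> by (simp add: vanishing_def)
  from eventually_happens'[OF sequentially_bot this]
  obtain n where n: "(\<integral>\<^sup>+s. F n s \<partial>?A n) \<le> ennreal \<epsilon>" ..
  \<comment> \<open>The distance of \<open>u n\<close> from its average over the signal is at most
    \<open>F n\<close>, the average of the distances.\<close>
  define v where "v h = (\<integral>x. u n (x, h) \<partial>\<pi>)" for h
  show thesis
  proof (rule that[OF um u _ _ dens])
    show "v \<in> borel_measurable MH"
      unfolding v_def by measurable
    show "0 \<le> v h" for h
      unfolding v_def using u by (intro Bochner_Integration.integral_nonneg) auto
    have "(\<integral>\<^sup>+s. ennreal \<bar>u n s - v (snd s)\<bar> \<partial>?A n) \<le> (\<integral>\<^sup>+s. F n s \<partial>?A n)"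
    proof (intro nn_integral_mono)
      fix s assume "s \<in> space (?A n)"
      then have "snd s \<in> space MH" by (rule marg_sections(2)[OF A])
      then have [measurable]: "(\<lambda>x. u n (x, snd s)) \<in> borel_measurable borel" by measurable
      have int: "integrable \<pi> (\<lambda>x. u n (x, snd s))"
        using u by (intro \<pi>.integrable_const_bound[where B=1]) auto
      have "\<bar>u n s - v (snd s)\<bar> = \<bar>\<integral>x. u n (x, snd s) - u n s \<partial>\<pi>\<bar>"
        using int \<pi>.prob_space by (simp add: v_def Bochner_Integration.integral_diff abs_minus_commute)
      also have "\<dots> \<le> (\<integral>x. \<bar>u n (x, snd s) - u n s\<bar> \<partial>\<pi>)"
        by (rule integral_abs_bound)
      finally have "ennreal \<bar>u n s - v (snd s)\<bar> \<le> ennreal (\<integral>x. \<bar>u n (x, snd s) - u n s\<bar> \<partial>\<pi>)"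
        by (rule ennreal_leI)
      also have "\<dots> = F n s"
        unfolding F_def using int by (intro nn_integral_eq_integral[symmetric]) auto
      finally show "ennreal \<bar>u n s - v (snd s)\<bar> \<le> F n s" .
    qed
    then show "(\<integral>\<^sup>+s. ennreal \<bar>u n s - v (snd s)\<bar> \<partial>?A n) \<le> ennreal \<epsilon>"
      using n by (rule order_trans)
  qed
qed

text \<open>Positive densities weigh the same observations, so kernels built from different
  densities have the same null sets. In contrast to \<open>steps_change\<close> this is a statement
  about each single start, and it therefore serves initial laws that are singular to \<pi>.\<close>

lemma nn_integral_steps_eq_0:
  assumes g1: "obs_density g\<^sub>1" and g2: "obs_density g\<^sub>2" and F[measurable]: "F \<in> borel_measurable EH"
    and "s \<in> space EH" and "(\<integral>\<^sup>+s'. F s' \<partial>steps g\<^sub>1 n s) = 0"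
  shows "(\<integral>\<^sup>+s'. F s' \<partial>steps g\<^sub>2 n s) = 0"
  using assms(4,5)
proof (induction n arbitrary: s)
  case 0
  then show ?case by (simp add: nn_integral_return)
next
  case (Suc n)
  obtain x h where s: "s = (x, h)" and h: "h \<in> space MH"
    using Suc.prems(1) by (cases s) (auto simp: space_pair_measure)
  let ?G = "\<lambda>g s. \<integral>\<^sup>+s'. F s' \<partial>steps g n s"
  have Suc_eq: "(\<integral>\<^sup>+s'. F s' \<partial>steps g (Suc n) s) =
    (\<integral>\<^sup>+w. ennreal (g x w) * (\<integral>\<^sup>+z. ?G g (z, push w h) \<partial>P x) \<partial>\<phi>)"
    and G: "(\<lambda>z. ?G g (z, push w h)) \<in> borel_measurable borel"
    and m: "(\<lambda>w. ennreal (g x w) * (\<integral>\<^sup>+z. ?G g (z, push w h) \<partial>P x)) \<in> borel_measurable \<phi>"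
    if g: "obs_density g" for g w
  proof -
    note obs_densityD(1)[OF g, measurable] push_section[OF h, measurable]
    have Gm[measurable]: "?G g \<in> borel_measurable EH"
      by (rule steps_integral_measurable[OF g F])
    show "(\<integral>\<^sup>+s'. F s' \<partial>steps g (Suc n) s) =
      (\<integral>\<^sup>+w. ennreal (g x w) * (\<integral>\<^sup>+z. ?G g (z, push w h) \<partial>P x) \<partial>\<phi>)"
      using nn_integral_kpow_Suc[OF step_kernel[OF g] F Suc.prems(1), of n] nn_integral_step[OF g Gm
        h, of x] s by simp
    have "push w h \<in> space MH" using h by (rule push_in)
    then show "(\<lambda>z. ?G g (z, push w h)) \<in> borel_measurable borel" by measurable
    show "(\<lambda>w. ennreal (g x w) * (\<integral>\<^sup>+z. ?G g (z, push w h) \<partial>P x)) \<in> borel_measurable \<phi>"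
      by measurable
  qed
  have "AE w in \<phi>. ennreal (g\<^sub>1 x w) * (\<integral>\<^sup>+z. ?G g\<^sub>1 (z, push w h) \<partial>P x) = 0"
    using Suc.prems(2) unfolding Suc_eq[OF g1] by (subst (asm) nn_integral_0_iff_AE[OF m[OF g1]])
  then have "AE w in \<phi>. ennreal (g\<^sub>2 x w) * (\<integral>\<^sup>+z. ?G g\<^sub>2 (z, push w h) \<partial>P x) = 0"
  proof eventually_elim
    case (elim w)
    have GP: "(\<lambda>z. ?G g (z, push w h)) \<in> borel_measurable (P x)" if "obs_density g" for g
      using G[OF that, of w] by simp
    have "(\<integral>\<^sup>+z. ?G g\<^sub>1 (z, push w h) \<partial>P x) = 0"
      using elim obs_densityD(2)[OF g1, of x w] by (simp add: ennreal_eq_0_iff not_le)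
    then have "AE z in P x. ?G g\<^sub>1 (z, push w h) = 0"
      by (subst (asm) nn_integral_0_iff_AE[OF GP[OF g1]])
    then have "AE z in P x. ?G g\<^sub>2 (z, push w h) = 0"
    proof eventually_elim
      case (elim z)
      then show ?case using push_in[OF h, of w] by (intro Suc.IH) (auto simp: space_pair_measure)
    qed
    then have "(\<integral>\<^sup>+z. ?G g\<^sub>2 (z, push w h) \<partial>P x) = 0"
      by (subst nn_integral_0_iff_AE[OF GP[OF g2]])
    then show ?case by simp
  qed
  then show ?case
    unfolding Suc_eq[OF g2] by (subst nn_integral_0_iff_AE[OF m[OF g2]])
qed

lemma bind_\<pi>_Pn: "\<pi> \<bind> Pn n = \<pi>"
proof (induction n)
  case 0
  then show ?case by (simp add: bind_return'')
next
  case (Suc n)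
  have "\<pi> \<bind> Pn (1 + n) = (\<pi> \<bind> Pn 1) \<bind> Pn n"
    by (rule bind_kpow_add[OF P \<pi>])
  moreover have "Pn 1 x = P x" for x
    by (simp add: bind_return'')
  then have "\<pi> \<bind> Pn 1 = \<pi> \<bind> P" by presburger
  ultimately show ?case by (simp add: stationary Suc)
qed

end

section \<open>Integrals against the path law of the Markov chain\<close>

context
  fixes P :: "'e::polish_space \<Rightarrow> 'e measure" and \<nu> :: "'e measure"
  assumes P[measurable]: "P \<in> borel \<rightarrow>\<^sub>M prob_algebra borel"
    and \<nu>: "\<nu> \<in> space (prob_algebra borel)"
begin

text \<open>The path law is restricted to an event of the past. Under this measure the next
  coordinate has the same law on the state space as the current one moved by P, and equal measures
  integrate f alike.\<close>

lemma nn_integral_markov_law_Suc: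
  assumes A[measurable]: "A \<in> sets (\<Pi>\<^sub>M i\<in>{0..<Suc n}. borel)"
    and f[measurable]: "f \<in> borel_measurable borel"
  shows "(\<integral>\<^sup>+x. indicator A (restrict x {0..<Suc n}) * f (x (Suc n)) \<partial>markov_law P \<nu>) =
    (\<integral>\<^sup>+x. indicator A (restrict x {0..<Suc n}) * (\<integral>\<^sup>+z. f z \<partial>P (x n)) \<partial>markov_law P \<nu>)"
proof -
  note sets_markov_law[OF P \<nu>, measurable_cong]
  let ?M = "markov_law P \<nu>"
  let ?D = "density ?M (\<lambda>x. indicator A (restrict x {0..<Suc n}))"
  have im: "(\<lambda>x. indicator A (restrict x {0..<Suc n}) :: ennreal) \<in> borel_measurable ?M" by measurable
  have k: "(\<lambda>x. P (x n)) \<in> ?D \<rightarrow>\<^sub>M prob_algebra borel" by measurable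
  have ne: "space ?D \<noteq> {}" by (simp add: space_markov_law[OF P \<nu>])
  have "distr ?D borel (\<lambda>x. x (Suc n)) = ?D \<bind> (\<lambda>x. P (x n))"
  proof (rule measure_eqI)
    show "sets (distr ?D borel (\<lambda>x. x (Suc n))) = sets (?D \<bind> (\<lambda>x. P (x n)))"
      using ne kernel_prob(2)[OF P] by (subst sets_bind[where N=borel]) auto
    fix B assume "B \<in> sets (distr ?D borel (\<lambda>x. x (Suc n)))"
    then have B[measurable]: "B \<in> sets borel" by simp
    have "emeasure (distr ?D borel (\<lambda>x. x (Suc n))) B = emeasure ?D ((\<lambda>x. x (Suc n)) -` B \<inter> space ?D)"
      by (rule emeasure_distr) measurable
    also have "\<dots> = (\<integral>\<^sup>+x. indicator A (restrict x {0..<Suc n}) *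
      indicator ((\<lambda>x. x (Suc n)) -` B \<inter> space ?D) x \<partial>?M)"
      by (rule emeasure_density[OF im]) measurable
    also have "\<dots> = (\<integral>\<^sup>+x. indicator {x. restrict x {0..<Suc n} \<in> A \<and> x (Suc n) \<in> B} x \<partial>?M)"
      by (intro nn_integral_cong) (auto simp: space_markov_law[OF P \<nu>] split: split_indicator)
    also have "\<dots> = emeasure ?M {x. restrict x {0..<Suc n} \<in> A \<and> x (Suc n) \<in> B}"
    proof (rule nn_integral_indicator)
      have "{x \<in> space ?M. restrict x {0..<Suc n} \<in> A \<and> x (Suc n) \<in> B} \<in> sets ?M" by measurable
      then show "{x. restrict x {0..<Suc n} \<in> A \<and> x (Suc n) \<in> B} \<in> sets ?M"
        by (simp add: space_markov_law[OF P \<nu>])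
    qed
    also have "\<dots> = (\<integral>\<^sup>+x. indicator A (restrict x {0..<Suc n}) * emeasure (P (x n)) B \<partial>?M)"
      by (rule emeasure_markov_law_Suc[OF P \<nu> A B])
    also have "\<dots> = (\<integral>\<^sup>+x. emeasure (P (x n)) B \<partial>?D)"
      using measurable_emeasure_kernel[OF measurable_prob_algebraD[OF P] B]
      by (subst nn_integral_density) auto
    also have "\<dots> = emeasure (?D \<bind> (\<lambda>x. P (x n))) B"
      by (rule emeasure_bind[symmetric, OF ne measurable_prob_algebraD[OF k] B])
    finally show "emeasure (distr ?D borel (\<lambda>x. x (Suc n))) B = emeasure (?D \<bind> (\<lambda>x. P (x n))) B" .
  qed
  then have "(\<integral>\<^sup>+z. f z \<partial>distr ?D borel (\<lambda>x. x (Suc n))) = (\<integral>\<^sup>+z. f z \<partial>(?D \<bind> (\<lambda>x. P (x n))))"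
    by simp
  also have "(\<integral>\<^sup>+z. f z \<partial>distr ?D borel (\<lambda>x. x (Suc n))) = (\<integral>\<^sup>+x. f (x (Suc n)) \<partial>?D)"
    by (rule nn_integral_distr) measurable
  also have "\<dots> = (\<integral>\<^sup>+x. indicator A (restrict x {0..<Suc n}) * f (x (Suc n)) \<partial>?M)"
    by (rule nn_integral_density[OF im]) measurable
  also have "(\<integral>\<^sup>+z. f z \<partial>(?D \<bind> (\<lambda>x. P (x n)))) = (\<integral>\<^sup>+x. \<integral>\<^sup>+z. f z \<partial>P (x n) \<partial>?D)"
    by (rule nn_integral_bind_prob[OF refl k f])
  also have "\<dots> = (\<integral>\<^sup>+x. indicator A (restrict x {0..<Suc n}) * (\<integral>\<^sup>+z. f z \<partial>P (x n)) \<partial>?M)"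
    by (rule nn_integral_density[OF im]) measurable
  finally show ?thesis .
qed

text \<open>The dual argument: for fixed f both sides integrate \<open>\<psi>\<close> against
  measures on the space of pasts, and by the previous lemma these agree on events.\<close>

lemma markov_law_step:
  assumes \<psi>[measurable]: "\<psi> \<in> borel_measurable (\<Pi>\<^sub>M i\<in>{0..<Suc n}. borel)"
    and f[measurable]: "f \<in> borel_measurable borel"
  shows "(\<integral>\<^sup>+x. \<psi> (restrict x {0..<Suc n}) * f (x (Suc n)) \<partial>markov_law P \<nu>) =
    (\<integral>\<^sup>+x. \<psi> (restrict x {0..<Suc n}) * (\<integral>\<^sup>+z. f z \<partial>P (x n)) \<partial>markov_law P \<nu>)"
proof -
  note sets_markov_law[OF P \<nu>, measurable_cong]
  let ?M = "markov_law P \<nu>" and ?N = "\<Pi>\<^sub>M i\<in>{0..<Suc n}. (borel :: 'e measure)"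
  let ?D = "\<lambda>h. distr (density ?M h) ?N (\<lambda>x. restrict x {0..<Suc n})"
  have D: "(\<integral>\<^sup>+s. \<psi>' s \<partial>?D h) = (\<integral>\<^sup>+x. \<psi>' (restrict x {0..<Suc n}) * h x \<partial>?M)"
    if [measurable]: "h \<in> borel_measurable ?M" "\<psi>' \<in> borel_measurable ?N" for h \<psi>'
    by (subst nn_integral_distr; (subst nn_integral_density)?) (auto simp: mult.commute)
  have m1: "(\<lambda>x. f (x (Suc n))) \<in> borel_measurable ?M"
    and m2: "(\<lambda>x. \<integral>\<^sup>+z. f z \<partial>P (x n)) \<in> borel_measurable ?M"
    by measurable
  have "?D (\<lambda>x. f (x (Suc n))) = ?D (\<lambda>x. \<integral>\<^sup>+z. f z \<partial>P (x n))"
  proof (rule measure_eqI)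
    fix A assume "A \<in> sets (?D (\<lambda>x. f (x (Suc n))))"
    then have A[measurable]: "A \<in> sets ?N" by simp
    have i: "indicator A \<in> borel_measurable ?N" by measurable
    have "emeasure (?D (\<lambda>x. f (x (Suc n)))) A = (\<integral>\<^sup>+s. indicator A s \<partial>?D (\<lambda>x. f (x (Suc n))))"
      by simp
    also have "\<dots> = (\<integral>\<^sup>+s. indicator A s \<partial>?D (\<lambda>x. \<integral>\<^sup>+z. f z \<partial>P (x n)))"
      unfolding D[OF m1 i] D[OF m2 i] by (rule nn_integral_markov_law_Suc[OF A f])
    also have "\<dots> = emeasure (?D (\<lambda>x. \<integral>\<^sup>+z. f z \<partial>P (x n))) A"
      by simp
    finally show "emeasure (?D (\<lambda>x. f (x (Suc n)))) A = emeasure (?D (\<lambda>x. \<integral>\<^sup>+z. f z \<partial>P (x n))) A" .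
  qed simp
  then show ?thesis
    using D[OF m1 \<psi>] D[OF m2 \<psi>] by simp
qed

lemma markov_law_prod_step:
  assumes q[measurable]: "\<And>i. q i \<in> borel_measurable borel" and f: "f \<in> borel_measurable borel"
  shows "(\<integral>\<^sup>+x. (\<Prod>i<Suc n. q i (x i)) * f (x (Suc n)) \<partial>markov_law P \<nu>) =
    (\<integral>\<^sup>+x. (\<Prod>i<n. q i (x i)) * (q n (x n) * (\<integral>\<^sup>+z. f z \<partial>P (x n))) \<partial>markov_law P \<nu>)"
proof -
  let ?\<psi> = "\<lambda>x. \<Prod>i<Suc n. (q i (x i) :: ennreal)"
  have "?\<psi> \<in> borel_measurable (\<Pi>\<^sub>M i\<in>{0..<Suc n}. borel)"
  proof (rule borel_measurable_prod_ennreal)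
    fix i assume "i \<in> {..<Suc n}"
    then have [measurable]: "(\<lambda>x. x i) \<in> (\<Pi>\<^sub>M i\<in>{0..<Suc n}. (borel :: 'e measure)) \<rightarrow>\<^sub>M borel"
      by (intro measurable_component_singleton) auto
    show "(\<lambda>x. q i (x i)) \<in> borel_measurable (\<Pi>\<^sub>M i\<in>{0..<Suc n}. borel)" by measurable
  qed
  note step = markov_law_step[OF this f]
  have eq: "?\<psi> (restrict x {0..<Suc n}) = ?\<psi> x" for x
    by (intro prod.cong) auto
  show ?thesis using step unfolding eq by (simp add: mult.assoc)
qed

lemma nn_integral_markov_law_0:
  assumes "f \<in> borel_measurable borel"
  shows "(\<integral>\<^sup>+x. f (x 0) \<partial>markov_law P \<nu>) = (\<integral>\<^sup>+z. f z \<partial>\<nu>)"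
proof -
  note sets_markov_law[OF P \<nu>, measurable_cong]
  have s: "sets \<nu> = sets borel" using \<nu> by (simp add: space_prob_algebra)
  have "distr (markov_law P \<nu>) borel (\<lambda>x. x 0) = \<nu>"
  proof (rule measure_eqI)
    fix A assume "A \<in> sets (distr (markov_law P \<nu>) borel (\<lambda>x. x 0))"
    then have A[measurable]: "A \<in> sets borel" by simp
    have "emeasure (distr (markov_law P \<nu>) borel (\<lambda>x. x 0)) A = emeasure (markov_law P \<nu>) {x. x 0 \<in> A}"
      by (subst emeasure_distr) (auto simp: space_markov_law[OF P \<nu>] vimage_def)
    then show "emeasure (distr (markov_law P \<nu>) borel (\<lambda>x. x 0)) A = emeasure \<nu> A"
      by (simp add: emeasure_markov_law_0[OF P \<nu> A])
  qed (simp add: s)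
  then show ?thesis
    using nn_integral_distr[of "\<lambda>x. x 0" "markov_law P \<nu>" borel f] assms
      by (simp add: measurable_cong_sets[OF s refl])
qed

lemma nn_integral_markov_law_coord:
  assumes f: "f \<in> borel_measurable borel"
  shows "(\<integral>\<^sup>+x. f (x n) \<partial>markov_law P \<nu>) = (\<integral>\<^sup>+x. \<integral>\<^sup>+z. f z \<partial>kpow borel P n x \<partial>\<nu>)"
  using f
proof (induction n arbitrary: f)
  case 0
  then show ?case
    by (simp add: nn_integral_markov_law_0 nn_integral_return)
next
  case (Suc n)
  note f[measurable] = Suc.prems
  have "(\<integral>\<^sup>+x. f (x (Suc n)) \<partial>markov_law P \<nu>) = (\<integral>\<^sup>+x. \<integral>\<^sup>+z. f z \<partial>P (x n) \<partial>markov_law P \<nu>)"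
    using markov_law_prod_step[of "\<lambda>_ _. 1" f n] by simp
  also have "\<dots> = (\<integral>\<^sup>+x. \<integral>\<^sup>+y. \<integral>\<^sup>+z. f z \<partial>P y \<partial>kpow borel P n x \<partial>\<nu>)"
    by (rule Suc.IH) measurable
  also have "\<dots> = (\<integral>\<^sup>+x. \<integral>\<^sup>+z. f z \<partial>kpow borel P (n + 1) x \<partial>\<nu>)"
  proof (intro nn_integral_cong)
    fix x
    have "kpow borel P 1 y = P y" for y
      using kernel_prob(2)[OF P] by (simp add: bind_return'')
    then show "(\<integral>\<^sup>+y. \<integral>\<^sup>+z. f z \<partial>P y \<partial>kpow borel P n x) = (\<integral>\<^sup>+z. f z \<partial>kpow borel P (n + 1) x)"
      using nn_integral_kpow_add[OF P f, of x n 1] by simp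
  qed
  finally show ?case by simp
qed

end

section \<open>Unnormalised filters\<close>

text \<open>
  Histories list the most recent observation first; positions that are not yet in use hold
  \<open>undefined\<close>.
\<close>

primrec hist :: "nat \<Rightarrow> (nat \<Rightarrow> 'f) \<Rightarrow> nat \<Rightarrow> 'f" where
  "hist 0 y = (\<lambda>_. undefined)"
| "hist (Suc n) y = case_nat (y n) (hist n y)"

lemma hist_nth: "hist n y j = (if j < n then y (n - Suc j) else undefined)"
  by (induction n arbitrary: j) (auto split: nat.split)

lemma hist_measurable[measurable]: "hist n \<in> (\<Pi>\<^sub>M i\<in>UNIV. borel) \<rightarrow>\<^sub>M (\<Pi>\<^sub>M i\<in>UNIV. (borel ::
  'f::topological_space measure))"
proof (rule measurable_PiM_single')
  fix j
  have "(\<lambda>y. hist n y j) = (if j < n then (\<lambda>y. y (n - Suc j)) else (\<lambda>_. undefined))"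
    by (simp add: hist_nth fun_eq_iff)
  also have "\<dots> \<in> (\<Pi>\<^sub>M i\<in>UNIV. borel) \<rightarrow>\<^sub>M (borel :: 'f measure)" by simp
  finally show "(\<lambda>y. hist n y j) \<in> (\<Pi>\<^sub>M i\<in>UNIV. borel) \<rightarrow>\<^sub>M (borel :: 'f measure)" .
qed auto

locale hmm = hist_chain P \<phi> \<pi> "\<Pi>\<^sub>M i\<in>UNIV. borel" case_nat
  for P :: "'e::polish_space \<Rightarrow> 'e measure" and \<phi> :: "'f::polish_space measure" and \<pi> :: "'e measure" +
  fixes g :: "'e \<Rightarrow> 'f \<Rightarrow> real"
  assumes g: "obs_density g"
begin

abbreviation MH :: "(nat \<Rightarrow> 'f) measure" where
  "MH \<equiv> \<Pi>\<^sub>M i\<in>UNIV. borel"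

lemma space_MH[simp]: "space MH = UNIV"
  and space_EH[simp]: "space (EH :: ('e \<times> (nat \<Rightarrow> 'f)) measure) = UNIV"
  by (simp_all add: space_PiM space_pair_measure)

text \<open>Along exceptional histories an unnormalised filter may fail to be sigma-finite. The
  exchange of integrals with \<phi> is therefore carried as a property that densities and binding
  with P preserve.\<close>

definition fubini :: "'e measure \<Rightarrow> bool" where
  "fubini M \<longleftrightarrow> sets M = sets borel \<and> (\<forall>F. (\<lambda>(x, w). F x w) \<in> borel_measurable (borel \<Otimes>\<^sub>M borel) \<longrightarrow>
     (\<integral>\<^sup>+x. \<integral>\<^sup>+w. F x w \<partial>\<phi> \<partial>M) = (\<integral>\<^sup>+w. \<integral>\<^sup>+x. F x w \<partial>M \<partial>\<phi>))"

lemma fubiniD: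
  assumes "fubini M"
  shows "sets M = sets borel"
    and "(\<lambda>(x, w). F x w) \<in> borel_measurable (borel \<Otimes>\<^sub>M borel) \<Longrightarrow>
      (\<integral>\<^sup>+x. \<integral>\<^sup>+w. F x w \<partial>\<phi> \<partial>M) = (\<integral>\<^sup>+w. \<integral>\<^sup>+x. F x w \<partial>M \<partial>\<phi>)"
  using assms by (simp_all add: fubini_def)

lemma fubini_prob: "M \<in> space (prob_algebra borel) \<Longrightarrow> fubini M"
  unfolding fubini_def
  by (auto simp: space_prob_algebra intro!: nn_integral_swap_prob \<phi>.prob_space_axioms
      cong: measurable_cong_sets[OF sets_pair_measure_cong[OF _ sets_\<phi>] refl])

lemma fubini_density:
  assumes M: "fubini M" and b[measurable]: "b \<in> borel_measurable borel"
  shows "fubini (density M b)"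
  unfolding fubini_def
proof (intro conjI allI impI)
  note [measurable_cong] = fubiniD(1)[OF M]
  show "sets (density M b) = sets borel" by (simp add: fubiniD(1)[OF M])
  fix F :: "'e \<Rightarrow> 'f \<Rightarrow> ennreal" assume F[measurable]:
    "(\<lambda>(x, w). F x w) \<in> borel_measurable (borel \<Otimes>\<^sub>M borel)"
  have "(\<integral>\<^sup>+x. \<integral>\<^sup>+w. F x w \<partial>\<phi> \<partial>density M b) = (\<integral>\<^sup>+x. b x * (\<integral>\<^sup>+w. F x w \<partial>\<phi>) \<partial>M)"
    by (rule nn_integral_density) measurable
  also have "\<dots> = (\<integral>\<^sup>+x. \<integral>\<^sup>+w. b x * F x w \<partial>\<phi> \<partial>M)"
    by (intro nn_integral_cong nn_integral_cmult[symmetric]) measurable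
  also have "\<dots> = (\<integral>\<^sup>+w. \<integral>\<^sup>+x. b x * F x w \<partial>M \<partial>\<phi>)"
    by (rule fubiniD(2)[OF M]) measurable
  also have "\<dots> = (\<integral>\<^sup>+w. \<integral>\<^sup>+x. F x w \<partial>density M b \<partial>\<phi>)"
    by (intro nn_integral_cong nn_integral_density[symmetric]) measurable
  finally show "(\<integral>\<^sup>+x. \<integral>\<^sup>+w. F x w \<partial>\<phi> \<partial>density M b) = (\<integral>\<^sup>+w. \<integral>\<^sup>+x. F x w \<partial>density M b \<partial>\<phi>)" .
qed

lemma fubini_bind:
  assumes M: "fubini M"
  shows "fubini (M \<bind> P)"
  unfolding fubini_def
proof (intro conjI allI impI)
  note s[measurable_cong] = fubiniD(1)[OF M]
  show "sets (M \<bind> P) = sets borel"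
    using sets_eq_imp_space_eq[OF s] by (intro sets_bind) auto
  fix F :: "'e \<Rightarrow> 'f \<Rightarrow> ennreal" assume F[measurable]:
    "(\<lambda>(x, w). F x w) \<in> borel_measurable (borel \<Otimes>\<^sub>M borel)"
  have "(\<integral>\<^sup>+x. \<integral>\<^sup>+w. F x w \<partial>\<phi> \<partial>(M \<bind> P)) = (\<integral>\<^sup>+x. \<integral>\<^sup>+z. \<integral>\<^sup>+w. F z w \<partial>\<phi> \<partial>P x \<partial>M)"
    by (rule nn_integral_bind_prob[OF s P]) measurable
  also have "\<dots> = (\<integral>\<^sup>+x. \<integral>\<^sup>+w. \<integral>\<^sup>+z. F z w \<partial>P x \<partial>\<phi> \<partial>M)"
    by (intro nn_integral_cong nn_integral_swap_prob prob_P \<phi>.prob_space_axioms) measurable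
  also have "\<dots> = (\<integral>\<^sup>+w. \<integral>\<^sup>+x. \<integral>\<^sup>+z. F z w \<partial>P x \<partial>M \<partial>\<phi>)"
    by (rule fubiniD(2)[OF M]) measurable
  also have "\<dots> = (\<integral>\<^sup>+w. \<integral>\<^sup>+z. F z w \<partial>(M \<bind> P) \<partial>\<phi>)"
    by (intro nn_integral_cong nn_integral_bind_prob[symmetric, OF s P]) measurable
  finally show "(\<integral>\<^sup>+x. \<integral>\<^sup>+w. F x w \<partial>\<phi> \<partial>(M \<bind> P)) = (\<integral>\<^sup>+w. \<integral>\<^sup>+x. F x w \<partial>(M \<bind> P) \<partial>\<phi>)" .
qed

text \<open>
  Unnormalised filters need not be finite measures for every observation history, so they are not
  kernels in the sense of the Giry monad. Measurability is therefore stated for integrals; the shift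
  by \<open>k\<close> lets the integrand depend on \<open>k\<close> further observations, as the induction requires.
\<close>

definition kernel_family :: "((nat \<Rightarrow> 'f) \<Rightarrow> 'e measure) \<Rightarrow> bool" where
  "kernel_family K \<longleftrightarrow> (\<forall>h. fubini (K h)) \<and>
     (\<forall>k. \<forall>F\<in>borel_measurable EH. (\<lambda>h. \<integral>\<^sup>+x. F (x, h) \<partial>K (\<lambda>i. h (i + k))) \<in> borel_measurable MH)"

lemma kernel_familyD:
  assumes "kernel_family K"
  shows "fubini (K h)" and "sets (K h) = sets borel" and "space (K h) = UNIV"
    and "F \<in> borel_measurable EH \<Longrightarrow> (\<lambda>h. \<integral>\<^sup>+x. F (x, h) \<partial>K (\<lambda>i. h (i + k))) \<in> borel_measurable MH"
    and "F \<in> borel_measurable EH \<Longrightarrow> (\<lambda>h. \<integral>\<^sup>+x. F (x, h) \<partial>K h) \<in> borel_measurable MH"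
proof -
  show "fubini (K h)" and s: "sets (K h) = sets borel"
    using assms fubiniD(1) by (auto simp: kernel_family_def)
  show "space (K h) = UNIV" using sets_eq_imp_space_eq[OF s] by simp
  show m: "F \<in> borel_measurable EH \<Longrightarrow> (\<lambda>h. \<integral>\<^sup>+x. F (x, h) \<partial>K (\<lambda>i. h (i +
    k))) \<in> borel_measurable MH" for k
    using assms by (simp add: kernel_family_def)
  show "F \<in> borel_measurable EH \<Longrightarrow> (\<lambda>h. \<integral>\<^sup>+x. F (x, h) \<partial>K h) \<in> borel_measurable MH"
    using m[of 0] by simp
qed

lemma shift_measurable[measurable]: "(\<lambda>h i. h (i + k)) \<in> MH \<rightarrow>\<^sub>M MH"
  by (rule measurable_PiM_single') auto

lemma kernel_family_const:
  assumes \<nu>: "\<nu> \<in> space (prob_algebra borel)"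
  shows "kernel_family (\<lambda>_. \<nu>)"
  unfolding kernel_family_def
proof (intro conjI allI ballI)
  show "fubini \<nu>" by (rule fubini_prob[OF \<nu>])
  have [measurable]: "(\<lambda>_. \<nu>) \<in> MH \<rightarrow>\<^sub>M prob_algebra borel" using \<nu> by simp
  show "(\<lambda>h. \<integral>\<^sup>+x. F (x, h) \<partial>\<nu>) \<in> borel_measurable MH" if [measurable]: "F \<in> borel_measurable EH" for F
    by measurable
qed

lemma kernel_family_density:
  assumes K: "kernel_family K" and b[measurable]: "b \<in> borel_measurable EH"
  shows "kernel_family (\<lambda>h. density (K h) (\<lambda>x. b (x, h)))"
  unfolding kernel_family_def
proof (intro conjI allI ballI)
  show "fubini (density (K h) (\<lambda>x. b (x, h)))" for h
    by (rule fubini_density[OF kernel_familyD(1)[OF K]]) measurable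
  fix k :: nat and F :: "'e \<times> (nat \<Rightarrow> 'f) \<Rightarrow> ennreal" assume [measurable]: "F \<in> borel_measurable EH"
  have "(\<lambda>h. \<integral>\<^sup>+x. b (x, \<lambda>i. h (i + k)) * F (x, h) \<partial>K (\<lambda>i. h (i + k))) \<in> borel_measurable MH"
    using kernel_familyD(4)[OF K, of "\<lambda>s. b (fst s, \<lambda>i. snd s (i + k)) * F s" k] by simp
  also have "(\<lambda>h. \<integral>\<^sup>+x. b (x, \<lambda>i. h (i + k)) * F (x, h) \<partial>K (\<lambda>i. h (i + k))) =
      (\<lambda>h. \<integral>\<^sup>+x. F (x, h) \<partial>density (K (\<lambda>i. h (i + k))) (\<lambda>x. b (x, \<lambda>i. h (i + k))))"
    by (intro ext nn_integral_density[symmetric])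
      (simp_all cong: measurable_cong_sets add: kernel_familyD(2)[OF K])
  finally show "(\<lambda>h. \<integral>\<^sup>+x. F (x, h) \<partial>density (K (\<lambda>i. h (i + k))) (\<lambda>x. b (x, \<lambda>i. h (i +
    k)))) \<in> borel_measurable MH" .
qed

text \<open>Weighing precedes moving: \<open>h 0\<close> is the observation of the signal before the
  move, and the result predicts the next signal, whose observation is still unknown.\<close>

definition advance :: "((nat \<Rightarrow> 'f) \<Rightarrow> 'e measure) \<Rightarrow> (nat \<Rightarrow> 'f) \<Rightarrow> 'e measure" where
  "advance K h = density (K (\<lambda>i. h (Suc i))) (\<lambda>x. ennreal (g x (h 0))) \<bind> P"

lemma g_section: "(\<lambda>x. ennreal (g x w)) \<in> borel_measurable borel"
proof -
  note obs_densityD(1)[OF g, measurable]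
  show ?thesis by measurable
qed

lemma nn_integral_advance:
  assumes M: "sets M = sets borel" and F: "F \<in> borel_measurable borel"
  shows "(\<integral>\<^sup>+x. F x \<partial>(density M (\<lambda>x. ennreal (g x w)) \<bind> P)) =
    (\<integral>\<^sup>+x. ennreal (g x w) * (\<integral>\<^sup>+z. F z \<partial>P x) \<partial>M)"
proof -
  note M[measurable_cong] g_section[measurable] F[measurable]
  have "(\<integral>\<^sup>+x. F x \<partial>(density M (\<lambda>x. ennreal (g x w)) \<bind> P)) =
    (\<integral>\<^sup>+x. \<integral>\<^sup>+z. F z \<partial>P x \<partial>density M (\<lambda>x. ennreal (g x w)))"
    by (rule nn_integral_bind_prob[OF _ P F]) (simp add: M)
  also have "\<dots> = (\<integral>\<^sup>+x. ennreal (g x w) * (\<integral>\<^sup>+z. F z \<partial>P x) \<partial>M)"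
    by (rule nn_integral_density) measurable
  finally show ?thesis .
qed

lemma kernel_family_advance:
  assumes K: "kernel_family K"
  shows "kernel_family (advance K)"
  unfolding kernel_family_def advance_def
proof (intro conjI allI ballI)
  note obs_densityD(1)[OF g, measurable]
  show "fubini (density (K (\<lambda>i. h (Suc i))) (\<lambda>x. ennreal (g x (h 0))) \<bind> P)" for h
    by (intro fubini_bind fubini_density kernel_familyD(1)[OF K] g_section)
  fix k :: nat and F :: "'e \<times> (nat \<Rightarrow> 'f) \<Rightarrow> ennreal" assume F[measurable]: "F \<in> borel_measurable EH"
  have Fs: "(\<lambda>x. F (x, h)) \<in> borel_measurable borel" for h by measurable
  \<comment> \<open>The likelihood uses up the observation at position k, and the kernel sees the
    history from position Suc k on. This is where the induction needs arbitrary shifts.\<close>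
  have "(\<lambda>h. \<integral>\<^sup>+x. ennreal (g x (h k)) * (\<integral>\<^sup>+z. F (z, h) \<partial>P x) \<partial>K (\<lambda>i. h (i +
    Suc k))) \<in> borel_measurable MH"
    using kernel_familyD(4)[OF K, of "\<lambda>s. ennreal (g (fst s) (snd s k)) *
      (\<integral>\<^sup>+z. F (z, snd s) \<partial>P (fst s))" "Suc k"] by simp
  then show "(\<lambda>h. \<integral>\<^sup>+x. F (x, h) \<partial>(density (K (\<lambda>i. h (Suc i + k))) (\<lambda>x. ennreal (g x (h (0 +
    k)))) \<bind> P)) \<in> borel_measurable MH"
    by (simp add: nn_integral_advance[OF kernel_familyD(2)[OF K] Fs])
qed

section \<open>Joint laws of signal and history, disintegrated over noise\<close>

definition origin :: "nat \<Rightarrow> 'f" where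
  "origin = (\<lambda>_. undefined)"

text \<open>The reference law, under which the first n observations are independent with law
  \<phi>.\<close>

abbreviation noise :: "nat \<Rightarrow> (nat \<Rightarrow> 'f) measure" where
  "noise n \<equiv> refreshes n origin"

lemma sets_noise[measurable_cong, simp]: "sets (noise n) = sets MH"
  and prob_noise: "prob_space (noise n)"
  and space_noise[simp]: "space (noise n) = UNIV"
  using kernel_prob[OF refreshes_kernel, of origin n] sets_eq_imp_space_eq[of "noise n" MH] by auto

text \<open>\<open>kpow\<close> peels off the first step, whereas the newest observation belongs to
  the last one; \<open>nn_integral_kpow_add\<close> makes the change.\<close>

lemma nn_integral_noise_Suc:
  assumes f[measurable]: "f \<in> borel_measurable MH"
  shows "(\<integral>\<^sup>+h. f h \<partial>noise (Suc n)) = (\<integral>\<^sup>+h. \<integral>\<^sup>+w. f (case_nat w h) \<partial>\<phi> \<partial>noise n)"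
proof -
  have "(\<integral>\<^sup>+h. f h \<partial>noise (n + 1)) = (\<integral>\<^sup>+h. \<integral>\<^sup>+h'. f h' \<partial>refreshes 1 h \<partial>noise n)"
    by (rule nn_integral_kpow_add[OF refresh_kernel f]) simp
  also have "\<dots> = (\<integral>\<^sup>+h. \<integral>\<^sup>+w. f (case_nat w h) \<partial>\<phi> \<partial>noise n)"
  proof (intro nn_integral_cong)
    fix h
    have "refreshes 1 h = refresh h"
      using kernel_prob(2)[OF refresh_kernel, of h] by (simp add: bind_return'')
    then show "(\<integral>\<^sup>+h'. f h' \<partial>refreshes 1 h) = (\<integral>\<^sup>+w. f (case_nat w h) \<partial>\<phi>)"
      by (simp add: nn_integral_refresh)
  qed
  finally show ?thesis by simp
qed

text \<open>In the chain, g is the density of the new observation given the signal. In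
  \<open>advance\<close> it is a weight on the signal, given an observation drawn from \<phi>.
  Exchanging the two integrals identifies both views.\<close>

lemma nn_integral_noise_advance:
  assumes K: "kernel_family K" and F[measurable]: "F \<in> borel_measurable EH"
  shows "(\<integral>\<^sup>+h. \<integral>\<^sup>+x. F (x, h) \<partial>advance K h \<partial>noise (Suc n)) =
    (\<integral>\<^sup>+h. \<integral>\<^sup>+x. \<integral>\<^sup>+s. F s \<partial>step g (x, h) \<partial>K h \<partial>noise n)"
proof -
  note obs_densityD(1)[OF g, measurable] push[measurable]
  have "(\<integral>\<^sup>+h. \<integral>\<^sup>+x. F (x, h) \<partial>advance K h \<partial>noise (Suc n)) =
      (\<integral>\<^sup>+h. \<integral>\<^sup>+w. \<integral>\<^sup>+x. F (x, case_nat w h) \<partial>advance K (case_nat w h) \<partial>\<phi> \<partial>noise n)"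
    by (rule nn_integral_noise_Suc) (rule kernel_familyD(5)[OF kernel_family_advance[OF K] F])
  also have "\<dots> = (\<integral>\<^sup>+h. \<integral>\<^sup>+w. \<integral>\<^sup>+x. ennreal (g x w) *
    (\<integral>\<^sup>+z. F (z, case_nat w h) \<partial>P x) \<partial>K h \<partial>\<phi> \<partial>noise n)"
  proof (intro nn_integral_cong)
    fix h w
    have "(\<lambda>x. F (x, case_nat w h)) \<in> borel_measurable borel" by measurable
    then show "(\<integral>\<^sup>+x. F (x, case_nat w h) \<partial>advance K (case_nat w h)) =
      (\<integral>\<^sup>+x. ennreal (g x w) * (\<integral>\<^sup>+z. F (z, case_nat w h) \<partial>P x) \<partial>K h)"
      using nn_integral_advance[OF kernel_familyD(2)[OF K, of h], of "\<lambda>x. F (x, case_nat w h)" w]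
        by (simp add: advance_def)
  qed
  also have "\<dots> = (\<integral>\<^sup>+h. \<integral>\<^sup>+x. \<integral>\<^sup>+w. ennreal (g x w) *
    (\<integral>\<^sup>+z. F (z, case_nat w h) \<partial>P x) \<partial>\<phi> \<partial>K h \<partial>noise n)"
  proof (intro nn_integral_cong fubiniD(2)[OF kernel_familyD(1)[OF K], symmetric])
    fix h
    have "(\<lambda>w. case_nat w h) \<in> borel \<rightarrow>\<^sub>M MH" using push_section[of h] by simp
    note this[measurable]
    show "(\<lambda>(x, w). ennreal (g x w) * (\<integral>\<^sup>+z. F (z, case_nat w h) \<partial>P x)) \<in> borel_measurable (borel
      \<Otimes>\<^sub>M borel)"
      by measurable
  qed
  also have "\<dots> = (\<integral>\<^sup>+h. \<integral>\<^sup>+x. \<integral>\<^sup>+s. F s \<partial>step g (x, h) \<partial>K h \<partial>noise n)"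
    by (intro nn_integral_cong nn_integral_step[symmetric, OF g F]) simp
  finally show ?thesis .
qed

text \<open>The law of \<open>X\<^sub>n\<close> together with the n observations before time n; the
  observation of \<open>X\<^sub>n\<close> itself is not included.\<close>

definition joint :: "'e measure \<Rightarrow> nat \<Rightarrow> ('e \<times> (nat \<Rightarrow> 'f)) measure" where
  "joint \<nu> n = distr \<nu> EH (\<lambda>x. (x, origin)) \<bind> steps g n"

abbreviation predict :: "'e measure \<Rightarrow> nat \<Rightarrow> (nat \<Rightarrow> 'f) \<Rightarrow> 'e measure" where
  "predict \<nu> n \<equiv> (advance ^^ n) (\<lambda>_. \<nu>)"

lemma start_in:
  assumes "\<nu> \<in> space (prob_algebra borel)"
  shows "distr \<nu> EH (\<lambda>x. (x, origin)) \<in> space (prob_algebra EH)"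
    and "sets (distr \<nu> EH (\<lambda>x. (x, origin))) = sets EH"
    and "(\<lambda>x. (x, origin)) \<in> \<nu> \<rightarrow>\<^sub>M EH"
proof -
  have s[measurable_cong]: "sets \<nu> = sets borel" and p: "prob_space \<nu>"
    using assms by (auto simp: space_prob_algebra)
  show m: "(\<lambda>x. (x, origin)) \<in> \<nu> \<rightarrow>\<^sub>M EH" by measurable
  show "distr \<nu> EH (\<lambda>x. (x, origin)) \<in> space (prob_algebra EH)"
    using prob_space.prob_space_distr[OF p m] by (simp add: space_prob_algebra)
qed simp

lemma joint_in:
  assumes "\<nu> \<in> space (prob_algebra borel)"
  shows "joint \<nu> n \<in> space (prob_algebra EH)" and "sets (joint \<nu> n) = sets EH"
    and "prob_space (joint \<nu> n)"
  using bind_in_prob_algebra[OF start_in(1)[OF assms] steps_kernel[OF g, of n]]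
  by (simp_all add: joint_def space_prob_algebra)

lemma nn_integral_joint_0:
  assumes \<nu>: "\<nu> \<in> space (prob_algebra borel)" and F[measurable]: "F \<in> borel_measurable EH"
  shows "(\<integral>\<^sup>+s. F s \<partial>joint \<nu> 0) = (\<integral>\<^sup>+x. F (x, origin) \<partial>\<nu>)"
proof -
  have "joint \<nu> 0 = distr \<nu> EH (\<lambda>x. (x, origin))"
    unfolding joint_def by (simp add: bind_return'')
  then show ?thesis
    using nn_integral_distr[OF start_in(3)[OF \<nu>], of F] by simp
qed

lemma nn_integral_joint_Suc:
  assumes \<nu>: "\<nu> \<in> space (prob_algebra borel)" and F[measurable]: "F \<in> borel_measurable EH"
  shows "(\<integral>\<^sup>+s. F s \<partial>joint \<nu> (Suc n)) = (\<integral>\<^sup>+s. \<integral>\<^sup>+s'. F s' \<partial>step g s \<partial>joint \<nu> n)"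
proof -
  have "steps g 1 s = step g s" for s
    using kernel_prob(2)[OF step_kernel[OF g], of s] by (simp add: bind_return'')
  then show ?thesis
    using nn_integral_bind_kpow_add[OF step_kernel[OF g] start_in(2)[OF \<nu>] F, of n 1]
      by (simp add: joint_def)
qed

lemma step_integral_measurable:
  assumes F: "F \<in> borel_measurable EH"
  shows "(\<lambda>s. \<integral>\<^sup>+s'. F s' \<partial>step g s) \<in> borel_measurable EH"
  using measurable_compose[OF measurable_snd F]
  by (intro nn_integral_kernel[OF step_kernel[OF g]]) (simp add: split_beta')

lemma kernel_family_predict:
  "\<nu> \<in> space (prob_algebra borel) \<Longrightarrow> kernel_family (predict \<nu> n)"
  by (induction n) (simp_all add: kernel_family_const kernel_family_advance)

text \<open>Iterating \<open>nn_integral_noise_advance\<close> gives the unnormalised Bayes formula: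
  \<open>predict\<close> disintegrates the joint law over the reference noise.\<close>

lemma nn_integral_joint_predict:
  assumes \<nu>: "\<nu> \<in> space (prob_algebra borel)" and F: "F \<in> borel_measurable EH"
  shows "(\<integral>\<^sup>+s. F s \<partial>joint \<nu> n) = (\<integral>\<^sup>+h. \<integral>\<^sup>+x. F (x, h) \<partial>predict \<nu> n h \<partial>noise n)"
  using F
proof (induction n arbitrary: F)
  case 0
  have "(\<lambda>h. \<integral>\<^sup>+x. F (x, h) \<partial>\<nu>) \<in> borel_measurable MH"
    using kernel_familyD(5)[OF kernel_family_const[OF \<nu>] 0] .
  then show ?case
    using 0 by (simp add: nn_integral_joint_0[OF \<nu>] nn_integral_return)
next
  case (Suc n)
  have "(\<integral>\<^sup>+s. F s \<partial>joint \<nu> (Suc n)) = (\<integral>\<^sup>+s. \<integral>\<^sup>+s'. F s' \<partial>step g s \<partial>joint \<nu> n)"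
    by (rule nn_integral_joint_Suc[OF \<nu> Suc.prems])
  also have "\<dots> = (\<integral>\<^sup>+h. \<integral>\<^sup>+x. \<integral>\<^sup>+s'. F s' \<partial>step g (x, h) \<partial>predict \<nu> n h \<partial>noise n)"
    by (rule Suc.IH[OF step_integral_measurable[OF Suc.prems]])
  also have "\<dots> = (\<integral>\<^sup>+h. \<integral>\<^sup>+x. F (x, h) \<partial>advance (predict \<nu> n) h \<partial>noise (Suc n))"
    by (rule nn_integral_noise_advance[symmetric, OF kernel_family_predict[OF \<nu>] Suc.prems])
  finally show ?case by simp
qed

text \<open>Links the chain of states and histories to the path law of the signal. Histories run
  backwards, so position n - Suc i holds the observation at time i. The factor over {n..<N} comes
  from positions that still hold \<open>undefined\<close>.\<close>

lemma nn_integral_joint_cylinder: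
  assumes \<nu>: "\<nu> \<in> space (prob_algebra borel)" and "n \<le> N"
    and f: "f \<in> borel_measurable borel" and c: "\<And>j. c j \<in> borel_measurable borel"
  shows "(\<integral>\<^sup>+s. f (fst s) * (\<Prod>j<N. c j (snd s j)) \<partial>joint \<nu> n) =
    (\<Prod>j\<in>{n..<N}. c j undefined) * (\<integral>\<^sup>+x. (\<Prod>i<n. \<integral>\<^sup>+w. c (n - Suc i) w \<partial>obs g (x i)) *
      f (x n) \<partial>markov_law P \<nu>)"
  using \<open>n \<le> N\<close> f c
proof (induction n arbitrary: f c N)
  case 0
  note [measurable] = 0(2,3)
  have s: "sets \<nu> = sets borel" using \<nu> by (simp add: space_prob_algebra)
  have "(\<integral>\<^sup>+s. f (fst s) * (\<Prod>j<N. c j (snd s j)) \<partial>joint \<nu> 0) = (\<integral>\<^sup>+x. f x * (\<Prod>j<N. c j undefined) \<partial>\<nu>)"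
  proof -
    have "(\<lambda>s. f (fst s) * (\<Prod>j<N. c j (snd s j))) \<in> borel_measurable EH" by measurable
    from nn_integral_joint_0[OF \<nu> this] show ?thesis by (simp add: origin_def)
  qed
  also have "\<dots> = (\<Prod>j<N. c j undefined) * (\<integral>\<^sup>+x. f x \<partial>\<nu>)"
    using 0(2) by (subst nn_integral_multc) (auto simp: mult.commute measurable_cong_sets[OF s refl])
  finally show ?case
    using 0 by (simp add: nn_integral_markov_law_0[OF P \<nu>] lessThan_atLeast0)
next
  case (Suc n)
  note f[measurable] = Suc.prems(2) and c[measurable] = Suc.prems(3)
  have q: "(\<lambda>x. \<integral>\<^sup>+w. c j w \<partial>obs g x) \<in> borel_measurable borel" for j
    using measurable_compose[OF measurable_snd c]
    by (intro nn_integral_kernel[OF obs_kernel[OF g]]) (simp add: split_beta')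
  have Pf: "(\<lambda>x. \<integral>\<^sup>+z. f z \<partial>P x) \<in> borel_measurable borel"
    using measurable_compose[OF measurable_snd f]
    by (intro nn_integral_kernel[OF P]) (simp add: split_beta')
  obtain N' where N: "N = Suc N'" "n \<le> N'" using Suc.prems(1) by (cases N) auto
  define f' where "f' x = (\<integral>\<^sup>+w. c 0 w \<partial>obs g x) * (\<integral>\<^sup>+z. f z \<partial>P x)" for x
  have f'[measurable]: "f' \<in> borel_measurable borel"
    unfolding f'_def by (intro borel_measurable_times_ennreal q Pf)
  have st: "(\<integral>\<^sup>+s'. f (fst s') * (\<Prod>j<N. c j (snd s' j)) \<partial>step g (x, h)) =
    f' x * (\<Prod>j<N'. c (Suc j) (h j))" for x h
  proof -
    have p: "(\<Prod>j<N. c j (case_nat w h j)) = c 0 w * (\<Prod>j<N'. c (Suc j) (h j))" for w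
      unfolding N(1) by (subst prod.lessThan_Suc_shift) simp
    have "(\<integral>\<^sup>+s'. f (fst s') * (\<Prod>j<N. c j (snd s' j)) \<partial>step g (x, h)) =
        (\<integral>\<^sup>+w. ennreal (g x w) * (\<integral>\<^sup>+z. f z * (c 0 w * (\<Prod>j<N'. c (Suc j) (h j))) \<partial>P x) \<partial>\<phi>)"
      using nn_integral_step[OF g, of "\<lambda>s'. f (fst s') * (\<Prod>j<N. c j (snd s' j))" h x] by (simp add: p)
    also have "\<dots> = (\<integral>\<^sup>+w. ennreal (g x w) * (c 0 w * ((\<integral>\<^sup>+z. f z \<partial>P x) * (\<Prod>j<N'. c (Suc j) (h j)))) \<partial>\<phi>)"
      by (subst nn_integral_multc) (auto simp: mult_ac)
    also have "\<dots> = (\<integral>\<^sup>+w. c 0 w * ((\<integral>\<^sup>+z. f z \<partial>P x) * (\<Prod>j<N'. c (Suc j) (h j))) \<partial>obs g x)"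
      by (rule nn_integral_obs[symmetric, OF g]) measurable
    also have "\<dots> = (\<integral>\<^sup>+w. c 0 w \<partial>obs g x) * ((\<integral>\<^sup>+z. f z \<partial>P x) * (\<Prod>j<N'. c (Suc j) (h j)))"
      by (rule nn_integral_multc) (simp only: measurable_cong_sets[OF sets_obs refl] c)
    also have "\<dots> = f' x * (\<Prod>j<N'. c (Suc j) (h j))"
      by (simp only: f'_def mult.assoc)
    finally show ?thesis .
  qed
  have "(\<integral>\<^sup>+s. f (fst s) * (\<Prod>j<N. c j (snd s j)) \<partial>joint \<nu> (Suc n)) =
      (\<integral>\<^sup>+s. \<integral>\<^sup>+s'. f (fst s') * (\<Prod>j<N. c j (snd s' j)) \<partial>step g s \<partial>joint \<nu> n)"
    by (rule nn_integral_joint_Suc[OF \<nu>]) measurable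
  also have "\<dots> = (\<integral>\<^sup>+s. f' (fst s) * (\<Prod>j<N'. c (Suc j) (snd s j)) \<partial>joint \<nu> n)"
  proof (intro nn_integral_cong)
    fix s
    show "(\<integral>\<^sup>+s'. f (fst s') * (\<Prod>j<N. c j (snd s' j)) \<partial>step g s) =
      f' (fst s) * (\<Prod>j<N'. c (Suc j) (snd s j))"
      using st[of "fst s" "snd s"] by simp
  qed
  also have "\<dots> = (\<Prod>j\<in>{n..<N'}. c (Suc j) undefined) *
      (\<integral>\<^sup>+x. (\<Prod>i<n. \<integral>\<^sup>+w. c (Suc (n - Suc i)) w \<partial>obs g (x i)) * f' (x n) \<partial>markov_law P \<nu>)"
    by (rule Suc.IH[OF N(2) f' c])
  also have "(\<Prod>j\<in>{n..<N'}. c (Suc j) undefined) = (\<Prod>j\<in>{Suc n..<N}. c j undefined)"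
    unfolding N(1) by (rule prod.shift_bounds_Suc_ivl[symmetric])
  also have "(\<integral>\<^sup>+x. (\<Prod>i<n. \<integral>\<^sup>+w. c (Suc (n - Suc i)) w \<partial>obs g (x i)) * f' (x n) \<partial>markov_law P \<nu>) =
      (\<integral>\<^sup>+x. (\<Prod>i<n. \<integral>\<^sup>+w. c (Suc n - Suc i) w \<partial>obs g (x i)) *
        ((\<integral>\<^sup>+w. c (Suc n - Suc n) w \<partial>obs g (x n)) * (\<integral>\<^sup>+z. f z \<partial>P (x n))) \<partial>markov_law P \<nu>)"
  proof -
    have "(\<Prod>i<n. \<integral>\<^sup>+w. c (Suc (n - Suc i)) w \<partial>obs g (x i)) =
      (\<Prod>i<n. \<integral>\<^sup>+w. c (Suc n - Suc i) w \<partial>obs g (x i))" for x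
      by (intro prod.cong refl) (simp add: Suc_diff_Suc)
    then show ?thesis by (simp only: f'_def diff_self_eq_0)
  qed
  also have "\<dots> = (\<integral>\<^sup>+x. (\<Prod>i<Suc n. \<integral>\<^sup>+w. c (Suc n - Suc i) w \<partial>obs g (x i)) *
    f (x (Suc n)) \<partial>markov_law P \<nu>)"
    by (rule markov_law_prod_step[symmetric, OF P \<nu>, where q="\<lambda>i x. \<integral>\<^sup>+w. c (Suc n - Suc i) w \<partial>obs g
      x"])
      (rule q, rule f)
  finally show ?case .
qed

end

section \<open>Total variation distance and setwise bounds\<close>

lemma tv_dist_le:
  assumes M: "prob_space M" and N: "prob_space N" and s: "sets M = sets N"
    and le: "\<And>A. A \<in> sets M \<Longrightarrow> emeasure M A \<le> emeasure N A + ennreal c" and c: "0 \<le> c"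
  shows "tv_dist M N \<le> 2 * c"
  unfolding tv_dist_def
proof (rule cSUP_least)
  show "{f \<in> borel_measurable M. \<forall>x. \<bar>f x\<bar> \<le> (1::real)} \<noteq> {}"
    by (auto intro!: exI[of _ "\<lambda>_. 0"])
  interpret M: prob_space M by fact
  interpret N: prob_space N by fact
  have one: "(\<integral>x. f x \<partial>M) - (\<integral>x. f x \<partial>N) \<le> 2 * c" if f: "f \<in> borel_measurable M" "\<And>x. \<bar>f x\<bar> \<le>
    1" for f :: "'a \<Rightarrow> real"
  proof -
    have fN: "f \<in> borel_measurable N" using f(1) by (simp add: measurable_cong_sets[OF s refl])
    have iM: "integrable M f" and iN: "integrable N f"
      using f fN by (auto intro!: M.integrable_const_bound[where B=1] N.integrable_const_bound[where
        B=1])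
    \<comment> \<open>Rescaling to values in [0, 1] makes the one-sided setwise bound applicable and
      doubles the constant. The other sign comes from the same bound for the negative of f.\<close>
    let ?f = "\<lambda>x. (f x + 1) / 2"
    have f01: "0 \<le> ?f x" "?f x \<le> 1" for x using f(2)[of x] by (auto simp: abs_le_iff)
    have "(\<integral>\<^sup>+x. ennreal (?f x) \<partial>M) \<le> (\<integral>\<^sup>+x. ennreal (?f x) \<partial>N) + ennreal c"
      using f f01 by (intro nn_integral_le_add_if_emeasure_le le s M.finite_measure_axioms
        N.finite_measure_axioms) auto
    moreover have "(\<integral>\<^sup>+x. ennreal (?f x) \<partial>M) = ennreal (\<integral>x. ?f x \<partial>M)" "(\<integral>\<^sup>+x. ennreal (?f x) \<partial>N) =
      ennreal (\<integral>x. ?f x \<partial>N)"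
    proof -
      have i: "integrable M ?f" "integrable N ?f" using iM iN by simp_all
      show "(\<integral>\<^sup>+x. ennreal (?f x) \<partial>M) = ennreal (\<integral>x. ?f x \<partial>M)" "(\<integral>\<^sup>+x. ennreal (?f x) \<partial>N) =
        ennreal (\<integral>x. ?f x \<partial>N)"
        by (rule nn_integral_eq_integral[OF i(1)], intro AE_I2 f01, rule nn_integral_eq_integral[OF
          i(2)], intro AE_I2 f01)
    qed
    moreover have "0 \<le> (\<integral>x. ?f x \<partial>M)" "0 \<le> (\<integral>x. ?f x \<partial>N)"
      using f01 by (auto intro!: Bochner_Integration.integral_nonneg)
    ultimately have "(\<integral>x. ?f x \<partial>M) \<le> (\<integral>x. ?f x \<partial>N) + c"
      using c by (simp add: ennreal_plus[symmetric] del: ennreal_plus)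
    moreover have "(\<integral>x. ?f x \<partial>M) = ((\<integral>x. f x \<partial>M) + 1) / 2" "(\<integral>x. ?f x \<partial>N) = ((\<integral>x. f x \<partial>N) + 1) / 2"
      using iM iN M.prob_space N.prob_space by simp_all
    ultimately show ?thesis by (simp add: field_simps)
  qed
  fix f :: "'a \<Rightarrow> real" assume f: "f \<in> {f \<in> borel_measurable M. \<forall>x. \<bar>f x\<bar> \<le> 1}"
  have "(\<integral>x. f x \<partial>M) - (\<integral>x. f x \<partial>N) \<le> 2 * c" "(\<integral>x. - f x \<partial>M) - (\<integral>x. - f x \<partial>N) \<le> 2 * c"
    using f by (intro one; simp)+
  then show "\<bar>(\<integral>x. f x \<partial>M) - (\<integral>x. f x \<partial>N)\<bar> \<le> 2 * c" by simp
qed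

lemma abs_measure_diff_le_tv_dist:
  assumes M: "prob_space M" and N: "prob_space N" and s: "sets M = sets N" and A: "A \<in> sets M"
  shows "\<bar>measure M A - measure N A\<bar> \<le> tv_dist M N"
proof -
  have "\<bar>integral\<^sup>L M (indicator A) - integral\<^sup>L N (indicator A :: _ \<Rightarrow> real)\<bar> \<le> tv_dist M N"
    unfolding tv_dist_def
    by (rule cSUP_upper[OF _ tv_dist_bdd_above[OF M N s]]) (use A in \<open>auto simp: indicator_def\<close>)
  moreover have "integral\<^sup>L M (indicator A :: _ \<Rightarrow> real) =
    measure M A" "integral\<^sup>L N (indicator A :: _ \<Rightarrow> real) = measure N A"
    using A sets.sets_into_space[OF A] s
      by (auto simp: Int_absorb1 Int_absorb2 sets_eq_imp_space_eq[OF s] intro!: arg_cong[where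
      f="measure N"])
  ultimately show ?thesis by simp
qed

lemma tv_dist_nonneg:
  assumes "prob_space M" "prob_space N" "sets M = sets N"
  shows "0 \<le> tv_dist M N"
  using abs_measure_diff_le_tv_dist[OF assms, of "{}"] by simp

lemma emeasure_le_tv_dist:
  assumes M: "prob_space M" and N: "prob_space N" and s: "sets M = sets N" and A: "A \<in> sets M"
  shows "emeasure M A \<le> emeasure N A + ennreal (tv_dist M N)"
proof -
  interpret M: prob_space M by fact
  interpret N: prob_space N by fact
  have "measure M A \<le> measure N A + tv_dist M N"
    using abs_measure_diff_le_tv_dist[OF assms] by simp
  then show ?thesis
    using tv_dist_nonneg[OF M N s]
    by (simp add: M.emeasure_eq_measure N.emeasure_eq_measure ennreal_plus[symmetric] del: ennreal_plus)
qed

context hmm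
begin

section \<open>Observation histories under the law of the model\<close>

lemma hmm_law_facts:
  assumes \<nu>: "\<nu> \<in> space (prob_algebra borel)"
  shows "prob_space (hmm_law P (obs g) \<nu>)"
    and "sets (hmm_law P (obs g) \<nu>) = sets ((\<Pi>\<^sub>M n\<in>UNIV. borel) \<Otimes>\<^sub>M MH)"
    and "space (hmm_law P (obs g) \<nu>) = UNIV"
proof -
  show "prob_space (hmm_law P (obs g) \<nu>)"
    by (rule prob_space_hmm_law[OF P \<nu> obs_kernel[OF g]])
  show s: "sets (hmm_law P (obs g) \<nu>) = sets ((\<Pi>\<^sub>M n\<in>UNIV. borel) \<Otimes>\<^sub>M MH)"
    by (rule sets_hmm_law[OF P \<nu> obs_kernel[OF g]])
  show "space (hmm_law P (obs g) \<nu>) = UNIV"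
    using sets_eq_imp_space_eq[OF s] by (simp add: space_pair_measure space_PiM)
qed

lemma hmm_law_coord:
  assumes \<nu>: "\<nu> \<in> space (prob_algebra borel)"
  shows "distr (hmm_law P (obs g) \<nu>) borel (\<lambda>(x, y). x n) = \<nu> \<bind> Pn n"
proof (rule measure_eqI)
  have s: "sets \<nu> = sets borel" using \<nu> by (simp add: space_prob_algebra)
  have sb: "sets (\<nu> \<bind> Pn n) = sets borel" by (rule sets_bind'[OF \<nu> Pn_kernel])
  then show "sets (distr (hmm_law P (obs g) \<nu>) borel (\<lambda>(x, y). x n)) = sets (\<nu> \<bind> Pn n)" by simp
  fix A assume "A \<in> sets (distr (hmm_law P (obs g) \<nu>) borel (\<lambda>(x, y). x n))"
  then have A[measurable]: "A \<in> sets borel" by simp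
  note hmm_law_facts(2)[OF \<nu>, measurable_cong] sets_markov_law[OF P \<nu>, measurable_cong]
  have X: "{x :: nat \<Rightarrow> 'e. x n \<in> A} \<in> sets (\<Pi>\<^sub>M n\<in>UNIV. borel)"
  proof -
    have "{x \<in> space (\<Pi>\<^sub>M n\<in>UNIV. borel). x n \<in> A} \<in> sets (\<Pi>\<^sub>M n\<in>(UNIV::nat set). borel)" by measurable
    then show ?thesis by (simp add: space_PiM)
  qed
  have "emeasure (distr (hmm_law P (obs g) \<nu>) borel (\<lambda>(x, y). x n)) A =
      emeasure (hmm_law P (obs g) \<nu>) ({x. x n \<in> A} \<times> {y. \<forall>j\<in>{}. y j \<in> UNIV})"
    by (subst emeasure_distr) (auto simp: hmm_law_facts(3)[OF \<nu>] intro!: arg_cong[where f="emeasure _"])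
  also have "\<dots> = (\<integral>\<^sup>+x. indicator {x. x n \<in> A} x \<partial>markov_law P \<nu>)"
    using emeasure_hmm_law[OF P \<nu> obs_kernel[OF g] X, of "{}" "\<lambda>_. UNIV"] by simp
  also have "\<dots> = (\<integral>\<^sup>+x. indicator A (x n) \<partial>markov_law P \<nu>)"
    by (intro nn_integral_cong) (auto split: split_indicator)
  also have "\<dots> = (\<integral>\<^sup>+x. \<integral>\<^sup>+z. indicator A z \<partial>Pn n x \<partial>\<nu>)"
    by (rule nn_integral_markov_law_coord[OF P \<nu>]) measurable
  also have "\<dots> = (\<integral>\<^sup>+z. indicator A z \<partial>(\<nu> \<bind> Pn n))"
    by (rule nn_integral_bind_prob[symmetric, OF s Pn_kernel]) measurable
  also have "\<dots> = emeasure (\<nu> \<bind> Pn n) A" by (simp add: sb)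
  finally show "emeasure (distr (hmm_law P (obs g) \<nu>) borel (\<lambda>(x, y). x n)) A = emeasure (\<nu> \<bind> Pn n) A" .
qed

text \<open>The two laws are compared on cylinders, where \<open>emeasure_hmm_law\<close> and
  \<open>nn_integral_joint_cylinder\<close> give the same product up to the reversal of
  time.\<close>

lemma hmm_law_hist:
  assumes \<nu>: "\<nu> \<in> space (prob_algebra borel)"
  shows "distr (hmm_law P (obs g) \<nu>) MH (\<lambda>s. hist n (snd s)) = distr (joint \<nu> n) MH snd"
proof (rule measure_eqI_PiM_infinite)
  note hmm_law_facts(2)[OF \<nu>, measurable_cong] joint_in(2)[OF \<nu>, measurable_cong]
  have spj: "space (joint \<nu> n) = UNIV"
    using sets_eq_imp_space_eq[OF joint_in(2)[OF \<nu>]] by simp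
  have hm: "(\<lambda>s. hist n (snd s)) \<in> hmm_law P (obs g) \<nu> \<rightarrow>\<^sub>M MH" by measurable
  show "finite_measure (distr (hmm_law P (obs g) \<nu>) MH (\<lambda>s. hist n (snd s)))"
    using prob_space.prob_space_distr[OF hmm_law_facts(1)[OF \<nu>] hm] by (rule prob_space.finite_measure)
  fix A :: "nat \<Rightarrow> 'f set" and J assume J: "finite J" and A0: "\<And>i. i \<in> J \<Longrightarrow> A i \<in> sets borel"
  obtain k where k: "\<And>j. j \<in> J \<Longrightarrow> j < k"
    using J by (auto simp: finite_nat_set_iff_bounded)
  define N where "N = max k n"
  have N: "n \<le> N" "\<And>j. j \<in> J \<Longrightarrow> j < N" using k by (auto simp: N_def less_max_iff_disj)
  define C where "C j = (if j \<in> J then A j else UNIV)" for j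
  have C[measurable]: "C j \<in> sets borel" for j using A0 by (simp add: C_def)
  have X: "prod_emb UNIV (\<lambda>_. borel) J (Pi\<^sub>E J A) = {h. \<forall>j<N. h j \<in> C j}"
    using N(2) by (auto simp: prod_emb_def C_def)
  have Xm: "{h. \<forall>j<N. h j \<in> C j} \<in> sets MH"
    unfolding X[symmetric] using J A0 by (intro sets_PiM_I) auto
  have "emeasure (distr (joint \<nu> n) MH snd) {h. \<forall>j<N. h j \<in> C j} =
    (\<integral>\<^sup>+s. indicator {h. \<forall>j<N. h j \<in> C j} (snd s) \<partial>joint \<nu> n)"
  proof -
    have "emeasure (distr (joint \<nu> n) MH snd) {h. \<forall>j<N. h j \<in> C j} =
      (\<integral>\<^sup>+h. indicator {h. \<forall>j<N. h j \<in> C j} h \<partial>distr (joint \<nu> n) MH snd)"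
      using Xm by simp
    also have "\<dots> = (\<integral>\<^sup>+s. indicator {h. \<forall>j<N. h j \<in> C j} (snd s) \<partial>joint \<nu> n)"
      using Xm by (intro nn_integral_distr) auto
    finally show ?thesis .
  qed
  also have "\<dots> = (\<integral>\<^sup>+s. 1 * (\<Prod>j<N. indicator (C j) (snd s j)) \<partial>joint \<nu> n)"
    by (intro nn_integral_cong) (auto simp: indicator_def prod_zero_iff)
  also have "\<dots> = (\<Prod>j\<in>{n..<N}. indicator (C j) undefined) *
      (\<integral>\<^sup>+x. (\<Prod>i<n. \<integral>\<^sup>+w. indicator (C (n - Suc i)) w \<partial>obs g (x i)) * 1 \<partial>markov_law P \<nu>)"
    by (rule nn_integral_joint_cylinder[OF \<nu> N(1), where f="\<lambda>_. 1"]) auto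
  also have "\<dots> = (\<Prod>j\<in>{n..<N}. indicator (C j) undefined) *
    (\<integral>\<^sup>+x. (\<Prod>i<n. emeasure (obs g (x i)) (C (n - Suc i))) \<partial>markov_law P \<nu>)"
    by simp
  also have "(\<integral>\<^sup>+x. (\<Prod>i<n. emeasure (obs g (x i)) (C (n - Suc i))) \<partial>markov_law P \<nu>) =
      emeasure (hmm_law P (obs g) \<nu>) (UNIV \<times> {y. \<forall>i\<in>{..<n}. y i \<in> C (n - Suc i)})"
  proof -
    have "UNIV \<in> sets (\<Pi>\<^sub>M n\<in>(UNIV :: nat set). (borel :: 'e measure))"
      using sets.top[of "\<Pi>\<^sub>M n\<in>(UNIV :: nat set). (borel :: 'e measure)"] by (simp add: space_PiM)
    from emeasure_hmm_law[OF P \<nu> obs_kernel[OF g] this, of "{..<n}"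
      "\<lambda>i. C (n - Suc i)"] show ?thesis by simp
  qed
  also have "(\<Prod>j\<in>{n..<N}. indicator (C j) undefined) *
    emeasure (hmm_law P (obs g) \<nu>) (UNIV \<times> {y. \<forall>i\<in>{..<n}. y i \<in> C (n - Suc i)}) =
      emeasure (hmm_law P (obs g) \<nu>) {s. hist n (snd s) \<in> {h. \<forall>j<N. h j \<in> C j}}"
  proof (cases "\<forall>j\<in>{n..<N}. undefined \<in> C j")
    case True
    have "(\<forall>j<N. hist n y j \<in> C j) \<longleftrightarrow> (\<forall>i\<in>{..<n}. y i \<in> C (n - Suc i))" for y
    proof
      assume *: "\<forall>j<N. hist n y j \<in> C j"
      show "\<forall>i\<in>{..<n}. y i \<in> C (n - Suc i)"
      proof
        fix i assume "i \<in> {..<n}"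
        then have "n - Suc i < N" "n - Suc i < n" "n - Suc (n - Suc i) = i" using N(1) by auto
        then show "y i \<in> C (n - Suc i)" using *[rule_format, of "n - Suc i"] by (simp add: hist_nth)
      qed
    next
      assume *: "\<forall>i\<in>{..<n}. y i \<in> C (n - Suc i)"
      show "\<forall>j<N. hist n y j \<in> C j"
      proof (intro allI impI)
        fix j assume "j < N"
        show "hist n y j \<in> C j"
        proof (cases "j < n")
          case True
          then have "n - Suc j \<in> {..<n}" "n - Suc (n - Suc j) = j" by auto
          then show ?thesis using * True by (metis hist_nth)
        qed (use \<open>j < N\<close> \<open>\<forall>j\<in>{n..<N}. undefined \<in> C j\<close> in \<open>auto simp: hist_nth\<close>)
      qed
    qed
    then have "{s :: (nat \<Rightarrow> 'e) \<times> (nat \<Rightarrow> 'f). hist n (snd s) \<in> {h. \<forall>j<N. h j \<in> C j}} =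
      UNIV \<times> {y. \<forall>i\<in>{..<n}. y i \<in> C (n - Suc i)}"
      by auto
    moreover have "(\<Prod>j\<in>{n..<N}. indicator (C j) undefined) = (1 :: ennreal)"
      using True by (intro prod.neutral) simp
    ultimately show ?thesis by simp
  next
    case False
    then obtain j where j: "j \<in> {n..<N}" "undefined \<notin> C j" by auto
    then have "hist n y j \<notin> C j" for y by (simp add: hist_nth)
    then have "{s :: (nat \<Rightarrow> 'e) \<times> (nat \<Rightarrow> 'f). hist n (snd s) \<in> {h. \<forall>j<N. h j \<in> C j}} = {}"
      using j(1) by auto
    moreover have "(\<Prod>j\<in>{n..<N}. indicator (C j) undefined) = (0 :: ennreal)"
      using j by (intro prod_zero bexI[of _ j]) simp_all
    ultimately show ?thesis by (simp only: mult_zero_left emeasure_empty)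
  qed
  also have "\<dots> = emeasure (distr (hmm_law P (obs g) \<nu>) MH (\<lambda>s. hist n (snd s))) {h. \<forall>j<N. h j \<in> C j}"
    using Xm by (subst emeasure_distr[OF hm]) (auto simp: hmm_law_facts(3)[OF \<nu>] vimage_def)
  finally show "emeasure (distr (hmm_law P (obs g) \<nu>) MH (\<lambda>s. hist n (snd s))) (prod_emb UNIV (\<lambda>_.
    borel) J (Pi\<^sub>E J A)) =
      emeasure (distr (joint \<nu> n) MH snd) (prod_emb UNIV (\<lambda>_. borel) J (Pi\<^sub>E J A))"
    by (simp only: X)
qed simp_all

definition mass :: "((nat \<Rightarrow> 'f) \<Rightarrow> 'e measure) \<Rightarrow> (nat \<Rightarrow> 'f) \<Rightarrow> ennreal" where
  "mass K h = emeasure (K h) UNIV"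

lemma mass_eq: "kernel_family K \<Longrightarrow> mass K h = (\<integral>\<^sup>+x. 1 \<partial>K h)"
  using kernel_familyD(3)[of K h] by (simp add: mass_def)

lemma mass_measurable: "kernel_family K \<Longrightarrow> mass K \<in> borel_measurable MH"
  using kernel_familyD(5)[of K "\<lambda>_. 1"] by (simp add: mass_eq cong: measurable_cong)

text \<open>Shows that \<open>mass (predict \<nu> n)\<close> is the likelihood ratio of the first n
  observations under \<nu> relative to the reference noise.\<close>

lemma nn_integral_hmm_law_hist:
  assumes \<nu>: "\<nu> \<in> space (prob_algebra borel)" and f[measurable]: "f \<in> borel_measurable MH"
  shows "(\<integral>\<^sup>+s. f (hist n (snd s)) \<partial>hmm_law P (obs g) \<nu>) = (\<integral>\<^sup>+h. f h * mass (predict \<nu> n) h \<partial>noise n)"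
proof -
  note hmm_law_facts(2)[OF \<nu>, measurable_cong] joint_in(2)[OF \<nu>, measurable_cong]
  note K = kernel_family_predict[OF \<nu>, of n]
  have "(\<integral>\<^sup>+s. f (hist n (snd s)) \<partial>hmm_law P (obs g) \<nu>) =
    (\<integral>\<^sup>+h. f h \<partial>distr (hmm_law P (obs g) \<nu>) MH (\<lambda>s. hist n (snd s)))"
    by (subst nn_integral_distr) auto
  also have "\<dots> = (\<integral>\<^sup>+s. f (snd s) \<partial>joint \<nu> n)"
    unfolding hmm_law_hist[OF \<nu>] by (subst nn_integral_distr) auto
  also have "\<dots> = (\<integral>\<^sup>+h. \<integral>\<^sup>+x. f h \<partial>predict \<nu> n h \<partial>noise n)"
    by (subst nn_integral_joint_predict[OF \<nu>]) auto
  also have "\<dots> = (\<integral>\<^sup>+h. f h * mass (predict \<nu> n) h \<partial>noise n)"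
    by (simp add: mass_def kernel_familyD(3)[OF K])
  finally show ?thesis .
qed

lemma mass_predict_finite:
  assumes \<nu>: "\<nu> \<in> space (prob_algebra borel)"
  shows "AE h in noise n. mass (predict \<nu> n) h < \<infinity>"
proof -
  have "(\<integral>\<^sup>+h. mass (predict \<nu> n) h \<partial>noise n) = 1"
    using nn_integral_hmm_law_hist[OF \<nu>, of "\<lambda>_. 1" n] prob_space.emeasure_space_1[OF
      hmm_law_facts(1)[OF \<nu>]] by simp
  moreover have "mass (predict \<nu> n) \<in> borel_measurable (noise n)"
    using mass_measurable[OF kernel_family_predict[OF \<nu>]] by simp
  ultimately have "AE h in noise n. mass (predict \<nu> n) h \<noteq> \<infinity>"
    by (intro nn_integral_PInf_AE) auto
  then show ?thesis by (simp add: less_top)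
qed

text \<open>Since \<open>mass\<close> is a density, observation laws from all initial measures are
  absolutely continuous with respect to the noise. Regularity of the \<pi>-filter therefore holds
  almost surely also along observations of the chain started from another law.\<close>

lemma AE_hmm_law_hist:
  assumes \<nu>: "\<nu> \<in> space (prob_algebra borel)" and Q: "AE h in noise n. Q h"
  shows "AE s in hmm_law P (obs g) \<nu>. Q (hist n (snd s))"
proof -
  obtain Z where Z: "{h\<in>space (noise n). \<not> Q h} \<subseteq> Z" "emeasure (noise n) Z = 0" "Z \<in> sets (noise n)"
    using AE_E[OF Q] by auto
  have Zm[measurable]: "Z \<in> sets MH" using Z(3) by simp
  note hmm_law_facts(2)[OF \<nu>, measurable_cong]
  have "(\<integral>\<^sup>+s. indicator Z (hist n (snd s)) \<partial>hmm_law P (obs g) \<nu>) =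
    (\<integral>\<^sup>+h. indicator Z h * mass (predict \<nu> n) h \<partial>noise n)"
    by (rule nn_integral_hmm_law_hist[OF \<nu>]) measurable
  also have "\<dots> = 0"
  proof (subst nn_integral_0_iff_AE)
    show "(\<lambda>h. indicator Z h * mass (predict \<nu> n) h) \<in> borel_measurable (noise n)"
      using mass_measurable[OF kernel_family_predict[OF \<nu>]] by measurable
    have "AE h in noise n. h \<notin> Z" using Z by (intro AE_not_in) (auto simp: null_sets_def)
    then show "AE h in noise n. indicator Z h * mass (predict \<nu> n) h = 0" by eventually_elim simp
  qed
  finally have "AE s in hmm_law P (obs g) \<nu>. indicator Z (hist n (snd s)) = (0 :: ennreal)"
    by (subst (asm) nn_integral_0_iff_AE) auto
  then show ?thesis
  proof eventually_elim
    case (elim s)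
    then show ?case using Z(1) by (auto split: split_indicator_asm)
  qed
qed

section \<open>Filters as normalised kernels\<close>

definition updated :: "((nat \<Rightarrow> 'f) \<Rightarrow> 'e measure) \<Rightarrow> (nat \<Rightarrow> 'f) \<Rightarrow> 'e measure" where
  "updated K h = density (K (\<lambda>i. h (Suc i))) (\<lambda>x. ennreal (g x (h 0)))"

text \<open>The last fact holds because P has mass one: moving the signal does not change the total
  mass, so the normalising constant of a filter is the mass of the next prediction.\<close>

lemma updated_facts:
  assumes K: "kernel_family K"
  shows "sets (updated K h) = sets borel" "space (updated K h) = UNIV"
    and "f \<in> borel_measurable borel \<Longrightarrow> (\<integral>\<^sup>+x. f x \<partial>updated K h) =
      (\<integral>\<^sup>+x. ennreal (g x (h 0)) * f x \<partial>K (\<lambda>i. h (Suc i)))"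
    and "emeasure (updated K h) UNIV = mass (advance K) h"
proof -
  note kernel_familyD(2)[OF K, measurable_cong] g_section[measurable]
  show s: "sets (updated K h) = sets borel" by (simp add: updated_def kernel_familyD(2)[OF K])
  show sp: "space (updated K h) = UNIV" using sets_eq_imp_space_eq[OF s] by simp
  show d: "f \<in> borel_measurable borel \<Longrightarrow> (\<integral>\<^sup>+x. f x \<partial>updated K h) =
    (\<integral>\<^sup>+x. ennreal (g x (h 0)) * f x \<partial>K (\<lambda>i. h (Suc i)))" for f
    unfolding updated_def by (rule nn_integral_density) measurable
  have "emeasure (updated K h) UNIV = (\<integral>\<^sup>+x. 1 \<partial>updated K h)" by (simp add: sp)
  also have "\<dots> = (\<integral>\<^sup>+x. ennreal (g x (h 0)) * 1 \<partial>K (\<lambda>i. h (Suc i)))" by (rule d) simp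
  also have "\<dots> = (\<integral>\<^sup>+x. ennreal (g x (h 0)) * (\<integral>\<^sup>+z. 1 \<partial>P x) \<partial>K (\<lambda>i. h (Suc i)))"
    using prob_space.emeasure_space_1[OF prob_P] by simp
  also have "\<dots> = (\<integral>\<^sup>+x. 1 \<partial>advance K h)"
    unfolding advance_def by (rule nn_integral_advance[symmetric, OF kernel_familyD(2)[OF K]]) simp
  also have "\<dots> = mass (advance K) h" by (rule mass_eq[symmetric, OF kernel_family_advance[OF K]])
  finally show "emeasure (updated K h) UNIV = mass (advance K) h" .
qed

lemma hmm_filter_updated:
  assumes \<nu>: "\<nu> \<in> space (prob_algebra borel)"
    and \<rho>: "\<And>n. \<rho> n \<in> (\<Pi>\<^sub>M k\<in>UNIV. borel) \<rightarrow>\<^sub>M prob_algebra borel"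
    and fin: "\<And>k. k \<le> n \<Longrightarrow> mass (predict \<nu> (Suc k)) (hist (Suc k) y) < \<infinity>"
  shows "hmm_filter P g \<rho> \<nu> n y = scale_measure (1 / mass (predict \<nu> (Suc n)) (hist (Suc n) y))
    (updated (predict \<nu> n) (hist (Suc n) y))"
  using fin
proof (induction n)
  note [simp del] = funpow.simps funpow_0 hmm_filter.simps
  case 0
  have g0: "\<And>z u. 0 < g z u" by (rule obs_densityD(2)[OF g])
  note K = kernel_family_predict[OF \<nu>]
  show ?case
  proof (rule measure_eqI)
    have "hmm_filter P g \<rho> \<nu> 0 y \<in> space (prob_algebra borel)"
      by (rule hmm_filter_prob[OF P obs_densityD(1)[OF g] g0 \<rho> \<nu>])
    then have s: "sets (hmm_filter P g \<rho> \<nu> 0 y) = sets borel" by (simp add: space_prob_algebra)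
    then show "sets (hmm_filter P g \<rho> \<nu> 0 y) =
      sets (scale_measure (1 / mass (predict \<nu> (Suc 0)) (hist (Suc 0) y)) (updated (predict \<nu> 0)
      (hist (Suc 0) y)))"
      by (simp add: updated_facts(1)[OF K])
    fix A assume "A \<in> sets (hmm_filter P g \<rho> \<nu> 0 y)"
    then have A: "A \<in> sets borel" by (simp add: s)
    have c: "(\<integral>\<^sup>+z. ennreal (g z (y 0)) \<partial>\<nu>) = mass (predict \<nu> (Suc 0)) (hist (Suc 0) y)"
      using updated_facts(3)[OF K, of "\<lambda>_. 1" 0 "hist (Suc 0) y"] updated_facts(2,4)[OF K, of 0
        "hist (Suc 0) y"] by (simp add: funpow.simps)
    have "emeasure (updated (predict \<nu> 0) (hist (Suc 0) y)) A =
      (\<integral>\<^sup>+z. indicator A z \<partial>updated (predict \<nu> 0) (hist (Suc 0) y))"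
      using A by (simp add: updated_facts(1)[OF K])
    also have "\<dots> = (\<integral>\<^sup>+z. indicator A z * ennreal (g z (y 0)) \<partial>\<nu>)"
      using A by (subst updated_facts(3)[OF K]) (simp_all add: mult.commute funpow.simps(1))
    finally show "emeasure (hmm_filter P g \<rho> \<nu> 0 y) A =
      emeasure (scale_measure (1 / mass (predict \<nu> (Suc 0)) (hist (Suc 0) y)) (updated (predict \<nu> 0)
      (hist (Suc 0) y))) A"
      using emeasure_hmm_filter_0[OF P obs_densityD(1)[OF g] g0 \<rho> \<nu> A, of y] 0[of 0]
      by (simp add: c divide_ennreal_def mult.commute del: hmm_filter.simps)
  qed
next
  note [simp del] = funpow.simps funpow_0 hmm_filter.simps
  case (Suc n)
  have g0: "\<And>z u. 0 < g z u" by (rule obs_densityD(2)[OF g])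
  note K = kernel_family_predict[OF \<nu>]
  let ?c = "mass (predict \<nu> (Suc n)) (hist (Suc n) y)"
    and ?c' = "mass (predict \<nu> (Suc (Suc n))) (hist (Suc (Suc n)) y)"
  let ?M = "updated (predict \<nu> n) (hist (Suc n) y)"
    and ?M' = "updated (predict \<nu> (Suc n)) (hist (Suc (Suc n)) y)"
  have IH: "hmm_filter P g \<rho> \<nu> n y = scale_measure (1 / ?c) ?M"
    using Suc.prems by (intro Suc.IH) auto
  have cfin: "?c < \<infinity>" "?c' < \<infinity>" using Suc.prems[of n] Suc.prems[of "Suc n"] by auto
  have pr: "hmm_filter P g \<rho> \<nu> k y \<in> space (prob_algebra borel)" for k
    by (rule hmm_filter_prob[OF P obs_densityD(1)[OF g] g0 \<rho> \<nu>])
  have "emeasure (hmm_filter P g \<rho> \<nu> n y) UNIV = 1"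
    using in_space_prob_algebra[OF pr[of n]] by simp
  \<comment> \<open>The filter is a probability measure for any fallback, so its unnormalised
    version cannot have mass 0.\<close>
  then have c0: "?c \<noteq> 0"
    unfolding IH by (auto simp: updated_facts(4)[OF K] funpow.simps(2))
  have adv: "(\<integral>\<^sup>+z'. \<integral>\<^sup>+z. f z \<partial>P z' \<partial>hmm_filter P g \<rho> \<nu> n y) =
    (1 / ?c) * (\<integral>\<^sup>+z. f z \<partial>predict \<nu> (Suc n) (hist (Suc n) y))"
    if f[measurable]: "f \<in> borel_measurable borel" for f
  proof -
    have "(\<integral>\<^sup>+z'. \<integral>\<^sup>+z. f z \<partial>P z' \<partial>hmm_filter P g \<rho> \<nu> n y) = (1 / ?c) * (\<integral>\<^sup>+z'. \<integral>\<^sup>+z. f z \<partial>P z' \<partial>?M)"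
      unfolding IH by (rule nn_integral_scale_measure)
        (simp add: measurable_cong_sets[OF updated_facts(1)[OF K] refl])
    also have "(\<integral>\<^sup>+z'. \<integral>\<^sup>+z. f z \<partial>P z' \<partial>?M) = (\<integral>\<^sup>+z. f z \<partial>(?M \<bind> P))"
      by (rule nn_integral_bind_prob[symmetric, OF updated_facts(1)[OF K] P f])
    also have "?M \<bind> P = predict \<nu> (Suc n) (hist (Suc n) y)"
      by (simp add: updated_def advance_def funpow.simps(2))
    finally show ?thesis .
  qed
  have upd: "(\<integral>\<^sup>+z. f z \<partial>?M') = (\<integral>\<^sup>+z. ennreal (g z (y (Suc n))) *
    f z \<partial>predict \<nu> (Suc n) (hist (Suc n) y))"
    if f: "f \<in> borel_measurable borel" for f
    using updated_facts(3)[OF K f, of "Suc n" "hist (Suc (Suc n)) y"] by simp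
  have e1: "(\<integral>\<^sup>+z'. \<integral>\<^sup>+z. ennreal (g z (y (Suc n))) \<partial>P z' \<partial>hmm_filter P g \<rho> \<nu> n y) = (1 / ?c) * ?c'"
    using adv[OF g_section[of "y (Suc n)"]] upd[of "\<lambda>_. 1"] updated_facts(2,4)[OF K, of "Suc n"
      "hist (Suc (Suc n)) y"]
    by (simp add: funpow.simps(2)[of "Suc n"])
  show ?case
  proof (rule measure_eqI)
    have s: "sets (hmm_filter P g \<rho> \<nu> (Suc n) y) = sets borel"
      using pr[of "Suc n"] by (simp add: space_prob_algebra)
    show "sets (hmm_filter P g \<rho> \<nu> (Suc n) y) = sets (scale_measure (1 / ?c') ?M')"
      using s by (simp add: updated_facts(1)[OF K] del: hmm_filter.simps)
    fix A assume "A \<in> sets (hmm_filter P g \<rho> \<nu> (Suc n) y)"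
    then have A[measurable]: "A \<in> sets borel" using s by (simp del: hmm_filter.simps)
    note g_section[measurable]
    have "(\<lambda>z. indicator A z * ennreal (g z (y (Suc n)))) \<in> borel_measurable borel" by measurable
    from adv[OF this] have e2: "(\<integral>\<^sup>+z'. \<integral>\<^sup>+z. indicator A z *
      ennreal (g z (y (Suc n))) \<partial>P z' \<partial>hmm_filter P g \<rho> \<nu> n y) =
        (1 / ?c) * emeasure ?M' A"
      using upd[of "indicator A"] by (simp add: updated_facts(1)[OF K] mult.commute)
    have "(\<integral>\<^sup>+z'. \<integral>\<^sup>+z. ennreal (g z (y (Suc n))) \<partial>P z' \<partial>hmm_filter P g \<rho> \<nu> n y) < \<infinity>"
      unfolding e1 using c0 cfin by (auto simp: ennreal_mult_eq_top_iff divide_ennreal_def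
        less_top[symmetric])
    then have "emeasure (hmm_filter P g \<rho> \<nu> (Suc n) y) A =
      ((1 / ?c) * emeasure ?M' A) / ((1 / ?c) * ?c')"
      using emeasure_hmm_filter_Suc[OF P obs_densityD(1)[OF g] g0 \<rho> \<nu> A, where n=n and y=y]
        by (simp only: e1 e2)
    also have "\<dots> = (1 / ?c') * emeasure ?M' A"
    proof -
      have i: "1 / ?c \<noteq> 0" "1 / ?c \<noteq> \<infinity>"
        using c0 cfin by (auto simp: divide_ennreal_def)
      have "((1 / ?c) * emeasure ?M' A) / ((1 / ?c) * ?c') = emeasure ?M' A / ?c'"
        using divide_mult_eq[OF i, of "emeasure ?M' A" ?c'] by (simp only: mult.commute)
      then show ?thesis by (simp add: divide_ennreal_def mult.commute)
    qed
    finally show "emeasure (hmm_filter P g \<rho> \<nu> (Suc n) y) A = emeasure (scale_measure (1 / ?c') ?M') A"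
      by (simp del: hmm_filter.simps)
  qed
qed

text \<open>By \<open>nn_integral_steps_eq_0\<close> the observations may be replaced by noise
  without changing null sets, and then signal and history are independent.\<close>

lemma nn_integral_joint_eq_0_iff:
  assumes \<nu>: "\<nu> \<in> space (prob_algebra borel)" and F[measurable]: "F \<in> borel_measurable EH"
  shows "(\<integral>\<^sup>+s. F s \<partial>joint \<nu> n) = 0 \<longleftrightarrow> (\<integral>\<^sup>+h. \<integral>\<^sup>+z. F (z, h) \<partial>(\<nu> \<bind> Pn n) \<partial>noise n) = 0"
proof -
  have s[measurable_cong]: "sets \<nu> = sets borel" and p: "prob_space \<nu>" using \<nu>
    by (auto simp: space_prob_algebra)
  let ?G = "\<lambda>g x. \<integral>\<^sup>+s. F s \<partial>steps g n (x, origin)"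
  have m: "?G g' \<in> borel_measurable \<nu>" if "obs_density g'" for g'
    using measurable_compose[OF start_in(3)[OF \<nu>] steps_integral_measurable[OF that F]] by simp
  have "(\<integral>\<^sup>+s. F s \<partial>joint \<nu> n) = (\<integral>\<^sup>+s. \<integral>\<^sup>+s'. F s' \<partial>steps g n s \<partial>distr \<nu> EH (\<lambda>x. (x, origin)))"
    unfolding joint_def by (rule nn_integral_bind_prob[OF start_in(2)[OF \<nu>] steps_kernel[OF g] F])
  also have "\<dots> = (\<integral>\<^sup>+x. ?G g x \<partial>\<nu>)"
    using steps_integral_measurable[OF g F] by (subst nn_integral_distr[OF start_in(3)[OF \<nu>]]) simp_all
  finally have "(\<integral>\<^sup>+s. F s \<partial>joint \<nu> n) = 0 \<longleftrightarrow> (AE x in \<nu>. ?G g x = 0)"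
    by (simp add: nn_integral_0_iff_AE[OF m[OF g]])
  also have "\<dots> \<longleftrightarrow> (AE x in \<nu>. ?G blind x = 0)"
    using nn_integral_steps_eq_0[OF g obs_density_1 F, of "(_, origin)"] nn_integral_steps_eq_0[OF
      obs_density_1 g F, of "(_, origin)"]
    by (intro AE_cong) auto
  also have "\<dots> \<longleftrightarrow> (\<integral>\<^sup>+x. ?G blind x \<partial>\<nu>) = 0"
    by (simp add: nn_integral_0_iff_AE[OF m[OF obs_density_1]])
  also have "(\<integral>\<^sup>+x. ?G blind x \<partial>\<nu>) = (\<integral>\<^sup>+x. \<integral>\<^sup>+h. \<integral>\<^sup>+z. F (z, h) \<partial>Pn n x \<partial>noise n \<partial>\<nu>)"
    by (intro nn_integral_cong nn_integral_steps_blind F) simp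
  also have "\<dots> = (\<integral>\<^sup>+h. \<integral>\<^sup>+x. \<integral>\<^sup>+z. F (z, h) \<partial>Pn n x \<partial>\<nu> \<partial>noise n)"
    by (rule nn_integral_swap_prob[OF p prob_noise]) measurable
  also have "\<dots> = (\<integral>\<^sup>+h. \<integral>\<^sup>+z. F (z, h) \<partial>(\<nu> \<bind> Pn n) \<partial>noise n)"
    by (intro nn_integral_cong nn_integral_bind_prob[symmetric, OF s Pn_kernel]) measurable
  finally show ?thesis .
qed

lemma nn_integral_joint_fst:
  assumes \<nu>: "\<nu> \<in> space (prob_algebra borel)" and f[measurable]: "f \<in> borel_measurable borel"
  shows "(\<integral>\<^sup>+s. f (fst s) \<partial>joint \<nu> n) = (\<integral>\<^sup>+z. f z \<partial>(\<nu> \<bind> Pn n))"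
proof -
  have s[measurable_cong]: "sets \<nu> = sets borel" using \<nu> by (auto simp: space_prob_algebra)
  have F: "(\<lambda>s. f (fst s)) \<in> borel_measurable EH" by measurable
  have "(\<integral>\<^sup>+s. f (fst s) \<partial>joint \<nu> n) =
    (\<integral>\<^sup>+s. \<integral>\<^sup>+s'. f (fst s') \<partial>steps g n s \<partial>distr \<nu> EH (\<lambda>x. (x, origin)))"
    unfolding joint_def by (rule nn_integral_bind_prob[OF start_in(2)[OF \<nu>] steps_kernel[OF g] F])
  also have "\<dots> = (\<integral>\<^sup>+x. \<integral>\<^sup>+s'. f (fst s') \<partial>steps g n (x, origin) \<partial>\<nu>)"
    using steps_integral_measurable[OF g F] by (subst nn_integral_distr[OF start_in(3)[OF \<nu>]]) simp_all
  also have "\<dots> = (\<integral>\<^sup>+x. \<integral>\<^sup>+z. f z \<partial>Pn n x \<partial>\<nu>)"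
    by (intro nn_integral_cong nn_integral_steps_fst[OF g f]) simp
  also have "\<dots> = (\<integral>\<^sup>+z. f z \<partial>(\<nu> \<bind> Pn n))"
    by (rule nn_integral_bind_prob[symmetric, OF s Pn_kernel f])
  finally show ?thesis .
qed

text \<open>Off B, the law of \<open>X\<^sub>n\<close> started from \<nu> is absolutely continuous
  with respect to \<pi>, and \<open>nn_integral_joint_eq_0_iff\<close> lifts this to the joint laws
  with the history. Hence a null set of \<open>joint \<pi> n\<close> receives mass from B
  only.\<close>

lemma emeasure_joint_le:
  assumes \<nu>: "\<nu> \<in> space (prob_algebra borel)" and B[measurable]: "B \<in> sets borel"
    and X[measurable]: "X \<in> sets EH"
    and ac: "\<And>A. A \<in> sets borel \<Longrightarrow> emeasure \<pi> A = 0 \<Longrightarrow> emeasure (\<nu> \<bind> Pn n) (A - B) = 0"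
    and zero: "emeasure (joint \<pi> n) X = 0"
  shows "emeasure (joint \<nu> n) X \<le> emeasure (\<nu> \<bind> Pn n) B"
proof -
  note joint_in(2)[OF \<pi>, measurable_cong] joint_in(2)[OF \<nu>, measurable_cong]
  have sn[measurable_cong]: "sets (\<nu> \<bind> Pn n) = sets borel" by (rule sets_bind'[OF \<nu> Pn_kernel])
  have pn: "\<nu> \<bind> Pn n \<in> space (prob_algebra borel)" by (rule bind_in_prob_algebra[OF \<nu> Pn_kernel])
  have sec: "{z. (z, h) \<in> X} \<in> sets borel" for h
    using measurable_sets_borel[of "\<lambda>z. (z, h)" borel] measurable_sets[OF measurable_Pair2'[of h MH
      borel] X] by (simp add: vimage_def)
  have i: "(\<integral>\<^sup>+z. indicator X (z, h) \<partial>M) = emeasure M {z. (z, h) \<in> X}" if "sets M = sets borel" for M h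
  proof -
    have "(\<integral>\<^sup>+z. indicator X (z, h) \<partial>M) = (\<integral>\<^sup>+z. indicator {z. (z, h) \<in> X} z \<partial>M)"
      by (intro nn_integral_cong) (auto split: split_indicator)
    then show ?thesis using sec[of h] that by simp
  qed
  let ?F = "\<lambda>s. indicator X s * indicator (- B) (fst s) :: ennreal"
  have iX: "indicator X \<in> borel_measurable EH" by measurable
  have mk: "(\<lambda>h. \<integral>\<^sup>+z. f (z, h) \<partial>M) \<in> borel_measurable (noise n)"
    if "f \<in> borel_measurable EH" "M \<in> space (prob_algebra borel)" for f ::
      "'e \<times> (nat \<Rightarrow> 'f) \<Rightarrow> ennreal" and M :: "'e measure"
    using kernel_familyD(5)[OF kernel_family_const[OF that(2)] that(1)] by simp
  have "(\<integral>\<^sup>+s. indicator X s \<partial>joint \<pi> n) = 0"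
    using zero X by (simp add: joint_in(2)[OF \<pi>])
  then have "(\<integral>\<^sup>+h. \<integral>\<^sup>+z. indicator X (z, h) \<partial>\<pi> \<partial>noise n) = 0"
    unfolding nn_integral_joint_eq_0_iff[OF \<pi> iX] bind_\<pi>_Pn .
  then have "AE h in noise n. (\<integral>\<^sup>+z. indicator X (z, h) \<partial>\<pi>) = 0"
    by (simp add: nn_integral_0_iff_AE[OF mk[OF iX \<pi>]])
  then have ae: "AE h in noise n. (\<integral>\<^sup>+z. ?F (z, h) \<partial>(\<nu> \<bind> Pn n)) = 0"
  proof eventually_elim
    case (elim h)
    have "(\<integral>\<^sup>+z. ?F (z, h) \<partial>(\<nu> \<bind> Pn n)) = (\<integral>\<^sup>+z. indicator ({z. (z, h) \<in> X} - B) z \<partial>(\<nu> \<bind> Pn n))"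
      by (intro nn_integral_cong) (auto split: split_indicator)
    also have "\<dots> = 0"
      using ac[OF sec[of h]] elim sec[of h] B i[OF sets_\<pi>, of h] by (simp add: sn)
    finally show ?case .
  qed
  have FE: "?F \<in> borel_measurable EH" by measurable
  have "(\<integral>\<^sup>+s. ?F s \<partial>joint \<nu> n) = 0"
    unfolding nn_integral_joint_eq_0_iff[OF \<nu> FE] nn_integral_0_iff_AE[OF mk[OF FE pn]] by (rule ae)
  moreover have "emeasure (joint \<nu> n) X \<le> (\<integral>\<^sup>+s. ?F s + indicator B (fst s) \<partial>joint \<nu> n)"
  proof -
    have "emeasure (joint \<nu> n) X = (\<integral>\<^sup>+s. indicator X s \<partial>joint \<nu> n)" by (simp add: joint_in(2)[OF \<nu>])
    also have "\<dots> \<le> (\<integral>\<^sup>+s. ?F s + indicator B (fst s) \<partial>joint \<nu> n)"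
      by (intro nn_integral_mono) (auto split: split_indicator)
    finally show ?thesis .
  qed
  moreover have "(\<integral>\<^sup>+s. ?F s + indicator B (fst s) \<partial>joint \<nu> n) =
    (\<integral>\<^sup>+s. ?F s \<partial>joint \<nu> n) + (\<integral>\<^sup>+s. indicator B (fst s) \<partial>joint \<nu> n)"
    by (rule nn_integral_add) measurable
  moreover have "(\<integral>\<^sup>+s. indicator B (fst s) \<partial>joint \<nu> n) = emeasure (\<nu> \<bind> Pn n) B"
    using nn_integral_joint_fst[OF \<nu>, of "indicator B" n] by (simp add: sn)
  ultimately show ?thesis by simp
qed

section \<open>Likelihood ratios of the law started from an arbitrary measure\<close>

lemma marg_joint: "marg (joint \<pi> n)"
  unfolding joint_def
proof (rule marg_steps[OF margI g])
  show "distr \<pi> EH (\<lambda>x. (x, origin)) \<in> space (prob_algebra EH)" by (rule start_in(1)[OF \<pi>])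
  fix A :: "'e set" assume [measurable]: "A \<in> sets borel"
  have "(\<integral>\<^sup>+s. indicator A (fst s) \<partial>distr \<pi> EH (\<lambda>x. (x, origin))) =
    (\<integral>\<^sup>+x. indicator A (fst (x, origin)) \<partial>\<pi>)"
    by (rule nn_integral_distr[OF start_in(3)[OF \<pi>]]) measurable
  then show "(\<integral>\<^sup>+s. indicator A (fst s) \<partial>distr \<pi> EH (\<lambda>x. (x, origin))) = emeasure \<pi> A" by simp
qed

lemma joint_add:
  assumes \<nu>: "\<nu> \<in> space (prob_algebra borel)"
  shows "joint \<nu> (m + n) = joint \<nu> m \<bind> steps g n"
  unfolding joint_def by (rule bind_kpow_add[OF step_kernel[OF g] start_in(1)[OF \<nu>]])

text \<open>Two parts of the joint law are lost: its singular part, which convergence in total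
  variation bounds by \<eta> / 2 at a suitable time k, and the part of its density above a
  truncation level, chosen to lose at most \<eta> / 2 as well.\<close>

lemma ex_dominated_joint:
  assumes \<nu>: "\<nu> \<in> space (prob_algebra borel)"
    and conv: "(\<lambda>n. tv_dist (\<nu> \<bind> Pn n) \<pi>) \<longlonglongrightarrow> 0" and \<eta>: "0 < (\<eta> :: real)"
  obtains k C and u\<^sub>0 :: "'e \<times> (nat \<Rightarrow> 'f) \<Rightarrow> real" where "0 < (C :: real)"
    "u\<^sub>0 \<in> borel_measurable EH" "\<And>s. 0 \<le> u\<^sub>0 s" "\<And>s. u\<^sub>0 s \<le> 1"
    "\<And>X. X \<in> sets EH \<Longrightarrow> emeasure (density (joint \<pi> k) (\<lambda>s. ennreal (C * u\<^sub>0 s))) X \<le>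
      emeasure (joint \<nu> k) X"
    "1 \<le> (\<integral>\<^sup>+s. ennreal (C * u\<^sub>0 s) \<partial>joint \<pi> k) + ennreal \<eta>"
proof -
  have pn: "\<nu> \<bind> Pn n \<in> space (prob_algebra borel)" for n by (rule bind_in_prob_algebra[OF \<nu> Pn_kernel])
  have "\<exists>k. tv_dist (\<nu> \<bind> Pn k) \<pi> < \<eta> / 2"
    using order_tendstoD(2)[OF conv, of "\<eta> / 2"] \<eta>
      by (auto dest!: eventually_happens'[OF sequentially_bot])
  then obtain k where k: "tv_dist (\<nu> \<bind> Pn k) \<pi> < \<eta> / 2" ..
  have sn[measurable_cong]: "sets (\<nu> \<bind> Pn k) = sets borel" and ppn: "prob_space (\<nu> \<bind> Pn k)"
    using pn[of k] by (auto simp: space_prob_algebra)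
  have spn: "space (\<nu> \<bind> Pn k) = UNIV" using sets_eq_imp_space_eq[OF sn] by simp
  have ss: "sets (\<nu> \<bind> Pn k) = sets \<pi>" by (simp add: sn)
  \<comment> \<open>B carries the singular part of the law of \<open>X\<^sub>k\<close>. It is
    \<pi>-null, so the total variation distance bounds its mass.\<close>
  obtain B q' where B0: "B \<in> sets \<pi>" "emeasure \<pi> B = 0" and q': "q' \<in> borel_measurable \<pi>"
    and LB: "density (\<nu> \<bind> Pn k) (indicator (space \<pi> - B)) = density \<pi> (\<lambda>x. ennreal (q' x))"
    by (rule Lebesgue_decomposition[OF prob_\<pi> ppn ss]) (rule that)
  have B[measurable]: "B \<in> sets borel" using B0(1) by simp
  have ac: "emeasure (\<nu> \<bind> Pn k) (A - B) = 0" if A[measurable]: "A \<in> sets borel"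
    and A0: "emeasure \<pi> A = 0" for A
  proof -
    have "emeasure (\<nu> \<bind> Pn k) (A - B) = emeasure (density (\<nu> \<bind> Pn k) (indicator (space \<pi> - B))) A"
      by (subst emeasure_density) (auto simp: sn nn_integral_indicator[symmetric] simp del:
        nn_integral_indicator
          intro!: nn_integral_cong split: split_indicator)
    also have "\<dots> = (\<integral>\<^sup>+x. ennreal (q' x) * indicator A x \<partial>\<pi>)"
      unfolding LB using q' by (subst emeasure_density) auto
    also have "\<dots> = 0"
    proof -
      have "AE x in \<pi>. x \<notin> A" using A0 by (intro AE_not_in) (auto simp: null_sets_def)
      then have "AE x in \<pi>. ennreal (q' x) * indicator A x = 0" by eventually_elim simp
      then show ?thesis using q' by (subst nn_integral_0_iff_AE) auto
    qed
    finally show ?thesis .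
  qed
  have Bsmall: "emeasure (\<nu> \<bind> Pn k) B \<le> ennreal (\<eta> / 2)"
    using emeasure_le_tv_dist[OF ppn prob_\<pi> ss, of B] B0(2) k
      by (simp add: sn ennreal_leI order_trans[OF _ ennreal_leI[of _ "\<eta> / 2"]])
  let ?J = "joint \<pi> k" and ?M = "joint \<nu> k"
  note sJ[measurable_cong] = joint_in(2)[OF \<pi>, of k] and sM[measurable_cong] = joint_in(2)[OF \<nu>, of k]
  have sMJ: "sets ?M = sets ?J" by (simp add: sJ sM)
  have spJ: "space ?J = UNIV" using sets_eq_imp_space_eq[OF sJ] by simp
  \<comment> \<open>N carries the singular part of the joint law, and by
    \<open>emeasure_joint_le\<close> its mass is at most that of B.\<close>
  obtain N q where N0: "N \<in> sets ?J" "emeasure ?J N = 0" and q0: "q \<in> borel_measurable ?J" "\<And>s. 0 \<le>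
    (q s :: real)"
    and LN: "density ?M (indicator (space ?J - N)) = density ?J (\<lambda>s. ennreal (q s))"
    by (rule Lebesgue_decomposition[OF joint_in(3)[OF \<pi>] joint_in(3)[OF \<nu>] sMJ]) (rule that)
  have N[measurable]: "N \<in> sets EH" using N0(1) by (simp add: sJ)
  have q[measurable]: "q \<in> borel_measurable EH" using q0(1)
    by (simp add: measurable_cong_sets[OF sJ refl])
  have Nsmall: "emeasure ?M N \<le> ennreal (\<eta> / 2)"
    using emeasure_joint_le[OF \<nu> B N ac N0(2)] Bsmall by (rule order_trans)
  have qX: "(\<integral>\<^sup>+s. ennreal (q s) * indicator X s \<partial>?J) =
    emeasure ?M (X - N)" if [measurable]: "X \<in> sets EH" for X
  proof -
    have "(\<integral>\<^sup>+s. ennreal (q s) * indicator X s \<partial>?J) = emeasure (density ?J (\<lambda>s. ennreal (q s))) X"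
      by (subst emeasure_density) (auto simp: sJ)
    also have "\<dots> = emeasure ?M (X - N)"
      unfolding LN[symmetric] spJ
      by (subst emeasure_density) (auto simp: sM nn_integral_indicator[symmetric] simp del:
        nn_integral_indicator
          intro!: nn_integral_cong split: split_indicator)
    finally show ?thesis .
  qed
  have U: "(UNIV :: ('e \<times> (nat \<Rightarrow> 'f)) set) \<in> sets EH"
    using sets.top[of "EH :: ('e \<times> (nat \<Rightarrow> 'f)) measure"] by (simp only: space_EH)
  \<comment> \<open>Truncation at Suc j keeps the constant C positive. Dividing by it gives a
    density bounded by 1, as \<open>likelihood_forgets\<close> requires.\<close>
  let ?c = "\<lambda>j s. ennreal (min (q s) (real (Suc j)))"
  have SUPc: "(SUP j. ?c j s) = ennreal (q s)" for s
  proof (rule antisym)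
    obtain j where "q s \<le> real j" using real_arch_simple by blast
    then have "ennreal (q s) = ?c j s" by (simp add: min_def)
    then show "ennreal (q s) \<le> (SUP j. ?c j s)" using SUP_upper[of j UNIV "\<lambda>j. ?c j s"] by simp
    show "(SUP j. ?c j s) \<le> ennreal (q s)" by (intro SUP_least ennreal_leI) simp
  qed
  have "(\<integral>\<^sup>+s. ennreal (q s) \<partial>?J) = (SUP j. \<integral>\<^sup>+s. ?c j s \<partial>?J)"
    unfolding SUPc[symmetric]
    by (intro nn_integral_monotone_convergence_SUP)
      (auto simp: incseq_def le_fun_def intro!: ennreal_leI)
  note SUPq = this
  have qfin: "(\<integral>\<^sup>+s. ennreal (q s) \<partial>?J) \<le> 1"
    using qX[OF U] prob_space.emeasure_le_1[OF joint_in(3)[OF \<nu>, of k], of "UNIV - N"] by simp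
  \<comment> \<open>Otherwise all truncated integrals would stay below the finite integral of q by
    \<eta> / 2, against monotone convergence.\<close>
  have "\<exists>j. (\<integral>\<^sup>+s. ennreal (q s) \<partial>?J) \<le> (\<integral>\<^sup>+s. ?c j s \<partial>?J) + ennreal (\<eta> / 2)"
  proof (rule ccontr)
    assume neg: "\<not> ?thesis"
    define S where "S = (\<integral>\<^sup>+s. ennreal (q s) \<partial>?J)"
    have "(\<integral>\<^sup>+s. ?c j s \<partial>?J) + ennreal (\<eta> / 2) \<le> S" for j using neg
      by (auto simp: S_def not_le less_imp_le)
    then have "(SUP j. (\<integral>\<^sup>+s. ?c j s \<partial>?J) + ennreal (\<eta> / 2)) \<le> S" by (intro SUP_least)
    then have "S + ennreal (\<eta> / 2) \<le> S"
      using SUPq by (simp add: S_def ennreal_SUP_add_left)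
    moreover have "S \<noteq> \<top>" using qfin by (auto simp: S_def top_unique)
    ultimately show False using \<eta>
      by (cases S) (auto simp: ennreal_plus[symmetric] simp del: ennreal_plus)
  qed
  then obtain j where j: "(\<integral>\<^sup>+s. ennreal (q s) \<partial>?J) \<le> (\<integral>\<^sup>+s. ?c j s \<partial>?J) + ennreal (\<eta> / 2)" ..
  define u\<^sub>0 where "u\<^sub>0 s = min (q s) (real (Suc j)) / real (Suc j)" for s
  have Cu: "real (Suc j) * u\<^sub>0 s = min (q s) (real (Suc j))" for s by (simp add: u\<^sub>0_def)
  show thesis
  proof (rule that)
    show "0 < real (Suc j)" by simp
    show u0m[measurable]: "u\<^sub>0 \<in> borel_measurable EH" unfolding u\<^sub>0_def by measurable
    show "0 \<le> u\<^sub>0 s" "u\<^sub>0 s \<le> 1" for s using q0(2)[of s] by (auto simp: u\<^sub>0_def divide_le_eq_1)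
    show "emeasure (density ?J (\<lambda>s. ennreal (real (Suc j) * u\<^sub>0 s))) X \<le>
      emeasure ?M X" if X[measurable]: "X \<in> sets EH" for X
    proof -
      have "emeasure (density ?J (\<lambda>s. ennreal (real (Suc j) * u\<^sub>0 s))) X =
        (\<integral>\<^sup>+s. ?c j s * indicator X s \<partial>?J)"
        unfolding Cu by (subst emeasure_density) (auto simp: sJ)
      also have "\<dots> \<le> (\<integral>\<^sup>+s. ennreal (q s) * indicator X s \<partial>?J)"
        by (intro nn_integral_mono mult_right_mono ennreal_leI) auto
      also have "\<dots> \<le> emeasure ?M X" unfolding qX[OF X] by (intro emeasure_mono) (auto simp: sM)
      finally show ?thesis .
    qed
    have "1 = emeasure ?M (space ?M)" using prob_space.emeasure_space_1[OF joint_in(3)[OF \<nu>]] by simp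
    also have "space ?M = UNIV" using sets_eq_imp_space_eq[OF sM] by simp
    also have "emeasure ?M UNIV \<le> emeasure ?M (UNIV - N) + emeasure ?M N"
    proof -
      have "emeasure ?M ((UNIV - N) \<union> N) \<le> emeasure ?M (UNIV - N) + emeasure ?M N"
        using U by (intro emeasure_subadditive) (auto simp: sM)
      then show ?thesis by simp
    qed
    also have "\<dots> \<le> (\<integral>\<^sup>+s. ennreal (q s) \<partial>?J) + ennreal (\<eta> / 2)"
      using qX[OF U] Nsmall by (intro add_mono) simp_all
    also have "\<dots> \<le> ((\<integral>\<^sup>+s. ?c j s \<partial>?J) + ennreal (\<eta> / 2)) + ennreal (\<eta> / 2)"
      using j by (rule add_right_mono)
    also have "\<dots> = (\<integral>\<^sup>+s. ?c j s \<partial>?J) + ennreal \<eta>"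
      using \<eta> by (simp add: add.assoc ennreal_plus[symmetric] del: ennreal_plus)
    finally show "1 \<le> (\<integral>\<^sup>+s. ennreal (real (Suc j) * u\<^sub>0 s) \<partial>?J) + ennreal \<eta>" unfolding Cu .
  qed
qed

text \<open>After time k the dominated part evolves from a start with a bounded density, to which
  \<open>likelihood_forgets\<close> applies. The constant C is restored by linearity, and domination
  by the law started from \<nu> is preserved by the steps.\<close>

lemma ex_almost_observable_density:
  assumes mix: "mixing \<longlonglongrightarrow> 0" and \<nu>: "\<nu> \<in> space (prob_algebra borel)"
    and conv: "(\<lambda>n. tv_dist (\<nu> \<bind> Pn n) \<pi>) \<longlonglongrightarrow> 0" and \<eta>: "0 < (\<eta> :: real)"
  obtains n and u :: "'e \<times> (nat \<Rightarrow> 'f) \<Rightarrow> real" and v :: "(nat \<Rightarrow> 'f) \<Rightarrow> real"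
    where "u \<in> borel_measurable EH" "\<And>s. 0 \<le> u s" "v \<in> borel_measurable MH" "\<And>h. 0 \<le> v h"
    "\<And>X. X \<in> sets EH \<Longrightarrow> emeasure (density (joint \<pi> n) (\<lambda>s. ennreal (u s))) X \<le> emeasure (joint \<nu> n) X"
    "1 \<le> (\<integral>\<^sup>+s. ennreal (u s) \<partial>joint \<pi> n) + ennreal \<eta>"
    "(\<integral>\<^sup>+s. ennreal \<bar>u s - v (snd s)\<bar> \<partial>joint \<pi> n) \<le> ennreal \<eta>"
proof -
  obtain k C u\<^sub>0 where C: "0 < (C :: real)" and u0[measurable]: "u\<^sub>0 \<in> borel_measurable EH"
    and u01: "\<And>s. 0 \<le> u\<^sub>0 s" "\<And>s. u\<^sub>0 s \<le> 1"
    and dom: "\<And>X. X \<in> sets EH \<Longrightarrow> emeasure (density (joint \<pi> k) (\<lambda>s. ennreal (C * u\<^sub>0 s))) X \<le>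
      emeasure (joint \<nu> k) X"
    and tot: "1 \<le> (\<integral>\<^sup>+s. ennreal (C * u\<^sub>0 s) \<partial>joint \<pi> k) + ennreal \<eta>"
    by (rule ex_dominated_joint[OF \<nu> conv \<eta>]) (rule that)
  let ?L = "joint \<pi> k"
  note sL[measurable_cong] = joint_in(2)[OF \<pi>, of k]
  \<comment> \<open>Restoring the factor C turns this accuracy into \<eta>.\<close>
  have \<eta>C: "0 < \<eta> / C" using C \<eta> by simp
  obtain n u v where u[measurable]: "u \<in> borel_measurable EH" and u1: "\<And>s. 0 \<le> u s" "\<And>s. u s \<le>
    (1::real)"
    and v[measurable]: "v \<in> borel_measurable MH" and v0: "\<And>h. 0 \<le> v h"
    and dens: "density ?L (\<lambda>s. ennreal (u\<^sub>0 s)) \<bind> steps g n =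
      density (?L \<bind> steps g n) (\<lambda>s. ennreal (u s))"
    and small: "(\<integral>\<^sup>+s. ennreal \<bar>u s - v (snd s)\<bar> \<partial>(?L \<bind> steps g n)) \<le> ennreal (\<eta> / C)"
    by (rule likelihood_forgets[OF g mix marg_joint[of k] u0 u01(2) \<eta>C]) (rule that)
  note J = joint_add[OF \<pi>, of k n, symmetric]
  note sJ[measurable_cong] = joint_in(2)[OF \<pi>, of "k + n"] and sM[measurable_cong] = joint_in(2)[OF \<nu>]
  have key: "(\<integral>\<^sup>+s. ennreal (C * u s) * F s \<partial>joint \<pi> (k + n)) =
    (\<integral>\<^sup>+s. F s \<partial>(density ?L (\<lambda>s. ennreal (C * u\<^sub>0 s)) \<bind> steps g n))"
    if F[measurable]: "F \<in> borel_measurable EH" for F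
  proof -
    have G[measurable]: "(\<lambda>s. \<integral>\<^sup>+s'. F s' \<partial>steps g n s) \<in> borel_measurable EH"
      by (rule steps_integral_measurable[OF g F])
    have "(\<integral>\<^sup>+s. F s \<partial>(density ?L (\<lambda>s. ennreal (C * u\<^sub>0 s)) \<bind> steps g n)) =
        (\<integral>\<^sup>+s. \<integral>\<^sup>+s'. F s' \<partial>steps g n s \<partial>density ?L (\<lambda>s. ennreal (C * u\<^sub>0 s)))"
      by (rule nn_integral_bind_prob[OF _ steps_kernel[OF g] F]) (simp add: sL)
    also have "\<dots> = (\<integral>\<^sup>+s. ennreal (C * u\<^sub>0 s) * (\<integral>\<^sup>+s'. F s' \<partial>steps g n s) \<partial>?L)"
      by (rule nn_integral_density) measurable
    also have "\<dots> = (\<integral>\<^sup>+s. ennreal C * (ennreal (u\<^sub>0 s) * (\<integral>\<^sup>+s'. F s' \<partial>steps g n s)) \<partial>?L)"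
      using C u01(1) by (simp add: ennreal_mult mult.assoc)
    also have "\<dots> = ennreal C * (\<integral>\<^sup>+s. ennreal (u\<^sub>0 s) * (\<integral>\<^sup>+s'. F s' \<partial>steps g n s) \<partial>?L)"
      by (rule nn_integral_cmult) measurable
    also have "(\<integral>\<^sup>+s. ennreal (u\<^sub>0 s) * (\<integral>\<^sup>+s'. F s' \<partial>steps g n s) \<partial>?L) =
      (\<integral>\<^sup>+s. \<integral>\<^sup>+s'. F s' \<partial>steps g n s \<partial>density ?L (\<lambda>s. ennreal (u\<^sub>0 s)))"
      by (rule nn_integral_density[symmetric]) measurable
    also have "\<dots> = (\<integral>\<^sup>+s. F s \<partial>(density ?L (\<lambda>s. ennreal (u\<^sub>0 s)) \<bind> steps g n))"
      by (rule nn_integral_bind_prob[symmetric, OF _ steps_kernel[OF g] F]) (simp add: sL)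
    also have "\<dots> = (\<integral>\<^sup>+s. ennreal (u s) * F s \<partial>joint \<pi> (k + n))"
      unfolding dens J by (rule nn_integral_density) measurable
    also have "ennreal C * \<dots> = (\<integral>\<^sup>+s. ennreal C * (ennreal (u s) * F s) \<partial>joint \<pi> (k + n))"
      by (rule nn_integral_cmult[symmetric]) measurable
    also have "\<dots> = (\<integral>\<^sup>+s. ennreal (C * u s) * F s \<partial>joint \<pi> (k + n))"
      using C u1(1) by (simp add: ennreal_mult mult.assoc)
    finally show ?thesis by simp
  qed
  show thesis
  proof (rule that)
    show "(\<lambda>s. C * u s) \<in> borel_measurable EH" by measurable
    show "0 \<le> C * u s" for s using C u1(1) by simp
    show "(\<lambda>h. C * v h) \<in> borel_measurable MH" by measurable
    show "0 \<le> C * v h" for h using C v0 by simp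
    show "emeasure (density (joint \<pi> (k + n)) (\<lambda>s. ennreal (C * u s))) X \<le> emeasure (joint \<nu> (k + n)) X"
      if X[measurable]: "X \<in> sets EH" for X
    proof -
      have iX: "indicator X \<in> borel_measurable EH" by measurable
      have "emeasure (density (joint \<pi> (k + n)) (\<lambda>s. ennreal (C * u s))) X =
        (\<integral>\<^sup>+s. ennreal (C * u s) * indicator X s \<partial>joint \<pi> (k + n))"
        by (subst emeasure_density) (auto simp: sJ)
      also have "\<dots> \<le> (\<integral>\<^sup>+s. indicator X s \<partial>(joint \<nu> k \<bind> steps g n))"
        unfolding key[OF iX] by (rule emeasure_steps_bind_le[OF _ sM g dom iX]) (simp_all add: sL)
      also have "\<dots> = emeasure (joint \<nu> (k + n)) X" by (simp add: joint_add[OF \<nu>, symmetric] sM)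
      finally show ?thesis .
    qed
    have "(\<integral>\<^sup>+s. ennreal (C * u s) \<partial>joint \<pi> (k + n)) =
      (\<integral>\<^sup>+s. 1 \<partial>(density ?L (\<lambda>s. ennreal (C * u\<^sub>0 s)) \<bind> steps g n))"
      using key[OF borel_measurable_const, of 1] by (simp only: mult_1_right)
    also have "\<dots> = (\<integral>\<^sup>+s. \<integral>\<^sup>+s'. 1 \<partial>steps g n s \<partial>density ?L (\<lambda>s. ennreal (C * u\<^sub>0 s)))"
      by (rule nn_integral_bind_prob[OF _ steps_kernel[OF g]]) (simp_all add: sL)
    also have "\<dots> = (\<integral>\<^sup>+s. 1 \<partial>density ?L (\<lambda>s. ennreal (C * u\<^sub>0 s)))"
    proof (intro nn_integral_cong)
      fix s
      have "prob_space (steps g n s)" by (rule kernel_prob(1)[OF steps_kernel[OF g]]) simp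
      then show "(\<integral>\<^sup>+s'. 1 \<partial>steps g n s) = 1" using prob_space.emeasure_space_1 by simp
    qed
    also have "\<dots> = (\<integral>\<^sup>+s. ennreal (C * u\<^sub>0 s) \<partial>?L)"
      by (subst nn_integral_density) simp_all
    finally show "1 \<le> (\<integral>\<^sup>+s. ennreal (C * u s) \<partial>joint \<pi> (k + n)) + ennreal \<eta>" using tot by simp
    have "(\<integral>\<^sup>+s. ennreal \<bar>C * u s - C * v (snd s)\<bar> \<partial>joint \<pi> (k + n)) =
      (\<integral>\<^sup>+s. ennreal C * ennreal \<bar>u s - v (snd s)\<bar> \<partial>joint \<pi> (k + n))"
      using C by (intro nn_integral_cong)
        (simp add: ennreal_mult[symmetric] abs_mult right_diff_distrib[symmetric])
    also have "\<dots> = ennreal C * (\<integral>\<^sup>+s. ennreal \<bar>u s - v (snd s)\<bar> \<partial>joint \<pi> (k + n))"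
      by (rule nn_integral_cmult) measurable
    also have "\<dots> \<le> ennreal C * ennreal (\<eta> / C)" using small unfolding J by (rule mult_left_mono) simp
    also have "\<dots> = ennreal \<eta>" using C \<eta> by (simp add: ennreal_mult[symmetric])
    finally show "(\<integral>\<^sup>+s. ennreal \<bar>C * u s - C * v (snd s)\<bar> \<partial>joint \<pi> (k + n)) \<le> ennreal \<eta>" .
  qed
qed

end

section \<open>Merging of filters\<close>

text \<open>The intersection of exceptional sets of measure at most 1 / (k + 1) is a null
  set.\<close>

lemma AE_if_small_exceptions:
  assumes "\<And>e::real. 0 < e \<Longrightarrow> \<exists>U\<in>sets M. emeasure M U \<le> ennreal e \<and> (AE x in M. x \<notin> U \<longrightarrow> Q x)"
  shows "AE x in M. Q x"
proof -
  have "\<forall>k. \<exists>U\<in>sets M. emeasure M U \<le> ennreal (1 / real (Suc k)) \<and> (AE x in M. x \<notin> U \<longrightarrow> Q x)"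
    using assms by simp
  then obtain U where U: "\<And>k. U k \<in> sets M" "\<And>k. emeasure M (U k) \<le> ennreal (1 / real (Suc k))"
    "\<And>k. AE x in M. x \<notin> U k \<longrightarrow> Q x" by metis
  have "(\<lambda>k. ennreal (1 / real (Suc k))) \<longlonglongrightarrow> ennreal 0"
    by (intro tendsto_ennrealI) (use LIMSEQ_inverse_real_of_nat in \<open>simp add: inverse_eq_divide\<close>)
  moreover have "emeasure M (\<Inter>k. U k) \<le> ennreal (1 / real (Suc k))" for k
    using emeasure_mono[of "\<Inter>k. U k" "U k" M] U(1,2)[of k] by (intro order_trans[OF _ U(2)[of k]]) auto
  ultimately have "emeasure M (\<Inter>k. U k) \<le> 0"
    using LIMSEQ_le_const[of "\<lambda>k. ennreal (1 / real (Suc k))" "ennreal 0" "emeasure M (\<Inter>k. U k)"]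
      by auto
  then have "(\<Inter>k. U k) \<in> null_sets M" using U(1) by (auto simp: null_sets_def)
  then have "AE x in M. x \<notin> (\<Inter>k. U k)" by (rule AE_not_in)
  moreover have "AE x in M. \<forall>k. x \<notin> U k \<longrightarrow> Q x" by (intro AE_all_countable[THEN iffD2] allI U(3))
  ultimately show ?thesis by eventually_elim auto
qed

text \<open>After division by m, the inequality for \<open>t * m'\<close> eliminates t, since b is
  at most m'. The error r enters once through each of the first two bounds and is at most c after
  division by m, hence the factor 2.\<close>

lemma normalized_le:
  fixes a b c m m' r t :: ennreal
  assumes m: "m \<noteq> 0" "m \<noteq> \<infinity>" and m': "m' \<noteq> 0" "m' \<noteq> \<infinity>"
    and "a \<le> t * b + r" "t * m' \<le> m + r" "b \<le> m'" "r \<le> c * m"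
  shows "1 / m * a \<le> 1 / m' * b + 2 * c"
proof -
  have canc: "1 / x * x = 1" if "x \<noteq> 0" "x \<noteq> \<infinity>" for x :: ennreal
    using that by (simp add: ennreal_divide_times ennreal_divide_self less_top)
  let ?p = "1 / m' * b"
  have "?p \<le> 1 / m' * m'" using assms(7) by (rule mult_left_mono) simp
  then have p: "?p \<le> 1" by (simp only: canc[OF m'])
  have "b = 1 / m' * m' * b" by (simp only: canc[OF m'] mult_1)
  then have b: "b = m' * ?p" by (simp only: mult_ac)
  have "1 / m * r \<le> 1 / m * (c * m)" using assms(8) by (rule mult_left_mono) simp
  also have "\<dots> = 1 / m * m * c" by (simp only: mult_ac)
  finally have r: "1 / m * r \<le> c" by (simp only: canc[OF m] mult_1)
  have "1 / m * a \<le> 1 / m * (t * (m' * ?p) + r)"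
    using assms(5) unfolding b[symmetric] by (rule mult_left_mono) simp
  also have "\<dots> = 1 / m * (t * m') * ?p + 1 / m * r" by (simp only: distrib_left mult.assoc)
  also have "\<dots> \<le> 1 / m * (m + r) * ?p + c"
    using assms(6) r by (intro add_mono mult_right_mono mult_left_mono) simp_all
  also have "1 / m * (m + r) * ?p + c = ?p + 1 / m * r * ?p + c"
    by (simp only: distrib_left distrib_right canc[OF m] mult_1)
  also have "\<dots> \<le> ?p + c * 1 + c"
    using r p by (intro add_right_mono add_left_mono mult_mono) simp_all
  finally show ?thesis by (simp only: mult_1_right add.assoc mult_2)
qed

context hmm
begin

section \<open>Masses of evolving kernels and the maximal inequality\<close>

lemma kernel_family_advances: "kernel_family K \<Longrightarrow> kernel_family ((advance ^^ j) K)"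
  by (induction j) (simp_all add: kernel_family_advance)

lemma tail_measurable: "(\<lambda>h i. h (Suc i)) \<in> MH \<rightarrow>\<^sub>M MH"
  using shift_measurable[of 1] by simp

text \<open>\<open>g\<close> integrates to 1 over the new observation and P has mass one, so
  integrating out the new observation returns the previous mass. This is the martingale property,
  with f a weight that depends on the older observations.\<close>

lemma nn_integral_mass_advance:
  assumes K: "kernel_family K" and f[measurable]: "f \<in> borel_measurable MH"
  shows "(\<integral>\<^sup>+h. f (\<lambda>i. h (Suc i)) * mass (advance K) h \<partial>noise (Suc n)) =
    (\<integral>\<^sup>+h. f h * mass K h \<partial>noise n)"
proof -
  have F: "(\<lambda>s. f (\<lambda>i. snd s (Suc i))) \<in> borel_measurable EH"
    by (rule measurable_compose[OF measurable_snd measurable_compose[OF tail_measurable f]])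
  have st: "(\<integral>\<^sup>+s. f (\<lambda>i. snd s (Suc i)) \<partial>step g (x, h)) = f h" for x h
  proof -
    have "(\<integral>\<^sup>+s. f (\<lambda>i. snd s (Suc i)) \<partial>step g (x, h)) = (\<integral>\<^sup>+w. ennreal (g x w) * (\<integral>\<^sup>+z. f h \<partial>P x) \<partial>\<phi>)"
      using nn_integral_step[OF g F, of h x] by simp
    also have "\<dots> = (\<integral>\<^sup>+w. ennreal (g x w) * f h \<partial>\<phi>)"
      using prob_space.emeasure_space_1[OF prob_P, of x] by simp
    also have "\<dots> = (\<integral>\<^sup>+w. ennreal (g x w) \<partial>\<phi>) * f h"
      using measurable_compose[OF measurable_Pair1'[of x borel borel] obs_densityD(1)[OF g]]
      by (intro nn_integral_multc) (simp add: measurable_cong_sets[OF sets_\<phi> refl])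
    finally show ?thesis by (simp add: obs_densityD(3)[OF g])
  qed
  have "(\<integral>\<^sup>+h. f (\<lambda>i. h (Suc i)) * mass (advance K) h \<partial>noise (Suc n)) =
    (\<integral>\<^sup>+h. \<integral>\<^sup>+x. f (\<lambda>i. snd (x, h) (Suc i)) \<partial>advance K h \<partial>noise (Suc n))"
    using kernel_familyD(3)[OF kernel_family_advance[OF K]] by (simp add: mass_def)
  also have "\<dots> = (\<integral>\<^sup>+h. \<integral>\<^sup>+x. f h \<partial>K h \<partial>noise n)"
    unfolding nn_integral_noise_advance[OF K F] st ..
  also have "\<dots> = (\<integral>\<^sup>+h. f h * mass K h \<partial>noise n)"
    using kernel_familyD(3)[OF K] by (simp add: mass_def)
  finally show ?thesis .
qed

lemma predict_add: "(advance ^^ j) (predict \<nu> n) = predict \<nu> (n + j)"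
  by (simp add: funpow_add[of j n, unfolded add.commute[of j n]])

text \<open>
  Total masses of advanced kernel families are martingales under the reference law of the
  observations, so this is Ville's inequality for the likelihood ratio of \<open>R\<^sub>1 + R\<^sub>2\<close> to the
  prediction kernel.
\<close>

lemma maximal_inequality:
  fixes c :: ennreal and n :: nat
  assumes \<nu>: "\<nu> \<in> space (prob_algebra borel)" and R: "kernel_family R\<^sub>1" "kernel_family R\<^sub>2"
  defines "D \<equiv> \<lambda>j. {h. c * mass (predict \<nu> (n + j)) h < mass ((advance ^^ j) R\<^sub>1) h +
    mass ((advance ^^ j) R\<^sub>2) h}"
  defines "U \<equiv> {s. \<exists>j. hist (n + j) (snd s) \<in> D j}"
  shows "U \<in> sets (hmm_law P (obs g) \<nu>)"
    and "c * emeasure (hmm_law P (obs g) \<nu>) U \<le> (\<integral>\<^sup>+h. mass R\<^sub>1 h + mass R\<^sub>2 h \<partial>noise n)"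
proof -
  define m where "m j = mass (predict \<nu> (n + j))" for j
  define r where "r j h = mass ((advance ^^ j) R\<^sub>1) h + mass ((advance ^^ j) R\<^sub>2) h" for j h
  have m_meas[measurable]: "m j \<in> borel_measurable MH" for j
    unfolding m_def by (rule mass_measurable[OF kernel_family_predict[OF \<nu>]])
  have R_meas: "mass ((advance ^^ j) R\<^sub>1) \<in> borel_measurable MH"
    "mass ((advance ^^ j) R\<^sub>2) \<in> borel_measurable MH" for j
    by (rule mass_measurable[OF kernel_family_advances[OF R(1)]], rule mass_measurable[OF
      kernel_family_advances[OF R(2)]])
  have r_meas[measurable]: "r j \<in> borel_measurable MH" for j
    unfolding r_def using R_meas[of j] by measurable
  have D_eq: "D j = {h. c * m j h < r j h}" for j by (simp add: D_def m_def r_def)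
  have D_meas[measurable]: "D j \<in> sets MH" for j
  proof -
    have "{h \<in> space MH. c * m j h < r j h} \<in> sets MH" by measurable
    then show ?thesis by (simp add: D_eq)
  qed
  have m_Suc: "(\<integral>\<^sup>+h. f (\<lambda>i. h (Suc i)) * m (Suc j) h \<partial>noise (Suc (n + j))) =
    (\<integral>\<^sup>+h. f h * m j h \<partial>noise (n + j))"
    if "f \<in> borel_measurable MH" for f j
    using nn_integral_mass_advance[OF kernel_family_predict[OF \<nu>, of "n + j"] that, of "n + j"]
      by (simp add: m_def)
  have r_Suc: "(\<integral>\<^sup>+h. f (\<lambda>i. h (Suc i)) * r (Suc j) h \<partial>noise (Suc (n + j))) =
    (\<integral>\<^sup>+h. f h * r j h \<partial>noise (n + j))"
    if f[measurable]: "f \<in> borel_measurable MH" for f j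
  proof -
    have "(\<integral>\<^sup>+h. f (\<lambda>i. h (Suc i)) * r (Suc j) h \<partial>noise (Suc (n + j))) =
        (\<integral>\<^sup>+h. f (\<lambda>i. h (Suc i)) * mass ((advance ^^ Suc j) R\<^sub>1) h \<partial>noise (Suc (n + j))) +
        (\<integral>\<^sup>+h. f (\<lambda>i. h (Suc i)) * mass ((advance ^^ Suc j) R\<^sub>2) h \<partial>noise (Suc (n + j)))"
      unfolding r_def distrib_left
      by (rule nn_integral_add; unfold measurable_cong_sets[OF sets_noise refl])
        (intro borel_measurable_times_ennreal measurable_compose[OF tail_measurable f] R_meas)+
    also have "\<dots> = (\<integral>\<^sup>+h. f h * mass ((advance ^^ j) R\<^sub>1) h \<partial>noise (n + j)) + (\<integral>\<^sup>+h. f h *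
      mass ((advance ^^ j) R\<^sub>2) h \<partial>noise (n + j))"
      using nn_integral_mass_advance[OF kernel_family_advances[OF R(1)] f]
        nn_integral_mass_advance[OF kernel_family_advances[OF R(2)] f] by simp
    also have "\<dots> = (\<integral>\<^sup>+h. f h * r j h \<partial>noise (n + j))"
      unfolding r_def distrib_left 
      by (rule nn_integral_add[symmetric]; unfold measurable_cong_sets[OF sets_noise refl])
        (intro borel_measurable_times_ennreal f R_meas)+
    finally show ?thesis .
  qed
  \<comment> \<open>On histories of observations, \<open>E j\<close> is the event that the threshold
    has been exceeded at some time up to j. A history contains all earlier ones as its tails, which
    makes the recursion possible.\<close>
  define E where "E = rec_nat (D 0) (\<lambda>j X. D (Suc j) \<union> {h. (\<lambda>i. h (Suc i)) \<in> X})"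
  have E_0: "E 0 = D 0" and E_Suc: "E (Suc j) = D (Suc j) \<union> {h. (\<lambda>i. h (Suc i)) \<in> E j}" for j
    by (simp_all add: E_def)
  have tl_meas: "{h. (\<lambda>i. h (Suc i)) \<in> X} \<in> sets MH" if "X \<in> sets MH" for X
    using measurable_sets[OF tail_measurable that] by (simp add: vimage_def)
  have E_meas[measurable]: "E j \<in> sets MH" for j
    by (induction j) (auto simp: E_0 E_Suc intro!: sets.Un D_meas tl_meas)
  \<comment> \<open>Takes the place of optional stopping: on histories already in the event the
    inequality is kept by the martingale property of both sides, and on those that enter it now the
    inequality holds pointwise.\<close>
  have E_int: "(\<integral>\<^sup>+h. indicator (E j) h * (c * m j h) \<partial>noise (n + j)) \<le>
    (\<integral>\<^sup>+h. indicator (E j) h * r j h \<partial>noise (n + j))" for j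
  proof (induction j)
    case 0
    show ?case unfolding E_0 by (intro nn_integral_mono) (auto simp: D_eq split: split_indicator)
  next
    case (Suc j)
    let ?T = "{h. (\<lambda>i. h (Suc i)) \<in> E j}"
    have T[measurable]: "?T \<in> sets MH" by (rule tl_meas[OF E_meas])
    have iT: "indicator (E j) (\<lambda>i. h (Suc i)) = (indicator ?T h :: ennreal)" for h
      by (auto split: split_indicator)
    have split: "(\<integral>\<^sup>+h. indicator (E (Suc j)) h * f h \<partial>noise (Suc (n + j))) =
        (\<integral>\<^sup>+h. indicator (E j) (\<lambda>i. h (Suc i)) * f h \<partial>noise (Suc (n + j))) +
        (\<integral>\<^sup>+h. indicator (D (Suc j) - ?T) h * f h \<partial>noise (Suc (n + j)))" if [measurable]:
          "f \<in> borel_measurable MH" for f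
    proof -
      have "(\<integral>\<^sup>+h. indicator (E (Suc j)) h * f h \<partial>noise (Suc (n + j))) =
          (\<integral>\<^sup>+h. indicator ?T h * f h + indicator (D (Suc j) - ?T) h * f h \<partial>noise (Suc (n + j)))"
        unfolding E_Suc by (intro nn_integral_cong) (auto split: split_indicator)
      also have "\<dots> = (\<integral>\<^sup>+h. indicator ?T h * f h \<partial>noise (Suc (n + j))) +
        (\<integral>\<^sup>+h. indicator (D (Suc j) - ?T) h * f h \<partial>noise (Suc (n + j)))"
        by (rule nn_integral_add) measurable
      also have "(\<integral>\<^sup>+h. indicator ?T h * f h \<partial>noise (Suc (n + j))) =
        (\<integral>\<^sup>+h. indicator (E j) (\<lambda>i. h (Suc i)) * f h \<partial>noise (Suc (n + j)))"
        by (simp only: iT)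
      finally show ?thesis .
    qed
    have "(\<integral>\<^sup>+h. indicator (E j) (\<lambda>i. h (Suc i)) * (c * m (Suc j) h) \<partial>noise (Suc (n + j))) =
        (\<integral>\<^sup>+h. (indicator (E j) (\<lambda>i. h (Suc i)) * c) * m (Suc j) h \<partial>noise (Suc (n + j)))"
      by (simp only: mult.assoc)
    also have "\<dots> = (\<integral>\<^sup>+h. (indicator (E j) h * c) * m j h \<partial>noise (n + j))"
      by (rule m_Suc) measurable
    also have "\<dots> \<le> (\<integral>\<^sup>+h. indicator (E j) h * r j h \<partial>noise (n + j))"
      using Suc by (simp only: mult.assoc)
    also have "\<dots> = (\<integral>\<^sup>+h. indicator (E j) (\<lambda>i. h (Suc i)) * r (Suc j) h \<partial>noise (Suc (n + j)))"
      by (rule r_Suc[symmetric]) measurable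
    finally have "(\<integral>\<^sup>+h. indicator (E j) (\<lambda>i. h (Suc i)) * (c * m (Suc j) h) \<partial>noise (Suc (n + j))) \<le>
        (\<integral>\<^sup>+h. indicator (E j) (\<lambda>i. h (Suc i)) * r (Suc j) h \<partial>noise (Suc (n + j)))" .
    moreover have "(\<integral>\<^sup>+h. indicator (D (Suc j) - ?T) h * (c * m (Suc j) h) \<partial>noise (Suc (n + j))) \<le>
        (\<integral>\<^sup>+h. indicator (D (Suc j) - ?T) h * r (Suc j) h \<partial>noise (Suc (n + j)))"
      by (intro nn_integral_mono) (auto simp: D_eq split: split_indicator)
    moreover have "(\<lambda>h. c * m (Suc j) h) \<in> borel_measurable MH" by measurable
    ultimately show ?case
      unfolding add_Suc_right by (simp only: split r_meas add_mono)
  qed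
  have r_int: "(\<integral>\<^sup>+h. r j h \<partial>noise (n + j)) = (\<integral>\<^sup>+h. r 0 h \<partial>noise n)" for j
  proof (induction j)
    case (Suc j)
    then show ?case using r_Suc[of "\<lambda>_. 1" j] by simp
  qed simp
  have E_hist: "hist (n + j) y \<in> E j \<longleftrightarrow> (\<exists>i\<le>j. hist (n + i) y \<in> D i)" for j y
  proof (induction j)
    case (Suc j)
    have "hist (n + Suc j) y \<in> E (Suc j) \<longleftrightarrow> hist (n + Suc j) y \<in> D (Suc j) \<or> hist (n + j) y \<in> E j"
      by (simp add: E_Suc)
    then show ?case using Suc by (auto simp: le_Suc_eq)
  qed (simp add: E_0)
  let ?H = "hmm_law P (obs g) \<nu>" and ?V = "\<lambda>j. {s. hist (n + j) (snd s) \<in> E j}"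
  note hmm_law_facts(2)[OF \<nu>, measurable_cong]
  have V[measurable]: "?V j \<in> sets ?H" for j
  proof -
    have "{s \<in> space ?H. hist (n + j) (snd s) \<in> E j} \<in> sets ?H" by measurable
    then show ?thesis by (simp add: hmm_law_facts(3)[OF \<nu>])
  qed
  have U_eq: "U = (\<Union>j. ?V j)" unfolding U_def E_hist by auto
  show "U \<in> sets ?H" unfolding U_eq using V by auto
  have "incseq ?V" unfolding incseq_def E_hist by (auto intro: le_trans)
  then have "emeasure ?H U = (SUP j. emeasure ?H (?V j))"
    unfolding U_eq using V by (intro SUP_emeasure_incseq[symmetric]) auto
  then have "c * emeasure ?H U = (SUP j. c * emeasure ?H (?V j))" by (simp add: SUP_mult_left_ennreal)
  also have "\<dots> \<le> (\<integral>\<^sup>+h. r 0 h \<partial>noise n)"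
  proof (rule SUP_least)
    fix j
    have "emeasure ?H (?V j) = (\<integral>\<^sup>+s. indicator (E j) (hist (n + j) (snd s)) \<partial>?H)"
      unfolding nn_integral_indicator[OF V, symmetric] by (intro nn_integral_cong)
        (auto split: split_indicator)
    also have "\<dots> = (\<integral>\<^sup>+h. indicator (E j) h * m j h \<partial>noise (n + j))"
      unfolding m_def by (rule nn_integral_hmm_law_hist[OF \<nu>]) measurable
    finally have "c * emeasure ?H (?V j) = (\<integral>\<^sup>+h. c * (indicator (E j) h * m j h) \<partial>noise (n + j))"
      by (simp add: nn_integral_cmult)
    also have "\<dots> = (\<integral>\<^sup>+h. indicator (E j) h * (c * m j h) \<partial>noise (n + j))"
      by (simp only: mult.left_commute)
    also have "\<dots> \<le> (\<integral>\<^sup>+h. indicator (E j) h * r j h \<partial>noise (n + j))" by (rule E_int)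
    also have "\<dots> \<le> (\<integral>\<^sup>+h. r j h \<partial>noise (n + j))" by (intro nn_integral_mono)
      (auto split: split_indicator)
    finally show "c * emeasure ?H (?V j) \<le> (\<integral>\<^sup>+h. r 0 h \<partial>noise n)" unfolding r_int .
  qed
  finally show "c * emeasure ?H U \<le> (\<integral>\<^sup>+h. mass R\<^sub>1 h + mass R\<^sub>2 h \<partial>noise n)" by (simp add: r_def)
qed

text \<open>
  \<open>K\<close> is within \<open>R\<^sub>1 + R\<^sub>2\<close> of the multiple \<open>t K'\<close>. The factor \<open>t\<close> does not change as the
  filters evolve and cancels when they are normalised.
\<close>

definition near :: "ennreal \<Rightarrow> ((nat \<Rightarrow> 'f) \<Rightarrow> 'e measure) \<Rightarrow> ((nat \<Rightarrow> 'f) \<Rightarrow> 'e measure) \<Rightarrow>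
    ((nat \<Rightarrow> 'f) \<Rightarrow> 'e measure) \<Rightarrow> ((nat \<Rightarrow> 'f) \<Rightarrow> 'e measure) \<Rightarrow> (nat \<Rightarrow> 'f) \<Rightarrow> bool" where
  "near t K K' R\<^sub>1 R\<^sub>2 h \<longleftrightarrow> (\<forall>F\<in>borel_measurable borel.
     (\<integral>\<^sup>+x. F x \<partial>K h) \<le> t * (\<integral>\<^sup>+x. F x \<partial>K' h) + ((\<integral>\<^sup>+x. F x \<partial>R\<^sub>1 h) + (\<integral>\<^sup>+x. F x \<partial>R\<^sub>2 h)) \<and>
     t * (\<integral>\<^sup>+x. F x \<partial>K' h) \<le> (\<integral>\<^sup>+x. F x \<partial>K h) + ((\<integral>\<^sup>+x. F x \<partial>R\<^sub>1 h) + (\<integral>\<^sup>+x. F x \<partial>R\<^sub>2 h)))"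

text \<open>Both inequalities hold for all nonnegative test functions, so they may be applied to the
  product of F with the likelihood of the new observation.\<close>

lemma near_updated:
  assumes K: "kernel_family K" "kernel_family K'" "kernel_family R\<^sub>1" "kernel_family R\<^sub>2"
    and near: "near t K K' R\<^sub>1 R\<^sub>2 (\<lambda>i. h (Suc i))"
  shows "near t (updated K) (updated K') (updated R\<^sub>1) (updated R\<^sub>2) h"
  unfolding near_def
proof
  fix F :: "'e \<Rightarrow> ennreal" assume F: "F \<in> borel_measurable borel"
  have "(\<lambda>x. ennreal (g x (h 0)) * F x) \<in> borel_measurable borel"
    using F g_section by (intro borel_measurable_times_ennreal)
  from near[unfolded near_def, rule_format, OF this]
  show "(\<integral>\<^sup>+x. F x \<partial>updated K h) \<le> t * (\<integral>\<^sup>+x. F x \<partial>updated K' h) + ((\<integral>\<^sup>+x. F x \<partial>updated R\<^sub>1 h) +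
    (\<integral>\<^sup>+x. F x \<partial>updated R\<^sub>2 h)) \<and>
     t * (\<integral>\<^sup>+x. F x \<partial>updated K' h) \<le> (\<integral>\<^sup>+x. F x \<partial>updated K h) + ((\<integral>\<^sup>+x. F x \<partial>updated R\<^sub>1 h) +
       (\<integral>\<^sup>+x. F x \<partial>updated R\<^sub>2 h))"
    by (simp only: updated_facts(3)[OF _ F] K)
qed

lemma nn_integral_advance_updated:
  assumes K: "kernel_family K" and F: "F \<in> borel_measurable borel"
  shows "(\<integral>\<^sup>+x. F x \<partial>advance K h) = (\<integral>\<^sup>+x. \<integral>\<^sup>+z. F z \<partial>P x \<partial>updated K h)"
  unfolding advance_def updated_def[symmetric]
  by (rule nn_integral_bind_prob[OF updated_facts(1)[OF K] P F])

lemma near_advance: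
  assumes K: "kernel_family K" "kernel_family K'" "kernel_family R\<^sub>1" "kernel_family R\<^sub>2"
    and near: "near t K K' R\<^sub>1 R\<^sub>2 (\<lambda>i. h (Suc i))"
  shows "near t (advance K) (advance K') (advance R\<^sub>1) (advance R\<^sub>2) h"
  unfolding near_def
proof
  fix F :: "'e \<Rightarrow> ennreal" assume F[measurable]: "F \<in> borel_measurable borel"
  have "(\<lambda>x. \<integral>\<^sup>+z. F z \<partial>P x) \<in> borel_measurable borel" by measurable
  from near_updated[OF K near, unfolded near_def, rule_format, OF this]
  show "(\<integral>\<^sup>+x. F x \<partial>advance K h) \<le> t * (\<integral>\<^sup>+x. F x \<partial>advance K' h) + ((\<integral>\<^sup>+x. F x \<partial>advance R\<^sub>1 h) +
    (\<integral>\<^sup>+x. F x \<partial>advance R\<^sub>2 h)) \<and>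
     t * (\<integral>\<^sup>+x. F x \<partial>advance K' h) \<le> (\<integral>\<^sup>+x. F x \<partial>advance K h) + ((\<integral>\<^sup>+x. F x \<partial>advance R\<^sub>1 h) +
       (\<integral>\<^sup>+x. F x \<partial>advance R\<^sub>2 h))"
    by (simp only: nn_integral_advance_updated[OF _ F] K)
qed

lemma near_advances:
  assumes K: "kernel_family K" "kernel_family K'" "kernel_family R\<^sub>1" "kernel_family R\<^sub>2"
    and near: "near t K K' R\<^sub>1 R\<^sub>2 (hist n y)"
  shows "near t ((advance ^^ j) K) ((advance ^^ j) K') ((advance ^^ j) R\<^sub>1) ((advance ^^ j) R\<^sub>2)
    (hist (n + j) y)"
proof (induction j)
  case (Suc j)
  have "near t (advance ((advance ^^ j) K)) (advance ((advance ^^ j) K')) (advance ((advance ^^ j)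
    R\<^sub>1)) (advance ((advance ^^ j) R\<^sub>2)) (hist (n + Suc j) y)"
    using Suc by (intro near_advance kernel_family_advances K) simp
  then show ?case by simp
qed (simp add: near)

lemma hmm_filter_in:
  fixes \<rho> :: "nat \<Rightarrow> (nat \<Rightarrow> 'f) \<Rightarrow> 'e measure"
  assumes \<nu>: "\<nu> \<in> space (prob_algebra borel)"
    and \<rho>: "\<And>n. \<rho> n \<in> (\<Pi>\<^sub>M k\<in>UNIV. borel) \<rightarrow>\<^sub>M prob_algebra borel"
  shows "prob_space (hmm_filter P g \<rho> \<nu> n y)" "sets (hmm_filter P g \<rho> \<nu> n y) = sets borel"
  using hmm_filter_prob[OF P obs_densityD(1,2)[OF g] \<rho> \<nu>, where n=n and y=y]
    by (auto simp: space_prob_algebra)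

text \<open>A vanishing mass would make the filter the zero measure, although it is a probability
  measure.\<close>

lemma mass_predict_pos:
  fixes \<rho> :: "nat \<Rightarrow> (nat \<Rightarrow> 'f) \<Rightarrow> 'e measure"
  assumes \<nu>: "\<nu> \<in> space (prob_algebra borel)"
    and \<rho>: "\<And>n. \<rho> n \<in> (\<Pi>\<^sub>M k\<in>UNIV. borel) \<rightarrow>\<^sub>M prob_algebra borel"
    and fin: "\<And>k. mass (predict \<nu> (Suc k)) (hist (Suc k) y) < \<infinity>"
  shows "mass (predict \<nu> (Suc n)) (hist (Suc n) y) \<noteq> 0"
proof
  assume zero: "mass (predict \<nu> (Suc n)) (hist (Suc n) y) = 0"
  have sp: "space (hmm_filter P g \<rho> \<nu> n y) = UNIV"
    using sets_eq_imp_space_eq[OF hmm_filter_in(2)[where \<rho>=\<rho>, OF \<nu> \<rho>, where n=n and y=y]]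
      by (simp only: space_borel)
  have "1 = emeasure (hmm_filter P g \<rho> \<nu> n y) UNIV"
    using prob_space.emeasure_space_1[OF hmm_filter_in(1)[where \<rho>=\<rho>, OF \<nu> \<rho>, where n=n and y=y]]
      unfolding sp by (rule sym)
  also have "\<dots> = (1 / mass (predict \<nu> (Suc n)) (hist (Suc n) y)) *
    emeasure (updated (predict \<nu> n) (hist (Suc n) y)) UNIV"
    unfolding hmm_filter_updated[where \<rho>=\<rho>, OF \<nu> \<rho> fin, where n=n] by (rule emeasure_scale_measure)
  also have "emeasure (updated (predict \<nu> n) (hist (Suc n) y)) UNIV = 0"
    using zero updated_facts(4)[OF kernel_family_predict[OF \<nu>, of n], of "hist (Suc n) y"] by simp
  finally show False by simp
qed

text \<open>\<open>normalized_le\<close> bounds the setwise difference by 2 c, and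
  \<open>tv_dist_le\<close> doubles this.\<close>

lemma tv_dist_filter_le:
  fixes \<rho> \<rho>' :: "nat \<Rightarrow> (nat \<Rightarrow> 'f) \<Rightarrow> 'e measure"
  assumes \<nu>: "\<nu> \<in> space (prob_algebra borel)" and R: "kernel_family R\<^sub>1" "kernel_family R\<^sub>2"
    and \<rho>: "\<And>n. \<rho> n \<in> (\<Pi>\<^sub>M k\<in>UNIV. borel) \<rightarrow>\<^sub>M prob_algebra borel"
      "\<And>n. \<rho>' n \<in> (\<Pi>\<^sub>M k\<in>UNIV. borel) \<rightarrow>\<^sub>M prob_algebra borel"
    and fin: "\<And>k. mass (predict \<nu> (Suc k)) (hist (Suc k) y) < \<infinity>"
      "\<And>k. mass (predict \<pi> (Suc k)) (hist (Suc k) y) < \<infinity>"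
    and near: "near t (predict \<nu> n) (predict \<pi> n) R\<^sub>1 R\<^sub>2 (\<lambda>i. hist (Suc n) y (Suc i))" and c: "0 \<le> c"
    and small: "mass (advance R\<^sub>1) (hist (Suc n) y) + mass (advance R\<^sub>2) (hist (Suc n) y) \<le>
      ennreal c * mass (predict \<nu> (Suc n)) (hist (Suc n) y)"
  shows "tv_dist (hmm_filter P g \<rho> \<nu> n y) (hmm_filter P g \<rho>' \<pi> n y) \<le> 4 * c"
proof -
  let ?h = "hist (Suc n) y"
  let ?M = "updated (predict \<nu> n) ?h" and ?M' = "updated (predict \<pi> n) ?h"
  let ?m = "mass (predict \<nu> (Suc n)) ?h" and ?m' = "mass (predict \<pi> (Suc n)) ?h"
  let ?r = "mass (advance R\<^sub>1) ?h + mass (advance R\<^sub>2) ?h"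
  note K = kernel_family_predict[OF \<nu>, of n] kernel_family_predict[OF \<pi>, of n]
  have m: "?m \<noteq> 0" "?m \<noteq> \<infinity>" and m': "?m' \<noteq> 0" "?m' \<noteq> \<infinity>"
    by (rule mass_predict_pos[where \<rho>=\<rho>, OF \<nu> \<rho>(1) fin(1)], use fin(1)[of n] in force,
        rule mass_predict_pos[where \<rho>=\<rho>', OF \<pi> \<rho>(2) fin(2)], use fin(2)[of n] in force)
  have adv: "advance (predict \<nu> n) = predict \<nu> (Suc n)" "advance (predict \<pi> n) = predict \<pi> (Suc n)"
    by simp_all
  note near' = near_updated[OF K R near, unfolded near_def, rule_format]
  have *: "emeasure (hmm_filter P g \<rho> \<nu> n y) A \<le>
    emeasure (hmm_filter P g \<rho>' \<pi> n y) A + ennreal (2 * c)" if A: "A \<in> sets borel" for A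
  proof -
    have ind: "(\<integral>\<^sup>+x. indicator A x \<partial>updated L ?h) =
      emeasure (updated L ?h) A" if "kernel_family L" for L
      using A by (simp add: updated_facts(1)[OF that] del: hist.simps)
    have tot: "(\<integral>\<^sup>+x. 1 \<partial>updated L ?h) = mass (advance L) ?h" if "kernel_family L" for L
      using updated_facts(2,4)[OF that, of ?h] by (simp del: hist.simps)
    have le: "emeasure (updated L ?h) A \<le> mass (advance L) ?h" if "kernel_family L" for L
      using A emeasure_mono[of A UNIV "updated L ?h"] updated_facts(1,4)[OF that, of ?h]
        by (simp del: hist.simps)
    have 1: "emeasure ?M A \<le> t * emeasure ?M' A + ?r"
    proof -
      have "indicator A \<in> borel_measurable borel" using A by measurable
      from conjunct1[OF near'[OF this]]
      have "emeasure ?M A \<le> t * emeasure ?M' A + (emeasure (updated R\<^sub>1 ?h) A +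
        emeasure (updated R\<^sub>2 ?h) A)"
        unfolding ind[OF K(1)] ind[OF K(2)] ind[OF R(1)] ind[OF R(2)] .
      also have "\<dots> \<le> t * emeasure ?M' A + ?r"
        by (intro add_left_mono add_mono le R)
      finally show ?thesis .
    qed
    have 2: "t * ?m' \<le> ?m + ?r"
      using conjunct2[OF near'[OF borel_measurable_const, of 1]]
      unfolding tot[OF K(1)] tot[OF K(2)] tot[OF R(1)] tot[OF R(2)] adv .
    have F: "emeasure (hmm_filter P g \<rho> \<nu> n y) A = (1 / ?m) * emeasure ?M A"
      unfolding hmm_filter_updated[where \<rho>=\<rho>, OF \<nu> \<rho>(1) fin(1), where n=n]
        by (rule emeasure_scale_measure)
    have F': "emeasure (hmm_filter P g \<rho>' \<pi> n y) A = (1 / ?m') * emeasure ?M' A"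
      unfolding hmm_filter_updated[where \<rho>=\<rho>', OF \<pi> \<rho>(2) fin(2), where n=n]
        by (rule emeasure_scale_measure)
    have "emeasure ?M' A \<le> ?m'" using le[OF K(2)] unfolding adv .
    then have "emeasure (hmm_filter P g \<rho> \<nu> n y) A \<le>
      emeasure (hmm_filter P g \<rho>' \<pi> n y) A + 2 * ennreal c"
      unfolding F F' by (rule normalized_le[OF m m' 1 2 _ small])
    also have "2 * ennreal c = ennreal (2 * c)" using c by (simp add: ennreal_mult)
    finally show ?thesis .
  qed
  have "tv_dist (hmm_filter P g \<rho> \<nu> n y) (hmm_filter P g \<rho>' \<pi> n y) \<le> 2 * (2 * c)"
  proof (rule tv_dist_le)
    show "prob_space (hmm_filter P g \<rho> \<nu> n y)" "prob_space (hmm_filter P g \<rho>' \<pi> n y)"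
      by (rule hmm_filter_in(1)[where \<rho>=\<rho>, OF \<nu> \<rho>(1)], rule hmm_filter_in(1)[where \<rho>=\<rho>', OF \<pi> \<rho>(2)])
    show "sets (hmm_filter P g \<rho> \<nu> n y) = sets (hmm_filter P g \<rho>' \<pi> n y)"
      unfolding hmm_filter_in(2)[where \<rho>=\<rho>, OF \<nu> \<rho>(1)] hmm_filter_in(2)[where \<rho>=\<rho>', OF \<pi> \<rho>(2)] ..
    show "emeasure (hmm_filter P g \<rho> \<nu> n y) A \<le> emeasure (hmm_filter P g \<rho>' \<pi> n y) A + ennreal (2 * c)"
      if "A \<in> sets (hmm_filter P g \<rho> \<nu> n y)" for A
      using that unfolding hmm_filter_in(2)[where \<rho>=\<rho>, OF \<nu> \<rho>(1)] by (rule *)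
  qed (use c in simp)
  then show ?thesis by simp
qed

section \<open>Error kernels from an almost observable density\<close>

lemma mass_density:
  assumes K: "kernel_family K" and b: "b \<in> borel_measurable EH"
  shows "mass (\<lambda>h. density (K h) (\<lambda>x. b (x, h))) h = (\<integral>\<^sup>+x. b (x, h) \<partial>K h)"
proof -
  have "(\<lambda>x. b (x, h)) \<in> borel_measurable borel"
    by (rule measurable_compose[OF measurable_Pair2' b]) simp
  then have "mass (\<lambda>h. density (K h) (\<lambda>x. b (x, h))) h = (\<integral>\<^sup>+x. b (x, h) * indicator UNIV x \<partial>K h)"
    unfolding mass_def by (intro emeasure_density)
      (simp_all add: kernel_familyD(2)[OF K] measurable_cong_sets[OF kernel_familyD(2)[OF K] refl])
  then show ?thesis by simp
qed

lemma nn_integral_mass_density_predict: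
  assumes \<nu>: "\<nu> \<in> space (prob_algebra borel)" and b: "b \<in> borel_measurable EH"
  shows "(\<integral>\<^sup>+h. mass (\<lambda>h. density (predict \<nu> n h) (\<lambda>x. b (x, h))) h \<partial>noise n) = (\<integral>\<^sup>+s. b s \<partial>joint \<nu> n)"
  unfolding mass_density[OF kernel_family_predict[OF \<nu>] b]
    by (rule nn_integral_joint_predict[OF \<nu> b, symmetric])

text \<open>Disintegration over the noise turns the comparison of joint laws into one on rectangles,
  and \<open>AE_kernel_le\<close> makes it pointwise in the history.\<close>

lemma AE_density_predict_le:
  assumes \<nu>: "\<nu> \<in> space (prob_algebra borel)" and \<nu>': "\<nu>' \<in> space (prob_algebra borel)"
    and a[measurable]: "a \<in> borel_measurable EH" and b[measurable]: "b \<in> borel_measurable EH"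
    and le: "\<And>X. X \<in> sets EH \<Longrightarrow> (\<integral>\<^sup>+s. a s * indicator X s \<partial>joint \<nu> n) \<le>
      (\<integral>\<^sup>+s. b s * indicator X s \<partial>joint \<nu>' n)"
    and fin: "(\<integral>\<^sup>+s. b s \<partial>joint \<nu>' n) < \<infinity>"
  shows "AE h in noise n. \<forall>B\<in>sets borel. emeasure (density (predict \<nu> n h) (\<lambda>x. a (x, h))) B \<le>
    emeasure (density (predict \<nu>' n h) (\<lambda>x. b (x, h))) B"
proof -
  have em: "emeasure (density (predict \<nu> n h) (\<lambda>x. a (x, h))) B =
    (\<integral>\<^sup>+x. a (x, h) * indicator B x \<partial>predict \<nu> n h)"
    if B: "B \<in> sets borel" and a: "a \<in> borel_measurable EH"
      and \<nu>: "\<nu> \<in> space (prob_algebra borel)" for a :: "'e \<times> (nat \<Rightarrow> 'f) \<Rightarrow> ennreal" and B h \<nu>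
  proof -
    note K = kernel_family_predict[OF \<nu>, of n]
    have "(\<lambda>x. a (x, h)) \<in> borel_measurable borel"
      by (rule measurable_compose[OF measurable_Pair2' a]) simp
    then show ?thesis
      using B by (intro emeasure_density)
        (simp_all add: kernel_familyD(2)[OF K] measurable_cong_sets[OF kernel_familyD(2)[OF K] refl])
  qed
  have mB: "(\<lambda>s. a s * indicator B (fst s)) \<in> borel_measurable EH" if [measurable]: "B \<in> sets borel"
    "a \<in> borel_measurable EH"
    for a :: "'e \<times> (nat \<Rightarrow> 'f) \<Rightarrow> ennreal" and B by measurable
  have m: "(\<lambda>h. emeasure (density (predict \<nu> n h) (\<lambda>x. a (x, h))) B) \<in> borel_measurable (noise n)"
    if B: "B \<in> sets borel" and a: "a \<in> borel_measurable EH"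
      and \<nu>: "\<nu> \<in> space (prob_algebra borel)" for a :: "'e \<times> (nat \<Rightarrow> 'f) \<Rightarrow> ennreal" and B \<nu>
    using kernel_familyD(5)[OF kernel_family_predict[OF \<nu>, of n] mB[OF B a]]
    unfolding em[OF B a \<nu>] measurable_cong_sets[OF sets_noise refl] by simp
  have int: "(\<integral>\<^sup>+h. emeasure (density (predict \<nu> n h) (\<lambda>x. a (x, h))) B * indicator C h \<partial>noise n) =
      (\<integral>\<^sup>+s. a s * indicator (B \<times> C) s \<partial>joint \<nu> n)"
    if B[measurable]: "B \<in> sets borel" and C[measurable]: "C \<in> sets MH"
      and a[measurable]: "a \<in> borel_measurable EH"
      and \<nu>: "\<nu> \<in> space (prob_algebra borel)" for a :: "'e \<times> (nat \<Rightarrow> 'f) \<Rightarrow> ennreal" and B C \<nu>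
  proof -
    have "(\<lambda>s. a s * indicator (B \<times> C) s) \<in> borel_measurable EH" by measurable
    from nn_integral_joint_predict[OF \<nu> this]
    have "(\<integral>\<^sup>+s. a s * indicator (B \<times> C) s \<partial>joint \<nu> n) =
      (\<integral>\<^sup>+h. \<integral>\<^sup>+x. a (x, h) * indicator (B \<times> C) (x, h) \<partial>predict \<nu> n h \<partial>noise n)" .
    also have "\<dots> = (\<integral>\<^sup>+h. emeasure (density (predict \<nu> n h) (\<lambda>x. a (x, h))) B * indicator C h \<partial>noise n)"
      unfolding em[OF B a \<nu>] by (intro nn_integral_cong)
        (auto simp: indicator_def intro!: nn_integral_cong)
    finally show ?thesis ..
  qed
  show ?thesis
  proof (rule AE_kernel_le)
    show "sets (density (predict \<nu> n h) (\<lambda>x. a (x, h))) =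
      sets borel" "sets (density (predict \<nu>' n h) (\<lambda>x. b (x, h))) = sets borel" for h
      using kernel_familyD(2)[OF kernel_family_predict[OF \<nu>, of n]] kernel_familyD(2)[OF
        kernel_family_predict[OF \<nu>', of n]] by simp_all
    show "(\<lambda>h. emeasure (density (predict \<nu> n h) (\<lambda>x. a (x, h))) B) \<in> borel_measurable (noise n)"
      "(\<lambda>h. emeasure (density (predict \<nu>' n h) (\<lambda>x. b (x, h))) B) \<in> borel_measurable (noise n)"
        if "B \<in> sets borel" for B
      by (rule m[OF that a \<nu>], rule m[OF that b \<nu>'])
    show "(\<integral>\<^sup>+h. emeasure (density (predict \<nu>' n h) (\<lambda>x. b (x, h))) UNIV \<partial>noise n) < \<infinity>"
      using fin nn_integral_mass_density_predict[OF \<nu>' b, of n] by (simp only: mass_def)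
    fix B :: "'e set" and C assume B: "B \<in> sets borel" and "C \<in> sets (noise n)"
    then have C: "C \<in> sets MH" by (simp only: sets_noise)
    have "B \<times> C \<in> sets EH" using B C by simp
    from le[OF this] show "(\<integral>\<^sup>+h. emeasure (density (predict \<nu> n h) (\<lambda>x. a (x, h))) B *
      indicator C h \<partial>noise n)
        \<le> (\<integral>\<^sup>+h. emeasure (density (predict \<nu>' n h) (\<lambda>x. b (x, h))) B * indicator C h \<partial>noise n)"
      unfolding int[OF B C a \<nu>] int[OF B C b \<nu>'] .
  qed
qed

text \<open>Formally, K - t K' = (1 - w) K + (u - t) K', because u K' and w K are the same measure.
  The error r collects the two terms on the right, with the absolute value of u - t.\<close>

lemma nearI:
  fixes K K' :: "'e measure" and u w :: "'e \<Rightarrow> real"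
  assumes K: "sets K = sets borel" "sets K' = sets borel"
    and [measurable]: "u \<in> borel_measurable borel" "w \<in> borel_measurable borel" and t: "0 \<le> t"
      and u: "\<And>x. 0 \<le> u x" and w: "\<And>x. 0 \<le> w x" "\<And>x. w x \<le> (1 :: real)"
    and eq: "\<And>B. B \<in> sets borel \<Longrightarrow> emeasure (density K' (\<lambda>x. ennreal (u x))) B =
      emeasure (density K (\<lambda>x. ennreal (w x))) B"
    and F[measurable]: "F \<in> borel_measurable borel"
  defines "r \<equiv> (\<integral>\<^sup>+x. F x \<partial>density K' (\<lambda>x. ennreal \<bar>u x - t\<bar>)) +
    (\<integral>\<^sup>+x. F x \<partial>density K (\<lambda>x. ennreal (1 - w x)))"
  shows "(\<integral>\<^sup>+x. F x \<partial>K) \<le> ennreal t * (\<integral>\<^sup>+x. F x \<partial>K') + r" and "ennreal t * (\<integral>\<^sup>+x. F x \<partial>K') \<le>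
    (\<integral>\<^sup>+x. F x \<partial>K) + r"
proof -
  note K[measurable_cong]
  have "density K' (\<lambda>x. ennreal (u x)) = density K (\<lambda>x. ennreal (w x))"
    by (rule measure_eqI) (simp_all add: K eq)
  then have eqF: "(\<integral>\<^sup>+x. ennreal (u x) * F x \<partial>K') = (\<integral>\<^sup>+x. ennreal (w x) * F x \<partial>K)"
    by (simp add: nn_integral_density[symmetric])
  have r: "r = (\<integral>\<^sup>+x. ennreal \<bar>u x - t\<bar> * F x \<partial>K') + (\<integral>\<^sup>+x. ennreal (1 - w x) * F x \<partial>K)"
    unfolding r_def by (simp add: nn_integral_density)
  have "F x = ennreal (w x) * F x + ennreal (1 - w x) * F x" for x
  proof -
    have "ennreal (w x) * F x + ennreal (1 - w x) * F x = ennreal (w x + (1 - w x)) * F x"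
      using w[of x] by (subst ennreal_plus) (auto simp: distrib_right)
    then show ?thesis by simp
  qed
  then have "(\<integral>\<^sup>+x. F x \<partial>K) = (\<integral>\<^sup>+x. ennreal (w x) * F x + ennreal (1 - w x) * F x \<partial>K)" by simp
  also have "\<dots> = (\<integral>\<^sup>+x. ennreal (w x) * F x \<partial>K) + (\<integral>\<^sup>+x. ennreal (1 - w x) * F x \<partial>K)"
    by (rule nn_integral_add) measurable
  finally have FK: "(\<integral>\<^sup>+x. F x \<partial>K) = (\<integral>\<^sup>+x. ennreal (u x) * F x \<partial>K') + (\<integral>\<^sup>+x. ennreal (1 - w x) *
    F x \<partial>K)"
    by (simp only: eqF)
  have le: "(\<integral>\<^sup>+x. ennreal (a x) * F x \<partial>K') \<le>
    (\<integral>\<^sup>+x. ennreal (b x) * F x \<partial>K') + (\<integral>\<^sup>+x. ennreal \<bar>u x - t\<bar> * F x \<partial>K')"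
    if [measurable]: "b \<in> borel_measurable borel" and b: "\<And>x. 0 \<le> b x"
      and ab: "\<And>x. a x \<le> b x + \<bar>u x - t\<bar>" for a b :: "'e \<Rightarrow> real"
  proof -
    have "(\<integral>\<^sup>+x. ennreal (a x) * F x \<partial>K') \<le> (\<integral>\<^sup>+x. ennreal (b x) * F x + ennreal \<bar>u x - t\<bar> * F x \<partial>K')"
    proof (intro nn_integral_mono)
      fix x
      have "ennreal (a x) * F x \<le> ennreal (b x + \<bar>u x - t\<bar>) * F x"
        using ab by (intro mult_right_mono ennreal_leI) auto
      then show "ennreal (a x) * F x \<le> ennreal (b x) * F x + ennreal \<bar>u x - t\<bar> * F x"
        using b by (simp add: ennreal_plus distrib_right)
    qed
    also have "\<dots> = (\<integral>\<^sup>+x. ennreal (b x) * F x \<partial>K') + (\<integral>\<^sup>+x. ennreal \<bar>u x - t\<bar> * F x \<partial>K')"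
      by (rule nn_integral_add) measurable
    finally show ?thesis .
  qed
  have tF: "(\<integral>\<^sup>+x. ennreal t * F x \<partial>K') = ennreal t * (\<integral>\<^sup>+x. F x \<partial>K')"
    by (rule nn_integral_cmult) measurable
  have 1: "(\<integral>\<^sup>+x. ennreal (u x) * F x \<partial>K') \<le>
    ennreal t * (\<integral>\<^sup>+x. F x \<partial>K') + (\<integral>\<^sup>+x. ennreal \<bar>u x - t\<bar> * F x \<partial>K')"
    unfolding tF[symmetric] using t by (intro le) auto
  have 2: "ennreal t * (\<integral>\<^sup>+x. F x \<partial>K') \<le>
    (\<integral>\<^sup>+x. ennreal (u x) * F x \<partial>K') + (\<integral>\<^sup>+x. ennreal \<bar>u x - t\<bar> * F x \<partial>K')"
    unfolding tF[symmetric] using u by (intro le) auto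
  show "(\<integral>\<^sup>+x. F x \<partial>K) \<le> ennreal t * (\<integral>\<^sup>+x. F x \<partial>K') + r"
    unfolding FK r using add_right_mono[OF 1, of "\<integral>\<^sup>+x. ennreal (1 - w x) * F x \<partial>K"]
      by (simp only: add.assoc)
  have "ennreal t * (\<integral>\<^sup>+x. F x \<partial>K') + 0 \<le>
    ((\<integral>\<^sup>+x. ennreal (u x) * F x \<partial>K') + (\<integral>\<^sup>+x. ennreal \<bar>u x - t\<bar> * F x \<partial>K')) +
    ((\<integral>\<^sup>+x. ennreal (1 - w x) * F x \<partial>K) + (\<integral>\<^sup>+x. ennreal (1 - w x) * F x \<partial>K))"
    using 2 by (intro add_mono) auto
  then show "ennreal t * (\<integral>\<^sup>+x. F x \<partial>K') \<le> (\<integral>\<^sup>+x. F x \<partial>K) + r"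
    unfolding FK r by (simp only: add.assoc add.commute add.left_commute add_0_right add_0_left)
qed

text \<open>Let u be the almost observable density and v its approximation. \<open>nearI\<close> is
  applied with t = v(h) and with w the density of the dominated part relative to the law started
  from \<nu>. One error mass is the distance of u from v, the other is the mass of that law which
  the dominated part misses; each is at most \<eta>.\<close>

lemma AE_near:
  assumes mix: "mixing \<longlonglongrightarrow> 0" and \<nu>: "\<nu> \<in> space (prob_algebra borel)"
    and conv: "(\<lambda>n. tv_dist (\<nu> \<bind> Pn n) \<pi>) \<longlonglongrightarrow> 0" and \<eta>: "0 < (\<eta> :: real)"
  obtains n t R\<^sub>1 R\<^sub>2 where "kernel_family R\<^sub>1" "kernel_family R\<^sub>2"
    "AE h in noise n. near (t h) (predict \<nu> n) (predict \<pi> n) R\<^sub>1 R\<^sub>2 h"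
    "(\<integral>\<^sup>+h. mass R\<^sub>1 h + mass R\<^sub>2 h \<partial>noise n) \<le> ennreal (2 * \<eta>)"
proof -
  obtain n u v where u[measurable]: "u \<in> borel_measurable EH" and u0: "\<And>s. 0 \<le> u s"
    and v[measurable]: "v \<in> borel_measurable MH" and v0: "\<And>h. 0 \<le> (v h :: real)"
    and dom: "\<And>X. X \<in> sets EH \<Longrightarrow> emeasure (density (joint \<pi> n) (\<lambda>s. ennreal (u s))) X \<le>
      emeasure (joint \<nu> n) X"
    and tot: "1 \<le> (\<integral>\<^sup>+s. ennreal (u s) \<partial>joint \<pi> n) + ennreal \<eta>"
    and uv: "(\<integral>\<^sup>+s. ennreal \<bar>u s - v (snd s)\<bar> \<partial>joint \<pi> n) \<le> ennreal \<eta>"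
    by (rule ex_almost_observable_density[OF mix \<nu> conv \<eta>]) (rule that)
  let ?J = "joint \<pi> n" and ?M = "joint \<nu> n"
  note sJ[measurable_cong] = joint_in(2)[OF \<pi>, of n] and sM[measurable_cong] = joint_in(2)[OF \<nu>, of n]
  interpret M: prob_space ?M by (rule joint_in(3)[OF \<nu>])
  have sD: "sets (density ?J (\<lambda>s. ennreal (u s))) = sets ?M" by (simp add: sJ sM)
  obtain w :: "'e \<times> (nat \<Rightarrow> 'f) \<Rightarrow> real" where wM: "w \<in> borel_measurable ?M"
    and w: "\<And>s. 0 \<le> w s" "\<And>s. w s \<le> 1"
    and eq: "density ?J (\<lambda>s. ennreal (u s)) = density ?M (\<lambda>s. ennreal (w s))"
  proof (rule Radon_Nikodym_le[OF M.finite_measure_axioms sD])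
    show "emeasure (density ?J (\<lambda>s. ennreal (u s))) A \<le> emeasure ?M A" if "A \<in> sets ?M" for A
      using that unfolding sM by (rule dom)
  qed (rule that)
  have wm[measurable]: "w \<in> borel_measurable EH" using wM unfolding measurable_cong_sets[OF sM refl] .
  have int_eq: "(\<integral>\<^sup>+s. ennreal (u s) * F s \<partial>?J) =
    (\<integral>\<^sup>+s. ennreal (w s) * F s \<partial>?M)" if [measurable]: "F \<in> borel_measurable EH" for F
  proof -
    have "(\<integral>\<^sup>+s. ennreal (u s) * F s \<partial>?J) = (\<integral>\<^sup>+s. F s \<partial>density ?J (\<lambda>s. ennreal (u s)))"
      by (rule nn_integral_density[symmetric]) measurable
    also have "\<dots> = (\<integral>\<^sup>+s. ennreal (w s) * F s \<partial>?M)"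
      unfolding eq by (rule nn_integral_density) measurable
    finally show ?thesis .
  qed
  have uw: "(\<integral>\<^sup>+s. ennreal (u s) \<partial>?J) = (\<integral>\<^sup>+s. ennreal (w s) \<partial>?M)"
    using int_eq[OF borel_measurable_const, of 1] by (simp only: mult_1_right)
  have w_le: "(\<integral>\<^sup>+s. ennreal (w s) \<partial>?M) \<le> 1"
    using w by (intro M.nn_integral_le_1) (simp add: ennreal_le_1)
  let ?u = "\<lambda>s. ennreal (u s)" and ?w = "\<lambda>s. ennreal (w s)"
  have um: "?u \<in> borel_measurable EH" "?w \<in> borel_measurable EH" by measurable
  \<comment> \<open>Equality of the two weighted joint laws passes to the prediction kernels as a
    pair of inequalities, for almost every history.\<close>
  have ae: "AE h in noise n. (\<forall>B\<in>sets borel. emeasure (density (predict \<pi> n h) (\<lambda>x. ?u (x, h))) B \<le>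
    emeasure (density (predict \<nu> n h) (\<lambda>x. ?w (x, h))) B) \<and>
      (\<forall>B\<in>sets borel. emeasure (density (predict \<nu> n h) (\<lambda>x. ?w (x, h))) B \<le>
        emeasure (density (predict \<pi> n h) (\<lambda>x. ?u (x, h))) B)"
  proof (intro AE_conjI AE_density_predict_le[OF \<pi> \<nu> um] AE_density_predict_le[OF \<nu> \<pi> um(2,1)])
    show "(\<integral>\<^sup>+s. ?u s * indicator X s \<partial>?J) \<le> (\<integral>\<^sup>+s. ?w s * indicator X s \<partial>?M)"
      "(\<integral>\<^sup>+s. ?w s * indicator X s \<partial>?M) \<le> (\<integral>\<^sup>+s. ?u s * indicator X s \<partial>?J)" if "X \<in> sets EH" for X
      using int_eq[OF borel_measurable_indicator[OF that]] by simp_all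
    show "(\<integral>\<^sup>+s. ?w s \<partial>?M) < \<infinity>" "(\<integral>\<^sup>+s. ?u s \<partial>?J) < \<infinity>"
      unfolding uw using w_le by (auto intro: le_less_trans)
  qed
  let ?b1 = "\<lambda>s. ennreal \<bar>u s - v (snd s)\<bar>" and ?b2 = "\<lambda>s. ennreal (1 - w s)"
  have bm: "?b1 \<in> borel_measurable EH" "?b2 \<in> borel_measurable EH" by measurable
  let ?R1 = "\<lambda>h. density (predict \<pi> n h) (\<lambda>x. ?b1 (x, h))"
    and ?R2 = "\<lambda>h. density (predict \<nu> n h) (\<lambda>x. ?b2 (x, h))"
  have fam: "kernel_family ?R1" "kernel_family ?R2"
    by (rule kernel_family_density[OF kernel_family_predict[OF \<pi>] bm(1)], rule
      kernel_family_density[OF kernel_family_predict[OF \<nu>] bm(2)])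
  show thesis
  proof (rule that[OF fam])
    show "AE h in noise n. near (ennreal (v h)) (predict \<nu> n) (predict \<pi> n) ?R1 ?R2 h"
      using ae
    proof eventually_elim
      case (elim h)
      have sec: "(\<lambda>x. u (x, h)) \<in> borel_measurable borel" "(\<lambda>x. w (x, h)) \<in> borel_measurable borel"
        by (rule measurable_compose[OF measurable_Pair2' u], simp, rule measurable_compose[OF
          measurable_Pair2' wm], simp)
      have "emeasure (density (predict \<pi> n h) (\<lambda>x. ennreal (u (x, h)))) B =
        emeasure (density (predict \<nu> n h) (\<lambda>x. ennreal (w (x, h)))) B"
        if "B \<in> sets borel" for B using elim that by (intro antisym) auto
      note nearI[OF kernel_familyD(2)[OF kernel_family_predict[OF \<nu>]] kernel_familyD(2)[OF
        kernel_family_predict[OF \<pi>]] sec v0[of h] u0 w this]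
      then show ?case unfolding near_def snd_conv by simp
    qed
    have "(\<integral>\<^sup>+h. mass ?R1 h + mass ?R2 h \<partial>noise n) =
      (\<integral>\<^sup>+h. mass ?R1 h \<partial>noise n) + (\<integral>\<^sup>+h. mass ?R2 h \<partial>noise n)"
      using mass_measurable[OF fam(1)] mass_measurable[OF fam(2)]
      by (intro nn_integral_add) (simp_all only: measurable_cong_sets[OF sets_noise refl])
    also have "\<dots> = (\<integral>\<^sup>+s. ?b1 s \<partial>?J) + (\<integral>\<^sup>+s. ?b2 s \<partial>?M)"
      unfolding nn_integral_mass_density_predict[OF \<pi> bm(1)] nn_integral_mass_density_predict[OF \<nu>
        bm(2)] ..
    also have "\<dots> \<le> ennreal \<eta> + ennreal \<eta>"
    proof (rule add_mono[OF uv])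
      have "(\<integral>\<^sup>+s. ?w s \<partial>?M) + (\<integral>\<^sup>+s. ?b2 s \<partial>?M) = (\<integral>\<^sup>+s. ?w s + ?b2 s \<partial>?M)"
        by (rule nn_integral_add[symmetric]) measurable
      also have "\<dots> = (\<integral>\<^sup>+s. 1 \<partial>?M)"
        using w by (intro nn_integral_cong) (simp add: ennreal_plus[symmetric] del: ennreal_plus)
      also have "\<dots> \<le> (\<integral>\<^sup>+s. ?w s \<partial>?M) + ennreal \<eta>"
        using tot unfolding uw by (simp add: M.emeasure_space_1)
      finally show "(\<integral>\<^sup>+s. ?b2 s \<partial>?M) \<le> ennreal \<eta>"
        using w_le by (subst (asm) ennreal_add_left_cancel_le) (auto simp: top_unique)
    qed
    finally show "(\<integral>\<^sup>+h. mass ?R1 h + mass ?R2 h \<partial>noise n) \<le> ennreal (2 * \<eta>)"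
      using \<eta> by (simp add: ennreal_plus[symmetric] del: ennreal_plus)
  qed
qed

lemma AE_mass_predict_finite:
  assumes \<nu>: "\<nu> \<in> space (prob_algebra borel)" and \<nu>': "\<nu>' \<in> space (prob_algebra borel)"
  shows "AE s in hmm_law P (obs g) \<nu>. \<forall>k. mass (predict \<nu>' k) (hist k (snd s)) < \<infinity>"
  by (intro AE_all_countable[THEN iffD2] allI AE_hmm_law_hist[OF \<nu>] mass_predict_finite[OF \<nu>'])

lemma filters_merge:
  fixes \<rho> \<rho>' :: "nat \<Rightarrow> (nat \<Rightarrow> 'f) \<Rightarrow> 'e measure"
  assumes mix: "mixing \<longlonglongrightarrow> 0" and \<nu>: "\<nu> \<in> space (prob_algebra borel)"
    and \<rho>: "\<And>n. \<rho> n \<in> (\<Pi>\<^sub>M k\<in>UNIV. borel) \<rightarrow>\<^sub>M prob_algebra borel"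
      "\<And>n. \<rho>' n \<in> (\<Pi>\<^sub>M k\<in>UNIV. borel) \<rightarrow>\<^sub>M prob_algebra borel"
    and conv: "(\<lambda>n. tv_dist (\<nu> \<bind> Pn n) \<pi>) \<longlonglongrightarrow> 0"
  shows "AE s in hmm_law P (obs g) \<nu>. (\<lambda>n. tv_dist (hmm_filter P g \<rho> \<nu> n (snd s)) (hmm_filter P g \<rho>'
    \<pi> n (snd s))) \<longlonglongrightarrow> 0"
proof -
  let ?H = "hmm_law P (obs g) \<nu>"
  let ?d = "\<lambda>n s. tv_dist (hmm_filter P g \<rho> \<nu> n (snd s)) (hmm_filter P g \<rho>' \<pi> n (snd s))"
  have ev: "AE s in ?H. eventually (\<lambda>n. ?d n s \<le> \<delta>) sequentially" if \<delta>: "0 < \<delta>" for \<delta> :: real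
  proof (rule AE_if_small_exceptions)
    fix e :: real assume e: "0 < e"
    \<comment> \<open>The level in the maximal inequality is \<delta> / 4, since
      \<open>tv_dist_filter_le\<close> multiplies it by 4. The error mass is at most 2 \<eta> = e
      (\<delta> / 4), so the exceptional event has probability at most e.\<close>
    define \<eta> where "\<eta> = e * \<delta> / 8"
    have \<eta>: "0 < \<eta>" using e \<delta> by (simp add: \<eta>_def)
    obtain n t R\<^sub>1 R\<^sub>2 where R: "kernel_family R\<^sub>1" "kernel_family R\<^sub>2"
      and near: "AE h in noise n. near (t h) (predict \<nu> n) (predict \<pi> n) R\<^sub>1 R\<^sub>2 h"
      and Rs: "(\<integral>\<^sup>+h. mass R\<^sub>1 h + mass R\<^sub>2 h \<partial>noise n) \<le> ennreal (2 * \<eta>)"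
      by (rule AE_near[OF mix \<nu> conv \<eta>]) (rule that)
    let ?c = "ennreal (\<delta> / 4)"
    let ?D = "\<lambda>j. {h. ?c * mass (predict \<nu> (n + j)) h < mass ((advance ^^ j) R\<^sub>1) h +
      mass ((advance ^^ j) R\<^sub>2) h}"
    define U :: "((nat \<Rightarrow> 'e) \<times> (nat \<Rightarrow> 'f)) set" where "U = {s. \<exists>j. hist (n + j) (snd s) \<in> ?D j}"
    note max = maximal_inequality[OF \<nu> R, where n=n and c="?c", folded U_def]
    have "?c * emeasure ?H U \<le> ?c * ennreal e"
      using order_trans[OF max(2) Rs] \<delta> e by (simp add: \<eta>_def ennreal_mult[symmetric] mult.commute)
    then have "emeasure ?H U \<le> ennreal e"
      using \<delta> by (subst (asm) ennreal_mult_le_mult_iff) auto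
    moreover have "AE s in ?H. s \<notin> U \<longrightarrow> eventually (\<lambda>n. ?d n s \<le> \<delta>) sequentially"
      using AE_hmm_law_hist[OF \<nu> near] AE_mass_predict_finite[OF \<nu> \<nu>] AE_mass_predict_finite[OF \<nu> \<pi>]
    proof eventually_elim
      case (elim s)
      let ?y = "snd s"
      show ?case
      proof
        assume sU: "s \<notin> U"
        have "?d (n + j) s \<le> \<delta>" for j
        proof -
          note K = kernel_family_predict[OF \<nu>, of n] kernel_family_predict[OF \<pi>, of n]
          have tl: "(\<lambda>i. hist (Suc (n + j)) ?y (Suc i)) = hist (n + j) ?y" by simp
          have ad: "(advance ^^ Suc j) R = advance ((advance ^^ j) R)" for R by simp
          \<comment> \<open>The filter at time n + j has used the observation made at that time, so
            its normalising constant is the prediction mass one step later.\<close>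
          have "\<not> hist (n + Suc j) ?y \<in> ?D (Suc j)" using sU unfolding U_def by blast
          then have small: "mass (advance ((advance ^^ j) R\<^sub>1)) (hist (Suc (n + j)) ?y) +
            mass (advance ((advance ^^ j) R\<^sub>2)) (hist (Suc (n + j)) ?y)
              \<le> ?c * mass (predict \<nu> (Suc (n + j))) (hist (Suc (n + j)) ?y)"
            unfolding mem_Collect_eq not_less add_Suc_right ad .
          have near': "near (t (hist n ?y)) (predict \<nu> (n + j)) (predict \<pi> (n +
            j)) ((advance ^^ j) R\<^sub>1) ((advance ^^ j) R\<^sub>2) (\<lambda>i. hist (Suc (n + j)) ?y (Suc i))"
            unfolding tl using near_advances[OF K R elim(1), of j] unfolding predict_add .
          have "?d (n + j) s \<le> 4 * (\<delta> / 4)"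
            by (rule tv_dist_filter_le[where \<rho>=\<rho>
              and \<rho>'=\<rho>', OF \<nu> kernel_family_advances[OF R(1)] kernel_family_advances[OF R(2)] \<rho>
                  elim(2)[rule_format] elim(3)[rule_format] near' _ small]) (use \<delta> in simp)
          then show ?thesis by simp
        qed
        then have "\<forall>m\<ge>n. ?d m s \<le> \<delta>" by (metis le_Suc_ex)
        then show "eventually (\<lambda>n. ?d n s \<le> \<delta>) sequentially" unfolding eventually_sequentially by blast
      qed
    qed
    ultimately show "\<exists>U\<in>sets ?H. emeasure ?H U \<le> ennreal e \<and> (AE s in ?H. s \<notin> U \<longrightarrow>
      eventually (\<lambda>n. ?d n s \<le> \<delta>) sequentially)"
      using max(1) by blast
  qed
  have "AE s in ?H. \<forall>k. eventually (\<lambda>n. ?d n s \<le> 1 / real (Suc k)) sequentially"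
    by (intro AE_all_countable[THEN iffD2] allI ev) simp
  then show ?thesis
  proof eventually_elim
    case (elim s)
    have d0: "0 \<le> ?d n s" for n
    proof (rule tv_dist_nonneg)
      show "prob_space (hmm_filter P g \<rho> \<nu> n (snd s))" "prob_space (hmm_filter P g \<rho>' \<pi> n (snd s))"
        by (rule hmm_filter_in(1)[where \<rho>=\<rho>, OF \<nu> \<rho>(1)], rule hmm_filter_in(1)[where \<rho>=\<rho>', OF \<pi> \<rho>(2)])
      show "sets (hmm_filter P g \<rho> \<nu> n (snd s)) = sets (hmm_filter P g \<rho>' \<pi> n (snd s))"
        unfolding hmm_filter_in(2)[where \<rho>=\<rho>, OF \<nu> \<rho>(1)] hmm_filter_in(2)[where \<rho>=\<rho>', OF \<pi> \<rho>(2)] ..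
    qed
    show ?case
    proof (rule order_tendstoI)
      show "eventually (\<lambda>n. a < ?d n s) sequentially" if "a < 0" for a
        using d0 that by (intro always_eventually allI) (rule less_le_trans)
      show "eventually (\<lambda>n. ?d n s < a) sequentially" if a: "0 < a" for a
      proof -
        obtain k where k: "1 / real (Suc k) < a" using reals_Archimedean[OF a]
          by (auto simp: inverse_eq_divide)
        from elim[rule_format, of k] show ?thesis by (rule eventually_mono) (use k in linarith)
      qed
    qed
  qed
qed

section \<open>Convergence of the signal from merging of filters\<close>

text \<open>By stationarity \<pi>-almost no signal moves into a \<pi>-null set, and weighing by
  likelihoods keeps null sets null. The argument applies to each history separately.\<close>

lemma predict_null:
  assumes "B \<in> sets borel" and "emeasure \<pi> B = 0"
  shows "emeasure (predict \<pi> n h) B = 0"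
  using assms
proof (induction n arbitrary: B h)
  case (Suc n)
  note B[measurable] = Suc.prems(1) and K = kernel_family_predict[OF \<pi>, of n]
  note sK[measurable_cong] = kernel_familyD(2)[OF K] and g_section[measurable]
  define A where "A = {x. emeasure (P x) B \<noteq> 0}"
  have PB[measurable]: "(\<lambda>x. emeasure (P x) B) \<in> borel_measurable borel"
    using measurable_compose[OF measurable_prob_algebraD[OF P]
      measurable_emeasure_subprob_algebra[OF B]] .
  have A[measurable]: "A \<in> sets borel"
  proof -
    have "{x \<in> space borel. emeasure (P x) B \<noteq> 0} \<in> sets borel" by measurable
    then show ?thesis by (simp add: A_def)
  qed
  have iB: "indicator B \<in> borel_measurable borel" by measurable
  have "(\<integral>\<^sup>+x. emeasure (P x) B \<partial>\<pi>) = 0"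
    using nn_integral_P_\<pi>[OF iB] Suc.prems(2) by simp
  then have "AE x in \<pi>. emeasure (P x) B = 0"
    by (subst (asm) nn_integral_0_iff_AE) (auto simp: measurable_cong_sets[OF sets_\<pi> refl])
  then have "AE x in \<pi>. x \<notin> A" by eventually_elim (simp add: A_def)
  then have "emeasure \<pi> A = 0"
    using AE_iff_null_sets[of A \<pi>] by (simp add: null_sets_def)
  then have "emeasure (predict \<pi> n (\<lambda>i. h (Suc i))) A = 0" by (rule Suc.IH[OF A])
  then have "AE x in predict \<pi> n (\<lambda>i. h (Suc i)). x \<notin> A"
    by (intro AE_not_in) (auto simp: null_sets_def sK)
  then have "AE x in predict \<pi> n (\<lambda>i. h (Suc i)). ennreal (g x (h 0)) * emeasure (P x) B = 0"
    by eventually_elim (simp add: A_def)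
  then have "(\<integral>\<^sup>+x. ennreal (g x (h 0)) * emeasure (P x) B \<partial>predict \<pi> n (\<lambda>i. h (Suc i))) = 0"
    by (subst nn_integral_0_iff_AE) simp_all
  then have "(\<integral>\<^sup>+x. indicator B x \<partial>advance (predict \<pi> n) h) = 0"
    unfolding advance_def[of "predict \<pi> n"]
    using nn_integral_advance[OF sK iB, of "\<lambda>i. h (Suc i)" "h 0"] by simp
  then show ?case
    using kernel_familyD(2)[OF kernel_family_advance[OF K], of h] by simp
qed simp

text \<open>Dominated convergence, as \<open>excess\<close> is at most 1. The weight q serves starts
  that are absolutely continuous with respect to \<pi>; the constant weight 1 gives
  \<open>mixing\<close>.\<close>

lemma excess_vanishes:
  assumes erg: "AE z in \<pi>. (\<lambda>j. excess j z) \<longlonglongrightarrow> 0"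
    and q[measurable]: "q \<in> borel_measurable borel" and fin: "(\<integral>\<^sup>+x. ennreal (q x) \<partial>\<pi>) < \<infinity>"
  shows "(\<lambda>j. \<integral>\<^sup>+x. ennreal (q x) * excess j x \<partial>\<pi>) \<longlonglongrightarrow> 0"
proof -
  have "(\<lambda>j. \<integral>\<^sup>+x. ennreal (q x) * excess j x \<partial>\<pi>) \<longlonglongrightarrow> (\<integral>\<^sup>+x. 0 \<partial>\<pi>)"
  proof (rule nn_integral_dominated_convergence[where w="\<lambda>x. ennreal (q x)"])
    show "AE x in \<pi>. ennreal (q x) * excess j x \<le> ennreal (q x)" for j
      using mult_left_mono[OF excess_le_1] by (intro AE_I2) (metis mult_1_right zero_le)
    show "AE x in \<pi>. (\<lambda>j. ennreal (q x) * excess j x) \<longlonglongrightarrow> 0"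
      using erg
    proof eventually_elim
      case (elim x)
      show ?case using ennreal_tendsto_cmult[OF _ elim, of "ennreal (q x)"] by simp
    qed
  qed (use fin in \<open>auto simp: measurable_cong_sets[OF sets_\<pi> refl]\<close>)
  then show ?thesis by simp
qed

lemma mixing_tendsto_0:
  assumes "AE z in \<pi>. (\<lambda>j. excess j z) \<longlonglongrightarrow> 0"
  shows "mixing \<longlonglongrightarrow> 0"
  using excess_vanishes[OF assms borel_measurable_const, of 1] \<pi>.emeasure_space_1
  by (simp add: mixing_def[abs_def])

text \<open>Apart from the mass on B, the law of \<open>X\<^sub>n\<close> has the density q with
  respect to \<pi>. After j further steps this part exceeds \<pi> by at most the q-weighted integral
  of \<open>excess j\<close>, eventually below \<delta>. The resulting one-sided bound 2 \<delta> is
  doubled by \<open>tv_dist_le\<close>.\<close>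

lemma eventually_tv_dist_le:
  assumes erg: "AE z in \<pi>. (\<lambda>j. excess j z) \<longlonglongrightarrow> 0" and \<nu>: "\<nu> \<in> space (prob_algebra borel)"
    and B[measurable]: "B \<in> sets borel" and q[measurable]: "q \<in> borel_measurable borel"
    and LD: "density (\<nu> \<bind> Pn n) (indicator (UNIV - B)) = density \<pi> (\<lambda>x. ennreal (q x))"
    and small: "emeasure (\<nu> \<bind> Pn n) B \<le> ennreal \<delta>" and \<delta>: "0 < \<delta>"
  shows "eventually (\<lambda>m. tv_dist (\<nu> \<bind> Pn m) \<pi> \<le> 4 * \<delta>) sequentially"
proof -
  have pn: "\<nu> \<bind> Pn k \<in> space (prob_algebra borel)" for k by (rule bind_in_prob_algebra[OF \<nu> Pn_kernel])
  have sn: "sets (\<nu> \<bind> Pn k) = sets borel" and ppn: "prob_space (\<nu> \<bind> Pn k)" for k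
    using pn[of k] by (auto simp: space_prob_algebra)
  note sn[of n, measurable_cong]
  have dens: "(\<integral>\<^sup>+x. F x * indicator (UNIV - B) x \<partial>(\<nu> \<bind> Pn n)) = (\<integral>\<^sup>+x. ennreal (q x) * F x \<partial>\<pi>)"
    if [measurable]: "F \<in> borel_measurable borel" for F
  proof -
    have "(\<integral>\<^sup>+x. indicator (UNIV - B) x * F x \<partial>(\<nu> \<bind> Pn n)) =
      (\<integral>\<^sup>+x. F x \<partial>density (\<nu> \<bind> Pn n) (indicator (UNIV - B)))"
      by (rule nn_integral_density[symmetric]) measurable
    also have "\<dots> = (\<integral>\<^sup>+x. ennreal (q x) * F x \<partial>\<pi>)"
      unfolding LD by (rule nn_integral_density) measurable
    finally show ?thesis by (simp only: mult.commute)
  qed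
  have q1: "(\<integral>\<^sup>+x. ennreal (q x) \<partial>\<pi>) \<le> 1"
  proof -
    have "(\<integral>\<^sup>+x. ennreal (q x) \<partial>\<pi>) = (\<integral>\<^sup>+x. indicator (UNIV - B) x \<partial>(\<nu> \<bind> Pn n))"
      using dens[OF borel_measurable_const, of 1] by (simp only: mult_1 mult_1_right)
    also have "\<dots> \<le> 1" by (intro prob_space.nn_integral_le_1[OF ppn]) (auto split: split_indicator)
    finally show ?thesis .
  qed
  have "eventually (\<lambda>j. (\<integral>\<^sup>+x. ennreal (q x) * excess j x \<partial>\<pi>) < ennreal \<delta>) sequentially"
    using q1 \<delta> by (intro order_tendstoD(2)[OF excess_vanishes[OF erg q]]) (auto intro: le_less_trans)
  then obtain N where N: "\<And>j. N \<le> j \<Longrightarrow> (\<integral>\<^sup>+x. ennreal (q x) * excess j x \<partial>\<pi>) < ennreal \<delta>"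
    unfolding eventually_sequentially by blast
  have "tv_dist (\<nu> \<bind> Pn m) \<pi> \<le> 4 * \<delta>" if m: "n + N \<le> m" for m
  proof -
    define j where "j = m - n"
    have j: "m = n + j" "N \<le> j" using m by (auto simp: j_def)
    have "tv_dist (\<nu> \<bind> Pn m) \<pi> \<le> 2 * (2 * \<delta>)"
    proof (rule tv_dist_le[OF ppn prob_\<pi>])
      show "sets (\<nu> \<bind> Pn m) = sets \<pi>" by (simp only: sn sets_\<pi>)
      fix A assume "A \<in> sets (\<nu> \<bind> Pn m)"
      then have A[measurable]: "A \<in> sets borel" by (simp only: sn)
      have iA: "indicator A \<in> borel_measurable borel" by measurable
      let ?F = "\<lambda>x. emeasure (Pn j x) A"
      have F: "?F \<in> borel_measurable borel" by (rule emeasure_Pn_measurable[OF A])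
      note F[measurable]
      have "emeasure (\<nu> \<bind> Pn m) A = (\<integral>\<^sup>+x. indicator A x \<partial>((\<nu> \<bind> Pn n) \<bind> Pn j))"
        unfolding bind_kpow_add[OF P \<nu>, of n j, symmetric] j(1)[symmetric] using A by (simp add: sn)
      also have "\<dots> = (\<integral>\<^sup>+x. ?F x \<partial>(\<nu> \<bind> Pn n))"
        using nn_integral_bind_prob[OF sn[of n] Pn_kernel iA, of j] by simp
      also have "\<dots> \<le> (\<integral>\<^sup>+x. ?F x * indicator (UNIV - B) x + indicator B x \<partial>(\<nu> \<bind> Pn n))"
        using prob_space.emeasure_le_1[OF prob_Pn] by (intro nn_integral_mono)
          (auto split: split_indicator)
      also have "\<dots> = (\<integral>\<^sup>+x. ?F x * indicator (UNIV - B) x \<partial>(\<nu> \<bind> Pn n)) + emeasure (\<nu> \<bind> Pn n) B"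
        by (subst nn_integral_add) (auto simp: sn)
      also have "(\<integral>\<^sup>+x. ?F x * indicator (UNIV - B) x \<partial>(\<nu> \<bind> Pn n)) = (\<integral>\<^sup>+x. ennreal (q x) * ?F x \<partial>\<pi>)"
        by (rule dens[OF F])
      also have "\<dots> \<le> (\<integral>\<^sup>+x. emeasure \<pi> A * ennreal (q x) + ennreal (q x) * excess j x \<partial>\<pi>)"
        using mult_left_mono[OF emeasure_Pn_le[OF A], of "ennreal _" j] by (intro nn_integral_mono)
          (simp add: distrib_left mult.commute)
      also have "\<dots> = emeasure \<pi> A * (\<integral>\<^sup>+x. ennreal (q x) \<partial>\<pi>) + (\<integral>\<^sup>+x. ennreal (q x) * excess j x \<partial>\<pi>)"
        by (subst nn_integral_add) (auto simp: nn_integral_cmult measurable_cong_sets[OF sets_\<pi> refl])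
      also have "\<dots> \<le> emeasure \<pi> A * 1 + ennreal \<delta>"
        using q1 N[OF j(2)] by (intro add_mono mult_left_mono) auto
      finally have "emeasure (\<nu> \<bind> Pn m) A \<le> emeasure \<pi> A * 1 + ennreal \<delta> + emeasure (\<nu> \<bind> Pn n) B"
        by (simp add: add_right_mono)
      also have "\<dots> \<le> emeasure \<pi> A * 1 + ennreal \<delta> + ennreal \<delta>" using small by (rule add_left_mono)
      also have "\<dots> = emeasure \<pi> A + ennreal (2 * \<delta>)"
        using \<delta> by (simp add: add.assoc ennreal_plus[symmetric] del: ennreal_plus)
      finally show "emeasure (\<nu> \<bind> Pn m) A \<le> emeasure \<pi> A + ennreal (2 * \<delta>)" .
    qed (use \<delta> in simp)
    then show ?thesis by simp
  qed
  then show ?thesis unfolding eventually_sequentially by blast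
qed

lemma nn_integral_predict_filter:
  fixes \<rho> :: "nat \<Rightarrow> (nat \<Rightarrow> 'f) \<Rightarrow> 'e measure"
  assumes \<nu>: "\<nu> \<in> space (prob_algebra borel)"
    and \<rho>: "\<And>n. \<rho> n \<in> (\<Pi>\<^sub>M k\<in>UNIV. borel) \<rightarrow>\<^sub>M prob_algebra borel"
    and fin: "\<And>k. mass (predict \<nu> (Suc k)) (hist (Suc k) y) < \<infinity>" and B[measurable]: "B \<in> sets borel"
  shows "(\<integral>\<^sup>+x. emeasure (P x) B \<partial>hmm_filter P g \<rho> \<nu> n y) =
    1 / mass (predict \<nu> (Suc n)) (hist (Suc n) y) * emeasure (predict \<nu> (Suc n) (hist (Suc n) y)) B"
proof -
  note K = kernel_family_predict[OF \<nu>]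
  have iB: "indicator B \<in> borel_measurable borel" by measurable
  have PB: "(\<lambda>x. emeasure (P x) B) \<in> borel_measurable borel"
    using measurable_compose[OF measurable_prob_algebraD[OF P]
      measurable_emeasure_subprob_algebra[OF B]] .
  have "(\<integral>\<^sup>+x. emeasure (P x) B \<partial>hmm_filter P g \<rho> \<nu> n y) =
      1 / mass (predict \<nu> (Suc n)) (hist (Suc n) y) *
        (\<integral>\<^sup>+x. emeasure (P x) B \<partial>updated (predict \<nu> n) (hist (Suc n) y))"
    unfolding hmm_filter_updated[where \<rho>=\<rho>, OF \<nu> \<rho> fin, where n=n]
    by (rule nn_integral_scale_measure)
      (simp only: measurable_cong_sets[OF updated_facts(1)[OF K] refl] PB)
  also have "(\<integral>\<^sup>+x. emeasure (P x) B \<partial>updated (predict \<nu> n) (hist (Suc n) y)) =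
    (\<integral>\<^sup>+x. \<integral>\<^sup>+z. indicator B z \<partial>P x \<partial>updated (predict \<nu> n) (hist (Suc n) y))"
    by simp
  also have "\<dots> = (\<integral>\<^sup>+x. indicator B x \<partial>advance (predict \<nu> n) (hist (Suc n) y))"
    by (rule nn_integral_advance_updated[OF K iB, symmetric])
  also have "\<dots> = emeasure (predict \<nu> (Suc n) (hist (Suc n) y)) B"
    using nn_integral_indicator[of B "advance (predict \<nu> n) (hist (Suc n) y)"] kernel_familyD(2)[OF
      kernel_family_advance[OF K, of n], of "hist (Suc n) y"] B by simp
  finally show ?thesis .
qed

text \<open>The \<nu>-filter at time n gives the conditional probability that the next signal lies
  in \<open>B n\<close>, and its expectation is the mass in question. The \<pi>-filter gives this
  event probability 0 by \<open>predict_null\<close>, so the conditional probability is at most the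
  distance of the filters, and dominated convergence applies.\<close>

lemma null_sets_vanish:
  fixes \<rho> \<rho>' :: "nat \<Rightarrow> (nat \<Rightarrow> 'f) \<Rightarrow> 'e measure"
  assumes \<nu>: "\<nu> \<in> space (prob_algebra borel)"
    and \<rho>: "\<And>n. \<rho> n \<in> (\<Pi>\<^sub>M k\<in>UNIV. borel) \<rightarrow>\<^sub>M prob_algebra borel"
      "\<And>n. \<rho>' n \<in> (\<Pi>\<^sub>M k\<in>UNIV. borel) \<rightarrow>\<^sub>M prob_algebra borel"
    and merge: "AE s in hmm_law P (obs g) \<nu>. (\<lambda>n. tv_dist (hmm_filter P g \<rho> \<nu> n (snd s)) (hmm_filter
      P g \<rho>' \<pi> n (snd s))) \<longlonglongrightarrow> 0"
    and B: "\<And>n. B n \<in> sets borel" and B0: "\<And>n. emeasure \<pi> (B n) = 0"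
  shows "(\<lambda>n. emeasure (\<nu> \<bind> Pn (Suc n)) (B n)) \<longlonglongrightarrow> 0"
proof -
  let ?H = "hmm_law P (obs g) \<nu>"
  interpret H: prob_space ?H by (rule hmm_law_facts(1)[OF \<nu>])
  note K = kernel_family_predict[OF \<nu>]
  define f where "f n h = 1 / mass (predict \<nu> (Suc n)) h * emeasure (predict \<nu> (Suc n) h) (B n)" for n h
  have em: "emeasure (predict \<nu> k h) A =
    (\<integral>\<^sup>+x. indicator A x \<partial>predict \<nu> k h)" if "A \<in> sets borel" for k h and A :: "'e set"
    using that kernel_familyD(2)[OF K] by simp
  have iB: "(\<lambda>s. indicator (B n) (fst s)) \<in> borel_measurable EH" for n
    by (rule measurable_compose[OF measurable_fst borel_measurable_indicator[OF B]])
  have emB: "(\<lambda>h. emeasure (predict \<nu> (Suc n) h) (B n)) \<in> borel_measurable MH" for n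
    using kernel_familyD(5)[OF K iB[of n], of "Suc n"] unfolding em[OF B] fst_conv .
  have f_meas: "f n \<in> borel_measurable MH" for n
    unfolding f_def using emB[of n] mass_measurable[OF K, of "Suc n"]
    by (intro borel_measurable_times_ennreal borel_measurable_divide_ennreal borel_measurable_const)
  have canc: "1 / m * b * m = b" if "m \<noteq> 0" "m \<noteq> \<infinity>" for m b :: ennreal
  proof -
    have "1 / m * b * m = (1 / m * m) * b" by (simp only: mult_ac)
    also have "1 / m * m = 1" using that
      by (simp add: ennreal_divide_times ennreal_divide_self less_top)
    finally show ?thesis by simp
  qed
  have f_int: "(\<integral>\<^sup>+s. f n (hist (Suc n) (snd s)) \<partial>?H) = emeasure (\<nu> \<bind> Pn (Suc n)) (B n)" for n
  proof -
    have "(\<integral>\<^sup>+s. f n (hist (Suc n) (snd s)) \<partial>?H) =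
      (\<integral>\<^sup>+h. f n h * mass (predict \<nu> (Suc n)) h \<partial>noise (Suc n))"
      by (rule nn_integral_hmm_law_hist[OF \<nu> f_meas])
    also have "\<dots> = (\<integral>\<^sup>+h. emeasure (predict \<nu> (Suc n) h) (B n) \<partial>noise (Suc n))"
      using mass_predict_finite[OF \<nu>, of "Suc n"]
    proof (intro nn_integral_cong_AE, eventually_elim)
      case (elim h)
      let ?m = "mass (predict \<nu> (Suc n)) h" and ?b = "emeasure (predict \<nu> (Suc n) h) (B n)"
      have le: "?b \<le> ?m"
        unfolding mass_def by (rule emeasure_mono[OF subset_UNIV]) (unfold kernel_familyD(2)[OF K],
          simp)
      show ?case
      proof (cases "?m = 0")
        \<comment> \<open>The quotient 1 / ?m is infinite here, but the factor ?m makes the left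
          side 0, and the right side is 0 as well.\<close>
        case True
        then have "?b = 0" using le by simp
        then show ?thesis by (simp only: f_def mult_zero_right mult_zero_left)
      next
        case False
        have "?m \<noteq> \<infinity>" using elim by (simp only: less_top infinity_ennreal_def)
        from canc[OF False this] show ?thesis unfolding f_def .
      qed
    qed
    also have "\<dots> = (\<integral>\<^sup>+s. indicator (B n) (fst s) \<partial>joint \<nu> (Suc n))"
      unfolding nn_integral_joint_predict[OF \<nu> iB] fst_conv em[OF B] ..
    also have "\<dots> = (\<integral>\<^sup>+z. indicator (B n) z \<partial>(\<nu> \<bind> Pn (Suc n)))"
      by (rule nn_integral_joint_fst[OF \<nu> borel_measurable_indicator[OF B]])
    also have "\<dots> = emeasure (\<nu> \<bind> Pn (Suc n)) (B n)"
      using sets_bind'[OF \<nu> Pn_kernel, of "Suc n"] B by (intro nn_integral_indicator) (simp only:)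
    finally show ?thesis .
  qed
  have bounds: "AE s in ?H. \<forall>n. f n (hist (Suc n) (snd s)) \<le> 1 \<and>
      f n (hist (Suc n) (snd s)) \<le> ennreal (tv_dist (hmm_filter P g \<rho> \<nu> n (snd s)) (hmm_filter P g
        \<rho>' \<pi> n (snd s)))"
    using AE_mass_predict_finite[OF \<nu> \<nu>] AE_mass_predict_finite[OF \<nu> \<pi>]
  proof eventually_elim
    case (elim s)
    let ?F = "\<lambda>n. hmm_filter P g \<rho> \<nu> n (snd s)" and ?F' = "\<lambda>n. hmm_filter P g \<rho>' \<pi> n (snd s)"
    note F = hmm_filter_in[where \<rho>=\<rho>, OF \<nu> \<rho>(1)] and F' = hmm_filter_in[where \<rho>=\<rho>', OF \<pi> \<rho>(2)]
    show ?case
    proof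
      fix n
      have PB: "(\<lambda>x. emeasure (P x) (B n)) \<in> borel_measurable borel"
        using measurable_compose[OF measurable_prob_algebraD[OF P]
          measurable_emeasure_subprob_algebra[OF B]] .
      have P1: "emeasure (P x) (B n) \<le> 1" for x by (rule prob_space.emeasure_le_1[OF prob_P])
      have f_eq: "f n (hist (Suc n) (snd s)) = (\<integral>\<^sup>+x. emeasure (P x) (B n) \<partial>?F n)"
        unfolding f_def nn_integral_predict_filter[where \<rho>=\<rho>, OF \<nu> \<rho>(1) elim(1)[rule_format] B] ..
      have "(\<integral>\<^sup>+x. emeasure (P x) (B n) \<partial>?F' n) = 0"
        unfolding nn_integral_predict_filter[where \<rho>=\<rho>', OF \<pi> \<rho>(2) elim(2)[rule_format] B]
          predict_null[OF B B0] by simp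
      moreover have "(\<integral>\<^sup>+x. emeasure (P x) (B n) \<partial>?F n) \<le>
        (\<integral>\<^sup>+x. emeasure (P x) (B n) \<partial>?F' n) + ennreal (tv_dist (?F n) (?F' n))"
      proof (rule nn_integral_le_add_if_emeasure_le)
        show "finite_measure (?F n)" "finite_measure (?F' n)"
          by (rule prob_space.finite_measure[OF F(1)], rule prob_space.finite_measure[OF F'(1)])
        show ss: "sets (?F n) = sets (?F' n)" unfolding F(2) F'(2) ..
        show "emeasure (?F n) A \<le> emeasure (?F' n) A +
          ennreal (tv_dist (?F n) (?F' n))" if "A \<in> sets (?F n)" for A
          by (rule emeasure_le_tv_dist[OF F(1) F'(1) ss that])
        show "(\<lambda>x. emeasure (P x) (B n)) \<in> borel_measurable (?F n)"
          unfolding measurable_cong_sets[OF F(2) refl] by (rule PB)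
      qed (rule P1)
      moreover have "(\<integral>\<^sup>+x. emeasure (P x) (B n) \<partial>?F n) \<le> 1"
        by (rule prob_space.nn_integral_le_1[OF F(1) P1])
      ultimately show "f n (hist (Suc n) (snd s)) \<le> 1 \<and> f n (hist (Suc n) (snd s)) \<le>
        ennreal (tv_dist (?F n) (?F' n))"
        unfolding f_eq by (simp only: add_0_left simp_thms)
    qed
  qed
  have "(\<lambda>n. \<integral>\<^sup>+s. f n (hist (Suc n) (snd s)) \<partial>?H) \<longlonglongrightarrow> (\<integral>\<^sup>+s. 0 \<partial>?H)"
  proof (rule nn_integral_dominated_convergence[where w="\<lambda>_. 1"])
    show "(\<lambda>s. f n (hist (Suc n) (snd s))) \<in> borel_measurable ?H" for n
      unfolding measurable_cong_sets[OF hmm_law_facts(2)[OF \<nu>] refl]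
      by (rule measurable_compose[OF measurable_snd measurable_compose[OF hist_measurable f_meas]])
    show "AE s in ?H. f n (hist (Suc n) (snd s)) \<le> 1" for n
      using bounds by eventually_elim blast
    show "AE s in ?H. (\<lambda>n. f n (hist (Suc n) (snd s))) \<longlonglongrightarrow> 0"
      using bounds merge
    proof eventually_elim
      case (elim s)
      show ?case
      proof (rule tendsto_sandwich[OF _ _ tendsto_const])
        show "(\<lambda>n. ennreal (tv_dist (hmm_filter P g \<rho> \<nu> n (snd s)) (hmm_filter P g \<rho>' \<pi> n (snd s))))
          \<longlonglongrightarrow> 0"
          using tendsto_ennrealI[OF elim(2)] by simp
      qed (use elim(1) in auto)
    qed
  qed (auto simp: H.emeasure_space_1)
  then show ?thesis unfolding f_int by simp
qed

text \<open>A single time at which the singular part has mass below \<delta> is enough, since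
  \<open>eventually_tv_dist_le\<close> covers all later times. The filters at time n speak about the
  signal at time Suc n, hence the shift.\<close>

lemma tv_dist_chain_tendsto_0:
  fixes \<rho> \<rho>' :: "nat \<Rightarrow> (nat \<Rightarrow> 'f) \<Rightarrow> 'e measure"
  assumes erg: "AE z in \<pi>. (\<lambda>j. excess j z) \<longlonglongrightarrow> 0" and \<nu>: "\<nu> \<in> space (prob_algebra borel)"
    and \<rho>: "\<And>n. \<rho> n \<in> (\<Pi>\<^sub>M k\<in>UNIV. borel) \<rightarrow>\<^sub>M prob_algebra borel"
      "\<And>n. \<rho>' n \<in> (\<Pi>\<^sub>M k\<in>UNIV. borel) \<rightarrow>\<^sub>M prob_algebra borel"
    and merge: "AE s in hmm_law P (obs g) \<nu>. (\<lambda>n. tv_dist (hmm_filter P g \<rho> \<nu> n (snd s)) (hmm_filter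
      P g \<rho>' \<pi> n (snd s))) \<longlonglongrightarrow> 0"
  shows "(\<lambda>n. tv_dist (\<nu> \<bind> Pn n) \<pi>) \<longlonglongrightarrow> 0"
proof -
  have sn: "sets (\<nu> \<bind> Pn k) = sets borel" and ppn: "prob_space (\<nu> \<bind> Pn k)" for k
    using bind_in_prob_algebra[OF \<nu> Pn_kernel, of k] by (auto simp: space_prob_algebra)
  have "\<exists>B q. B \<in> sets borel \<and> emeasure \<pi> B = 0 \<and> q \<in> borel_measurable borel \<and>
      density (\<nu> \<bind> Pn (Suc n)) (indicator (UNIV - B)) = density \<pi> (\<lambda>x. ennreal (q x))" for n
  proof -
    have ss: "sets (\<nu> \<bind> Pn (Suc n)) = sets \<pi>" by (simp only: sn sets_\<pi>)
    obtain B q where "B \<in> sets \<pi>" "emeasure \<pi> B = 0" "q \<in> borel_measurable \<pi>"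
      "density (\<nu> \<bind> Pn (Suc n)) (indicator (space \<pi> - B)) = density \<pi> (\<lambda>x. ennreal (q x))"
      by (rule Lebesgue_decomposition[OF prob_\<pi> ppn ss]) (rule that)
    then show ?thesis unfolding sets_\<pi> space_\<pi> measurable_cong_sets[OF sets_\<pi> refl] by blast
  qed
  then have "\<forall>n. \<exists>B. B \<in> sets borel \<and> emeasure \<pi> B = 0 \<and> (\<exists>q. q \<in> borel_measurable borel \<and>
      density (\<nu> \<bind> Pn (Suc n)) (indicator (UNIV - B)) = density \<pi> (\<lambda>x. ennreal (q x)))" by blast
  then obtain B where B: "\<forall>n. B n \<in> sets borel \<and> emeasure \<pi> (B n) =
    0 \<and> (\<exists>q. q \<in> borel_measurable borel \<and>
      density (\<nu> \<bind> Pn (Suc n)) (indicator (UNIV - B n)) = density \<pi> (\<lambda>x. ennreal (q x)))"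
    by (rule choice[THEN exE])
  have lim: "(\<lambda>n. emeasure (\<nu> \<bind> Pn (Suc n)) (B n)) \<longlonglongrightarrow> 0"
    using B by (intro null_sets_vanish[OF \<nu> \<rho> merge]) blast+
  have ev: "eventually (\<lambda>m. tv_dist (\<nu> \<bind> Pn m) \<pi> \<le> 4 * \<delta>) sequentially" if \<delta>: "0 < \<delta>" for \<delta>
  proof -
    have "\<exists>n. emeasure (\<nu> \<bind> Pn (Suc n)) (B n) < ennreal \<delta>"
      using order_tendstoD(2)[OF lim, of "ennreal \<delta>"] \<delta>
      by (intro eventually_happens'[OF sequentially_bot]) simp
    then obtain n where n: "emeasure (\<nu> \<bind> Pn (Suc n)) (B n) < ennreal \<delta>" ..
    obtain q where q: "q \<in> borel_measurable borel"
      "density (\<nu> \<bind> Pn (Suc n)) (indicator (UNIV - B n)) = density \<pi> (\<lambda>x. ennreal (q x))"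
      using B by blast
    show ?thesis
      by (rule eventually_tv_dist_le[OF erg \<nu> _ q less_imp_le[OF n] \<delta>]) (use B in blast)
  qed
  have d0: "0 \<le> tv_dist (\<nu> \<bind> Pn m) \<pi>" for m
    by (rule tv_dist_nonneg[OF ppn prob_\<pi>]) (simp only: sn sets_\<pi>)
  show ?thesis
  proof (rule order_tendstoI)
    show "eventually (\<lambda>n. a < tv_dist (\<nu> \<bind> Pn n) \<pi>) sequentially" if "a < 0" for a
      using d0 that by (intro always_eventually allI) (rule less_le_trans)
    show "eventually (\<lambda>n. tv_dist (\<nu> \<bind> Pn n) \<pi> < a) sequentially" if a: "0 < a" for a
    proof -
      have "0 < a / 8" using a by simp
      from ev[OF this] show ?thesis by (rule eventually_mono) (use a in simp)
    qed
  qed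
qed

lemma excess_le_tv_dist: "excess m z \<le> ennreal (tv_dist (Pn m z) \<pi>)"
  unfolding excess_def
proof (rule SUP_least)
  fix B :: "'e set" assume "B \<in> comparing_base"
  then have "B \<in> sets (Pn m z)" using comparing_base_sets by simp
  then have "emeasure (Pn m z) B \<le> emeasure \<pi> B + ennreal (tv_dist (Pn m z) \<pi>)"
    by (intro emeasure_le_tv_dist prob_Pn prob_\<pi>) (simp_all only: sets_Pn sets_\<pi>)
  then show "emeasure (Pn m z) B - emeasure \<pi> B \<le> ennreal (tv_dist (Pn m z) \<pi>)"
    by (simp add: ennreal_minus_le_iff)
qed

lemma filters_merge_iff:
  fixes \<rho> \<rho>' :: "nat \<Rightarrow> (nat \<Rightarrow> 'f) \<Rightarrow> 'e measure"
  assumes erg: "AE z in \<pi>. (\<lambda>n. tv_dist (distr (hmm_law P (obs g) (return borel z)) borel (\<lambda>(x, y).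
    x n)) \<pi>) \<longlonglongrightarrow> 0"
    and \<nu>: "\<nu> \<in> space (prob_algebra borel)"
    and \<rho>: "\<And>n. \<rho> n \<in> (\<Pi>\<^sub>M k\<in>UNIV. borel) \<rightarrow>\<^sub>M prob_algebra borel"
      "\<And>n. \<rho>' n \<in> (\<Pi>\<^sub>M k\<in>UNIV. borel) \<rightarrow>\<^sub>M prob_algebra borel"
  shows "(AE (x, y) in hmm_law P (obs g) \<nu>. (\<lambda>n. tv_dist (hmm_filter P g \<rho> \<nu> n y) (hmm_filter P g \<rho>'
    \<pi> n y)) \<longlonglongrightarrow> 0)
    \<longleftrightarrow> (\<lambda>n. tv_dist (distr (hmm_law P (obs g) \<nu>) borel (\<lambda>(x, y). x n)) \<pi>) \<longlonglongrightarrow> 0"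
proof -
  have r: "return borel z \<in> space (prob_algebra (borel :: 'e measure))" for z
    by (simp add: space_prob_algebra prob_space_return)
  have "return borel z \<bind> Pn n = Pn n z" for z n
    by (rule bind_return[OF measurable_prob_algebraD[OF Pn_kernel]]) simp
  then have "AE z in \<pi>. (\<lambda>n. tv_dist (Pn n z) \<pi>) \<longlonglongrightarrow> 0"
    using erg by (simp only: hmm_law_coord[OF r])
  then have excess: "AE z in \<pi>. (\<lambda>j. excess j z) \<longlonglongrightarrow> 0"
  proof eventually_elim
    case (elim z)
    then have "(\<lambda>n. ennreal (tv_dist (Pn n z) \<pi>)) \<longlonglongrightarrow> 0" using tendsto_ennrealI by fastforce
    then show ?case
      by (rule tendsto_sandwich[OF _ _ tendsto_const, rotated 2]) (simp_all add: excess_le_tv_dist)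
  qed
  show ?thesis
    unfolding hmm_law_coord[OF \<nu>] unfolding case_prod_beta'
    using filters_merge[where \<rho>=\<rho> and \<rho>'=\<rho>', OF mixing_tendsto_0[OF excess] \<nu> \<rho>]
      tv_dist_chain_tendsto_0[where \<rho>=\<rho> and \<rho>'=\<rho>', OF excess \<nu> \<rho>]
    by (rule iffI[rotated])
qed

end

theorem theorem5p2:
  fixes P :: "'e::polish_space \<Rightarrow> 'e measure"
    and \<pi> \<mu> :: "'e measure"
    and \<Phi> :: "'e \<Rightarrow> 'f::polish_space measure"
    and \<phi> :: "'f measure"
    and g :: "'e \<Rightarrow> 'f \<Rightarrow> real"
    and \<rho>\<^sub>\<mu> \<rho>\<^sub>\<pi> :: "nat \<Rightarrow> (nat \<Rightarrow> 'f) \<Rightarrow> 'e measure"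
  assumes P: "P \<in> borel \<rightarrow>\<^sub>M prob_algebra borel"
    and \<Phi>: "\<Phi> \<in> borel \<rightarrow>\<^sub>M prob_algebra borel"
    and \<pi>: "\<pi> \<in> space (prob_algebra borel)"
    and stationary: "\<And>A. A \<in> sets borel \<Longrightarrow> (\<integral>\<^sup>+z. emeasure (P z) A \<partial>\<pi>) = emeasure \<pi> A"
    and ergodic: "AE z in \<pi>.
      (\<lambda>n. tv_dist (distr (hmm_law P \<Phi> (return borel z)) borel (\<lambda>(x, y). x n)) \<pi>)
        \<longlonglongrightarrow> 0"
    and \<phi>: "\<phi> \<in> space (prob_algebra borel)"
    and g_measurable: "(\<lambda>(z, u). g z u) \<in> borel_measurable (borel \<Otimes>\<^sub>M borel)"
    and g_pos: "\<And>z u. 0 < g z u"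
    and nondegenerate: "\<And>z A. A \<in> sets borel \<Longrightarrow>
      emeasure (\<Phi> z) A = (\<integral>\<^sup>+u. indicator A u * ennreal (g z u) \<partial>\<phi>)"
    and \<mu>: "\<mu> \<in> space (prob_algebra borel)"
    and \<rho>\<^sub>\<mu>: "\<And>n. \<rho>\<^sub>\<mu> n \<in> (\<Pi>\<^sub>M k\<in>UNIV. borel) \<rightarrow>\<^sub>M prob_algebra borel"
    and \<rho>\<^sub>\<pi>: "\<And>n. \<rho>\<^sub>\<pi> n \<in> (\<Pi>\<^sub>M k\<in>UNIV. borel) \<rightarrow>\<^sub>M prob_algebra borel"
  shows "(AE (x, y) in hmm_law P \<Phi> \<mu>.
      (\<lambda>n. tv_dist (hmm_filter P g \<rho>\<^sub>\<mu> \<mu> n y) (hmm_filter P g \<rho>\<^sub>\<pi> \<pi> n y)) \<longlonglongrightarrow> 0)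
    \<longleftrightarrow> (\<lambda>n. tv_dist (distr (hmm_law P \<Phi> \<mu>) borel (\<lambda>(x, y). x n)) \<pi>) \<longlonglongrightarrow> 0"
proof -
  have s\<pi>: "sets \<pi> = sets borel" and s\<phi>: "sets \<phi> = sets borel" using \<pi> \<phi>
    by (auto simp: space_prob_algebra)
  have s\<Phi>: "sets (\<Phi> z) = sets borel" and p\<Phi>: "prob_space (\<Phi> z)" for z
    using kernel_prob[OF \<Phi>, of z] by auto
  have sp\<Phi>: "space (\<Phi> z) = UNIV" for z using sets_eq_imp_space_eq[OF s\<Phi>] by simp
  have g_obs: "g z \<in> borel_measurable \<phi>" for z
    using measurable_compose[OF measurable_Pair1'[of z borel borel] g_measurable]
    by (simp add: measurable_cong_sets[OF s\<phi> refl])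
  have bind: "\<pi> \<bind> P = \<pi>"
  proof (rule measure_eqI)
    have sb: "sets (\<pi> \<bind> P) = sets borel" by (rule sets_bind'[OF \<pi> P])
    then show "sets (\<pi> \<bind> P) = sets \<pi>" by (simp add: s\<pi>)
    fix A assume "A \<in> sets (\<pi> \<bind> P)"
    then have A: "A \<in> sets borel" by (simp add: sb)
    then show "emeasure (\<pi> \<bind> P) A = emeasure \<pi> A"
      by (simp add: emeasure_bind_prob_algebra[OF \<pi> P A] stationary)
  qed
  have push: "(\<lambda>(w, h). case_nat w h) \<in> borel \<Otimes>\<^sub>M (\<Pi>\<^sub>M i\<in>UNIV. borel) \<rightarrow>\<^sub>M (\<Pi>\<^sub>M i\<in>UNIV. (borel :: 'f
    measure))"
  proof (rule measurable_PiM_single')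
    fix i
    show "(\<lambda>s. (case s of (w, h) \<Rightarrow> case_nat w h) i) \<in> borel \<Otimes>\<^sub>M (\<Pi>\<^sub>M i\<in>UNIV. borel) \<rightarrow>\<^sub>M (borel :: 'f
      measure)"
      by (cases i) (simp_all add: split_beta')
  qed auto
  interpret hist_chain P \<phi> \<pi> "\<Pi>\<^sub>M i\<in>UNIV. borel" case_nat
    by (unfold_locales) (rule P \<phi> \<pi> bind push)+
  have "obs_density g"
    unfolding obs_density_def
  proof (intro conjI allI g_measurable g_pos)
    fix z
    show "(\<integral>\<^sup>+u. ennreal (g z u) \<partial>\<phi>) = 1"
      using nondegenerate[of UNIV z] prob_space.emeasure_space_1[OF p\<Phi>, of z] by (simp add: sp\<Phi>)
  qed
  then interpret hmm P \<phi> \<pi> g by unfold_locales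
  \<comment> \<open>Nondegeneracy turns the observation kernel into \<open>obs g\<close>, so that
    ergodicity and the conclusion become statements about the locale.\<close>
  have "\<Phi> z = obs g z" for z
  proof (rule measure_eqI)
    show "sets (\<Phi> z) = sets (obs g z)" by (simp add: s\<Phi>)
    fix A assume "A \<in> sets (\<Phi> z)"
    then have A: "A \<in> sets borel" by (simp add: s\<Phi>)
    have "emeasure (obs g z) A = (\<integral>\<^sup>+u. ennreal (g z u) * indicator A u \<partial>\<phi>)"
      unfolding obs_def using A g_obs[of z] by (intro emeasure_density) (simp_all add: s\<phi>)
    then show "emeasure (\<Phi> z) A = emeasure (obs g z) A"
      by (simp add: nondegenerate[OF A] mult.commute)
  qed
  then have \<Phi>_eq: "\<Phi> = obs g" by (rule ext)
  show ?thesis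
    using ergodic unfolding \<Phi>_eq
    by (rule filters_merge_iff[where \<rho>=\<rho>\<^sub>\<mu> and \<rho>'=\<rho>\<^sub>\<pi>, OF _ \<mu> \<rho>\<^sub>\<mu> \<rho>\<^sub>\<pi>])
qed

end
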